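(* Let $K\subset\mathbb{R}^2$ be a convex body and let $\mu$ be a probability measure on $K$ with a density $\varphi$ with respect to the Lebesgue measure restricted to $K$; assume that $\varphi$ is Lipschitz continuous on $K$. Let $\xi_t$, $\widehat\xi_n$, $M_t^{(m)}$, $\widehat M_n^{(m)}$ be as defined in the context, and define $$\beta:=\int_K\int_K\int_0^1s(1-s)\,\varphi(sx_1+(1-s)x_2)\,\|x_1-x_2\|^2\,\mathrm{d}s\,\mu(\mathrm{d}x_1)\,\mu(\mathrm{d}x_2).$$ Then the rescaled point processes $t^3\xi_t$ and $n^3\widehat\xi_n$ both converge in distribution to a homogeneous Poisson point process on $\mathbb{R}_+=(0,\infty)$ with intensity $\beta$, as $t\to\infty$ or $n\to\infty$, respectively. In addition, for every $y>0$ there is a constant $C_y>0$ depending on $K$, $\varphi$ and $y$ such that $$\bigg|\mathbb{P}(t^3M_t^{(m)}>y)-e^{-\beta y}\sum_{i=0}^{m-1}\frac{(\beta y)^i}{i!}\bigg|\leq C_y\,t^{-1}$$ and $$\bigg|\mathbb{P}(n^3\widehat M_n^{(m)}>y)-e^{-\beta y}\sum_{i=0}^{m-1}\frac{(\beta y)^i}{i!}\bigg|\leq C_y\,n^{-1}$$ for all $t\geq1$, $n\geq3$ and $m\in\mathbb{N}$.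
   Context: A convex body is a compact convex set with interior points. For $t>0$, $\eta_t$ is a Poisson point process with intensity measure $t\mu$, and $\zeta_n$ is a binomial process of $n$ independent points with distribution $\mu$. $\eta^3_{t,\neq}$ and $\zeta^3_{n,\neq}$ are the sets of triples of distinct points of $\eta_t$ and $\zeta_n$. For a triple of distinct points, $\theta(x_1,x_2,x_3)$ is the largest angle of the triangle formed by $x_1,x_2,x_3$. With $\delta_x$ the Dirac measure at $x$, $$\xi_t:=\frac16\sum_{(x_1,x_2,x_3)\in\eta^3_{t,\neq}}\delta_{\pi-\theta(x_1,x_2,x_3)},\qquad\widehat\xi_n:=\frac16\sum_{(x_1,x_2,x_3)\in\zeta^3_{n,\neq}}\delta_{\pi-\theta(x_1,x_2,x_3)}.$$ $M_t^{(m)}$ and $\widehat M_n^{(m)}$ are the $m$-th smallest points in $(0,\infty)$ (with multiplicity) of $\xi_t$ and $\widehat\xi_n$, and $\infty$ if there are fewer than $m$ points. For $c>0$, $c\,\xi$ denotes the point process obtained by multiplying every point of $\xi$ by $c$. Convergence in distribution of point processes is with respect to the vague topology on locally finite measures on $\mathbb{R}$, point processes on $\mathbb{R}_+$ being viewed as point processes on $\mathbb{R}$. *)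

theory Defs
  imports "HOL-Probability.Probability"
begin

text \<open>Point processes are random integer-valued, locally finite measures. On Euclidean spaces
  (and closed subsets), local finiteness means finiteness on bounded measurable sets. The
  state space, with its \<open>\<sigma>\<close>-algebra, is given by the measure \<open>S\<close>.\<close>

definition point_process ::
  "'w measure \<Rightarrow> 'a::metric_space measure \<Rightarrow> ('w \<Rightarrow> 'a measure) \<Rightarrow> bool" where
  "point_process P S \<xi> \<longleftrightarrow>
     prob_space P \<and>
     (\<forall>\<omega>\<in>space P. sets (\<xi> \<omega>) = sets S \<and>
        (\<forall>B\<in>sets S. bounded B \<longrightarrow> emeasure (\<xi> \<omega>) B \<in> \<nat>)) \<and>
     (\<forall>B\<in>sets S. (\<lambda>\<omega>. emeasure (\<xi> \<omega>) B) \<in> borel_measurable P)"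

definition poisson_process ::
  "'w measure \<Rightarrow> 'a::metric_space measure \<Rightarrow> ('w \<Rightarrow> 'a measure) \<Rightarrow> bool" where
  "poisson_process P \<Lambda> \<eta> \<longleftrightarrow>
     point_process P \<Lambda> \<eta> \<and>
     (\<forall>B\<in>sets \<Lambda>. emeasure \<Lambda> B < \<infinity> \<longrightarrow>
        (\<forall>k. measure P {\<omega>\<in>space P. emeasure (\<eta> \<omega>) B = of_nat k} =
               exp (- measure \<Lambda> B) * measure \<Lambda> B ^ k / fact k)) \<and>
     (\<forall>B::nat \<Rightarrow> 'a set. range B \<subseteq> sets \<Lambda> \<and> disjoint_family B \<longrightarrow>
        prob_space.indep_vars P (\<lambda>_. borel) (\<lambda>i \<omega>. emeasure (\<eta> \<omega>) (B i)) UNIV)"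

text \<open>Sums of Dirac measures \<open>\<Sum>j\<in>J. \<delta> (f j)\<close> are written as images of the counting measure on \<open>J\<close>.\<close>

definition binomial_process ::
  "'w measure \<Rightarrow> 'a measure \<Rightarrow> nat \<Rightarrow> ('w \<Rightarrow> 'a measure) \<Rightarrow> bool" where
  "binomial_process P \<mu> n \<zeta> \<longleftrightarrow>
     prob_space P \<and>
     (\<exists>X::nat \<Rightarrow> 'w \<Rightarrow> 'a.
        prob_space.indep_vars P (\<lambda>_. \<mu>) X {..<n} \<and>
        (\<forall>i<n. distr P \<mu> (X i) = \<mu>) \<and>
        (\<forall>\<omega>\<in>space P. \<zeta> \<omega> = distr (count_space {..<n}) \<mu> (\<lambda>i. X i \<omega>)))"

definition points :: "'a measure \<Rightarrow> 'a set" where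
  "points N = {x \<in> space N. emeasure N {x} \<noteq> 0}"

text \<open>Ordered triples, so every triangle occurs six times. Below, \<open>A\<close> is the support of a point
  process; multiplicities of its points play no role, since the processes in question are
  almost surely simple.\<close>

definition distinct_triples :: "'a set \<Rightarrow> ('a \<times> 'a \<times> 'a) set" where
  "distinct_triples A =
     {(x1, x2, x3). x1 \<in> A \<and> x2 \<in> A \<and> x3 \<in> A \<and> x1 \<noteq> x2 \<and> x1 \<noteq> x3 \<and> x2 \<noteq> x3}"

definition angle_at :: "'a::real_inner \<Rightarrow> 'a \<Rightarrow> 'a \<Rightarrow> real" where
  "angle_at b a c = arccos (((a - b) \<bullet> (c - b)) / (norm (a - b) * norm (c - b)))"

definition largest_angle :: "'a::real_inner \<Rightarrow> 'a \<Rightarrow> 'a \<Rightarrow> real" where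
  "largest_angle x1 x2 x3 =
     Max {angle_at x1 x2 x3, angle_at x2 x1 x3, angle_at x3 x1 x2}"

definition angle_process :: "'a::real_inner measure \<Rightarrow> real measure" where
  "angle_process N =
     scale_measure (1 / 6)
       (distr (count_space (distinct_triples (points N))) borel
          (\<lambda>(x1, x2, x3). pi - largest_angle x1 x2 x3))"

definition rescale :: "real \<Rightarrow> real measure \<Rightarrow> real measure" where
  "rescale c \<xi> = distr \<xi> borel (\<lambda>x. c * x)"

text \<open>The \<open>m\<close>-th smallest point in \<open>(0,\<infinity>)\<close>, counted with multiplicity, for \<open>m \<ge> 1\<close>: the first
  point \<open>y\<close> such that \<open>(0,y]\<close> contains at least \<open>m\<close> points. The infimum of the empty set is \<open>\<infinity>\<close>.\<close>

definition mth_point :: "nat \<Rightarrow> real measure \<Rightarrow> ereal" where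
  "mth_point m \<xi> =
     Inf (ereal ` {y \<in> points \<xi>. 0 < y \<and> of_nat m \<le> emeasure \<xi> {0<..y}})"

definition locally_finite_measures :: "real measure set" where
  "locally_finite_measures =
     {\<nu>. sets \<nu> = sets borel \<and> (\<forall>B\<in>sets borel. bounded B \<longrightarrow> emeasure \<nu> B < \<infinity>)}"

definition vague_topology :: "real measure topology" where
  "vague_topology = topology_generated_by
     {{\<nu> \<in> locally_finite_measures. (\<integral>x. f x \<partial>\<nu>) \<in> U} | (f :: real \<Rightarrow> real) (U :: real set).
        continuous_on UNIV f \<and> compact (closure {x. f x \<noteq> 0}) \<and> open U}"

text \<open>Convergence in distribution, along a filter, of random elements of a topological space
  (measurable with respect to the Borel \<open>\<sigma>\<close>-algebra), each living on its own probability space.\<close>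

definition converges_in_distribution ::
  "'s topology \<Rightarrow> ('i \<Rightarrow> 'w measure) \<Rightarrow> ('i \<Rightarrow> 'w \<Rightarrow> 's) \<Rightarrow> 'v measure \<Rightarrow> ('v \<Rightarrow> 's)
     \<Rightarrow> 'i filter \<Rightarrow> bool" where
  "converges_in_distribution T P \<xi> Q \<zeta> F \<longleftrightarrow>
     (\<forall>\<^sub>F i in F. \<xi> i \<in> measurable (P i) (sigma (topspace T) {U. openin T U})) \<and>
     \<zeta> \<in> measurable Q (sigma (topspace T) {U. openin T U}) \<and>
     (\<forall>g. continuous_map T euclideanreal g \<and> bounded (g ` topspace T) \<longrightarrow>
        ((\<lambda>i. \<integral>\<omega>. g (\<xi> i \<omega>) \<partial>P i) \<longlongrightarrow> (\<integral>\<omega>. g (\<zeta> \<omega>) \<partial>Q)) F)"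

text \<open>A homogeneous Poisson process on \<open>(0,\<infinity>)\<close>, viewed as a point process on the real line.\<close>

definition homogeneous_poisson_process :: "'w measure \<Rightarrow> real \<Rightarrow> ('w \<Rightarrow> real measure) \<Rightarrow> bool" where
  "homogeneous_poisson_process Q \<beta> Z \<longleftrightarrow>
     poisson_process Q (density lborel (\<lambda>x. ennreal \<beta> * indicator {0<..} x)) Z"

end

theory Submission
 imports Defs
begin

text \<open>
 Three points form an angle of at least \<open>pi - e\<close> exactly if one of them, \<open>z\<close>, lies in the thin lens
 of all points that see the other two, \<open>x\<close> and \<open>y\<close>, under such an angle. At the point
 \<open>s x + (1 - s) y\<close> of the segment this lens has width about \<open>2 e s (1 - s) |x - y|\<close>, so its
 \<open>\<mu>\<close>-mass is \<open>2 e |x - y|^2\<close> times the integral of \<open>s (1 - s) \<phi> (s x + (1 - s) y)\<close>, up to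
 \<open>O (e^2)\<close>. The largest angle may sit at each of the three vertices, hence a random triangle has
 \<open>pi - \<theta> \<le> e\<close> with probability \<open>6 e \<beta> + O (e^2)\<close> (\<open>angle_event_asymptotics\<close>), and the \<open>t^3 / 6\<close>
 triangles yield \<open>\<beta> y\<close> expected points of \<open>t^3 \<xi>\<close> in \<open>(0, y]\<close>. The one delicate point is the
 boundary of \<open>K\<close>, where a lens may stick out of \<open>K\<close>; this concerns only pairs \<open>x, y\<close> from a layer of
 mass \<open>O (e)\<close>, because segments in a slightly shrunken copy of \<open>K\<close> have distance of order \<open>e\<close> from
 the complement (\<open>shrunk_thick\<close>, \<open>p_lens_asymptotics\<close>).

 The Poisson limit comes from weak dependence: triangles without a common vertex are independent,
 and two different triangles with a common vertex are both flat with probability \<open>O (e^2)\<close> only,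
 since in each case a vertex of the second one that is not a vertex of the first must fall into a
 strip of width \<open>O (e)\<close> around a given line (\<open>measure_deficit_le\<close>). With \<open>e = y / n^3\<close> the
 \<open>O (n^5)\<close> pairs contribute \<open>O (1 / n)\<close>. To use this, one product formula serves all purposes: for
 \<open>G I = 1 - g (deficit I)\<close> the expectation of the product of the factors \<open>1 - G I\<close> over all triples
 is close to \<open>exp (- (\<Sum>I. E (G I)))\<close>, with an error that is a sum over overlapping pairs
 (\<open>dissociated_prod_approx\<close>, by interpolation of the factors \<open>1 - s G I\<close> in \<open>s\<close>). The choice
 \<open>g = z\<close> on \<open>(0, a]\<close>, \<open>g = 1\<close> elsewhere, with \<open>|z| = 1\<close>, yields the generating function of the number
 of flat triangles; the error carries the factor \<open>|1 - z|^2\<close>, which Fourier inversion turns into a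
 bound on distribution functions uniform in \<open>m\<close> (\<open>poisson_kolmogorov_bound\<close>). The choice
 \<open>g x = exp (- f (c x))\<close> yields the Laplace functionals of the rescaled processes.

 The Poisson process is reached by discretization: rounding its points to a dyadic grid leaves a
 random set of occupied cells, and cells are occupied independently. The same product formula
 applies to triples of cells, and the mesh tends to zero at the end (\<open>poisson_mfun_bound\<close>).

 Convergence of Laplace functionals implies convergence in distribution for the vague topology:
 the integrals of countably many tent functions determine the topology, the exponentials of these
 integrals embed the measures into a compact cube, polynomials on the cube are combinations of
 Laplace functionals and dense by the Stone-Weierstrass theorem, and a bounded vaguely continuous
 function is a limit of continuous functions on the cube from below as well as from above
 (\<open>vague_convergence_of_laplace\<close>).\<close>

section \<open>Products of weakly dependent factors\<close>

lemmas lint_cong = Bochner_Integration.integral_cong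
  and lint_nonneg = Bochner_Integration.integral_nonneg

lemma norm_integral_le_integral:
 fixes f :: "'a => 'b :: {banach, second_countable_topology}"
 assumes "integrable M g" "\<And>x. x \<in> space M ==> norm (f x) <= g x"
 shows "norm (\<integral>x. f x \<partial>M) <= (\<integral>x. g x \<partial>M)"
proof (rule order_trans[OF integral_norm_bound integral_mono'])
 show "0 <= g x" if "x \<in> space M" for x using assms(2)[OF that] norm_ge_zero order_trans by blast
qed (use assms in auto)

text \<open>Convexity of the closed unit disc: \<open>1 - s g\<close> lies on the segment from \<open>1\<close> to \<open>1 - g\<close>.\<close>

lemma norm_one_minus_scaleR_le_1:
 fixes g :: complex
 assumes "norm (1 - g) <= 1" "0 <= s" "s <= 1"
 shows "norm (1 - of_real s * g) <= 1"
proof -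
 have "1 - of_real s * g = of_real (1 - s) + of_real s * (1 - g)" by (simp add: algebra_simps)
 then have "norm (1 - of_real s * g) <= norm (of_real (1 - s) :: complex) + norm (of_real s * (1 - g))"
  by (simp only: norm_triangle_ineq)
 also have "... = (1 - s) + s * norm (1 - g)" using assms by (simp only: norm_mult norm_of_real)
 also have "... <= (1 - s) + s * 1" using assms by (intro add_left_mono mult_left_mono) auto
 finally show ?thesis by simp
qed

lemma norm_prod_minus_subset_prod_le:
 fixes u :: "'i => complex"
 assumes "finite A" "B \<subseteq> A" "\<And>i. i \<in> A ==> norm (u i) <= 1"
 shows "norm ((\<Prod>i\<in>A. u i) - (\<Prod>i\<in>B. u i)) <= (\<Sum>i\<in>A-B. norm (1 - u i))"
proof -
 have fB: "finite B" using assms finite_subset by blast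
 have "(\<Prod>i\<in>A. u i) = (\<Prod>i\<in>B. u i) * (\<Prod>i\<in>A-B. u i)" using assms fB by (metis mult.commute prod.subset_diff)
 then have "(\<Prod>i\<in>A. u i) - (\<Prod>i\<in>B. u i) = (\<Prod>i\<in>B. u i) * ((\<Prod>i\<in>A-B. u i) - (\<Prod>i\<in>A-B. 1))"
  by (simp add: algebra_simps)
 moreover have "norm (\<Prod>i\<in>B. u i) <= 1" using assms by (auto simp: prod_norm[symmetric] intro!: prod_le_1)
 moreover have "norm ((\<Prod>i\<in>A-B. u i) - (\<Prod>i\<in>A-B. 1)) <= (\<Sum>i\<in>A-B. norm (u i - 1))"
  using assms by (intro norm_prod_diff) auto
 ultimately show ?thesis by (simp add: norm_mult norm_minus_commute)
    (meson mult_left_le_one_le norm_ge_zero order_trans)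
qed

text \<open>Let \<open>\<lambda>\<close> be the sum of the means. The function \<open>exp (- (1 - s) \<lambda>) * (\<Prod>J. 1 - s G J)\<close>
 interpolates between \<open>exp (- \<lambda>)\<close> and the product. In its derivative every index \<open>I\<close> contributes
 \<open>E (G I) * (\<Prod>J. 1 - s G J) - G I * (\<Prod>J\<noteq>I. 1 - s G J)\<close>. Restricting both products to indices outside
 \<open>D I\<close> changes them by at most the sum of \<open>norm (G J)\<close> over the removed \<open>J\<close>, and after the
 restriction the two terms have the same expectation. That the factors lie in the unit disc keeps all
 remaining products bounded by \<open>1\<close>, so complex factors do no harm.\<close>

lemma (in prob_space) dissociated_prod_approx:
 fixes G :: "'i => 'a => complex" and D :: "'i => 'i set"
 assumes fin: "finite \<I>"
  and G [measurable]: "\<And>I. I \<in> \<I> ==> G I \<in> borel_measurable M"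
  and le1: "\<And>I w. I \<in> \<I> ==> w \<in> space M ==> norm (1 - G I w) <= 1"
  and D: "\<And>I. I \<in> \<I> ==> I \<in> D I" "\<And>I. I \<in> \<I> ==> D I \<subseteq> \<I>"
  and ind: "\<And>I s. I \<in> \<I> ==> 0 <= s ==> s <= 1 ==>
   expectation (\<lambda>w. G I w * (\<Prod>J\<in>\<I>-D I. 1 - of_real s * G J w)) =
   expectation (G I) * expectation (\<lambda>w. \<Prod>J\<in>\<I>-D I. 1 - of_real s * G J w)"
 shows "norm (expectation (\<lambda>w. \<Prod>I\<in>\<I>. 1 - G I w) - exp (- (\<Sum>I\<in>\<I>. expectation (G I)))) <=
  (\<Sum>I\<in>\<I>. (\<Sum>J\<in>D I. expectation (\<lambda>w. norm (G I w)) * expectation (\<lambda>w. norm (G J w))) +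
    (\<Sum>J\<in>D I - {I}. expectation (\<lambda>w. norm (G I w) * norm (G J w))))"
  (is "_ <= ?R")
proof -
 define lam where "lam = (\<Sum>I\<in>\<I>. expectation (G I))"
 define p where "p s A w = (\<Prod>J\<in>A. 1 - of_real s * G J w)" for s :: real and A w
 have norm_G: "norm (G I w) <= 2" if "I \<in> \<I>" "w \<in> space M" for I w
  using le1[OF that] norm_triangle_ineq4[of 1 "1 - G I w"] by simp
 have intG [simp, intro]: "integrable M (G I)" if "I \<in> \<I>" for I
  using that norm_G by (intro integrable_const_bound[where B=2]) auto
 have intnG [simp, intro]: "integrable M (\<lambda>w. norm (G I w))" if "I \<in> \<I>" for I using that by simp
 have Re_G: "0 <= Re (G I w)" if "I \<in> \<I>" "w \<in> space M" for I w
  using le1[OF that] abs_Re_le_cmod[of "1 - G I w"] by simp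
 have Re_lam: "0 <= Re lam" unfolding lam_def Re_sum using Re_G
  by (intro sum_nonneg) (simp flip: integral_Re add: lint_nonneg)
 have p_le: "norm (p s A w) <= 1" if "A \<subseteq> \<I>" "w \<in> space M" "0 <= s" "s <= 1" for s A w
  unfolding p_def prod_norm[symmetric] using that le1
  by (intro prod_le_1) (auto intro!: norm_one_minus_scaleR_le_1)
 have p_meas [measurable]: "(\<lambda>x. p (fst x) A (snd x)) \<in> borel_measurable (borel \<Otimes>\<^sub>M M)"
    "(\<lambda>x. p s A x) \<in> borel_measurable M" if "A \<subseteq> \<I>" for A s
  unfolding p_def using that by (auto intro!: borel_measurable_prod)
 have p_int: "integrable M (p s A)" if "A \<subseteq> \<I>" "0 <= s" "s <= 1" for s A
  using that p_le by (intro integrable_const_bound[where B=1]) (auto simp: p_meas)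
 have Gp_int: "integrable M (\<lambda>w. G I w * p s A w)" if that1: "I \<in> \<I>" "A \<subseteq> \<I>" "0 <= s" "s <= 1" for s A I
 proof (rule integrable_const_bound[where B=2])
  have "norm (G I w * p s A w) <= 2 * 1" if w: "w \<in> space M" for w
   unfolding norm_mult using norm_G[OF that1(1) w] p_le[OF that1(2) w that1(3,4)] by (intro mult_mono) auto
  then show "AE w in M. norm (G I w * p s A w) <= 2" by (intro AE_I2) simp
  show "(\<lambda>w. G I w * p s A w) \<in> borel_measurable M" using that by (auto simp: p_meas)
 qed
 \<comment> \<open>The interpolating function and its derivative.\<close>
 define psi where "psi s w = exp (- (1 - of_real s) * lam) * p s \<I> w" for s w
 define dpsi where "dpsi s w = exp (- (1 - of_real s) * lam) *
   (lam * p s \<I> w - (\<Sum>I\<in>\<I>. G I w * p s (\<I> - {I}) w))" for s w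
 have deriv: "((\<lambda>s. psi s w) has_vector_derivative dpsi s w) (at s within S)" for s w S
 proof -
  have "((\<lambda>z. \<Prod>J\<in>\<I>. 1 - z * G J w) has_field_derivative
    (\<Sum>I\<in>\<I>. - G I w * (\<Prod>J\<in>\<I>-{I}. 1 - of_real s * G J w))) (at (of_real s))"
   by (rule has_field_derivative_prod) (auto intro!: derivative_eq_intros)
  then have "((\<lambda>z. exp (- (1 - z) * lam) * (\<Prod>J\<in>\<I>. 1 - z * G J w)) has_field_derivative
    dpsi s w) (at (of_real s))" unfolding dpsi_def p_def by (rule DERIV_cong[OF DERIV_mult, rotated])
     (auto intro!: derivative_eq_intros simp: algebra_simps sum_negf sum_distrib_left)
  then show ?thesis unfolding psi_def p_def by (rule has_vector_derivative_real_field)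
 qed
 have dpsi_cont: "continuous_on S (\<lambda>s. dpsi s w)" for w S
  unfolding dpsi_def p_def by (intro continuous_intros)
 have FTC: "(\<integral>s. indicator {0..1} s *\<^sub>R dpsi s w \<partial>lborel) = psi 1 w - psi 0 w" for w
  by (rule integral_FTC_Icc) (auto intro: deriv dpsi_cont)
 define B where "B = norm lam + (\<Sum>I\<in>\<I>. 2::real)"
 have exp_le: "norm (exp (- (1 - of_real s) * lam)) <= 1" if "0 <= s" "s <= 1" for s
 proof -
  have "norm (exp (- (1 - of_real s) * lam)) = exp (- ((1 - s) * Re lam))"
   unfolding norm_exp_eq_Re by (simp add: algebra_simps)
  then show ?thesis using Re_lam that by simp
 qed
 have dpsi_le: "norm (dpsi s w) <= B" if "0 <= s" "s <= 1" "w \<in> space M" for s w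
 proof -
  have "norm (lam * p s \<I> w - (\<Sum>I\<in>\<I>. G I w * p s (\<I> - {I}) w)) <=
    norm lam * norm (p s \<I> w) + (\<Sum>I\<in>\<I>. norm (G I w) * norm (p s (\<I> - {I}) w))"
   by (rule order_trans[OF norm_triangle_ineq4])
     (intro add_mono, auto simp: norm_mult intro!: order_trans[OF norm_sum])
  also have "... <= norm lam * 1 + (\<Sum>I\<in>\<I>. 2 * 1)"
   using that norm_G p_le by (intro add_mono sum_mono mult_mono) auto
  finally show ?thesis unfolding dpsi_def norm_mult B_def
   using mult_mono[OF exp_le[OF that(1,2)], of "norm (lam * p s \<I> w - (\<Sum>I\<in>\<I>. G I w * p s (\<I> - {I}) w))"
    "norm lam * 1 + (\<Sum>I\<in>\<I>. 2 * 1)"] by simp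
 qed
 interpret L: pair_sigma_finite lborel M
  by (simp add: pair_sigma_finite_def sigma_finite_lborel sigma_finite_measure_axioms)
 have meas: "(\<lambda>x. indicator {0..1} (fst x) *\<^sub>R dpsi (fst x) (snd x)) \<in> borel_measurable (lborel \<Otimes>\<^sub>M M)"
 proof -
  have "(\<lambda>x. indicator {0..1} (fst x) *\<^sub>R dpsi (fst x) (snd x)) \<in> borel_measurable (borel \<Otimes>\<^sub>M M)"
   unfolding dpsi_def by measurable
  then show ?thesis by (simp cong: measurable_cong_sets)
 qed
 have "integrable (lborel \<Otimes>\<^sub>M M) (\<lambda>x. indicator {0..1} (fst x) *\<^sub>R dpsi (fst x) (snd x))"
 proof (rule integrableI_bounded_set[where A="{0..1} \<times> space M" and B=B])
  show "emeasure (lborel \<Otimes>\<^sub>M M) ({0..1::real} \<times> space M) < \<infinity>"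
   by (subst emeasure_pair_measure_Times) (auto simp: emeasure_space_1)
  show "AE x in lborel \<Otimes>\<^sub>M M. x \<in> {0..1} \<times> space M -->
    norm (indicator {0..1} (fst x) *\<^sub>R dpsi (fst x) (snd x)) <= B"
   using dpsi_le by (intro AE_I2) (auto simp: indicator_def)
  show "AE x in lborel \<Otimes>\<^sub>M M. x \<notin> {0..1} \<times> space M --> indicator {0..1} (fst x) *\<^sub>R dpsi (fst x) (snd x) = 0"
   by (intro AE_I2) (auto simp: indicator_def space_pair_measure)
 qed (use meas in simp_all)
 then have int2: "integrable (lborel \<Otimes>\<^sub>M M) (\<lambda>(s, w). indicator {0..1} s *\<^sub>R dpsi s w)"
  by (simp add: case_prod_beta')
 have swap: "(\<integral>w. (\<integral>s. indicator {0..1} s *\<^sub>R dpsi s w \<partial>lborel) \<partial>M) =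
   (\<integral>s. (\<integral>w. indicator {0..1} s *\<^sub>R dpsi s w \<partial>M) \<partial>lborel)" by (rule L.Fubini_integral) (rule int2)
 have bound: "norm (expectation (dpsi s)) <= ?R" if s: "0 <= s" "s <= 1" for s
 proof -
  have E1: "expectation (dpsi s) = exp (- (1 - of_real s) * lam) *
    (\<Sum>I\<in>\<I>. expectation (G I) * expectation (p s \<I>) - expectation (\<lambda>w. G I w * p s (\<I> - {I}) w))"
   unfolding dpsi_def lam_def using s p_int Gp_int by (simp add: sum_subtractf sum_distrib_right)
  have single: "norm (expectation (G I) * expectation (p s \<I>) - expectation (\<lambda>w. G I w * p s (\<I> - {I}) w))
   <= (\<Sum>J\<in>D I. expectation (\<lambda>w. norm (G I w)) * expectation (\<lambda>w. norm (G J w))) +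
    (\<Sum>J\<in>D I - {I}. expectation (\<lambda>w. norm (G I w) * norm (G J w)))" if I: "I \<in> \<I>" for I
  proof -
   let ?Q = "\<I> - D I"
   have sG: "norm (of_real s * G J w) <= norm (G J w)" for J w
    using s by (simp add: norm_mult mult_left_le_one_le)
   have finD: "finite (D I)" using D(2)[OF I] fin finite_subset by blast
   have eq: "expectation (G I) * expectation (p s \<I>) - expectation (\<lambda>w. G I w * p s (\<I> - {I}) w) =
     expectation (G I) * expectation (\<lambda>w. p s \<I> w - p s ?Q w) -
     expectation (\<lambda>w. G I w * (p s (\<I> - {I}) w - p s ?Q w))"
    using ind[OF I s] I s p_int Gp_int by (simp add: right_diff_distrib p_def[symmetric])
   have d1: "norm (p s \<I> w - p s ?Q w) <= (\<Sum>J\<in>D I. norm (G J w))" if w: "w \<in> space M" for w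
   proof -
    have "norm (p s \<I> w - p s ?Q w) <= (\<Sum>i\<in>\<I> - ?Q. norm (1 - (1 - of_real s * G i w)))"
     unfolding p_def using fin w le1 s
     by (intro norm_prod_minus_subset_prod_le norm_one_minus_scaleR_le_1) auto
    also have "\<I> - ?Q = D I" using D(2)[OF I] by auto
    also have "(\<Sum>i\<in>D I. norm (1 - (1 - of_real s * G i w))) <= (\<Sum>J\<in>D I. norm (G J w))"
     using sG by (intro sum_mono) auto
    finally show ?thesis .
   qed
   have d2: "norm (p s (\<I> - {I}) w - p s ?Q w) <= (\<Sum>J\<in>D I - {I}. norm (G J w))" if w: "w \<in> space M" for w
   proof -
    have "norm (p s (\<I>-{I}) w - p s ?Q w) <= (\<Sum>i\<in>(\<I>-{I}) - ?Q. norm (1 - (1 - of_real s * G i w)))"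
     unfolding p_def using fin w le1 s D(1)[OF I]
     by (intro norm_prod_minus_subset_prod_le norm_one_minus_scaleR_le_1) auto
    also have "(\<I>-{I}) - ?Q = D I - {I}" using D(2)[OF I] by auto
    also have "(\<Sum>i\<in>D I - {I}. norm (1 - (1 - of_real s * G i w))) <= (\<Sum>J\<in>D I - {I}. norm (G J w))"
     using sG by (intro sum_mono) auto
    finally show ?thesis .
   qed
   have DI: "J \<in> \<I>" if "J \<in> D I" for J using D(2)[OF I] that by auto
   have "norm (expectation (\<lambda>w. p s \<I> w - p s ?Q w)) <= expectation (\<lambda>w. \<Sum>J\<in>D I. norm (G J w))"
    using DI d1 s p_int by (intro order_trans[OF integral_norm_bound integral_mono]) auto
   also have "... = (\<Sum>J\<in>D I. expectation (\<lambda>w. norm (G J w)))"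
    using DI by (intro Bochner_Integration.integral_sum) auto
   finally have A: "norm (expectation (G I) * expectation (\<lambda>w. p s \<I> w - p s ?Q w)) <=
     expectation (\<lambda>w. norm (G I w)) * (\<Sum>J\<in>D I. expectation (\<lambda>w. norm (G J w)))"
    unfolding norm_mult by (intro mult_mono) (auto intro!: integral_norm_bound lint_nonneg)
   have intGG: "integrable M (\<lambda>w. norm (G I w) * norm (G J w))" if "J \<in> \<I>" for J
   proof (rule integrable_const_bound[where B="2 * 2"])
    have "norm (G I w) * norm (G J w) <= 2 * 2" if "w \<in> space M" for w
     using norm_G[OF I that] norm_G[OF \<open>J \<in> \<I>\<close> that] by (intro mult_mono) auto
    then show "AE w in M. norm (norm (G I w) * norm (G J w)) <= 2 * 2" by (intro AE_I2) simp
   qed (use I that in measurable)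
   have "norm (expectation (\<lambda>w. G I w * (p s (\<I> - {I}) w - p s ?Q w))) <=
     expectation (\<lambda>w. \<Sum>J\<in>D I - {I}. norm (G I w) * norm (G J w))"
   proof (intro order_trans[OF integral_norm_bound integral_mono])
    show "integrable M (\<lambda>w. norm (G I w * (p s (\<I> - {I}) w - p s ?Q w)))"
     using I s Gp_int by (simp add: right_diff_distrib)
    show "integrable M (\<lambda>w. \<Sum>J\<in>D I - {I}. norm (G I w) * norm (G J w))" using DI intGG by auto
    show "norm (G I w * (p s (\<I> - {I}) w - p s ?Q w)) <= (\<Sum>J\<in>D I - {I}. norm (G I w) * norm (G J w))"
     if "w \<in> space M" for w using d2[OF that] by (simp add: norm_mult mult_left_mono flip: sum_distrib_left)
   qed
   also have "... = (\<Sum>J\<in>D I - {I}. expectation (\<lambda>w. norm (G I w) * norm (G J w)))"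
    using DI intGG by (intro Bochner_Integration.integral_sum) auto
   finally show ?thesis unfolding eq sum_distrib_left[symmetric]
    by (intro order_trans[OF norm_triangle_ineq4] add_mono A)
  qed
  have "norm (expectation (dpsi s)) <= 1 * norm (\<Sum>I\<in>\<I>. expectation (G I) * expectation (p s \<I>) - expectation (\<lambda>w. G I w * p s (\<I> - {I}) w))"
   unfolding E1 norm_mult using exp_le[OF s] by (intro mult_right_mono) auto
  also have "... <= ?R" unfolding mult_1 using single by (intro order_trans[OF norm_sum] sum_mono)
  finally show ?thesis .
 qed
 have R0: "0 <= ?R" by (rule order_trans[OF norm_ge_zero bound[of 0]]) auto
 have "expectation (\<lambda>w. psi 1 w - psi 0 w) =
   (\<integral>s. indicator {0..1} s *\<^sub>R expectation (dpsi s) \<partial>lborel)" using swap by (simp add: FTC)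
 moreover have "norm (\<integral>s. indicator {0..1} s *\<^sub>R expectation (dpsi s) \<partial>lborel) <=
   (\<integral>s. indicator {0..1::real} s * ?R \<partial>lborel)"
 proof (rule norm_integral_le_integral)
  show "norm (indicat_real {0..1} s *\<^sub>R expectation (dpsi s)) <= indicator {0..1} s * ?R" for s
   using bound[of s] by (cases "s \<in> {0..1}") simp_all
 qed simp
 ultimately have "norm (expectation (\<lambda>w. psi 1 w - psi 0 w)) <= ?R" by simp
 moreover have "expectation (\<lambda>w. psi 1 w - psi 0 w) = expectation (\<lambda>w. \<Prod>I\<in>\<I>. 1 - G I w) - exp (- lam)"
 proof -
  have "integrable M (\<lambda>w. \<Prod>J\<in>\<I>. 1 - G J w)" using p_int[of \<I> 1] by (simp add: p_def[abs_def])
  then show ?thesis by (simp add: psi_def p_def prob_space)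
 qed
 ultimately show ?thesis by (simp add: lam_def)
qed

section \<open>Fourier inversion for integer-valued random variables\<close>

lemma lborel_integral_cis_int:
 fixes j :: int
 shows "(\<integral>x. indicator {0..2*pi} x *\<^sub>R cis (of_int j * x) \<partial>lborel) = (if j = 0 then 2 * pi else 0)"
proof (cases "j = 0")
 case False
 have "(\<integral>x. indicator {0..2*pi} x *\<^sub>R cis (of_int j * x) \<partial>lborel) =
   cis (of_int j * (2*pi)) / (\<i> * of_int j) - cis (of_int j * 0) / (\<i> * of_int j)"
 proof (rule integral_FTC_Icc)
  fix x :: real
  have "((\<lambda>z. exp (\<i> * of_int j * z) / (\<i> * of_int j)) has_field_derivative exp (\<i> * of_int j * of_real x)) (at (of_real x))"
   using False by (auto intro!: derivative_eq_intros)
  from has_vector_derivative_real_field[OF this]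
  show "((\<lambda>x. cis (of_int j * x) / (\<i> * of_int j)) has_vector_derivative cis (of_int j * x)) (at x within {0..2*pi})"
   by (simp add: cis_conv_exp mult.assoc)
 qed (auto intro!: continuous_intros)
 also have "cis (of_int j * (2*pi)) = 1" by (simp add: cis_conv_exp exp_eq_1)
 finally show ?thesis using False by simp
qed (simp add: scaleR_conv_of_real)

text \<open>The function with Fourier coefficients \<open>1\<close> at the frequencies \<open>0, ..., m - 1\<close>: it extracts
 the event \<open>W < m\<close> from the characteristic function of \<open>W\<close>.\<close>

definition dirichlet_kernel :: "nat => real => complex" where
 "dirichlet_kernel m x = (\<Sum>k<m. cis (- (of_nat k * x)))"

text \<open>A geometric sum: the product telescopes to \<open>1 - cis (- m x)\<close> up to a unimodular factor.\<close>

lemma norm_dirichlet_kernel_le: "norm (dirichlet_kernel m x) * norm (1 - cis x) <= 2"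
proof -
 have "dirichlet_kernel m x = (\<Sum>k<m. cnj (cis x) ^ k)"
  by (simp add: dirichlet_kernel_def cis_cnj Complex.DeMoivre)
 then have "dirichlet_kernel m x * (1 - cnj (cis x)) = 1 - cnj (cis x) ^ m"
  by (simp add: one_diff_power_eq mult.commute)
 then have "norm (dirichlet_kernel m x) * norm (1 - cnj (cis x)) = norm (1 - cnj (cis x) ^ m)"
  by (metis norm_mult)
 also have "... <= norm (1::complex) + norm (cnj (cis x) ^ m)" by (rule norm_triangle_ineq4)
 also have "... = 2" by (simp add: norm_power)
 also have "norm (1 - cnj (cis x)) = norm (1 - cis x)"
  by (metis complex_cnj_diff complex_cnj_one complex_mod_cnj)
 finally show ?thesis .
qed

lemma dirichlet_kernel_cont: "continuous_on A (dirichlet_kernel m)"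
 unfolding dirichlet_kernel_def by (intro continuous_intros)

lemma (in prob_space) prob_less_eq_fourier:
 assumes W [measurable]: "W \<in> M \<rightarrow>\<^sub>M count_space (UNIV :: nat set)"
 shows "(\<integral>x. indicator {0..2*pi} x *\<^sub>R (expectation (\<lambda>w. cis (of_nat (W w) * x)) * dirichlet_kernel m x) \<partial>lborel)
   = of_real (2 * pi * prob {w \<in> space M. W w < m})"
  and "integrable lborel (\<lambda>x. indicator {0..2*pi} x *\<^sub>R (expectation (\<lambda>w. cis (of_nat (W w) * x)) * dirichlet_kernel m x))"
proof -
 interpret L: pair_sigma_finite lborel M
  by (simp add: pair_sigma_finite_def sigma_finite_lborel sigma_finite_measure_axioms)
 define f where "f x w = indicator {0..2*pi} x *\<^sub>R (cis (of_nat (W w) * x) * dirichlet_kernel m x)" for x w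
 have [measurable]: "dirichlet_kernel m \<in> borel_measurable borel" "cis \<in> borel_measurable borel"
  by (auto intro!: borel_measurable_continuous_onI dirichlet_kernel_cont continuous_intros)
 have dle: "norm (dirichlet_kernel m x) <= m" for x
  unfolding dirichlet_kernel_def by (rule order_trans[OF norm_sum]) simp
 have meas: "(\<lambda>(x, w). f x w) \<in> borel_measurable (lborel \<Otimes>\<^sub>M M)"
 proof -
  have "(\<lambda>(x, w). f x w) \<in> borel_measurable (borel \<Otimes>\<^sub>M M)" unfolding f_def by measurable
  then show ?thesis by (simp cong: measurable_cong_sets)
 qed
 have int: "integrable (lborel \<Otimes>\<^sub>M M) (\<lambda>(x, w). f x w)"
 proof (rule integrableI_bounded_set[where A="{0..2*pi} \<times> space M" and B="real m"])
  show "emeasure (lborel \<Otimes>\<^sub>M M) ({0..2*pi} \<times> space M) < \<infinity>"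
   by (subst emeasure_pair_measure_Times) (auto simp: emeasure_space_1)
  show "AE x in lborel \<Otimes>\<^sub>M M. x \<in> {0..2*pi} \<times> space M --> norm (case x of (x, w) => f x w) <= real m"
   using dle by (intro AE_I2) (auto simp: f_def indicator_def norm_mult)
 qed (auto simp: meas f_def indicator_def space_pair_measure)
 have eq: "(\<integral>w. f x w \<partial>M) = indicator {0..2*pi} x *\<^sub>R (expectation (\<lambda>w. cis (of_nat (W w) * x)) * dirichlet_kernel m x)" for x
  by (simp add: f_def)
 show "integrable lborel (\<lambda>x. indicator {0..2*pi} x *\<^sub>R (expectation (\<lambda>w. cis (of_nat (W w) * x)) * dirichlet_kernel m x))"
  using L.integrable_fst'[OF int] by (simp add: eq)
 have inner: "(\<integral>x. f x w \<partial>lborel) = of_real (2 * pi * indicator {w \<in> space M. W w < m} w)" if "w \<in> space M" for w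
 proof -
  have "f x w = (\<Sum>k<m. indicator {0..2*pi} x *\<^sub>R cis (of_int (int (W w) - int k) * x))" for x
   by (simp add: f_def dirichlet_kernel_def sum_distrib_left cis_mult scaleR_sum_right algebra_simps)
  then have "(\<integral>x. f x w \<partial>lborel) = (\<Sum>k<m. (\<integral>x. indicator {0..2*pi} x *\<^sub>R cis (of_int (int (W w) - int k) * x) \<partial>lborel))"
   by (simp only:) (intro Bochner_Integration.integral_sum borel_integrable_compact, auto intro!: continuous_intros)
  also have "... = (\<Sum>k<m. if k = W w then 2 * pi else 0)"
   unfolding lborel_integral_cis_int of_real_sum by (intro sum.cong) auto
  finally show ?thesis using that by (simp add: indicator_def)
 qed
 have "(\<integral>x. indicator {0..2*pi} x *\<^sub>R (expectation (\<lambda>w. cis (of_nat (W w) * x)) * dirichlet_kernel m x) \<partial>lborel)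
   = (\<integral>w. (\<integral>x. f x w \<partial>lborel) \<partial>M)" unfolding L.Fubini_integral[OF int] eq ..
 also have "... = (\<integral>w. of_real (2 * pi * indicator {w \<in> space M. W w < m} w) \<partial>M)"
  by (intro lint_cong refl inner)
 also have "... = of_real (2 * pi * prob {w \<in> space M. W w < m})" by (subst integral_complex_of_real) simp
 finally show "(\<integral>x. indicator {0..2*pi} x *\<^sub>R (expectation (\<lambda>w. cis (of_nat (W w) * x)) * dirichlet_kernel m x) \<partial>lborel)
   = of_real (2 * pi * prob {w \<in> space M. W w < m})" .
qed

lemma poisson_weights_sums: "(\<lambda>k. exp (- l) * l ^ k / fact k) sums (1::real)"
proof -
 have "(\<lambda>k. exp (- l) * (l ^ k /\<^sub>R fact k)) sums (exp (- l) * exp l)" by (intro sums_mult exp_converges)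
 then show ?thesis by (simp add: field_simps exp_minus)
qed

lemma prob_space_poisson_weights:
 assumes "0 <= (l::real)"
 shows "prob_space (density (count_space UNIV) (\<lambda>k. ennreal (exp (- l) * l ^ k / fact k)))"
proof (rule prob_spaceI)
 have "(\<integral>\<^sup>+k. ennreal (exp (- l) * l ^ k / fact k) \<partial>count_space UNIV) = ennreal 1"
  unfolding nn_integral_count_space_nat
  using assms poisson_weights_sums[of l] by (subst suminf_ennreal2) (auto simp: sums_iff)
 then show "emeasure (density (count_space UNIV) (\<lambda>k. ennreal (exp (- l) * l ^ k / fact k)))
   (space (density (count_space UNIV) (\<lambda>k. ennreal (exp (- l) * l ^ k / fact k)))) = 1"
  by (subst emeasure_density) auto
qed

lemma (in prob_space) expectation_power_poisson:
 fixes z :: complex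
 assumes W [measurable]: "W \<in> M \<rightarrow>\<^sub>M count_space (UNIV :: nat set)" and "0 <= l"
  and P: "\<And>k. prob {w \<in> space M. W w = k} = exp (- l) * l ^ k / fact k"
 shows "expectation (\<lambda>w. z ^ W w) = exp (of_real l * (z - 1))"
proof -
 let ?q = "\<lambda>k. exp (- l) * l ^ k / fact k"
 have d: "distr M (count_space UNIV) W = density (count_space UNIV) (\<lambda>k. ennreal (?q k))"
 proof (rule measure_eqI_countable[of _ UNIV])
  fix k :: nat
  have "emeasure (distr M (count_space UNIV) W) {k} = emeasure M {w \<in> space M. W w = k}"
   by (subst emeasure_distr) (auto intro!: arg_cong[where f="emeasure M"])
  also have "... = ennreal (?q k)" by (subst emeasure_eq_measure) (simp only: P)
  finally show "emeasure (distr M (count_space UNIV) W) {k} =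
   emeasure (density (count_space UNIV) (\<lambda>k. ennreal (?q k))) {k}" by (subst emeasure_density) auto
 qed auto
 have sums: "(\<lambda>k. of_real (?q k) * z ^ k) sums (of_real (exp (- l)) * exp (of_real l * z))"
 proof -
  have "(\<lambda>k. of_real (exp (- l)) * ((of_real l * z) ^ k /\<^sub>R fact k)) sums (of_real (exp (- l)) * exp (of_real l * z))"
   by (intro sums_mult exp_converges)
  then show ?thesis by (simp add: field_simps scaleR_conv_of_real power_mult_distrib)
 qed
 have "expectation (\<lambda>w. z ^ W w) = (\<integral>k. z ^ k \<partial>density (count_space UNIV) (\<lambda>k. ennreal (?q k)))"
  unfolding d[symmetric] by (subst integral_distr) auto
 also have "... = (\<integral>k. ?q k *\<^sub>R z ^ k \<partial>count_space UNIV)" using assms by (subst integral_density) auto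
 also have "... = (\<Sum>k. ?q k *\<^sub>R z ^ k)"
 proof (rule integral_count_space_nat)
  have "summable (\<lambda>k. exp (- l) * ((l * norm z) ^ k /\<^sub>R fact k))"
   by (intro summable_mult sums_summable[OF exp_converges])
  then show "integrable (count_space UNIV) (\<lambda>k. ?q k *\<^sub>R z ^ k)"
   using assms by (simp add: integrable_count_space_nat_iff norm_mult norm_power field_simps power_mult_distrib)
 qed
 also have "... = of_real (exp (- l)) * exp (of_real l * z)"
  using sums by (simp add: scaleR_conv_of_real sums_iff)
 also have "... = exp (of_real l * (z - 1))"
  by (simp add: exp_of_real[symmetric] exp_add[symmetric] algebra_simps flip: exp_add)
 finally show ?thesis .
qed

text \<open>The difference of the characteristic functions vanishes at \<open>0\<close> at least as fast as \<open>1 - cis x\<close>,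
 which cancels the pole of the Dirichlet kernels. Hence the bound does not depend on \<open>m\<close>.\<close>

lemma (in prob_space) poisson_kolmogorov_bound:
 assumes W [measurable]: "W \<in> M \<rightarrow>\<^sub>M count_space (UNIV :: nat set)" and l: "0 <= l"
  and A: "\<And>x. norm (expectation (\<lambda>w. cis x ^ W w) - exp (of_real l * (cis x - 1))) <= A * norm (1 - cis x)"
 shows "\<bar>prob {w \<in> space M. W w < m} - exp (- l) * (\<Sum>i<m. l ^ i / fact i)\<bar> <= 2 * A"
proof -
 define N where "N = density (count_space UNIV) (\<lambda>k. ennreal (exp (- l) * l ^ k / fact k))"
 interpret N: prob_space N unfolding N_def using l by (rule prob_space_poisson_weights)
 have sp [simp]: "space N = UNIV" "sets N = UNIV" by (auto simp: N_def)
 have id: "(\<lambda>k. k) \<in> N \<rightarrow>\<^sub>M count_space UNIV" by (simp add: N_def)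
 have em: "measure N B = (\<Sum>k\<in>B. exp (- l) * l ^ k / fact k)" if "finite B" for B
 proof -
  have "emeasure N B = (\<Sum>k\<in>B. ennreal (exp (- l) * l ^ k / fact k))" unfolding N_def using that
   by (subst emeasure_density) (auto simp: nn_integral_count_space_indicator[symmetric] nn_integral_count_space_finite)
  then show ?thesis using l by (simp add: measure_def sum_nonneg)
 qed
 have NP: "N.expectation (\<lambda>k. z ^ k) = exp (of_real l * (z - 1))" for z :: complex
  by (rule N.expectation_power_poisson[OF id l]) (use em[of "{_}"] in simp)
 let ?d = "\<lambda>x. expectation (\<lambda>w. cis (of_nat (W w) * x)) - N.expectation (\<lambda>k. cis (of_nat k * x))"
 \<comment> \<open>By linearity both distribution functions are combined into one integral.\<close>
 let ?I = "\<integral>x. indicator {0..2*pi} x *\<^sub>R (?d x * dirichlet_kernel m x) \<partial>lborel"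
 have eq: "?I = of_real (2 * pi * (prob {w \<in> space M. W w < m} - measure N {..<m}))"
  using prob_less_eq_fourier[OF W, of m] N.prob_less_eq_fourier[OF id, of m]
  by (simp add: algebra_simps lessThan_def)
 have dle: "norm (?d x * dirichlet_kernel m x) <= 2 * A" for x
 proof -
  have "norm (?d x) <= A * norm (1 - cis x)" using A[of x] NP[of "cis x"] by (simp add: Complex.DeMoivre)
  then have le: "norm (?d x * dirichlet_kernel m x) <= A * (norm (dirichlet_kernel m x) * norm (1 - cis x))"
   unfolding norm_mult by (smt (verit) mult.assoc mult.commute mult_right_mono norm_ge_zero)
  have "0 <= A"
  proof -
   have "0 <= A * norm (1 - cis pi)" using A[of pi] norm_ge_zero order_trans by blast
   then show ?thesis by (simp add: cis_pi)
  qed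
  then show ?thesis using le mult_left_mono[OF norm_dirichlet_kernel_le[of m x], of A] by simp
 qed
 have "norm ?I <= (\<integral>x. indicator {0..2*pi} x * (2 * A) \<partial>lborel)"
 proof (rule norm_integral_le_integral)
  show "norm (indicat_real {0..2 * pi} x *\<^sub>R (?d x * dirichlet_kernel m x)) <= indicator {0..2*pi} x * (2 * A)" for x
   using dle[of x] by (simp add: indicator_def)
 qed simp
 then have "2 * pi * \<bar>prob {w \<in> space M. W w < m} - measure N {..<m}\<bar> <= 2 * pi * (2 * A)"
  unfolding eq norm_of_real by (simp add: abs_mult)
 then have "\<bar>prob {w \<in> space M. W w < m} - measure N {..<m}\<bar> <= 2 * A"
  by (subst (asm) mult_le_cancel_left_pos) auto
 then show ?thesis by (simp add: em sum_distrib_left)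
qed

section \<open>Triples and their angles\<close>

definition triples_of :: "'a set => 'a set set" where
 "triples_of A = {I. I \<subseteq> A \<and> card I = 3}"

text \<open>An unordered triple replaces the six ordered ones. On sets with three elements
 this is \<open>pi\<close> minus the largest angle (\<open>deficit_eq_largest_angle\<close>).\<close>

definition deficit :: "'a::real_inner set => real" where
 "deficit I = pi - Max {angle_at b a c | a b c. I = {a, b, c} \<and> a ~= b \<and> b ~= c \<and> a ~= c}"

lemma finite_triples_of: "finite A ==> finite (triples_of A)"
 by (rule finite_subset[of _ "Pow A"]) (auto simp: triples_of_def)

lemma triples_ofE:
 assumes "I \<in> triples_of A"
 obtains x y z where "I = {x, y, z}" "x ~= y" "x ~= z" "y ~= z" "x \<in> A" "y \<in> A" "z \<in> A"
proof -
 have I: "card I = 3" "I \<subseteq> A" using assms by (auto simp: triples_of_def)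
 then obtain x y z where "I = {x, y, z}" "x ~= y" "y ~= z" "x ~= z" unfolding card_3_iff by blast
 then show ?thesis using I that by auto
qed

lemma angle_at_commute: "angle_at b a c = angle_at b c a"
 by (simp add: angle_at_def inner_commute mult.commute)

lemma deficit_eq_largest_angle:
 assumes "x ~= y" "x ~= z" "y ~= z"
 shows "deficit {x, y, z} = pi - largest_angle x y z"
proof -
 have "{angle_at b a c | a b c. {x, y, z} = {a, b, c} \<and> a ~= b \<and> b ~= c \<and> a ~= c} =
   {angle_at x y z, angle_at y x z, angle_at z x y}" (is "?L = ?R")
 proof
  show "?L \<subseteq> ?R"
  proof
   fix t assume "t \<in> ?L"
   then obtain a b c where t: "t = angle_at b a c" and e: "{x, y, z} = {a, b, c}" "a ~= b" "b ~= c" "a ~= c"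
    by blast
   have "a \<in> {x, y, z}" "b \<in> {x, y, z}" "c \<in> {x, y, z}" using e(1) by blast+
   then show "t \<in> ?R" using e(2-4) by (elim insertE emptyE) (simp_all add: t angle_at_commute)
  qed
  have "angle_at x y z \<in> ?L" using assms by (intro CollectI exI[of _ y] exI[of _ x] exI[of _ z]) auto
  moreover have "angle_at y x z \<in> ?L" using assms by (intro CollectI exI[of _ x] exI[of _ y] exI[of _ z]) auto
  moreover have "angle_at z x y \<in> ?L" using assms by (intro CollectI exI[of _ x] exI[of _ z] exI[of _ y]) auto
  ultimately show "?R \<subseteq> ?L" by blast
 qed
 then show ?thesis unfolding deficit_def largest_angle_def by simp
qed

lemma cos_angle_bounds:
 fixes a :: "'a::real_inner"
 shows "- 1 <= a \<bullet> b / (norm a * norm b)" "a \<bullet> b / (norm a * norm b) <= 1"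
proof -
 have "\<bar>a \<bullet> b / (norm a * norm b)\<bar> <= 1"
  using Cauchy_Schwarz_ineq2[of a b] by (cases "norm a * norm b = 0") (auto simp: abs_mult divide_le_eq_1)
 then show "- 1 <= a \<bullet> b / (norm a * norm b)" "a \<bullet> b / (norm a * norm b) <= 1"
  by (auto simp only: abs_le_iff minus_le_iff)
qed

lemma sum_distinct_triples:
 fixes F :: "'a set => 'b :: real_vector"
 assumes "finite A"
 shows "(\<Sum>(x, y, z)\<in>distinct_triples A. F {x, y, z}) = 6 *\<^sub>R (\<Sum>I\<in>triples_of A. F I)"
proof -
 let ?s = "\<lambda>(x, y, z). {x, y, z}"
 have fin: "finite (distinct_triples A)"
  by (rule finite_subset[of _ "A \<times> A \<times> A"]) (use assms in \<open>auto simp: distinct_triples_def\<close>)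
 have im: "?s ` distinct_triples A \<subseteq> triples_of A"
 proof (rule image_subsetI)
  fix t assume "t \<in> distinct_triples A"
  then obtain x y z where "t = (x, y, z)" "x \<in> A" "y \<in> A" "z \<in> A" "x ~= y" "x ~= z" "y ~= z"
   unfolding distinct_triples_def by blast
  then show "?s t \<in> triples_of A" by (simp add: triples_of_def)
 qed
 have "(\<Sum>(x, y, z)\<in>distinct_triples A. F {x, y, z}) = (\<Sum>t\<in>distinct_triples A. F (?s t))"
  by (intro sum.cong) auto
 also have "... = (\<Sum>I\<in>triples_of A. \<Sum>t\<in>{t\<in>distinct_triples A. ?s t = I}. F (?s t))"
  by (rule sum.group[symmetric]) (use fin im finite_triples_of[OF assms] in auto)
 also have "... = (\<Sum>I\<in>triples_of A. 6 *\<^sub>R F I)"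
 proof (intro sum.cong refl)
  fix I assume "I \<in> triples_of A"
  then obtain x y z where I: "I = {x, y, z}" "x ~= y" "x ~= z" "y ~= z" "x \<in> A" "y \<in> A" "z \<in> A"
   by (rule triples_ofE)
  have eq: "{t\<in>distinct_triples A. ?s t = I} =
   {(x,y,z), (x,z,y), (y,x,z), (y,z,x), (z,x,y), (z,y,x)}" (is "?L = ?R")
  proof
   show "?L \<subseteq> ?R"
   proof
    fix t assume t: "t \<in> ?L"
    obtain a b c where [simp]: "t = (a, b, c)" by (cases t) auto
    have d: "a ~= b" "a ~= c" "b ~= c" and e: "{a, b, c} = {x, y, z}"
     using t by (auto simp: distinct_triples_def I)
    have "a \<in> {x, y, z}" "b \<in> {x, y, z}" "c \<in> {x, y, z}" using e by blast+
    then show "t \<in> ?R" using d by (elim insertE emptyE) simp_all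
   qed
   show "?R \<subseteq> ?L" using I by (auto simp: distinct_triples_def)
  qed
  have "(\<Sum>t\<in>{t\<in>distinct_triples A. ?s t = I}. F (?s t)) = (\<Sum>t\<in>?R. F I)"
   by (rule sum.cong[OF eq]) (auto simp: eq[symmetric])
  also have "... = of_nat (card ?R) *\<^sub>R F I" by (rule sum_constant_scaleR)
  also have "card ?R = 6" using I(2-4) by simp
  finally show "(\<Sum>t\<in>{t\<in>distinct_triples A. ?s t = I}. F (?s t)) = 6 *\<^sub>R F I" by simp
 qed
 finally show ?thesis by (simp add: scaleR_sum_right)
qed

text \<open>Continuity and measurability of angles are seen from this form, since \<open>arccos\<close> is
 continuous on \<open>[-1, 1]\<close> only.\<close>

lemma angle_at_clamp:
 "angle_at b a c = arccos (max (- 1) (min 1 (((a - b) \<bullet> (c - b)) / (norm (a - b) * norm (c - b)))))"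
proof -
 have c: "max (- 1) (min 1 q) = q" if "- 1 <= q" "q <= 1" for q :: real using that by simp
 show ?thesis unfolding angle_at_def by (subst c[OF cos_angle_bounds]) (rule refl)
qed

lemma isCont_arccos_clamp: "continuous_on UNIV (\<lambda>x::real. arccos (max (- 1) (min 1 x)))"
 by (intro continuous_on_arccos continuous_intros) auto

lemma borel_measurable_angle_at [measurable (raw)]:
 fixes f g h :: "'b => 'a::euclidean_space"
 assumes [measurable]: "f \<in> borel_measurable M" "g \<in> borel_measurable M" "h \<in> borel_measurable M"
 shows "(\<lambda>x. angle_at (f x) (g x) (h x)) \<in> borel_measurable M"
 unfolding angle_at_clamp by (rule borel_measurable_continuous_on[OF isCont_arccos_clamp]) measurable

lemma borel_measurable_largest_angle [measurable (raw)]: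
 fixes f g h :: "'b => 'a::euclidean_space"
 assumes [measurable]: "f \<in> borel_measurable M" "g \<in> borel_measurable M" "h \<in> borel_measurable M"
 shows "(\<lambda>x. largest_angle (f x) (g x) (h x)) \<in> borel_measurable M"
 unfolding largest_angle_def by simp

lemma tendsto_angle_at:
 assumes "(a \<longlongrightarrow> a') F" "(b \<longlongrightarrow> b') F" "(c \<longlongrightarrow> c') F" "a' ~= b'" "c' ~= b'"
 shows "((\<lambda>n. angle_at (b n) (a n) (c n)) \<longlongrightarrow> angle_at b' a' c') F"
proof -
 have "((\<lambda>n. ((a n - b n) \<bullet> (c n - b n)) / (norm (a n - b n) * norm (c n - b n))) \<longlongrightarrow>
   ((a' - b') \<bullet> (c' - b')) / (norm (a' - b') * norm (c' - b'))) F" using assms by (intro tendsto_intros) auto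
 then show ?thesis unfolding angle_at_clamp
  by (rule continuous_on_tendsto_compose[OF isCont_arccos_clamp]) auto
qed

lemma tendsto_largest_angle:
 assumes "(x \<longlongrightarrow> x') F" "(y \<longlongrightarrow> y') F" "(z \<longlongrightarrow> z') F" "x' ~= y'" "x' ~= z'" "y' ~= z'"
 shows "((\<lambda>n. largest_angle (x n) (y n) (z n)) \<longlongrightarrow> largest_angle x' y' z') F"
 unfolding largest_angle_def using assms by (auto intro!: tendsto_max tendsto_angle_at)

text \<open>Twice the signed area of the triangle spanned by two vectors.\<close>

definition cross2 :: "real^2 => real^2 => real" where
 "cross2 a b = a$1 * b$2 - a$2 * b$1"

definition perp :: "real^2 => real^2" where
 "perp v = vector [- (v$2), v$1]"

lemma inner_vec2: "(a::real^2) \<bullet> b = a$1 * b$1 + a$2 * b$2" by (simp add: inner_vec_def sum_2)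

lemma norm_vec2: "(norm (a::real^2))\<^sup>2 = (a$1)\<^sup>2 + (a$2)\<^sup>2"
 unfolding power2_norm_eq_inner inner_vec2 by (simp add: power2_eq_square)

lemma perp_nth [simp]: "perp v $ 1 = - (v$2)" "perp v $ 2 = v$1" by (simp_all add: perp_def)

text \<open>The lengths being fixed, inner product and cross product are cosine and sine of the angle.\<close>

lemma lagrange_cross2: "(a \<bullet> b)\<^sup>2 + (cross2 a b)\<^sup>2 = (norm a * norm b)\<^sup>2"
 by (simp add: power_mult_distrib norm_vec2 inner_vec2 cross2_def) algebra

lemma norm_perp [simp]: "norm (perp v) = norm v" by (rule power2_eq_imp_eq) (simp_all add: norm_vec2)

lemma angle_at_ge_iff:
 fixes a :: "'a::real_inner"
 assumes "0 <= e" "e <= pi" "a ~= b" "c ~= b"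
 shows "pi - e <= angle_at b a c \<longleftrightarrow> (a - b) \<bullet> (c - b) <= - cos e * (norm (a - b) * norm (c - b))"
proof -
 have p: "norm (a - b) * norm (c - b) > 0" using assms by simp
 have "pi - e = arccos (- cos e)" using assms by (simp add: arccos_minus arccos_cos)
 moreover have "\<bar>(a - b) \<bullet> (c - b) / (norm (a - b) * norm (c - b))\<bar> <= 1"
  using cos_angle_bounds[of "a - b" "c - b"] by (auto simp: abs_le_iff)
 ultimately have "pi - e <= angle_at b a c \<longleftrightarrow> (a - b) \<bullet> (c - b) / (norm (a - b) * norm (c - b)) <= - cos e"
  unfolding angle_at_def by (simp add: arccos_le_mono abs_le_iff)
 then show ?thesis using p by (simp add: pos_divide_le_eq)
qed

lemma angle_at_ge_imp:
 assumes "0 <= e" "e <= pi / 2" "a ~= b" "c ~= b" "pi - e <= angle_at b a c"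
 shows "(a - b) \<bullet> (c - b) <= 0" "\<bar>cross2 (a - b) (c - b)\<bar> <= e * (norm (a - b) * norm (c - b))"
proof -
 let ?d = "(a - b) \<bullet> (c - b)" and ?N = "norm (a - b) * norm (c - b)"
 have le: "?d <= - cos e * ?N" using assms by (subst (asm) angle_at_ge_iff) auto
 have c0: "0 <= cos e" using assms by (intro cos_ge_zero) auto
 have "0 <= cos e * ?N" using c0 by (intro mult_nonneg_nonneg) auto
 then show "?d <= 0" using le by linarith
 have "(cos e * ?N)\<^sup>2 <= (- ?d)\<^sup>2" using le \<open>0 <= cos e * ?N\<close> by (intro power_mono) auto
 then have "(cross2 (a - b) (c - b))\<^sup>2 <= (sin e * ?N)\<^sup>2"
 proof -
  have *: "k <= (1 - x) * N" if "x * N <= d" "d + k = N" for k x N d :: real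
   using that by (simp add: algebra_simps)
  show ?thesis unfolding power_mult_distrib[of "sin e"] sin_squared_eq
   by (rule *[OF _ lagrange_cross2]) (use \<open>(cos e * ?N)\<^sup>2 <= (- ?d)\<^sup>2\<close> in \<open>simp only: power_mult_distrib power2_minus\<close>)
 qed
 then have "\<bar>cross2 (a - b) (c - b)\<bar> <= \<bar>sin e * ?N\<bar>" by (simp add: abs_le_square_iff)
 also have "... = sin e * ?N" using assms by (intro abs_of_nonneg mult_nonneg_nonneg sin_ge_zero) auto
 also have "... <= e * ?N" using assms by (intro mult_right_mono sin_x_le_x) auto
 finally show "\<bar>cross2 (a - b) (c - b)\<bar> <= e * ?N" .
qed

text \<open>For an obtuse angle \<open>pi - d\<close> the quotient of cross product and inner product is \<open>tan d\<close>
 in absolute value, and \<open>tan\<close> increases on \<open>[0, pi / 2)\<close>.\<close>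

lemma angle_at_ge_iff_tan:
 assumes "0 < e" "e < pi / 2" "a ~= b" "c ~= b"
 shows "pi - e <= angle_at b a c \<longleftrightarrow> \<bar>cross2 (a - b) (c - b)\<bar> <= - tan e * ((a - b) \<bullet> (c - b))"
proof -
 let ?d = "(a - b) \<bullet> (c - b)" and ?N = "norm (a - b) * norm (c - b)" and ?k = "cross2 (a - b) (c - b)"
 have c0: "0 < cos e" "0 < sin e" using assms by (auto intro!: cos_gt_zero sin_gt_zero)
 have L: "?d\<^sup>2 + ?k\<^sup>2 = ?N\<^sup>2" by (rule lagrange_cross2)
 have sc: "(sin e)\<^sup>2 = 1 - (cos e)\<^sup>2" by (rule sin_squared_eq)
 have "pi - e <= angle_at b a c \<longleftrightarrow> cos e * ?N <= - ?d" using assms by (subst angle_at_ge_iff) auto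
 also have "... \<longleftrightarrow> ?d <= 0 \<and> (cos e * ?N)\<^sup>2 <= ?d\<^sup>2"
 proof -
  have "0 <= cos e * ?N" using c0 by (intro mult_nonneg_nonneg) auto
  then show ?thesis using abs_le_square_iff[of "cos e * ?N" ?d] by auto
 qed
 also have "(cos e * ?N)\<^sup>2 <= ?d\<^sup>2 \<longleftrightarrow> (cos e * ?k)\<^sup>2 <= (sin e * ?d)\<^sup>2"
 proof -
  have *: "x * N <= d \<longleftrightarrow> x * k <= (1 - x) * d" if "d + k = N" for k x N d :: real
   unfolding that[symmetric] by (simp add: algebra_simps)
  show ?thesis using *[OF L] by (simp only: power_mult_distrib sc)
 qed
 also have "?d <= 0 \<and> (cos e * ?k)\<^sup>2 <= (sin e * ?d)\<^sup>2 \<longleftrightarrow> cos e * \<bar>?k\<bar> <= - (sin e * ?d)"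
 proof -
  have eq: "(cos e * ?k)\<^sup>2 <= (sin e * ?d)\<^sup>2 \<longleftrightarrow> cos e * \<bar>?k\<bar> <= sin e * \<bar>?d\<bar>"
   using c0 by (simp add: abs_le_square_iff[symmetric] abs_mult)
  have "?d <= 0" if "cos e * \<bar>?k\<bar> <= - (sin e * ?d)"
  proof -
   have "0 <= cos e * \<bar>?k\<bar>" using c0 by (intro mult_nonneg_nonneg) auto
   then have "sin e * ?d <= 0" using that by linarith
   then show ?thesis using c0 by (simp add: mult_le_0_iff)
  qed
  then show ?thesis unfolding eq by auto
 qed
 also have "... \<longleftrightarrow> \<bar>?k\<bar> <= - tan e * ?d" using c0 by (simp add: tan_def field_simps)
 finally show ?thesis .
qed

text \<open>All three values are twice the area of the triangle.\<close>

lemma cross2_cyclic: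
 "\<bar>cross2 (y - x) (z - x)\<bar> = \<bar>cross2 (x - y) (z - y)\<bar>"
 "\<bar>cross2 (y - x) (z - x)\<bar> = \<bar>cross2 (x - z) (y - z)\<bar>"
 by (simp_all add: cross2_def algebra_simps abs_minus_commute)

text \<open>Wherever the large angle sits, the area of the triangle is at most \<open>e / 2\<close> times the product of the
 two sides at that vertex. One of these sides can be bounded by \<open>2 r\<close>, the other one has to be compared
 with the side \<open>x y\<close>; this is possible because the side opposite to the obtuse angle is the longest one.\<close>

lemma deficit_le_imp_near_line:
 fixes x y z :: "real^2"
 assumes d: "x ~= y" "x ~= z" "y ~= z" and e: "0 <= e" "e <= pi / 2" "deficit {x, y, z} <= e"
  and r: "norm x <= r" "norm y <= r" "norm z <= r"
 shows "\<bar>cross2 (y - x) (z - x)\<bar> <= 2 * r * e * norm (y - x)"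
proof -
 have dist: "norm (u - v) <= 2 * r" if "norm u <= r" "norm v <= r" for u v :: "real^2"
  using that norm_triangle_ineq4[of u v] by linarith
 have "pi - e <= angle_at x y z \<or> pi - e <= angle_at y x z \<or> pi - e <= angle_at z x y"
  using e(3) unfolding deficit_eq_largest_angle[OF d] largest_angle_def by auto
 then consider "pi - e <= angle_at x y z" | "pi - e <= angle_at y x z" | "pi - e <= angle_at z x y" by blast
 then show ?thesis
 proof cases
  case 1
  have "\<bar>cross2 (y - x) (z - x)\<bar> <= e * (norm (y - x) * norm (z - x))"
   using angle_at_ge_imp(2)[OF e(1,2) _ _ 1] d by auto
  also have "... <= e * (norm (y - x) * (2 * r))" using e r by (intro mult_left_mono dist) auto
  finally show ?thesis by (simp add: algebra_simps)
 next
  case 2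
  have "\<bar>cross2 (y - x) (z - x)\<bar> <= e * (norm (x - y) * norm (z - y))"
   using angle_at_ge_imp(2)[OF e(1,2) _ _ 2] d by (auto simp: cross2_cyclic(1)[of y x z])
  also have "... <= e * (norm (x - y) * (2 * r))" using e r by (intro mult_left_mono dist) auto
  finally show ?thesis by (simp add: algebra_simps norm_minus_commute)
 next
  case 3
  note A = angle_at_ge_imp[OF e(1,2) _ _ 3]
  have "\<bar>cross2 (y - x) (z - x)\<bar> <= e * (norm (x - z) * norm (y - z))"
   using A(2) d by (auto simp: cross2_cyclic(2)[of y x z])
  also have "norm (x - z) <= norm (y - x)"
  proof (rule power2_le_imp_le)
   have "(norm (y - x))\<^sup>2 = (norm (x - z))\<^sup>2 + (norm (y - z))\<^sup>2 - 2 * ((x - z) \<bullet> (y - z))"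
    unfolding power2_norm_eq_inner by (simp add: inner_diff algebra_simps inner_commute)
   moreover have "(x - z) \<bullet> (y - z) <= 0" using A(1) d by auto
   ultimately show "(norm (x - z))\<^sup>2 <= (norm (y - x))\<^sup>2" using zero_le_power2[of "norm (y - z)"] by linarith
  qed auto
  also have "norm (y - z) <= 2 * r" using r by (intro dist)
  finally show ?thesis using e by (simp add: algebra_simps mult_left_mono mult_right_mono)
 qed
qed

lemma nn_integral_lborel_vec2:
 fixes f :: "real^2 => ennreal"
 assumes [measurable]: "f \<in> borel_measurable borel"
 shows "(\<integral>\<^sup>+x. f x \<partial>lborel) = (\<integral>\<^sup>+s. \<integral>\<^sup>+u. f (vector [s, u]) \<partial>lborel \<partial>lborel)"
proof -
 define T :: "real \<times> real => real^2" where "T = (\<lambda>(s, u). vector [s, u])"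
 have T_meas: "T \<in> borel_measurable borel"
 proof (rule borel_measurable_continuous_onI)
  have "T = (\<lambda>p. \<chi> i. if i = 1 then fst p else snd p)" by (auto simp: T_def vec_eq_iff forall_2 fun_eq_iff)
  moreover have "continuous_on UNIV (\<lambda>p::real\<times>real. \<chi> i::2. if i = 1 then fst p else snd p)"
  proof (intro continuous_on_vec_lambda)
   show "continuous_on UNIV (\<lambda>x::real\<times>real. if i = 1 then fst x else snd x)" for i :: 2
    by (cases "i = 1") (auto intro: continuous_intros)
  qed
  ultimately show "continuous_on UNIV T" by simp
 qed
 then have [measurable]: "T \<in> lborel \<Otimes>\<^sub>M lborel \<rightarrow>\<^sub>M borel"
  by (simp add: borel_prod[symmetric] cong: measurable_cong_sets)
 have basis: "(\<Prod>b\<in>Basis. (u - l) \<bullet> b) = (u$1 - l$1) * (u$2 - l$2)" for u l :: "real^2"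
 proof -
  have "(\<Prod>b\<in>(Basis::(real^2) set). (u - l) \<bullet> b) = (\<Prod>i\<in>UNIV. (u - l) $ i)"
   unfolding Basis_vec_def by (subst prod.UNION_disjoint) (auto simp: inner_axis axis_eq_axis)
  then show ?thesis by (simp add: UNIV_2 prod.insert)
 qed
 have "lborel = distr (lborel \<Otimes>\<^sub>M lborel) borel T"
 proof (rule lborel_eqI)
  fix l u :: "real^2" assume le: "\<And>b. b \<in> Basis ==> l \<bullet> b <= u \<bullet> b"
  have le': "l$1 <= u$1" "l$2 <= u$2"
   using le[of "axis 1 1"] le[of "axis 2 1"] by (auto simp: inner_axis Basis_vec_def)
  have "T -` box l u = {l$1<..<u$1} \<times> {l$2<..<u$2}"
   by (auto simp: T_def box_def Basis_vec_def inner_axis forall_2 exhaust_2)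
  then have "emeasure (distr (lborel \<Otimes>\<^sub>M lborel) borel T) (box l u) =
    emeasure (lborel \<Otimes>\<^sub>M lborel) ({l$1<..<u$1} \<times> {l$2<..<u$2})"
   by (subst emeasure_distr) (auto simp: space_pair_measure)
  also have "... = ennreal (u$1 - l$1) * ennreal (u$2 - l$2)"
   using le' by (subst lborel.emeasure_pair_measure_Times) auto
  finally show "emeasure (distr (lborel \<Otimes>\<^sub>M lborel) borel T) (box l u) = (\<Prod>b\<in>Basis. (u - l) \<bullet> b)"
   unfolding basis using le' by (simp add: ennreal_mult)
 qed simp
 then have "(\<integral>\<^sup>+x. f x \<partial>lborel) = (\<integral>\<^sup>+x. f x \<partial>distr (lborel \<Otimes>\<^sub>M lborel) borel T)" by simp
 also have "... = (\<integral>\<^sup>+p. f (T p) \<partial>(lborel \<Otimes>\<^sub>M lborel))" by (subst nn_integral_distr) auto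
 also have "... = (\<integral>\<^sup>+s. \<integral>\<^sup>+u. f (T (s, u)) \<partial>lborel \<partial>lborel)"
  by (subst lborel.nn_integral_fst[symmetric]) auto
 finally show ?thesis by (simp add: T_def)
qed

text \<open>Coordinates along and across a segment with direction \<open>v\<close>: the linear map that sends
 the unit vectors to \<open>v\<close> and \<open>perp v\<close> has determinant \<open>(norm v)^2\<close>.\<close>

lemma nn_integral_lborel_frame:
 fixes f :: "real^2 => ennreal"
 assumes f [measurable]: "f \<in> borel_measurable borel" and v: "v ~= 0"
 shows "(\<integral>\<^sup>+x. f x \<partial>lborel) =
   ennreal ((norm v)\<^sup>2) * (\<integral>\<^sup>+s. \<integral>\<^sup>+u. f (p + s *\<^sub>R v + u *\<^sub>R perp v) \<partial>lborel \<partial>lborel)"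
proof -
 define \<Phi> where "\<Phi> c = p + (c$1) *\<^sub>R v + (c$2) *\<^sub>R perp v" for c :: "real^2"
 define g where "g = (\<lambda>x::real^2. vector [x \<bullet> v / (norm v)\<^sup>2, x \<bullet> perp v / (norm v)\<^sup>2] :: real^2)"
 have [measurable]: "\<Phi> \<in> borel_measurable borel"
  unfolding \<Phi>_def by (intro borel_measurable_continuous_onI continuous_intros)
 have n0: "(norm v)\<^sup>2 ~= 0" "v$1 * v$1 + v$2 * v$2 ~= 0" using v norm_vec2[of v] by (auto simp: power2_eq_square)
 have lin: "linear g"
  by (rule linearI) (simp_all add: g_def vec_eq_iff forall_2 inner_add_left add_divide_distrib)
 have "det (matrix g) = 1 / (norm v)\<^sup>2"
 proof -
  have "det (matrix g) = (v$1 * v$1 + v$2 * v$2) / ((norm v)\<^sup>2 * (norm v)\<^sup>2)"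
   unfolding det_2 matrix_def g_def using n0 by (simp add: inner_vec2 axis_def add_divide_distrib)
  moreover have "v$1 * v$1 + v$2 * v$2 = (norm v)\<^sup>2" unfolding norm_vec2 by (simp only: power2_eq_square)
  moreover have "x / (x * x) = 1 / x" if "x ~= 0" for x :: real using that by simp
  ultimately show ?thesis using n0(1) by (simp only:)
 qed
 then have det: "\<bar>det (matrix g)\<bar> = 1 / (norm v)\<^sup>2" by simp
 have gr: "g (\<Phi> c - p) = c" and rg: "\<Phi> (g (x - p)) = x" for c x
 proof -
  let ?R = "v$1 * v$1 + v$2 * v$2"
  have R: "(norm v)\<^sup>2 = ?R" unfolding norm_vec2 by (simp only: power2_eq_square)
  have "((c$1 * v$1 - c$2 * v$2) * v$1 + (c$1 * v$2 + c$2 * v$1) * v$2) = c$1 * ?R"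
   "((c$1 * v$1 - c$2 * v$2) * (- v$2) + (c$1 * v$2 + c$2 * v$1) * v$1) = c$2 * ?R" by algebra+
  then show "g (\<Phi> c - p) = c" using n0 by (simp add: g_def \<Phi>_def vec_eq_iff forall_2 inner_vec2 R)
  have *: "((x$1 - p$1) * v$1 + (x$2 - p$2) * v$2) * v$1 + ((x$2 - p$2) * v$1 - (x$1 - p$1) * v$2) * (- v$2) = (x$1 - p$1) * ?R"
   "((x$1 - p$1) * v$1 + (x$2 - p$2) * v$2) * v$2 + ((x$2 - p$2) * v$1 - (x$1 - p$1) * v$2) * v$1 = (x$2 - p$2) * ?R"
   by algebra+
  have "a / R * b + d / R * c = e" if "a * b + d * c = e * R" "R ~= 0" for a b c d e R :: real
   using that by (simp add: field_simps)
  from this[OF *(1) n0(2)] this[OF *(2) n0(2)] show "\<Phi> (g (x - p)) = x"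
   by (simp add: g_def \<Phi>_def vec_eq_iff forall_2 inner_vec2 R)
 qed
 have pre: "\<Phi> -` B = g ` ((\<lambda>x. x - p) ` B)" for B
 proof (intro set_eqI iffI)
  fix c assume "c \<in> \<Phi> -` B"
  then have "g (\<Phi> c - p) \<in> g ` ((\<lambda>x. x - p) ` B)" by (intro imageI) simp
  then show "c \<in> g ` ((\<lambda>x. x - p) ` B)" by (simp only: gr)
 next
  fix c assume "c \<in> g ` ((\<lambda>x. x - p) ` B)"
  then obtain b where "b \<in> B" "c = g (b - p)" by blast
  then show "c \<in> \<Phi> -` B" by (simp add: rg)
 qed
 let ?M = "scale_measure (ennreal ((norm v)\<^sup>2)) (distr lborel borel \<Phi>)"
 have "lborel = ?M"
 proof (rule lborel_eqI)
  fix l u :: "real^2" assume le: "\<And>b. b \<in> Basis ==> l \<bullet> b <= u \<bullet> b"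
  let ?B = "(\<lambda>x. x - p) ` box l u"
  have B: "?B = box (l - p) (u - p)"
  proof (rule set_eqI)
   fix x
   have "x \<in> ?B \<longleftrightarrow> x + p \<in> box l u"
   proof
    assume "x + p \<in> box l u"
    then have "(x + p) - p \<in> ?B" by (rule imageI)
    then show "x \<in> ?B" by simp
   qed auto
   then show "x \<in> ?B \<longleftrightarrow> x \<in> box (l - p) (u - p)"
    by (simp add: box_def inner_diff_left inner_add_left less_diff_eq diff_less_eq)
  qed
  have Bm: "?B \<in> lmeasurable" unfolding B by simp
  have "emeasure lborel (\<Phi> -` box l u) = emeasure lebesgue (g ` ?B)"
  proof -
   have "\<Phi> -` box l u \<in> sets borel" using measurable_sets[of \<Phi> borel borel "box l u"] by simp
   then show ?thesis unfolding pre[symmetric] by simp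
  qed
  also have "... = ennreal (measure lebesgue (g ` ?B))"
   using measurable_linear_image[OF lin Bm] by (simp add: emeasure_eq_measure2)
  also have "measure lebesgue (g ` ?B) = 1 / (norm v)\<^sup>2 * measure lebesgue ?B"
   unfolding measure_linear_image[OF lin Bm] det ..
  also have "measure lebesgue ?B = (\<Prod>b\<in>Basis. (u - l) \<bullet> b)"
   unfolding B using le by (simp add: inner_diff_left measure_lborel_box_eq)
  finally have "emeasure lborel (\<Phi> -` box l u) = ennreal (1 / (norm v)\<^sup>2 * (\<Prod>b\<in>Basis. (u - l) \<bullet> b))" .
  moreover have "0 <= (\<Prod>b\<in>Basis. (u - l) \<bullet> b)" using le by (intro prod_nonneg) (auto simp: inner_diff_left)
  ultimately show "emeasure ?M (box l u) = (\<Prod>b\<in>Basis. (u - l) \<bullet> b)"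
   using n0 by (simp add: emeasure_distr ennreal_mult[symmetric])
 qed simp
 then have "(\<integral>\<^sup>+x. f x \<partial>lborel) = (\<integral>\<^sup>+x. f x \<partial>?M)" by (rule arg_cong[where f="\<lambda>M. nn_integral M f"])
 also have "... = ennreal ((norm v)\<^sup>2) * (\<integral>\<^sup>+x. f (\<Phi> x) \<partial>lborel)"
  by (subst nn_integral_scale_measure) (auto simp: nn_integral_distr)
 also have "(\<integral>\<^sup>+x. f (\<Phi> x) \<partial>lborel) = (\<integral>\<^sup>+s. \<integral>\<^sup>+u. f (p + s *\<^sub>R v + u *\<^sub>R perp v) \<partial>lborel \<partial>lborel)"
  by (subst nn_integral_lborel_vec2) (auto simp: \<Phi>_def)
 finally show ?thesis .
qed

section \<open>Strips and nearly collinear triples\<close>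

locale lipschitz_density =
 fixes K :: "(real^2) set" and \<phi> :: "real^2 => real" and \<mu> :: "(real^2) measure" and L :: real
 assumes compact_K: "compact K" and convex_K: "convex K" and interior_K: "interior K ~= {}"
  and \<phi>_nonneg: "x \<in> K ==> 0 <= \<phi> x" and lipschitz_\<phi>: "L-lipschitz_on K \<phi>"
  and \<mu>_def: "\<mu> = density (restrict_space lborel K) (\<lambda>x. ennreal (\<phi> x))"
  and prob_space_\<mu>: "prob_space \<mu>"
begin

sublocale mu: prob_space \<mu> by (rule prob_space_\<mu>)

text \<open>The density is used on the whole plane, since lenses and strips may leave \<open>K\<close>.\<close>

definition dens :: "real^2 => real" where "dens x = (if x \<in> K then \<phi> x else 0)"

definition sup_dens :: real where "sup_dens = (SOME b. 0 < b \<and> (\<forall>x. dens x <= b))"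

text \<open>The margin of \<open>2\<close> leaves room for points that have been moved by rounding.\<close>

definition rad :: real where "rad = (SOME r. 1 <= r \<and> (\<forall>x\<in>K. norm x + 2 <= r))"

lemma K_borel [measurable]: "K \<in> sets borel" using compact_K by (simp add: borel_closed compact_imp_closed)

lemma space_\<mu> [simp]: "space \<mu> = K" by (simp add: \<mu>_def space_restrict_space)

lemma sets_\<mu>: "sets \<mu> = sets (restrict_space borel K)" by (simp add: \<mu>_def sets_restrict_space)

lemma sets_\<mu>_iff: "B \<in> sets \<mu> \<longleftrightarrow> B \<in> sets borel \<and> B \<subseteq> K"
 unfolding sets_\<mu> by (subst sets_restrict_space_iff) (use K_borel in auto)

lemma measurable_\<mu> [measurable (raw)]:
 assumes "f \<in> borel_measurable borel"
 shows "f \<in> borel_measurable \<mu>"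
 unfolding measurable_cong_sets[OF sets_\<mu> refl] using assms by (rule measurable_restrict_space1)

lemma id_measurable_\<mu> [measurable (raw)]: "(\<lambda>x. x) \<in> borel_measurable \<mu>" by (rule measurable_\<mu>) simp

lemma dens_nonneg [simp]: "0 <= dens x" using \<phi>_nonneg by (simp add: dens_def)

lemma dens_measurable [measurable]: "dens \<in> borel_measurable borel"
proof -
 have "continuous_on K \<phi>" using lipschitz_\<phi> by (rule lipschitz_on_continuous_on)
 then have "(\<lambda>x. indicator K x *\<^sub>R \<phi> x) \<in> borel_measurable borel"
  by (rule borel_measurable_continuous_on_indicator[OF K_borel])
 moreover have "dens = (\<lambda>x. indicator K x *\<^sub>R \<phi> x)" by (auto simp: dens_def indicator_def)
 ultimately show ?thesis by simp
qed

lemma sup_dens: "0 < sup_dens" "dens x <= sup_dens"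
proof -
 have "continuous_on K \<phi>" using lipschitz_\<phi> by (rule lipschitz_on_continuous_on)
 then have "bounded (\<phi> ` K)" using compact_K by (intro compact_imp_bounded compact_continuous_image)
 then obtain b where b: "\<And>x. x \<in> K ==> norm (\<phi> x) <= b" by (auto simp: bounded_iff)
 have "0 < max b 1 \<and> (\<forall>x. dens x <= max b 1)" using b by (auto simp: dens_def abs_le_iff le_max_iff_disj)
 then have "0 < sup_dens \<and> (\<forall>x. dens x <= sup_dens)" unfolding sup_dens_def by (rule someI)
 then show "0 < sup_dens" "dens x <= sup_dens" by auto
qed

lemma rad: "1 <= rad" "x \<in> K ==> norm x + 2 <= rad"
proof -
 obtain b where b: "\<And>x. x \<in> K ==> norm x <= b"
  using compact_imp_bounded[OF compact_K] by (auto simp: bounded_iff)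
 have "1 <= max 1 (b + 2) \<and> (\<forall>x\<in>K. norm x + 2 <= max 1 (b + 2))" using b by (auto simp: le_max_iff_disj)
 then have "1 <= rad \<and> (\<forall>x\<in>K. norm x + 2 <= rad)" unfolding rad_def by (rule someI)
 then show "1 <= rad" "x \<in> K ==> norm x + 2 <= rad" by auto
qed

lemma dist_K: "x \<in> K ==> y \<in> K ==> norm (x - y) <= 2 * rad"
 using rad(2)[of x] rad(2)[of y] norm_triangle_ineq4[of x y] by linarith

lemma emeasure_\<mu>:
 assumes "B \<in> sets borel"
 shows "emeasure \<mu> (B \<inter> K) = (\<integral>\<^sup>+x. ennreal (dens x) * indicator B x \<partial>lborel)"
proof -
 have c: "continuous_on K \<phi>" using lipschitz_\<phi> by (rule lipschitz_on_continuous_on)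
 have m: "(\<lambda>x. ennreal (\<phi> x)) \<in> borel_measurable (restrict_space lborel K)"
  using borel_measurable_continuous_on_restrict[OF c] by (intro measurable_compose[OF _ measurable_ennreal])
    (simp cong: measurable_cong_sets add: sets_restrict_space)
 have B: "B \<inter> K \<in> sets (restrict_space lborel K)" using assms by (auto simp: sets_restrict_space)
 have "emeasure \<mu> (B \<inter> K) = (\<integral>\<^sup>+x. ennreal (\<phi> x) * indicator (B \<inter> K) x \<partial>restrict_space lborel K)"
  unfolding \<mu>_def using B m by (subst emeasure_density) auto
 also have "... = (\<integral>\<^sup>+x. ennreal (\<phi> x) * indicator (B \<inter> K) x * indicator K x \<partial>lborel)"
  by (subst nn_integral_restrict_space) auto
 also have "... = (\<integral>\<^sup>+x. ennreal (dens x) * indicator B x \<partial>lborel)"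
  by (intro nn_integral_cong) (auto simp: dens_def indicator_def)
 finally show ?thesis .
qed

text \<open>A strip of width \<open>2 d\<close> meets the disc of radius \<open>rad\<close> in a set of area at most \<open>4 * rad * d\<close>.\<close>

lemma measure_strip:
 assumes e: "norm e = 1" and "0 <= d" and B: "B \<in> sets borel" "B \<subseteq> {z. \<bar>cross2 e (z - p)\<bar> <= d}"
 shows "measure \<mu> (B \<inter> K) <= 4 * sup_dens * rad * d"
proof -
 let ?I = "{- (p \<bullet> e) - rad..- (p \<bullet> e) + rad}"
 have e0: "e ~= 0" using e by auto
 have e1: "e$1 * e$1 + e$2 * e$2 = 1" using e norm_vec2[of e] by (simp add: power2_eq_square)
 have "emeasure \<mu> (B \<inter> K) = (\<integral>\<^sup>+s. \<integral>\<^sup>+u. ennreal (dens (p + s *\<^sub>R e + u *\<^sub>R perp e)) *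
   indicator B (p + s *\<^sub>R e + u *\<^sub>R perp e) \<partial>lborel \<partial>lborel)"
  unfolding emeasure_\<mu>[OF B(1)] using B(1) e0 by (subst nn_integral_lborel_frame[of _ e p]) (auto simp: e)
 also have "... <= (\<integral>\<^sup>+s. \<integral>\<^sup>+u. ennreal sup_dens * (indicator ?I s * indicator {-d..d} u) \<partial>lborel \<partial>lborel)"
 proof (intro nn_integral_mono)
  fix s u :: real
  let ?z = "p + s *\<^sub>R e + u *\<^sub>R perp e"
  show "ennreal (dens ?z) * indicator B ?z <= ennreal sup_dens * (indicator ?I s * indicator {-d..d} u)"
  proof (cases "?z \<in> B \<and> ?z \<in> K")
   case True
   have "cross2 e (?z - p) = u * (e$1 * e$1 + e$2 * e$2)" by (simp add: cross2_def algebra_simps)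
   then have u: "u \<in> {-d..d}" using True B(2) e1 by (auto simp: abs_le_iff)
   have "?z \<bullet> e = p \<bullet> e + s * (e$1 * e$1 + e$2 * e$2)" by (simp add: inner_vec2 algebra_simps)
   then have "\<bar>p \<bullet> e + s\<bar> <= norm ?z" using Cauchy_Schwarz_ineq2[of ?z e] e e1 by simp
   then have "\<bar>p \<bullet> e + s\<bar> <= rad" using rad(2)[of ?z] True by linarith
   then have "s \<in> ?I" by auto
   then show ?thesis using True u sup_dens(2)[of ?z] by (simp add: ennreal_leI)
  qed (auto simp: dens_def indicator_def)
 qed
 also have "... = ennreal sup_dens * (ennreal (2 * rad) * ennreal (2 * d))"
 proof -
  have "(\<integral>\<^sup>+u. ennreal sup_dens * (indicator ?I s * indicator {-d..d} u) \<partial>lborel) =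
    ennreal sup_dens * ennreal (2 * d) * indicator ?I s" for s
   using assms(2) by (cases "s \<in> ?I") (simp_all add: nn_integral_cmult)
  moreover have "(\<integral>\<^sup>+s. ennreal sup_dens * ennreal (2 * d) * indicator ?I s \<partial>lborel) =
    ennreal sup_dens * ennreal (2 * d) * ennreal (2 * rad)"
   using rad(1) by (subst nn_integral_cmult_indicator) simp_all
  ultimately show ?thesis by (simp add: ac_simps)
 qed
 also have "... = ennreal (4 * sup_dens * rad * d)"
  using sup_dens(1) rad(1) assms(2) by (simp add: ennreal_mult[symmetric] algebra_simps)
 finally show ?thesis using sup_dens(1) rad(1) assms(2) by (simp add: mu.emeasure_eq_measure)
qed

lemma measure_\<mu>_singleton: "measure \<mu> {x} = 0"
proof (cases "x \<in> K")
 case True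
 let ?e = "axis 1 1 :: real^2"
 have "measure \<mu> ({x} \<inter> K) <= 4 * sup_dens * rad * 0"
  by (rule measure_strip[of ?e _ _ x]) (auto simp: cross2_def norm_axis_1)
 then show ?thesis using True measure_nonneg[of \<mu> "{x}"] by simp
next
 case False
 then have "{x} \<notin> sets \<mu>" by (simp add: sets_\<mu>_iff)
 then show ?thesis by (simp add: measure_notin_sets)
qed

text \<open>The summand \<open>1\<close> makes the estimate below trivial for \<open>e > pi / 2\<close>, where flatness no
 longer confines the third point to a strip.\<close>

definition C_line :: real where "C_line = 8 * sup_dens * rad * rad + 1"

lemma C_line_ge_1: "1 <= C_line" using sup_dens(1) rad(1) by (simp add: C_line_def)

text \<open>The third vertex of a flat triangle lies close to the line through the other two, so it falls into
 a strip; how close \<open>x\<close> and \<open>y\<close> are does not matter. The map \<open>q\<close> is the identity or a rounding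
 to a grid, which widens the strip by \<open>k\<close>.\<close>

lemma measure_deficit_le:
 assumes S: "S \<in> sets \<mu>" "\<And>z. z \<in> S ==> q z ~= x \<and> q z ~= y \<and> deficit {x, y, q z} <= e"
  and xy: "x ~= y" "norm x <= rad" "norm y <= rad"
  and q: "\<And>z. z \<in> K ==> norm (q z - z) <= k" "k <= 2" and e: "0 <= e"
 shows "measure \<mu> S <= C_line * (e + k)"
proof -
 obtain z0 where z0: "z0 \<in> K" using interior_K interior_subset[of K] by auto
 have k: "0 <= k" by (rule order_trans[OF norm_ge_zero q(1)[OF z0]])
 show ?thesis
 proof (cases "e <= pi / 2")
  case e2: True
  define a where "a = (1 / norm (y - x)) *\<^sub>R (y - x)"
  have a: "norm a = 1" using xy by (simp add: a_def)
  have cr: "cross2 (y - x) w = norm (y - x) * cross2 a w" for w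
   using xy by (simp add: a_def cross2_def field_simps)
  have sub: "S \<subseteq> {z. \<bar>cross2 a (z - x)\<bar> <= 2 * rad * e + k}"
  proof
   fix z assume z: "z \<in> S"
   then have zK: "z \<in> K" using S(1) by (auto simp: sets_\<mu>_iff)
   have "norm (q z) <= norm (q z - z) + norm z" using norm_triangle_ineq[of "q z - z" z] by simp
   then have "norm (q z) <= rad" using q(1)[OF zK] q(2) rad(2)[OF zK] by linarith
   then have "\<bar>cross2 (y - x) (q z - x)\<bar> <= 2 * rad * e * norm (y - x)"
    using S(2)[OF z] xy e e2 by (intro deficit_le_imp_near_line) auto
   then have 1: "\<bar>cross2 a (q z - x)\<bar> <= 2 * rad * e"
    unfolding cr using xy by (simp add: abs_mult mult.commute)
   have "(cross2 a (z - q z))\<^sup>2 <= (norm a * norm (z - q z))\<^sup>2"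
    using lagrange_cross2[of a "z - q z"] zero_le_power2[of "a \<bullet> (z - q z)"] by linarith
   then have "\<bar>cross2 a (z - q z)\<bar> <= norm (z - q z)"
    using abs_le_square_iff[of "cross2 a (z - q z)" "norm (z - q z)"] a by simp
   then have 2: "\<bar>cross2 a (z - q z)\<bar> <= k" using q(1)[OF zK] by (simp add: norm_minus_commute)
   have "cross2 a (z - x) = cross2 a (q z - x) + cross2 a (z - q z)" by (simp add: cross2_def algebra_simps)
   then show "z \<in> {z. \<bar>cross2 a (z - x)\<bar> <= 2 * rad * e + k}" using 1 2 by simp
  qed
  have "measure \<mu> (S \<inter> K) <= 4 * sup_dens * rad * (2 * rad * e + k)"
   by (rule measure_strip[OF a _ _ sub]) (use S(1) e k rad(1) in \<open>auto simp: sets_\<mu>_iff\<close>)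
  moreover have "S \<inter> K = S" using S(1) by (auto simp: sets_\<mu>_iff)
  moreover have "4 * sup_dens * rad * (2 * rad * e + k) <= C_line * (e + k)"
  proof -
   have "(4 * sup_dens * rad * k) * 1 <= (4 * sup_dens * rad * k) * (2 * rad)"
    using sup_dens(1) rad(1) k by (intro mult_left_mono mult_nonneg_nonneg) auto
   moreover have "C_line * (e + k) = 8 * sup_dens * rad * rad * e + (4 * sup_dens * rad * k) * (2 * rad) + e + k"
    by (simp add: C_line_def algebra_simps)
   moreover have "4 * sup_dens * rad * (2 * rad * e + k) = 8 * sup_dens * rad * rad * e + 4 * sup_dens * rad * k"
    by (simp add: algebra_simps)
   ultimately show ?thesis using e k by linarith
  qed
  ultimately show ?thesis by simp
 next
  case False
  have "measure \<mu> S <= 1" by simp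
  also have "1 <= e" using False pi_gt3 by simp
  also have "e <= e + k" using k by simp
  also have "e + k <= C_line * (e + k)" using mult_right_mono[OF C_line_ge_1, of "e + k"] e k by simp
  finally show ?thesis .
 qed
qed

end

section \<open>The lens of points that see a segment under a large angle\<close>

lemma tan_small_bounds:
 fixes e :: real
 assumes "0 < e" "e <= 1/2"
 shows "e <= tan e" "tan e <= 2 * e" "tan e - e <= 2 * e\<^sup>2" "0 < tan e" "tan e <= 1"
proof -
 have pi: "pi / 4 > 1 / 2" using pi_gt3 by simp
 have "\<exists>z>0. z < e \<and> tan e - tan 0 = (e - 0) * inverse ((cos z)\<^sup>2)"
 proof (rule MVT2)
  fix x assume "0 <= x" "x <= e"
  then have "cos x ~= 0" using cos_gt_zero_pi[of x] assms pi by force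
  then show "(tan has_real_derivative inverse ((cos x)\<^sup>2)) (at x)" by (rule DERIV_tan)
 qed (use assms in simp)
 then obtain z where z: "0 < z" "z < e" "tan e = e * inverse ((cos z)\<^sup>2)" by auto
 have cz: "cos z ~= 0" using cos_gt_zero_pi[of z] z assms pi by force
 have eq: "tan e = e * (1 + (tan z)\<^sup>2)" using z(3) tan_sec[OF cz] by (simp add: power_inverse)
 have tz: "0 <= tan z" "tan z <= tan e" "tan e < 1"
  using tan_pos_pi2_le[of z] tan_mono_le[of z e] tan_monotone[of e "pi/4"] z assms pi by (auto simp: tan_45)
 have tz1: "(tan z)\<^sup>2 <= 1" using power_mono[of "tan z" 1 2] tz by simp
 have "e * (1 + (tan z)\<^sup>2) <= e * (1 + 1)" using tz1 assms by (intro mult_left_mono) auto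
 then show le2: "tan e <= 2 * e" using eq by simp
 have "e * (1 + 0) <= e * (1 + (tan z)\<^sup>2)" using assms by (intro mult_left_mono) auto
 then show "e <= tan e" using eq by simp
 then show "0 < tan e" using assms by linarith
 show "tan e <= 1" using tz by simp
 have "(tan z)\<^sup>2 <= (2 * e)\<^sup>2" using tz le2 by (intro power_mono) auto
 then have "e * (tan z)\<^sup>2 <= e * (2 * e)\<^sup>2" using assms by (intro mult_left_mono) auto
 also have "... = 2 * e\<^sup>2 * (2 * e)" by (simp add: power2_eq_square)
 also have "... <= 2 * e\<^sup>2 * 1" using assms by (intro mult_left_mono) auto
 finally show "tan e - e <= 2 * e\<^sup>2" using eq by (simp add: algebra_simps)
qed

text \<open>For \<open>T = tan e\<close> these are the points \<open>z\<close> that see \<open>x\<close> and \<open>y\<close> under an angle of at least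
 \<open>pi - e\<close>, see \<open>angle_at_ge_iff_tan\<close>; the defining formula avoids any division.\<close>

definition lens :: "real => real^2 => real^2 => (real^2) set" where
 "lens T x y = {z. \<bar>cross2 (x - z) (y - z)\<bar> <= - T * ((x - z) \<bullet> (y - z))}"

lemma vec2_nth_measurable [measurable (raw)]:
 fixes f :: "'a => real^2"
 assumes "f \<in> borel_measurable M"
 shows "(\<lambda>x. f x $ i) \<in> borel_measurable M"
 using assms by (rule borel_measurable_continuous_on[rotated]) (intro continuous_intros)

lemma cross2_measurable [measurable (raw)]:
 assumes [measurable]: "f \<in> borel_measurable M" "g \<in> borel_measurable M"
 shows "(\<lambda>x. cross2 (f x) (g x)) \<in> borel_measurable M"
 unfolding cross2_def by measurable

lemma lens_borel [measurable]: "lens T x y \<in> sets borel" unfolding lens_def by measurable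

text \<open>With the length of the segment as unit, \<open>s\<close> runs along it and \<open>u\<close> is the distance from it.
 The two boundary arcs are circular, by the inscribed angle theorem.\<close>

lemma lens_frame:
 assumes "x ~= y"
 shows "y + s *\<^sub>R (x - y) + u *\<^sub>R perp (x - y) \<in> lens T x y \<longleftrightarrow> \<bar>u\<bar> + T * u\<^sup>2 <= T * (s * (1 - s))"
proof -
 define v where "v = x - y"
 define R where "R = v$1 * v$1 + v$2 * v$2"
 have "R = (norm v)\<^sup>2" unfolding norm_vec2 by (simp only: R_def power2_eq_square)
 then have R: "0 < R" using assms by (simp add: v_def)
 let ?z = "y + s *\<^sub>R v + u *\<^sub>R perp v"
 have x: "x = y + v" by (simp add: v_def)
 have e1: "cross2 (x - ?z) (y - ?z) = - (R * u)" by (simp add: x R_def cross2_def) algebra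
 have e2: "(x - ?z) \<bullet> (y - ?z) = R * (u\<^sup>2 - s * (1 - s))"
  by (simp add: x R_def inner_vec2 power2_eq_square) algebra
 have "\<bar>- (R * u)\<bar> = R * \<bar>u\<bar>" "- T * (R * (u\<^sup>2 - s * (1 - s))) = R * (- T * (u\<^sup>2 - s * (1 - s)))"
  using R by (simp_all add: abs_mult)
 then have "?z \<in> lens T x y \<longleftrightarrow> R * \<bar>u\<bar> <= R * (- T * (u\<^sup>2 - s * (1 - s)))"
  by (simp only: lens_def mem_Collect_eq e1 e2)
 also have "... \<longleftrightarrow> \<bar>u\<bar> <= - T * (u\<^sup>2 - s * (1 - s))" using R by (rule mult_le_cancel_left_pos)
 also have "... \<longleftrightarrow> \<bar>u\<bar> + T * u\<^sup>2 <= T * (s * (1 - s))" by (simp add: algebra_simps)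
 finally show ?thesis by (simp add: v_def)
qed

text \<open>The quadratic term changes the width of a section by a relative amount of
 at most \<open>T^2\<close>.\<close>

lemma lens_section_bounds:
 fixes s u T :: real
 assumes T: "0 < T" "T <= 1" and s: "0 <= s" "s <= 1"
 shows "\<bar>u\<bar> + T * u\<^sup>2 <= T * (s * (1 - s)) ==> \<bar>u\<bar> <= T * (s * (1 - s))"
  and "\<bar>u\<bar> <= T * (s * (1 - s)) * (1 - T\<^sup>2) ==> \<bar>u\<bar> + T * u\<^sup>2 <= T * (s * (1 - s))"
proof -
 define w where "w = s * (1 - s)"
 have w: "0 <= w" "w <= 1" using s by (auto simp: w_def intro!: mult_le_one)
 have "0 <= T * u\<^sup>2" using T by simp
 then show "\<bar>u\<bar> + T * u\<^sup>2 <= T * (s * (1 - s)) ==> \<bar>u\<bar> <= T * (s * (1 - s))" by linarith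
 assume "\<bar>u\<bar> <= T * (s * (1 - s)) * (1 - T\<^sup>2)"
 then have u: "\<bar>u\<bar> <= T * w * (1 - T\<^sup>2)" by (simp add: w_def)
 have T2: "T\<^sup>2 <= 1" "0 <= T\<^sup>2" using T power_mono[of T 1 2] by auto
 have "T * w * (1 - T\<^sup>2) <= T * w * 1" using T w T2 by (intro mult_left_mono) auto
 then have "\<bar>u\<bar> <= T * w" using u by simp
 then have "\<bar>u\<bar>\<^sup>2 <= (T * w)\<^sup>2" by (intro power_mono) auto
 then have "T * u\<^sup>2 <= T * (T * w)\<^sup>2" using T by (simp add: mult_left_mono)
 also have "... = T * T\<^sup>2 * w * w" by (simp add: power2_eq_square)
 also have "... <= T * T\<^sup>2 * w * 1" using T w by (intro mult_left_mono) auto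
 finally have "\<bar>u\<bar> + T * u\<^sup>2 <= T * w * (1 - T\<^sup>2) + T * T\<^sup>2 * w" using u by simp
 also have "... = T * w" by (simp add: algebra_simps)
 finally show "\<bar>u\<bar> + T * u\<^sup>2 <= T * (s * (1 - s))" by (simp add: w_def)
qed

context lipschitz_density
begin

text \<open>The integral over one segment that occurs in the definition of \<open>\<beta>\<close>.\<close>

definition chord :: "real^2 => real^2 => real" where
 "chord x y = (\<integral>s. indicator {0..1} s * (s * (1 - s) * dens (y + s *\<^sub>R (x - y))) \<partial>lborel)"

lemma L_nonneg: "0 <= L" using lipschitz_\<phi> by (simp add: lipschitz_on_def)

lemma chord_integrable:
 "integrable lborel (\<lambda>s. indicator {0..1} s * (s * (1 - s) * dens (y + s *\<^sub>R (x - y))))"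
proof (rule integrableI_bounded_set[where A="{0..1}" and B="1 * 1 * sup_dens"])
 show "AE s in lborel. s \<in> {0..1} --> norm (indicator {0..1} s * (s * (1 - s) * dens (y + s *\<^sub>R (x - y)))) <= 1 * 1 * sup_dens"
 proof (intro AE_I2 impI)
  fix s :: real assume s: "s \<in> {0..1}"
  then have "s * (1 - s) * dens (y + s *\<^sub>R (x - y)) <= 1 * 1 * sup_dens"
   using sup_dens by (intro mult_mono) auto
  then show "norm (indicator {0..1} s * (s * (1 - s) * dens (y + s *\<^sub>R (x - y)))) <= 1 * 1 * sup_dens"
   using s by (simp add: abs_mult)
 qed
qed auto

lemma chord_bounds: "0 <= chord x y" "chord x y <= sup_dens"
proof -
 show "0 <= chord x y"
  unfolding chord_def by (intro lint_nonneg) (auto simp: indicator_def)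
 have "chord x y <= (\<integral>s. indicator {0..1::real} s * sup_dens \<partial>lborel)" unfolding chord_def
 proof (rule integral_mono)
  fix s :: real
  show "indicator {0..1} s * (s * (1 - s) * dens (y + s *\<^sub>R (x - y))) <= indicator {0..1} s * sup_dens"
  proof (cases "s \<in> {0..1}")
   case True
   then have "s * (1 - s) * dens (y + s *\<^sub>R (x - y)) <= 1 * sup_dens"
    using sup_dens by (intro mult_mono mult_le_one) auto
   then show ?thesis using True by simp
  qed simp
 qed (use chord_integrable in auto)
 then show "chord x y <= sup_dens" by simp
qed

lemma emeasure_lens:
 assumes "x ~= y"
 shows "emeasure \<mu> (lens T x y \<inter> K) = ennreal ((norm (x - y))\<^sup>2) *
  (\<integral>\<^sup>+s. \<integral>\<^sup>+u. ennreal (dens (y + s *\<^sub>R (x - y) + u *\<^sub>R perp (x - y))) *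
    indicator {u. \<bar>u\<bar> + T * u\<^sup>2 <= T * (s * (1 - s))} u \<partial>lborel \<partial>lborel)"
 unfolding emeasure_\<mu>[OF lens_borel] using assms by (subst nn_integral_lborel_frame[of _ "x - y" y])
   (auto simp: indicator_def lens_frame intro!: arg_cong[where f="\<lambda>x. _ * x"] nn_integral_cong)

lemma lens_section_empty:
 fixes s u T :: real
 assumes "0 < T" "s \<notin> {0..1}" shows "\<not> \<bar>u\<bar> + T * u\<^sup>2 <= T * (s * (1 - s))"
proof -
 have "s * (1 - s) < 0" using assms(2) by (auto simp: mult_less_0_iff)
 then have "T * (s * (1 - s)) < 0" using assms(1) by (simp add: mult_pos_neg)
 moreover have "0 <= \<bar>u\<bar> + T * u\<^sup>2" using assms(1) by simp
 ultimately show ?thesis by linarith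
qed

text \<open>Two instances matter: \<open>a = 1\<close> and a small \<open>c\<close> when the density varies little across the
 lens, and \<open>a = 0\<close> with \<open>c\<close> an upper bound of the density when the lens may reach the boundary of \<open>K\<close>,
 where the extended density jumps.\<close>

lemma measure_lens_upper:
 assumes "x ~= y" and T: "0 < T" "T <= 1" and c: "0 <= c"
  and d: "\<And>s u. 0 <= s ==> s <= 1 ==> \<bar>u\<bar> <= T ==>
   dens (y + s *\<^sub>R (x - y) + u *\<^sub>R perp (x - y)) <= a * dens (y + s *\<^sub>R (x - y)) + c"
  and a: "0 <= a"
 shows "measure \<mu> (lens T x y \<inter> K) <= (norm (x - y))\<^sup>2 * (2 * T * (a * chord x y + c))"
proof -
 let ?v = "x - y" and ?r = "norm (x - y)"
 let ?D = "\<lambda>s. dens (y + s *\<^sub>R ?v)"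
 have "(\<integral>\<^sup>+s. \<integral>\<^sup>+u. ennreal (dens (y + s *\<^sub>R ?v + u *\<^sub>R perp ?v)) *
    indicator {u. \<bar>u\<bar> + T * u\<^sup>2 <= T * (s * (1 - s))} u \<partial>lborel \<partial>lborel) <=
   (\<integral>\<^sup>+s. ennreal (indicator {0..1} s * (2 * T * (a * (s * (1 - s) * ?D s) + c))) \<partial>lborel)"
 proof (intro nn_integral_mono)
  fix s :: real
  show "(\<integral>\<^sup>+u. ennreal (dens (y + s *\<^sub>R ?v + u *\<^sub>R perp ?v)) *
    indicator {u. \<bar>u\<bar> + T * u\<^sup>2 <= T * (s * (1 - s))} u \<partial>lborel) <=
    ennreal (indicator {0..1} s * (2 * T * (a * (s * (1 - s) * ?D s) + c)))"
  proof (cases "s \<in> {0..1}")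
   case True
   define w where "w = s * (1 - s)"
   have w: "0 <= w" "w <= 1" using True by (auto simp: w_def intro!: mult_le_one)
   have Tw: "0 <= T * w" "T * w <= T" using T w by (auto simp: mult_left_le)
   have "(\<integral>\<^sup>+u. ennreal (dens (y + s *\<^sub>R ?v + u *\<^sub>R perp ?v)) *
     indicator {u. \<bar>u\<bar> + T * u\<^sup>2 <= T * (s * (1 - s))} u \<partial>lborel) <=
     (\<integral>\<^sup>+u. ennreal (a * ?D s + c) * indicator {- (T * w)..T * w} u \<partial>lborel)"
   proof (intro nn_integral_mono)
    fix u :: real
    show "ennreal (dens (y + s *\<^sub>R ?v + u *\<^sub>R perp ?v)) *
     indicator {u. \<bar>u\<bar> + T * u\<^sup>2 <= T * (s * (1 - s))} u <= ennreal (a * ?D s + c) * indicator {- (T * w)..T * w} u"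
    proof (cases "\<bar>u\<bar> + T * u\<^sup>2 <= T * (s * (1 - s))")
     case u: True
     have "\<bar>u\<bar> <= T * w" using lens_section_bounds(1)[OF T _ _ u] True by (simp add: w_def)
     moreover have "dens (y + s *\<^sub>R ?v + u *\<^sub>R perp ?v) <= a * ?D s + c"
      using True \<open>\<bar>u\<bar> <= T * w\<close> Tw by (intro d) auto
     ultimately show ?thesis using u by (auto simp: abs_le_iff ennreal_leI indicator_def)
    qed simp
   qed
   also have "... = ennreal (a * ?D s + c) * ennreal (2 * (T * w))"
    using Tw by (subst nn_integral_cmult_indicator) auto
   also have "... = ennreal ((a * ?D s + c) * (2 * (T * w)))" using a c Tw by (simp add: ennreal_mult)
   also have "... <= ennreal (2 * T * (a * (w * ?D s) + c))"
   proof (rule ennreal_leI)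
    have "c * (2 * (T * w)) <= c * (2 * T)" using c Tw by (intro mult_left_mono) auto
    then show "(a * ?D s + c) * (2 * (T * w)) <= 2 * T * (a * (w * ?D s) + c)" by (simp add: algebra_simps)
   qed
   finally show ?thesis using True by (simp add: w_def)
  next
   case False
   then show ?thesis using lens_section_empty[OF T(1) False] by simp
  qed
 qed
 also have "... = ennreal (\<integral>s. indicator {0..1} s * (2 * T * (a * (s * (1 - s) * ?D s) + c)) \<partial>lborel)"
 proof (rule nn_integral_eq_integral)
  have "integrable lborel (\<lambda>s. 2 * T * a * (indicator {0..1} s * (s * (1 - s) * ?D s)) + 2 * T * c * indicator {0..1::real} s)"
   by (intro Bochner_Integration.integrable_add integrable_mult_right chord_integrable) simp
  then show "integrable lborel (\<lambda>s. indicator {0..1} s * (2 * T * (a * (s * (1 - s) * ?D s) + c)))"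
   by (simp add: algebra_simps)
  show "AE s in lborel. 0 <= indicator {0..1} s * (2 * T * (a * (s * (1 - s) * ?D s) + c))"
   using a c T by (intro AE_I2) (auto simp: indicator_def)
 qed
 also have "(\<integral>s. indicator {0..1} s * (2 * T * (a * (s * (1 - s) * ?D s) + c)) \<partial>lborel) =
   (\<integral>s. 2 * T * a * (indicator {0..1} s * (s * (1 - s) * ?D s)) + 2 * T * c * indicator {0..1::real} s \<partial>lborel)"
  by (simp add: algebra_simps)
 also have "... = 2 * T * a * chord x y + 2 * T * c"
  unfolding chord_def using chord_integrable by (subst Bochner_Integration.integral_add) auto
 finally have "emeasure \<mu> (lens T x y \<inter> K) <= ennreal (?r\<^sup>2) * ennreal (2 * T * a * chord x y + 2 * T * c)"
  unfolding emeasure_lens[OF assms(1)] by (intro mult_left_mono) auto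
 then have "emeasure \<mu> (lens T x y \<inter> K) <= ennreal (?r\<^sup>2 * (2 * T * (a * chord x y + c)))"
  using a c T chord_bounds(1)[of x y] by (simp add: ennreal_mult[symmetric] algebra_simps)
 then show ?thesis using a c T chord_bounds(1)[of x y] by (simp add: mu.emeasure_eq_measure)
qed

lemma measure_lens_lower:
 assumes "x ~= y" and T: "0 < T" "T <= 1" and c: "0 <= c"
  and d: "\<And>s u. 0 <= s ==> s <= 1 ==> \<bar>u\<bar> <= T ==>
   dens (y + s *\<^sub>R (x - y)) - c <= dens (y + s *\<^sub>R (x - y) + u *\<^sub>R perp (x - y))"
 shows "(norm (x - y))\<^sup>2 * (2 * T * (1 - T\<^sup>2) * (chord x y - c)) <= measure \<mu> (lens T x y \<inter> K)"
proof -
 let ?v = "x - y" and ?r = "norm (x - y)"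
 let ?D = "\<lambda>s. dens (y + s *\<^sub>R ?v)"
 define k where "k = 2 * T * (1 - T\<^sup>2)"
 have T2: "T\<^sup>2 <= 1" using T power_mono[of T 1 2] by auto
 have k: "0 <= k" using T T2 by (simp add: k_def)
 let ?g = "\<lambda>s. indicator {0..1} s * (k * (s * (1 - s) * ?D s - c))"
 have int: "integrable lborel (\<lambda>s. k * (indicator {0..1} s * (s * (1 - s) * ?D s)) - k * c * indicator {0..1::real} s)"
  by (intro Bochner_Integration.integrable_diff integrable_mult_right chord_integrable) simp
 then have int': "integrable lborel ?g" by (simp add: algebra_simps)
 have "ennreal (\<integral>s. ?g s \<partial>lborel) <= ennreal (\<integral>s. max 0 (?g s) \<partial>lborel)"
  using int' by (intro ennreal_leI integral_mono) auto
 also have "... = (\<integral>\<^sup>+s. ennreal (max 0 (?g s)) \<partial>lborel)"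
  using int' by (intro nn_integral_eq_integral[symmetric]) auto
 also have "... <= (\<integral>\<^sup>+s. \<integral>\<^sup>+u. ennreal (dens (y + s *\<^sub>R ?v + u *\<^sub>R perp ?v)) *
    indicator {u. \<bar>u\<bar> + T * u\<^sup>2 <= T * (s * (1 - s))} u \<partial>lborel \<partial>lborel)"
 proof (intro nn_integral_mono)
  fix s :: real
  show "ennreal (max 0 (?g s)) <= (\<integral>\<^sup>+u. ennreal (dens (y + s *\<^sub>R ?v + u *\<^sub>R perp ?v)) *
    indicator {u. \<bar>u\<bar> + T * u\<^sup>2 <= T * (s * (1 - s))} u \<partial>lborel)"
  proof (cases "s \<in> {0..1}")
   case True
   define w where "w = s * (1 - s)"
   define b where "b = T * w * (1 - T\<^sup>2)"
   have w: "0 <= w" "w <= 1" using True by (auto simp: w_def intro!: mult_le_one)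
   have b0: "0 <= b" using T T2 w by (simp add: b_def)
   have bT: "b <= T"
   proof -
    have "w * (1 - T\<^sup>2) <= 1" using w T2 by (intro mult_le_one) auto
    then show ?thesis using T mult_left_mono[of "w * (1 - T\<^sup>2)" 1 T] by (simp add: b_def mult.assoc)
   qed
   have "k * (w * ?D s - c) <= max 0 (?D s - c) * (2 * b)"
   proof -
    have "k * (w * ?D s - c) <= k * (w * (?D s - c))"
     using k w c mult_left_mono[of w 1 c] by (intro mult_left_mono) (auto simp: algebra_simps)
    also have "... <= k * (w * max 0 (?D s - c))" using k w by (intro mult_left_mono) auto
    also have "... = max 0 (?D s - c) * (2 * b)" by (simp add: k_def b_def algebra_simps)
    finally show ?thesis .
   qed
   then have "ennreal (max 0 (?g s)) <= ennreal (max 0 (?D s - c) * (2 * b))"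
    using True b0 by (intro ennreal_leI) (simp add: w_def)
   also have "... = ennreal (max 0 (?D s - c)) * ennreal (2 * b)" using b0 by (intro ennreal_mult) auto
   also have "... = (\<integral>\<^sup>+u. ennreal (max 0 (?D s - c)) * indicator {- b..b} u \<partial>lborel)"
    using b0 by (subst nn_integral_cmult_indicator) auto
   also have "... <= (\<integral>\<^sup>+u. ennreal (dens (y + s *\<^sub>R ?v + u *\<^sub>R perp ?v)) *
     indicator {u. \<bar>u\<bar> + T * u\<^sup>2 <= T * (s * (1 - s))} u \<partial>lborel)"
   proof (intro nn_integral_mono)
    fix u :: real
    show "ennreal (max 0 (?D s - c)) * indicator {- b..b} u <= ennreal (dens (y + s *\<^sub>R ?v + u *\<^sub>R perp ?v)) *
     indicator {u. \<bar>u\<bar> + T * u\<^sup>2 <= T * (s * (1 - s))} u"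
    proof (cases "u \<in> {- b..b}")
     case u: True
     then have ub: "\<bar>u\<bar> <= b" by auto
     then have "\<bar>u\<bar> + T * u\<^sup>2 <= T * (s * (1 - s))"
      using True by (intro lens_section_bounds(2)[OF T]) (auto simp: b_def w_def)
     moreover have "?D s - c <= dens (y + s *\<^sub>R ?v + u *\<^sub>R perp ?v)" using True ub bT by (intro d) auto
     ultimately show ?thesis using u by (simp add: ennreal_leI)
    qed simp
   qed
   finally show ?thesis .
  qed simp
 qed
 finally have "ennreal (?r\<^sup>2) * ennreal (\<integral>s. ?g s \<partial>lborel) <= emeasure \<mu> (lens T x y \<inter> K)"
  unfolding emeasure_lens[OF assms(1)] by (intro mult_left_mono) auto
 moreover have "(\<integral>s. ?g s \<partial>lborel) = (\<integral>s. k * (indicator {0..1} s * (s * (1 - s) * ?D s)) - k * c * indicator {0..1::real} s \<partial>lborel)"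
  by (simp add: algebra_simps)
 moreover have "... = k * chord x y - k * c"
  unfolding chord_def using chord_integrable by (subst Bochner_Integration.integral_diff) auto
 ultimately have "ennreal (?r\<^sup>2 * (k * chord x y - k * c)) <= ennreal (measure \<mu> (lens T x y \<inter> K))"
  by (simp add: ennreal_mult' mu.emeasure_eq_measure)
 then have "?r\<^sup>2 * (k * chord x y - k * c) <= measure \<mu> (lens T x y \<inter> K)" by simp
 then show ?thesis by (simp add: k_def algebra_simps)
qed

end

section \<open>Mean mass of a lens\<close>

context lipschitz_density
begin

text \<open>The copy of \<open>K\<close> contracted towards the point \<open>c\<close> by the factor \<open>1 - t\<close>.\<close>

definition shrunk :: "real^2 => real => (real^2) set" where
 "shrunk c t = (\<lambda>z. t *\<^sub>R c + (1 - t) *\<^sub>R z) ` K"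

lemma compact_shrunk: "compact (shrunk c t)"
 unfolding shrunk_def using compact_K by (intro compact_continuous_image continuous_intros)

lemma shrunk_borel [measurable]: "shrunk c t \<in> sets borel"
 using compact_shrunk by (simp add: borel_closed compact_imp_closed)

lemma shrunk_subset:
 assumes "c \<in> K" "0 <= t" "t <= 1" shows "shrunk c t \<subseteq> K"
 unfolding shrunk_def using assms convexD[OF convex_K, of c _ t "1 - t"] by auto

lemma convex_shrunk: "convex (shrunk c t)"
proof -
 have "shrunk c t = (+) (t *\<^sub>R c) ` ((*\<^sub>R) (1 - t) ` K)" by (auto simp: shrunk_def image_image)
 then show ?thesis using convex_K by (simp add: convex_translation convex_scaling)
qed

text \<open>Write \<open>z + w = t (c + w / t) + (1 - t) k\<close> with \<open>k\<close> in \<open>K\<close>: the first point lies in the ball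
 around \<open>c\<close>, and \<open>K\<close> is convex.\<close>

lemma shrunk_thick:
 assumes z: "z \<in> shrunk c t" and b: "ball c h \<subseteq> K" and t: "0 < t" "t <= 1" and w: "norm w < t * h"
 shows "z + w \<in> K"
proof -
 obtain k where k: "k \<in> K" "z = t *\<^sub>R c + (1 - t) *\<^sub>R k" using z by (auto simp: shrunk_def)
 have "norm ((1 / t) *\<^sub>R w) < h" using w t by (simp add: divide_simps mult.commute)
 then have "c + (1 / t) *\<^sub>R w \<in> K" using b by (auto simp: dist_norm)
 then have "t *\<^sub>R (c + (1 / t) *\<^sub>R w) + (1 - t) *\<^sub>R k \<in> K"
  using convexD[OF convex_K _ k(1), of _ t "1 - t"] t by simp
 then show ?thesis using t by (simp add: k(2) algebra_simps)
qed

text \<open>The area of the copy is \<open>(1 - t)^2\<close> times the area of \<open>K\<close>.\<close>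

lemma measure_outside_shrunk:
 assumes "c \<in> K" "0 <= t" "t <= 1"
 shows "measure \<mu> (K - shrunk c t) <= 2 * sup_dens * measure lborel K * t"
proof -
 have fin: "emeasure lborel K < \<infinity>" using compact_K by (rule emeasure_compact_finite)
 have eK: "emeasure lborel K = ennreal (measure lborel K)"
  using fin by (intro emeasure_eq_ennreal_measure) auto
 have "emeasure lborel (shrunk c t) = emeasure lebesgue ((\<lambda>x. t *\<^sub>R c + (1 - t) *\<^sub>R x) ` K)"
  unfolding shrunk_def[symmetric] by simp
 also have "... = ennreal (\<bar>1 - t\<bar> ^ DIM(real^2)) * emeasure lebesgue K"
  using emeasure_lebesgue_affine[of "1 - t" "t *\<^sub>R c" K] by (simp add: add.commute)
 also have "... = ennreal ((1 - t)\<^sup>2 * measure lborel K)" using assms eK by (simp add: ennreal_mult)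
 finally have eS: "emeasure lborel (shrunk c t) = ennreal ((1 - t)\<^sup>2 * measure lborel K)" .
 have "emeasure lborel (K - shrunk c t) = emeasure lborel K - emeasure lborel (shrunk c t)"
  using shrunk_subset[OF assms] eS by (intro emeasure_Diff) auto
 also have "... = ennreal (measure lborel K - (1 - t)\<^sup>2 * measure lborel K)"
  unfolding eK eS by (rule ennreal_minus) simp
 also have "... <= ennreal (2 * t * measure lborel K)"
 proof (rule ennreal_leI)
  have "0 <= t\<^sup>2 * measure lborel K" by simp
  then show "measure lborel K - (1 - t)\<^sup>2 * measure lborel K <= 2 * t * measure lborel K"
   by (simp add: power2_eq_square algebra_simps)
 qed
 finally have 1: "emeasure lborel (K - shrunk c t) <= ennreal (2 * t * measure lborel K)" .
 have "emeasure \<mu> ((K - shrunk c t) \<inter> K) <= (\<integral>\<^sup>+x. ennreal sup_dens * indicator (K - shrunk c t) x \<partial>lborel)"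
  by (subst emeasure_\<mu>) (auto intro!: nn_integral_mono mult_right_mono ennreal_leI sup_dens)
 also have "... = ennreal sup_dens * emeasure lborel (K - shrunk c t)"
  by (subst nn_integral_cmult_indicator) auto
 also have "... <= ennreal sup_dens * ennreal (2 * t * measure lborel K)"
  using 1 by (intro mult_left_mono) auto
 also have "... = ennreal (2 * sup_dens * measure lborel K * t)"
  using sup_dens(1) assms by (simp add: ennreal_mult[symmetric] algebra_simps)
 also have "(K - shrunk c t) \<inter> K = K - shrunk c t" by auto
 finally show ?thesis using sup_dens(1) assms by (simp add: mu.emeasure_eq_measure)
qed

definition kern :: "real^2 => real^2 => real" where
 "kern x y = (norm (x - y))\<^sup>2 * chord x y"

lemma kern_bounds:
 assumes "x \<in> K" "y \<in> K"
 shows "0 <= kern x y" "kern x y <= (2 * rad)\<^sup>2 * sup_dens"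
proof -
 have "(norm (x - y))\<^sup>2 <= (2 * rad)\<^sup>2" using dist_K[OF assms] by (intro power_mono) auto
 then show "0 <= kern x y" "kern x y <= (2 * rad)\<^sup>2 * sup_dens"
  unfolding kern_def using chord_bounds[of x y] by (auto intro: mult_mono)
qed

text \<open>Both quantities are of order \<open>e\<close>; this suffices for the few pairs close to the boundary.\<close>

lemma lens_estimate_crude:
 assumes xy: "x \<in> K" "y \<in> K" "x ~= y" and e: "0 < e" "e <= 1/2"
 shows "\<bar>measure \<mu> (lens (tan e) x y \<inter> K) - 2 * e * kern x y\<bar> <= 4 * (2 * rad)\<^sup>2 * sup_dens * e"
proof -
 note T = tan_small_bounds[OF e]
 have r: "(norm (x - y))\<^sup>2 <= (2 * rad)\<^sup>2" using dist_K[OF xy(1,2)] by (intro power_mono) auto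
 have "measure \<mu> (lens (tan e) x y \<inter> K) <= (norm (x - y))\<^sup>2 * (2 * tan e * (0 * chord x y + sup_dens))"
  using T sup_dens xy by (intro measure_lens_upper) auto
 also have "... <= (2 * rad)\<^sup>2 * (2 * (2 * e) * sup_dens)" using r T sup_dens(1) e by (intro mult_mono) auto
 finally have 1: "measure \<mu> (lens (tan e) x y \<inter> K) <= (2 * rad)\<^sup>2 * (2 * (2 * e) * sup_dens)" .
 define Q where "Q = (2 * rad)\<^sup>2 * sup_dens * e"
 have 1: "measure \<mu> (lens (tan e) x y \<inter> K) <= 4 * Q" using 1 by (simp only: Q_def) (simp add: algebra_simps)
 have "2 * e * kern x y <= 2 * e * ((2 * rad)\<^sup>2 * sup_dens)"
  using kern_bounds[OF xy(1,2)] e by (intro mult_left_mono) auto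
 then have "2 * (e * kern x y) <= 2 * Q" by (simp add: Q_def algebra_simps)
 moreover have "0 <= e * kern x y" "0 <= Q" using kern_bounds[OF xy(1,2)] e sup_dens(1) by (auto simp: Q_def)
 ultimately have "\<bar>measure \<mu> (lens (tan e) x y \<inter> K) - 2 * (e * kern x y)\<bar> <= 4 * Q"
  using 1 measure_nonneg[of \<mu> "lens (tan e) x y \<inter> K"] by linarith
 then show ?thesis by (simp add: Q_def algebra_simps)
qed

text \<open>The segment stays in the convex copy \<open>shrunk c t\<close>, so by \<open>shrunk_thick\<close> the whole lens lies
 in \<open>K\<close>, where the density is Lipschitz continuous and differs from its value on the segment by \<open>O (e)\<close>.\<close>

lemma lens_estimate_good:
 assumes xy: "x ~= y" and e: "0 < e" "e <= 1/2" and c: "ball c h \<subseteq> K" "0 < t" "t <= 1"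
  and t: "4 * rad * e < t * h" and sh: "x \<in> shrunk c t" "y \<in> shrunk c t" and K: "x \<in> K" "y \<in> K"
 shows "\<bar>measure \<mu> (lens (tan e) x y \<inter> K) - 2 * e * kern x y\<bar> <=
   (8 * (2 * rad)\<^sup>2 * sup_dens + 8 * L * (2 * rad)^3) * e\<^sup>2"
proof -
 note T = tan_small_bounds[OF e]
 let ?T = "tan e" and ?r = "norm (x - y)" and ?D = "2 * rad"
 let ?m = "measure \<mu> (lens ?T x y \<inter> K)"
 define d where "d = L * (?T * ?r)"
 have d0: "0 <= d" using L_nonneg T by (simp add: d_def)
 have r: "?r <= ?D" "0 <= ?r" using dist_K[OF K] by auto
 have rad0: "0 < rad" using rad(1) by simp
 have lip: "\<bar>dens (y + s *\<^sub>R (x - y) + u *\<^sub>R perp (x - y)) - dens (y + s *\<^sub>R (x - y))\<bar> <= d"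
  if s: "0 <= s" "s <= 1" and u: "\<bar>u\<bar> <= ?T" for s u
 proof -
  let ?z = "y + s *\<^sub>R (x - y)" and ?w = "u *\<^sub>R perp (x - y)"
  have "?z = s *\<^sub>R x + (1 - s) *\<^sub>R y" by (simp add: algebra_simps)
  then have z: "?z \<in> shrunk c t" using convexD[OF convex_shrunk sh, of s "1 - s"] s by simp
  have nw: "norm ?w <= ?T * ?r" using u by (simp add: mult_right_mono)
  also have "... <= (2 * e) * ?D" using T r e by (intro mult_mono) auto
  also have "... < t * h" using t by (simp add: algebra_simps)
  finally have wK: "?z + ?w \<in> K" by (intro shrunk_thick[OF z c(1-3)])
  have zK: "?z \<in> K" using convexD[OF convex_K K, of s "1 - s"] s \<open>?z = s *\<^sub>R x + (1 - s) *\<^sub>R y\<close> by simp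
  have "\<bar>dens (?z + ?w) - dens ?z\<bar> <= L * norm ?w"
   using lipschitz_onD[OF lipschitz_\<phi> wK zK] wK zK by (simp add: dens_def dist_norm)
  also have "... <= d" unfolding d_def using nw L_nonneg by (intro mult_left_mono)
  finally show ?thesis .
 qed
 have up: "?m <= ?r\<^sup>2 * (2 * ?T * (1 * chord x y + d))"
  using lip by (intro measure_lens_upper[OF xy T(4,5) d0]) (force simp: abs_le_iff)+
 have lo: "?r\<^sup>2 * (2 * ?T * (1 - ?T\<^sup>2) * (chord x y - d)) <= ?m"
  using lip by (intro measure_lens_lower[OF xy T(4,5) d0]) (force simp: abs_le_iff)+
 define B where "B = kern x y"
 have B: "0 <= B" "B <= ?D\<^sup>2 * sup_dens" using kern_bounds[OF K] by (auto simp: B_def)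
 have rd: "?r\<^sup>2 * (2 * ?T * d) <= 8 * L * ?D^3 * e\<^sup>2"
 proof -
  have "?r\<^sup>2 * (2 * ?T * d) = 2 * L * (?T\<^sup>2 * ?r^3)"
   by (simp add: d_def power2_eq_square power3_eq_cube algebra_simps)
  also have "... <= 2 * L * ((2 * e)\<^sup>2 * ?D^3)"
   using L_nonneg T r e by (intro mult_left_mono mult_mono power_mono) auto
  finally show ?thesis by (simp add: power_mult_distrib algebra_simps)
 qed
 have rd0: "0 <= ?r\<^sup>2 * (2 * ?T * d)" using d0 T by simp
 have T3: "?T * ?T\<^sup>2 <= 4 * e\<^sup>2"
 proof -
  have "?T * ?T\<^sup>2 <= 1 * (2 * e)\<^sup>2" using T by (intro mult_mono power_mono) auto
  then show ?thesis by (simp add: power_mult_distrib)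
 qed
 have "?m - 2 * e * B <= 2 * (?T - e) * B + ?r\<^sup>2 * (2 * ?T * d)"
  using up by (simp add: B_def kern_def algebra_simps)
 also have "2 * (?T - e) * B <= 2 * (2 * e\<^sup>2) * (?D\<^sup>2 * sup_dens)" using T B by (intro mult_mono) auto
 finally have "?m - 2 * e * B <= 2 * (2 * e\<^sup>2) * (?D\<^sup>2 * sup_dens) + ?r\<^sup>2 * (2 * ?T * d)" by simp
 then have 1: "?m - 2 * e * B <= 4 * (e\<^sup>2 * (?D\<^sup>2 * sup_dens)) + 8 * L * ?D^3 * e\<^sup>2"
  using rd by (simp only: mult.assoc)
 have "2 * e * B - ?m <= 2 * e * B - ?r\<^sup>2 * (2 * ?T * (1 - ?T\<^sup>2) * (chord x y - d))" using lo by simp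
 also have "... = 2 * (e - ?T) * B + 2 * (?T * ?T\<^sup>2) * B + (1 - ?T\<^sup>2) * (?r\<^sup>2 * (2 * ?T * d))"
  by (simp add: B_def kern_def algebra_simps)
 also have "... <= 0 + 2 * (4 * e\<^sup>2) * (?D\<^sup>2 * sup_dens) + 1 * (8 * L * ?D^3 * e\<^sup>2)"
 proof (intro add_mono)
  have "(e - ?T) * B <= 0" using T(1) B(1) by (intro mult_nonpos_nonneg) simp_all
  then show "2 * (e - ?T) * B <= 0" by (simp only: mult.assoc)
  show "2 * (?T * ?T\<^sup>2) * B <= 2 * (4 * e\<^sup>2) * (?D\<^sup>2 * sup_dens)"
  proof (rule mult_mono[OF _ B(2) _ B(1)])
   show "2 * (?T * ?T\<^sup>2) <= 2 * (4 * e\<^sup>2)" using T3 by linarith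
  qed simp
  show "(1 - ?T\<^sup>2) * (?r\<^sup>2 * (2 * ?T * d)) <= 1 * (8 * L * ?D^3 * e\<^sup>2)"
  proof (rule mult_mono[OF _ rd _ rd0])
   show "1 - ?T\<^sup>2 <= 1" by simp
  qed simp
 qed
 finally have 2: "2 * e * B - ?m <= 8 * e\<^sup>2 * (?D\<^sup>2 * sup_dens) + 8 * L * ?D^3 * e\<^sup>2" by simp
 define X where "X = e\<^sup>2 * (?D\<^sup>2 * sup_dens)"
 define Y where "Y = 8 * L * ?D^3 * e\<^sup>2"
 have X: "0 <= X" using sup_dens(1) by (simp add: X_def)
 have 1: "?m - 2 * e * B <= 4 * X + Y" using 1 by (simp only: X_def Y_def)
 have 2: "2 * e * B - ?m <= 8 * X + Y" using 2 by (simp only: X_def Y_def mult.assoc)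
 have "\<bar>?m - 2 * e * B\<bar> <= 8 * X + Y" using 1 2 X by linarith
 then show ?thesis by (simp add: B_def X_def Y_def algebra_simps)
qed

abbreviation mu2 :: "((real^2) \<times> (real^2)) measure" where "mu2 \<equiv> \<mu> \<Otimes>\<^sub>M \<mu>"
abbreviation mu3 :: "((real^2) \<times> (real^2) \<times> (real^2)) measure" where "mu3 \<equiv> \<mu> \<Otimes>\<^sub>M mu2"

sublocale mu2: pair_prob_space \<mu> \<mu> ..
sublocale mu3: pair_prob_space \<mu> mu2 ..

lemma space_mu2: "space mu2 = K \<times> K" and space_mu3: "space mu3 = K \<times> K \<times> K"
 by (simp_all add: space_pair_measure)

lemma kern_measurable [measurable]: "(\<lambda>p. kern (fst p) (snd p)) \<in> borel_measurable mu2"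
proof -
 have [measurable]: "fst \<in> borel_measurable mu2" "snd \<in> borel_measurable mu2"
  by (auto intro: measurable_compose[OF measurable_fst id_measurable_\<mu>] measurable_compose[OF measurable_snd id_measurable_\<mu>])
 have "(\<lambda>(p, s). indicator {0..1} s * (s * (1 - s) * dens (snd p + s *\<^sub>R (fst p - snd p))))
   \<in> borel_measurable (mu2 \<Otimes>\<^sub>M lborel)" by measurable
 then have "(\<lambda>p. chord (fst p) (snd p)) \<in> borel_measurable mu2"
  unfolding chord_def by (rule lborel.borel_measurable_lebesgue_integral)
 then show ?thesis unfolding kern_def by measurable
qed

definition beta :: real where "beta = (\<integral>p. kern (fst p) (snd p) \<partial>mu2)"

lemma kern_integrable: "integrable mu2 (\<lambda>p. kern (fst p) (snd p))" using kern_bounds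
 by (intro mu2.P.integrable_const_bound[where B="(2 * rad)\<^sup>2 * sup_dens"] AE_I2)
   (auto simp: space_mu2)

lemma beta_nonneg: "0 <= beta"
 unfolding beta_def using kern_bounds by (intro lint_nonneg) (auto simp: space_mu2)


definition mass :: "real => real^2 => real^2 => real" where
 "mass e x y = (if x = y then 0 else measure \<mu> (lens (tan e) x y \<inter> K))"

lemma measure_pair_outside_shrunk:
 assumes "c \<in> K" "0 <= t" "t <= 1"
 shows "measure mu2 {p \<in> space mu2. fst p \<notin> shrunk c t \<or> snd p \<notin> shrunk c t} <= 4 * sup_dens * measure lborel K * t"
proof -
 have S: "K - shrunk c t \<in> sets \<mu>" by (simp add: sets_\<mu>_iff)
 have "measure mu2 {p \<in> space mu2. fst p \<notin> shrunk c t \<or> snd p \<notin> shrunk c t} <=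
   measure mu2 ((K - shrunk c t) \<times> K \<union> K \<times> (K - shrunk c t))"
  using S by (intro mu2.P.finite_measure_mono) (auto simp: space_mu2 sets_\<mu>_iff)
 also have "... <= measure mu2 ((K - shrunk c t) \<times> K) + measure mu2 (K \<times> (K - shrunk c t))"
  using S by (intro measure_Un_le) (auto simp: sets_\<mu>_iff)
 also have "measure mu2 ((K - shrunk c t) \<times> K) = measure \<mu> (K - shrunk c t) * measure \<mu> K"
  using S by (simp add: measure_def mu.emeasure_pair_measure_Times sets_\<mu>_iff enn2real_mult)
 also have "measure mu2 (K \<times> (K - shrunk c t)) = measure \<mu> K * measure \<mu> (K - shrunk c t)"
  using S by (simp add: measure_def mu.emeasure_pair_measure_Times sets_\<mu>_iff enn2real_mult)
 also have "measure \<mu> K = 1" using mu.prob_space by simp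
 finally show ?thesis using measure_outside_shrunk[OF assms] by simp
qed

lemma mass_alt: "mass e x y = measure \<mu> {z \<in> K. x ~= y \<and> z \<in> lens (tan e) x y}"
 by (auto simp: mass_def intro!: arg_cong[where f="measure \<mu>"])

lemma mass_measurable [measurable]: "(\<lambda>p. mass e (fst p) (snd p)) \<in> borel_measurable mu2"
proof -
 let ?M = "mu2 \<Otimes>\<^sub>M \<mu>"
 have [measurable]: "(\<lambda>q. fst (fst q)) \<in> borel_measurable ?M" "(\<lambda>q. snd (fst q)) \<in> borel_measurable ?M" "snd \<in> borel_measurable ?M"
  by (auto intro: measurable_compose[OF measurable_fst measurable_compose[OF measurable_fst id_measurable_\<mu>]]
    measurable_compose[OF measurable_fst measurable_compose[OF measurable_snd id_measurable_\<mu>]]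
    measurable_compose[OF measurable_snd id_measurable_\<mu>])
 define Q where "Q = {q \<in> space ?M. fst (fst q) ~= snd (fst q) \<and> snd q \<in> lens (tan e) (fst (fst q)) (snd (fst q))}"
 have "Q \<in> sets ?M" unfolding Q_def lens_def mem_Collect_eq by measurable
 then have "(\<lambda>p. enn2real (emeasure \<mu> (Pair p -` Q))) \<in> borel_measurable mu2"
  by (intro measurable_compose[OF mu.measurable_emeasure_Pair]) auto
 moreover have "enn2real (emeasure \<mu> (Pair p -` Q)) = mass e (fst p) (snd p)" if "p \<in> space mu2" for p
  unfolding mass_alt measure_def
  by (intro arg_cong[where f="\<lambda>A. enn2real (emeasure \<mu> A)"]) (use that in \<open>auto simp: Q_def space_pair_measure\<close>)
 ultimately show ?thesis by (simp cong: measurable_cong)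
qed

text \<open>The probability that a random point sees two others under an angle of at least \<open>pi - e\<close>.\<close>

definition p_lens :: "real => real" where "p_lens e = (\<integral>p. mass e (fst p) (snd p) \<partial>mu2)"

lemma mass_bounds: "0 <= mass e x y" "mass e x y <= 1" by (auto simp: mass_def)

lemma mass_integrable: "integrable mu2 (\<lambda>p. mass e (fst p) (snd p))"
 using mass_bounds by (intro mu2.P.integrable_const_bound[where B=1] AE_I2) (auto simp: mass_measurable)

text \<open>For small \<open>e\<close> take a shrunken copy of \<open>K\<close> with \<open>t\<close> proportional to \<open>e\<close>. Pairs inside it have
 an error of \<open>O (e^2)\<close>, all other pairs have an error of \<open>O (e)\<close> but total mass \<open>O (e)\<close>. For \<open>e\<close>
 away from \<open>0\<close> both terms are \<open>O (e^2)\<close>.\<close>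

lemma p_lens_asymptotics: "\<exists>C>0. \<forall>e>0. \<bar>p_lens e - 2 * e * beta\<bar> <= C * e\<^sup>2"
proof -
 obtain c h where ch: "0 < h" "ball c h \<subseteq> K" using interior_K by (metis all_not_in_conv mem_interior)
 then have cK: "c \<in> K" by (meson centre_in_ball subsetD)
 \<comment> \<open>Below \<open>e0\<close> the contraction parameter \<open>5 * rad * e / h\<close> is at most \<open>1\<close>.\<close>
 define e0 where "e0 = min (1/2) (h / (5 * rad))"
 have rad0: "0 < rad" using rad(1) by simp
 have e0: "0 < e0" using ch rad0 by (simp add: e0_def)
 define C1 where "C1 = 8 * (2 * rad)\<^sup>2 * sup_dens + 8 * L * (2 * rad)^3"
 define C2 where "C2 = 4 * (2 * rad)\<^sup>2 * sup_dens"
 define C3 where "C3 = C1 + C2 * (4 * sup_dens * measure lborel K * (5 * rad / h))"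
 have C: "0 <= C1" "0 <= C2" "0 <= C3"
  using sup_dens(1) rad0 L_nonneg ch by (auto simp: C1_def C2_def C3_def intro!: add_nonneg_nonneg mult_nonneg_nonneg)
 have small: "\<bar>p_lens e - 2 * e * beta\<bar> <= C3 * e\<^sup>2" if e: "0 < e" "e <= e0" for e
 proof -
  \<comment> \<open>Chosen so that the half width of a lens, at most \<open>4 * rad * e\<close>, is below the distance \<open>t * h\<close> to the boundary.\<close>
  define t where "t = 5 * rad * e / h"
  have e2: "e <= 1/2" using e by (simp add: e0_def)
  have "e <= h / (5 * rad)" using e by (simp add: e0_def)
  then have t: "0 < t" "t <= 1" using ch rad0 e by (auto simp: t_def field_simps)
  have th: "4 * rad * e < t * h" using ch rad0 e by (simp add: t_def)
  let ?bad = "{p \<in> space mu2. fst p \<notin> shrunk c t \<or> snd p \<notin> shrunk c t}"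
  have [measurable]: "fst \<in> borel_measurable mu2" "snd \<in> borel_measurable mu2"
   by (auto intro: measurable_compose[OF measurable_fst id_measurable_\<mu>] measurable_compose[OF measurable_snd id_measurable_\<mu>])
  have bad: "?bad \<in> sets mu2" by measurable
  have pt: "norm (mass e (fst p) (snd p) - 2 * e * kern (fst p) (snd p)) <= C1 * e\<^sup>2 + C2 * e * indicator ?bad p"
   if p: "p \<in> space mu2" for p
  proof (cases "fst p = snd p")
   case True
   then show ?thesis using C e by (simp add: mass_def kern_def indicator_def)
  next
   case False
   have K: "fst p \<in> K" "snd p \<in> K" using p by (auto simp: space_mu2)
   show ?thesis
   proof (cases "p \<in> ?bad")
    case True
    have "\<bar>mass e (fst p) (snd p) - 2 * e * kern (fst p) (snd p)\<bar> <= C2 * e"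
     using lens_estimate_crude[OF K False e(1) e2] False by (simp add: mass_def C2_def)
    moreover have "0 <= C1 * e\<^sup>2" using C by simp
    ultimately show ?thesis using True by simp
   next
    case good: False
    then have "fst p \<in> shrunk c t" "snd p \<in> shrunk c t" using p by auto
    then have "\<bar>mass e (fst p) (snd p) - 2 * e * kern (fst p) (snd p)\<bar> <= C1 * e\<^sup>2"
     using lens_estimate_good[OF False e(1) e2 ch(2) t th _ _ K] False by (simp add: mass_def C1_def)
    then show ?thesis using good by simp
   qed
  qed
  have "p_lens e - 2 * e * beta = (\<integral>p. mass e (fst p) (snd p) - 2 * e * kern (fst p) (snd p) \<partial>mu2)"
   unfolding p_lens_def beta_def using mass_integrable kern_integrable by (subst Bochner_Integration.integral_diff) auto
  moreover have int: "integrable mu2 (\<lambda>p. C1 * e\<^sup>2 + C2 * e * indicator ?bad p)"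
   using bad by (intro Bochner_Integration.integrable_add integrable_mult_right integrable_real_indicator)
    (simp_all add: mu2.P.emeasure_eq_measure)
  ultimately have "\<bar>p_lens e - 2 * e * beta\<bar> <= (\<integral>p. C1 * e\<^sup>2 + C2 * e * indicator ?bad p \<partial>mu2)"
   using norm_integral_le_integral[OF int pt] by (simp only: real_norm_def)
  also have "... = C1 * e\<^sup>2 + C2 * e * measure mu2 ?bad"
  proof -
   have ib: "integrable mu2 (indicat_real ?bad)"
    using bad by (intro integrable_real_indicator) (simp_all add: mu2.P.emeasure_eq_measure)
   have "(\<integral>p. C1 * e\<^sup>2 + C2 * e * indicator ?bad p \<partial>mu2) = (\<integral>p. C1 * e\<^sup>2 \<partial>mu2) + (\<integral>p. C2 * e * indicator ?bad p \<partial>mu2)"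
    using ib by (intro Bochner_Integration.integral_add integrable_mult_right) (simp_all only: mu2.P.integrable_const)
   also have "(\<integral>p. C2 * e * indicator ?bad p \<partial>mu2) = C2 * e * measure mu2 ?bad"
    using bad by (simp only: integral_mult_right_zero integral_indicator) (simp add: Int_absorb2 Collect_subset)
   finally show ?thesis by (simp add: mu2.P.prob_space)
  qed
  also have "... <= C1 * e\<^sup>2 + C2 * e * (4 * sup_dens * measure lborel K * t)"
   using C e t by (intro add_left_mono mult_left_mono measure_pair_outside_shrunk[OF cK]) auto
  also have "... = C3 * e\<^sup>2" by (simp add: C3_def t_def power2_eq_square algebra_simps)
  finally show ?thesis .
 qed
 \<comment> \<open>For \<open>e > e0\<close> use \<open>1 \<le> (e / e0)\<^sup>2\<close> and \<open>e / e0 \<le> (e / e0)\<^sup>2\<close>.\<close>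
 define C4 where "C4 = (1 + 2 * e0 * beta) / e0\<^sup>2"
 have C4: "0 < C4" using e0 beta_nonneg by (simp add: C4_def add_pos_nonneg)
 have large: "\<bar>p_lens e - 2 * e * beta\<bar> <= C4 * e\<^sup>2" if e: "e0 < e" for e
 proof -
  have "0 <= p_lens e" unfolding p_lens_def using mass_bounds by (intro lint_nonneg) auto
  moreover have "p_lens e <= (\<integral>p. 1 \<partial>mu2)"
   unfolding p_lens_def using mass_bounds mass_integrable by (intro integral_mono) auto
  moreover have "0 <= 2 * e * beta" using e e0 beta_nonneg by simp
  ultimately have "\<bar>p_lens e - 2 * e * beta\<bar> <= 1 + 2 * e * beta" by (simp add: mu2.P.prob_space)
  also have "... <= (e / e0)\<^sup>2 * (1 + 2 * e0 * beta)"
  proof -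
   have sq: "1 * 1 <= r\<^sup>2 \<and> r * 1 <= r\<^sup>2" if "1 <= r" for r :: real
    unfolding power2_eq_square using that by (intro conjI mult_mono) auto
   have "1 <= e / e0" using e e0 by simp
   from sq[OF this] have "1 * 1 <= (e / e0)\<^sup>2" "e / e0 * 1 <= (e / e0)\<^sup>2" by auto
   then have "1 * 1 + (e / e0 * 1) * (2 * e0 * beta) <= (e / e0)\<^sup>2 * 1 + (e / e0)\<^sup>2 * (2 * e0 * beta)"
    using e0 beta_nonneg by (intro add_mono mult_right_mono) auto
   then show ?thesis using e0 by (simp add: algebra_simps)
  qed
  also have "... = C4 * e\<^sup>2" by (simp add: C4_def power_divide)
  finally show ?thesis .
 qed
 show ?thesis
 proof (intro exI[of _ "C3 + C4"] conjI allI impI)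
  show "0 < C3 + C4" using C C4 by simp
  fix e :: real assume "0 < e"
  then have "\<bar>p_lens e - 2 * e * beta\<bar> <= C3 * e\<^sup>2 \<or> \<bar>p_lens e - 2 * e * beta\<bar> <= C4 * e\<^sup>2"
   using small large by (cases "e <= e0") auto
  moreover have "C3 * e\<^sup>2 <= (C3 + C4) * e\<^sup>2" "C4 * e\<^sup>2 <= (C3 + C4) * e\<^sup>2"
   using C C4 by (auto intro!: mult_right_mono)
  ultimately show "\<bar>p_lens e - 2 * e * beta\<bar> <= (C3 + C4) * e\<^sup>2" by linarith
 qed
qed

end

section \<open>The largest angle of a random triangle\<close>

lemma pred_lens [measurable (raw)]:
 assumes [measurable]: "f \<in> borel_measurable M" "g \<in> borel_measurable M" "h \<in> borel_measurable M"
 shows "Measurable.pred M (\<lambda>t. f t \<in> lens T (g t) (h t))"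
 unfolding lens_def mem_Collect_eq by measurable

context lipschitz_density
begin

definition angle_event :: "real => ((real^2) \<times> (real^2) \<times> (real^2)) set" where
 "angle_event e = {(x, y, z) \<in> space mu3. x ~= y \<and> x ~= z \<and> y ~= z \<and>
   0 < pi - largest_angle x y z \<and> pi - largest_angle x y z <= e}"

lemma coord_measurable_mu3 [measurable]:
 "fst \<in> borel_measurable mu3" "(\<lambda>t. fst (snd t)) \<in> borel_measurable mu3" "(\<lambda>t. snd (snd t)) \<in> borel_measurable mu3"
 by (auto intro: measurable_compose[OF measurable_fst id_measurable_\<mu>]
    measurable_compose[OF measurable_snd measurable_compose[OF measurable_fst id_measurable_\<mu>]]
    measurable_compose[OF measurable_snd measurable_compose[OF measurable_snd id_measurable_\<mu>]])

lemma angle_event_sets [measurable]: "angle_event e \<in> sets mu3"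
proof -
 have "angle_event e = {t \<in> space mu3. fst t ~= fst (snd t) \<and> fst t ~= snd (snd t) \<and> fst (snd t) ~= snd (snd t) \<and>
   0 < pi - largest_angle (fst t) (fst (snd t)) (snd (snd t)) \<and> pi - largest_angle (fst t) (fst (snd t)) (snd (snd t)) <= e}"
  by (auto simp: angle_event_def)
 also have "... \<in> sets mu3" by measurable
 finally show ?thesis .
qed

lemma nn_integral_mu3:
 assumes "f \<in> borel_measurable mu3"
 shows "(\<integral>\<^sup>+t. f t \<partial>mu3) = (\<integral>\<^sup>+x. \<integral>\<^sup>+y. \<integral>\<^sup>+z. f (x, y, z) \<partial>\<mu> \<partial>\<mu> \<partial>\<mu>)"
proof -
 have "(\<integral>\<^sup>+t. f t \<partial>mu3) = (\<integral>\<^sup>+x. \<integral>\<^sup>+p. f (x, p) \<partial>mu2 \<partial>\<mu>)"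
  using assms by (rule mu2.P.nn_integral_fst[symmetric])
 also have "... = (\<integral>\<^sup>+x. \<integral>\<^sup>+y. \<integral>\<^sup>+z. f (x, y, z) \<partial>\<mu> \<partial>\<mu> \<partial>\<mu>)"
  using assms by (intro nn_integral_cong mu.nn_integral_fst[symmetric]) (auto intro: measurable_Pair2 simp: measurable_Pair2)
 finally show ?thesis .
qed

lemma emeasure_mu3:
 assumes "A \<in> sets mu3"
 shows "emeasure mu3 A = (\<integral>\<^sup>+x. \<integral>\<^sup>+y. emeasure \<mu> {z \<in> K. (x, y, z) \<in> A} \<partial>\<mu> \<partial>\<mu>)"
proof -
 have "emeasure mu3 A = (\<integral>\<^sup>+x. \<integral>\<^sup>+y. \<integral>\<^sup>+z. indicator A (x, y, z) \<partial>\<mu> \<partial>\<mu> \<partial>\<mu>)"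
  using assms by (subst nn_integral_mu3[symmetric]) auto
 also have "... = (\<integral>\<^sup>+x. \<integral>\<^sup>+y. emeasure \<mu> {z \<in> K. (x, y, z) \<in> A} \<partial>\<mu> \<partial>\<mu>)"
 proof (intro nn_integral_cong)
  fix x y assume "x \<in> space \<mu>" "y \<in> space \<mu>"
  have "Pair y -` (Pair x -` A) \<in> sets \<mu>" using assms by (intro sets_Pair1)
  moreover have "Pair y -` (Pair x -` A) = {z \<in> K. (x, y, z) \<in> A}"
   using sets.sets_into_space[OF assms] by (auto simp: space_mu3)
  ultimately have "{z \<in> K. (x, y, z) \<in> A} \<in> sets \<mu>" by simp
  then have "(\<integral>\<^sup>+z. indicator {z \<in> K. (x, y, z) \<in> A} z \<partial>\<mu>) = emeasure \<mu> {z \<in> K. (x, y, z) \<in> A}" by simp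
  also have "(\<integral>\<^sup>+z. indicator {z \<in> K. (x, y, z) \<in> A} z \<partial>\<mu>) = (\<integral>\<^sup>+z. indicator A (x, y, z) \<partial>\<mu>)"
   by (intro nn_integral_cong) (auto simp: indicator_def)
  finally show "(\<integral>\<^sup>+z. indicator A (x, y, z) \<partial>\<mu>) = emeasure \<mu> {z \<in> K. (x, y, z) \<in> A}" .
 qed
 finally show ?thesis .
qed


lemma mass_ennreal: "(\<integral>\<^sup>+z. indicator {z \<in> K. x ~= y \<and> z \<in> lens (tan e) x y} z \<partial>\<mu>) = ennreal (mass e x y)"
 unfolding mass_alt
proof (subst nn_integral_indicator)
 have "{z \<in> K. x ~= y \<and> z \<in> lens (tan e) x y} = (if x = y then {} else lens (tan e) x y \<inter> K)" by auto
 then show "{z \<in> K. x ~= y \<and> z \<in> lens (tan e) x y} \<in> sets \<mu>" by (simp add: sets_\<mu>_iff)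
qed (simp add: mu.emeasure_eq_measure)

definition vertex_event :: "real => nat => ((real^2) \<times> (real^2) \<times> (real^2)) set" where
 "vertex_event e i = {t \<in> space mu3.
   (if i = 0 then fst (snd t) ~= snd (snd t) \<and> fst t \<in> lens (tan e) (fst (snd t)) (snd (snd t))
   else if i = 1 then fst t ~= snd (snd t) \<and> fst (snd t) \<in> lens (tan e) (fst t) (snd (snd t))
   else fst t ~= fst (snd t) \<and> snd (snd t) \<in> lens (tan e) (fst t) (fst (snd t)))}"

lemma vertex_event_sets [measurable]: "vertex_event e i \<in> sets mu3" unfolding vertex_event_def by measurable

text \<open>The three coordinates are exchangeable, so each vertex is equally likely to
 carry the large angle.\<close>

lemma measure_vertex_event: "measure mu3 (vertex_event e i) = p_lens e"
proof -
 have pl: "(\<integral>\<^sup>+p. ennreal (mass e (fst p) (snd p)) \<partial>mu2) = ennreal (p_lens e)"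
  unfolding p_lens_def using mass_integrable mass_bounds by (intro nn_integral_eq_integral) auto
 have m1: "(\<lambda>p. ennreal (mass e (fst p) (snd p))) \<in> borel_measurable mu2" using mass_measurable by simp
 let ?A = "vertex_event e i"
 let ?L = "\<lambda>x y z. indicator {z \<in> K. x ~= y \<and> z \<in> lens (tan e) x y} z :: ennreal"
 consider "i = 0" | "i = 1" | "i ~= 0 \<and> i ~= 1" by auto
 then have "emeasure mu3 ?A = (\<integral>\<^sup>+p. ennreal (mass e (fst p) (snd p)) \<partial>mu2)"
 proof cases
  case 1
  have "emeasure mu3 ?A = (\<integral>\<^sup>+x. \<integral>\<^sup>+p. indicator ?A (x, p) \<partial>mu2 \<partial>\<mu>)"
   by (subst mu2.P.nn_integral_fst) (auto simp: vertex_event_sets)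
  also have "... = (\<integral>\<^sup>+p. \<integral>\<^sup>+x. indicator ?A (x, p) \<partial>\<mu> \<partial>mu2)"
   by (rule mu3.Fubini[symmetric]) (simp add: vertex_event_sets)
  also have "... = (\<integral>\<^sup>+p. ennreal (mass e (fst p) (snd p)) \<partial>mu2)" unfolding mass_ennreal[symmetric] using 1
   by (intro nn_integral_cong) (auto simp: vertex_event_def indicator_def space_mu3 space_mu2)
  finally show ?thesis .
 next
  case 2
  have "emeasure mu3 ?A = (\<integral>\<^sup>+x. \<integral>\<^sup>+y. \<integral>\<^sup>+z. indicator ?A (x, y, z) \<partial>\<mu> \<partial>\<mu> \<partial>\<mu>)"
   by (subst nn_integral_mu3[symmetric]) (auto simp: vertex_event_sets)
  also have "... = (\<integral>\<^sup>+x. \<integral>\<^sup>+z. \<integral>\<^sup>+y. indicator ?A (x, y, z) \<partial>\<mu> \<partial>\<mu> \<partial>\<mu>)"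
  proof (rule nn_integral_cong)
   fix x assume "x \<in> space \<mu>"
   have "Pair x -` ?A \<in> sets mu2" by (rule sets_Pair1[OF vertex_event_sets])
   then have "(\<lambda>p. indicator (Pair x -` ?A) p :: ennreal) \<in> borel_measurable mu2"
    by (rule borel_measurable_indicator)
   then have "(\<lambda>(z, y). indicator ?A (x, z, y) :: ennreal) \<in> borel_measurable mu2"
    by (simp add: indicator_def case_prod_beta' vimage_def)
   then show "(\<integral>\<^sup>+y. \<integral>\<^sup>+z. indicator ?A (x, y, z) \<partial>\<mu> \<partial>\<mu>) = (\<integral>\<^sup>+z. \<integral>\<^sup>+y. indicator ?A (x, y, z) \<partial>\<mu> \<partial>\<mu>)"
    by (rule mu2.Fubini'[symmetric])
  qed
  also have "... = (\<integral>\<^sup>+x. \<integral>\<^sup>+z. ennreal (mass e x z) \<partial>\<mu> \<partial>\<mu>)" unfolding mass_ennreal[symmetric] using 2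
   by (intro nn_integral_cong) (auto simp: vertex_event_def indicator_def space_mu3)
  also have "... = (\<integral>\<^sup>+p. ennreal (mass e (fst p) (snd p)) \<partial>mu2)" using mu.nn_integral_fst[OF m1] by simp
  finally show ?thesis .
 next
  case 3
  have "emeasure mu3 ?A = (\<integral>\<^sup>+x. \<integral>\<^sup>+y. \<integral>\<^sup>+z. indicator ?A (x, y, z) \<partial>\<mu> \<partial>\<mu> \<partial>\<mu>)"
   by (subst nn_integral_mu3[symmetric]) (auto simp: vertex_event_sets)
  also have "... = (\<integral>\<^sup>+x. \<integral>\<^sup>+y. ennreal (mass e x y) \<partial>\<mu> \<partial>\<mu>)" unfolding mass_ennreal[symmetric] using 3
   by (intro nn_integral_cong) (auto simp: vertex_event_def indicator_def space_mu3)
  also have "... = (\<integral>\<^sup>+p. ennreal (mass e (fst p) (snd p)) \<partial>mu2)" using mu.nn_integral_fst[OF m1] by simp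
  finally show ?thesis .
 qed
 then show ?thesis
  unfolding pl measure_def using mass_bounds by (simp add: p_lens_def lint_nonneg)
qed

text \<open>A triangle with an angle \<open>pi\<close> has its third vertex on the line through the other two, a strip
 of width \<open>0\<close>.\<close>

lemma AE_mu3_generic:
 "AE t in mu3. case t of (x, y, z) => x ~= y \<and> x ~= z \<and> y ~= z \<and> largest_angle x y z < pi"
proof -
 define N where "N = {t \<in> space mu3. fst t = fst (snd t) \<or> fst t = snd (snd t) \<or> fst (snd t) = snd (snd t) \<or>
   pi <= largest_angle (fst t) (fst (snd t)) (snd (snd t))}"
 have N: "N \<in> sets mu3" unfolding N_def by measurable
 have em_sing: "emeasure \<mu> {x} = 0" for x
  using measure_\<mu>_singleton[of x] by (simp add: mu.emeasure_eq_measure)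
 have inner: "emeasure \<mu> {z \<in> K. (x, y, z) \<in> N} <= indicator {x} y" if xy: "x \<in> K" "y \<in> K" for x y
 proof (cases "x = y")
  case True
  then show ?thesis by (simp add: mu.emeasure_le_1)
 next
  case False
  have S: "{z \<in> K. (x, y, z) \<in> N} \<in> sets \<mu>"
  proof -
   have "Pair y -` (Pair x -` N) \<in> sets \<mu>" using N by (intro sets_Pair1)
   moreover have "Pair y -` (Pair x -` N) = {z \<in> K. (x, y, z) \<in> N}"
    using sets.sets_into_space[OF N] by (auto simp: space_mu3)
   ultimately show ?thesis by simp
  qed
  have sing: "{x} \<in> sets \<mu>" "{y} \<in> sets \<mu>" using xy by (auto simp: sets_\<mu>_iff)
  let ?S = "{z \<in> K. (x, y, z) \<in> N} - {x} - {y}"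
  have S': "?S \<in> sets \<mu>" using S sing by auto
  have "measure \<mu> ?S <= C_line * (0 + 0)"
  proof (rule measure_deficit_le[where q="\<lambda>z. z" and x=x and y=y, OF S'])
   show "norm x <= rad" "norm y <= rad" using rad(2)[OF xy(1)] rad(2)[OF xy(2)] by auto
   fix z assume z: "z \<in> ?S"
   then show "z ~= x \<and> z ~= y \<and> deficit {x, y, z} <= 0"
    using False deficit_eq_largest_angle[of x y z] by (auto simp: N_def)
  qed (use False in auto)
  then have S0: "emeasure \<mu> ?S = 0" by (simp add: mu.emeasure_eq_measure measure_le_0_iff)
  have "emeasure \<mu> {z \<in> K. (x, y, z) \<in> N} <= emeasure \<mu> (?S \<union> {x} \<union> {y})"
   by (rule emeasure_mono[OF _ sets.Un[OF sets.Un[OF S' sing(1)] sing(2)]]) auto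
  also have "... <= emeasure \<mu> (?S \<union> {x}) + emeasure \<mu> {y}"
   by (rule emeasure_subadditive[OF sets.Un[OF S' sing(1)] sing(2)])
  also have "... <= emeasure \<mu> ?S + emeasure \<mu> {x} + emeasure \<mu> {y}"
   by (rule add_right_mono[OF emeasure_subadditive[OF S' sing(1)]])
  finally show ?thesis by (simp add: S0 em_sing)
 qed
 have "emeasure mu3 N <= (\<integral>\<^sup>+x. \<integral>\<^sup>+y. indicator {x} y \<partial>\<mu> \<partial>\<mu>)"
  unfolding emeasure_mu3[OF N] using inner by (intro nn_integral_mono) auto
 also have "... = (\<integral>\<^sup>+x. 0 \<partial>\<mu>)"
 proof (intro nn_integral_cong)
  fix x assume "x \<in> space \<mu>"
  then have "{x} \<in> sets \<mu>" by (auto simp: sets_\<mu>_iff)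
  then show "(\<integral>\<^sup>+y. indicator {x} y \<partial>\<mu>) = 0" by (simp add: em_sing)
 qed
 finally have "emeasure mu3 N = 0" by simp
 then have "N \<in> null_sets mu3" using N by auto
 then show ?thesis by (rule AE_I') (auto simp: N_def not_less)
qed

text \<open>The two inner products add up to the squared length of the common side.\<close>

lemma obtuse_unique:
 fixes x y z :: "'a::real_inner"
 assumes "x ~= z" "(x - z) \<bullet> (y - z) <= 0" "(z - x) \<bullet> (y - x) <= 0"
 shows False
proof -
 have "(x - z) \<bullet> (y - z) + (z - x) \<bullet> (y - x) = (norm (x - z))\<^sup>2"
  by (simp add: power2_norm_eq_inner inner_diff algebra_simps inner_commute)
 moreover have "0 < (norm (x - z))\<^sup>2" using assms(1) by simp
 ultimately show False using assms(2,3) by linarith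
qed

lemma lens_obtuse:
 assumes "z \<in> lens T x y" "0 < T"
 shows "(x - z) \<bullet> (y - z) <= 0"
proof -
 have "0 <= - T * ((x - z) \<bullet> (y - z))" using assms(1) abs_ge_zero order_trans unfolding lens_def by blast
 then show ?thesis using assms(2) by (simp add: mult_le_0_iff)
qed

text \<open>Up to null sets the event is the union of the three events that a given vertex carries the
 large angle, and these are disjoint because only one angle of a triangle is obtuse.\<close>

lemma measure_angle_event_small:
 assumes e: "0 < e" "e < pi / 2"
 shows "measure mu3 (angle_event e) = 3 * p_lens e"
proof -
 have T: "0 < tan e" using e by (intro tan_gt_zero) auto
 have "AE t in mu3. indicat_real (angle_event e) t = indicat_real (vertex_event e 0) t +
   indicat_real (vertex_event e 1) t + indicat_real (vertex_event e 2) t" using AE_mu3_generic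
 proof eventually_elim
  case (elim t)
  obtain x y z where t: "t = (x, y, z)" by (cases t) auto
  have d: "x ~= y" "x ~= z" "y ~= z" "largest_angle x y z < pi" using elim by (auto simp: t)
  let ?ax = "x \<in> lens (tan e) y z" and ?ay = "y \<in> lens (tan e) x z" and ?az = "z \<in> lens (tan e) x y"
  have ax: "pi - e <= angle_at x y z \<longleftrightarrow> ?ax"
   using angle_at_ge_iff_tan[OF e, of y x z] d by (auto simp: lens_def)
  have ay: "pi - e <= angle_at y x z \<longleftrightarrow> ?ay"
   using angle_at_ge_iff_tan[OF e, of x y z] d by (auto simp: lens_def)
  have az: "pi - e <= angle_at z x y \<longleftrightarrow> ?az"
   using angle_at_ge_iff_tan[OF e, of x z y] d by (auto simp: lens_def)
  have ev: "t \<in> angle_event e \<longleftrightarrow> t \<in> space mu3 \<and> (?ax \<or> ?ay \<or> ?az)"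
  proof -
   have "pi - largest_angle x y z <= e \<longleftrightarrow> pi - e <= largest_angle x y z" by linarith
   also have "... \<longleftrightarrow> ?ax \<or> ?ay \<or> ?az"
    unfolding largest_angle_def ax[symmetric] ay[symmetric] az[symmetric] by (auto simp: le_max_iff_disj)
   finally show ?thesis using d by (auto simp: angle_event_def t)
  qed
  have n1: "\<not> (?ax \<and> ?ay)" using obtuse_unique[of y x z] lens_obtuse[OF _ T] d by blast
  have n2: "\<not> (?ax \<and> ?az)"
   using obtuse_unique[of x z y] lens_obtuse[OF _ T, of x y z] lens_obtuse[OF _ T, of z x y] d
   by (auto simp: inner_commute)
  have n3: "\<not> (?ay \<and> ?az)"
   using obtuse_unique[of y z x] lens_obtuse[OF _ T, of y x z] lens_obtuse[OF _ T, of z x y] d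
   by (auto simp: inner_commute)
  show ?case using n1 n2 n3 d unfolding indicator_def ev by (auto simp: vertex_event_def t)
 qed
 then have "(\<integral>t. indicat_real (angle_event e) t \<partial>mu3) = (\<integral>t. indicat_real (vertex_event e 0) t +
   indicat_real (vertex_event e 1) t + indicat_real (vertex_event e 2) t \<partial>mu3)"
  by (intro integral_cong_AE) auto
 also have "... = measure mu3 (vertex_event e 0) + measure mu3 (vertex_event e 1) + measure mu3 (vertex_event e 2)"
  by (simp add: mu3.P.emeasure_eq_measure)
 finally show ?thesis by (simp add: measure_vertex_event)
qed

text \<open>Beyond the range of the preceding lemma, the probability, at most \<open>1\<close>, and the linear term are both \<open>O (e^2)\<close>.\<close>

lemma angle_event_asymptotics:
 "\<exists>C>0. \<forall>e>0. \<bar>measure mu3 (angle_event e) - 6 * e * beta\<bar> <= C * e\<^sup>2"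
proof -
 obtain C where C: "C > 0" "\<And>e. e > 0 ==> \<bar>p_lens e - 2 * e * beta\<bar> <= C * e\<^sup>2" using p_lens_asymptotics by blast
 define C4 where "C4 = 1 + 6 * beta"
 show ?thesis
 proof (intro exI[of _ "3 * C + C4"] conjI allI impI)
  show "0 < 3 * C + C4" using C beta_nonneg by (simp add: C4_def)
  fix e :: real assume e: "0 < e"
  show "\<bar>measure mu3 (angle_event e) - 6 * e * beta\<bar> <= (3 * C + C4) * e\<^sup>2"
  proof (cases "e < pi / 2")
   case True
   have "\<bar>3 * p_lens e - 6 * e * beta\<bar> <= 3 * (C * e\<^sup>2)" using C(2)[OF e] by linarith
   also have "... <= (3 * C + C4) * e\<^sup>2" using beta_nonneg by (simp add: C4_def algebra_simps)
   finally show ?thesis using measure_angle_event_small[OF e True] by simp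
  next
   case False
   then have e1: "1 <= e" using pi_gt3 by simp
   have "\<bar>measure mu3 (angle_event e) - 6 * e * beta\<bar> <= 1 + 6 * e * beta"
    using mu3.P.prob_le_1[of "angle_event e"] measure_nonneg[of mu3 "angle_event e"] beta_nonneg e
    by (intro abs_leI) (auto simp: add_increasing2 add_increasing intro: order_trans)
   also have "... <= e\<^sup>2 + 6 * e\<^sup>2 * beta"
    using e1 beta_nonneg self_le_power[of e 2] by (intro add_mono mult_right_mono) auto
   also have "... <= (3 * C + C4) * e\<^sup>2" using C by (simp add: C4_def algebra_simps)
   finally show ?thesis .
  qed
 qed
qed

end

section \<open>Angle processes of finite random sets\<close>

lemma finite_distinct_triples: "finite A ==> finite (distinct_triples A)"
 by (rule finite_subset[of _ "A \<times> A \<times> A"]) (auto simp: distinct_triples_def)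

text \<open>The factor \<open>1 / 6\<close> compensates for the six orderings of a triple.\<close>

lemma angle_process_eq:
 assumes fin: "finite (points N)"
 shows "angle_process N = distr (count_space (triples_of (points N))) borel deficit"
proof (rule measure_eqI)
 let ?A = "points N"
 let ?F = "\<lambda>(x1, x2, x3). pi - largest_angle x1 x2 x3"
 fix B assume "B \<in> sets (angle_process N)"
 then have B: "B \<in> sets borel" by (simp add: angle_process_def)
 let ?T = "distinct_triples ?A"
 have fT: "finite ?T" using fin by (rule finite_distinct_triples)
 have "real (card (?F -` B \<inter> ?T)) = (\<Sum>t\<in>?T. indicat_real B (?F t))"
  using fT by (simp add: indicator_def sum.If_cases vimage_def Int_def conj_commute)
 also have "... = (\<Sum>(x, y, z)\<in>?T. indicat_real B (deficit {x, y, z}))"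
  by (intro sum.cong) (auto simp: distinct_triples_def deficit_eq_largest_angle)
 also have "... = 6 * (\<Sum>I\<in>triples_of ?A. indicat_real B (deficit I))"
  using sum_distinct_triples[OF fin, of "\<lambda>I. indicat_real B (deficit I)"] by simp
 also have "(\<Sum>I\<in>triples_of ?A. indicat_real B (deficit I)) = real (card (deficit -` B \<inter> triples_of ?A))"
  using finite_triples_of[OF fin] by (simp add: indicator_def sum.If_cases vimage_def Int_def conj_commute)
 finally have card: "card (?F -` B \<inter> ?T) = 6 * card (deficit -` B \<inter> triples_of ?A)" by linarith
 have "emeasure (angle_process N) B = 1/6 * of_nat (card (?F -` B \<inter> ?T))"
  unfolding angle_process_def using B fT by (simp add: emeasure_distr)
 also have "... = 1/6 * (6 * of_nat (card (deficit -` B \<inter> triples_of ?A)))" unfolding card by simp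
 also have "... = of_nat (card (deficit -` B \<inter> triples_of ?A))"
  by (simp add: mult.assoc[symmetric] ennreal_divide_times)
 also have "... = emeasure (distr (count_space (triples_of ?A)) borel deficit) B"
  using B finite_triples_of[OF fin] by (simp add: emeasure_distr)
 finally show "emeasure (angle_process N) B = emeasure (distr (count_space (triples_of ?A)) borel deficit) B" .
qed (simp add: angle_process_def)

lemma rescale_angle_process_eq:
 assumes fin: "finite (points N)"
 shows "rescale c (angle_process N) = distr (count_space (triples_of (points N))) borel (\<lambda>I. c * deficit I)"
 unfolding rescale_def angle_process_eq[OF fin] by (subst distr_distr) (auto simp: comp_def)

lemma integral_rescale_angle_process:
 fixes f :: "real => real"
 assumes fin: "finite (points N)" and f: "f \<in> borel_measurable borel"
 shows "(\<integral>x. f x \<partial>rescale c (angle_process N)) = (\<Sum>I\<in>triples_of (points N). f (c * deficit I))"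
 unfolding rescale_angle_process_eq[OF fin] using f finite_triples_of[OF fin]
 by (subst integral_distr) (auto simp: lebesgue_integral_count_space_finite)

lemma rescale_angle_process_locally_finite:
 assumes fin: "finite (points N)"
 shows "rescale c (angle_process N) \<in> locally_finite_measures"
 unfolding rescale_angle_process_eq[OF fin] locally_finite_measures_def
 using finite_triples_of[OF fin] by (auto simp: emeasure_distr of_nat_less_top)

definition angle_count :: "real => 'a::real_inner set => nat" where
 "angle_count a A = card {I \<in> triples_of A. 0 < deficit I \<and> deficit I <= a}"

text \<open>The infimum is attained, as the process has finitely many points.\<close>

lemma mth_point_le_iff:
 assumes fin: "finite (points N)" and m: "1 <= m" and a: "0 < a"
 shows "mth_point m (angle_process N) <= ereal a \<longleftrightarrow> m <= angle_count a (points N)"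
proof -
 let ?T = "triples_of (points N)" and ?\<xi> = "angle_process N"
 have fT: "finite ?T" using fin by (rule finite_triples_of)
 have em: "emeasure ?\<xi> B = of_nat (card {I \<in> ?T. deficit I \<in> B})" if "B \<in> sets borel" for B
 proof -
  have "emeasure ?\<xi> B = of_nat (card (deficit -` B \<inter> ?T))"
   unfolding angle_process_eq[OF fin] using that fT by (simp add: emeasure_distr)
  also have "deficit -` B \<inter> ?T = {I \<in> ?T. deficit I \<in> B}" by auto
  finally show ?thesis .
 qed
 have pts: "points ?\<xi> = deficit ` ?T"
 proof -
  have sp: "space ?\<xi> = UNIV" unfolding angle_process_eq[OF fin] by simp
  have "points ?\<xi> = {y. emeasure ?\<xi> {y} ~= 0}" unfolding points_def[of "?\<xi>"] sp by simp
  also have "... = {y. {I \<in> ?T. deficit I \<in> {y}} ~= {}}" using fT by (subst em) auto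
  finally show ?thesis by auto
 qed
 have cnt: "of_nat m <= emeasure ?\<xi> {0<..y} \<longleftrightarrow> m <= angle_count y (points N)" for y
  by (simp add: em angle_count_def)
 define S where "S = {y \<in> points ?\<xi>. 0 < y \<and> of_nat m <= emeasure ?\<xi> {0<..y}}"
 have fS: "finite S" using fT by (simp add: S_def pts)
 have mono: "angle_count x (points N) <= angle_count y (points N)" if "x <= y" for x y
  unfolding angle_count_def using fT that by (intro card_mono) auto
 have M: "mth_point m ?\<xi> = Inf (ereal ` S)" by (simp add: mth_point_def S_def)
 show ?thesis
 proof
  assume le: "mth_point m ?\<xi> <= ereal a"
  have "S ~= {}" using le unfolding M by (auto simp: top_ereal_def)
  then have "Inf (ereal ` S) \<in> ereal ` S" using fS by (metis Min_Inf Min_in finite_imageI image_is_empty)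
  then obtain y where y: "y \<in> S" "ereal y <= ereal a" using le unfolding M by auto
  then show "m <= angle_count a (points N)" using mono[of y a] by (auto simp: S_def cnt)
 next
  assume le: "m <= angle_count a (points N)"
  define R where "R = {I \<in> ?T. 0 < deficit I \<and> deficit I <= a}"
  have R: "finite R" "R ~= {}"
  proof -
   show "finite R" using fT by (simp add: R_def)
   have "card R ~= 0" using le m by (simp add: R_def angle_count_def)
   then show "R ~= {}" by auto
  qed
  define y where "y = Max (deficit ` R)"
  have y: "y \<in> deficit ` R" unfolding y_def using R by (intro Max_in) auto
  have "R \<subseteq> {I \<in> ?T. 0 < deficit I \<and> deficit I <= y}"
   using R by (auto simp: R_def[symmetric] y_def) (auto simp: R_def)
  then have "card R <= angle_count y (points N)" unfolding angle_count_def using fT by (intro card_mono) auto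
  then have "y \<in> S" using y le by (auto simp: S_def cnt pts R_def angle_count_def)
  then have "mth_point m ?\<xi> <= ereal y" unfolding M by (intro Inf_lower) auto
  also have "ereal y <= ereal a" using y by (auto simp: R_def)
  finally show "mth_point m ?\<xi> <= ereal a" .
 qed
qed

lemma less_times_mth_point_iff:
 assumes fin: "finite (points N)" and m: "1 <= m" and "0 < y" "0 < c"
 shows "ereal y < ereal c * mth_point m (angle_process N) \<longleftrightarrow> angle_count (y / c) (points N) < m"
proof -
 have "ereal y < ereal c * x \<longleftrightarrow> ereal (y / c) < x" for x using assms(4) by (cases x) (auto simp: field_simps)
 then have "ereal y < ereal c * mth_point m (angle_process N) \<longleftrightarrow> \<not> mth_point m (angle_process N) <= ereal (y / c)"
  by (simp add: not_le)
 then show ?thesis using mth_point_le_iff[OF fin m, of "y / c"] assms by (simp add: not_le)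
qed

text \<open>A multiplicative functional of the angle process. With \<open>g = z\<close> on \<open>(0, a]\<close> it is the generating
 function of a count, with \<open>g = exp (- f)\<close> a Laplace functional.\<close>

definition mfun :: "(real => complex) => 'a::real_inner set => complex" where
 "mfun g A = (\<Prod>I\<in>triples_of A. g (deficit I))"

lemma norm_mfun_le: "(\<And>x. norm (g x) <= 1) ==> norm (mfun g A) <= 1"
 unfolding mfun_def prod_norm[symmetric] by (intro prod_le_1) auto

lemma mfun_power:
 assumes "finite A"
 shows "mfun (\<lambda>x. if 0 < x \<and> x <= a then z else 1) A = z ^ angle_count a A"
 unfolding mfun_def angle_count_def using finite_triples_of[OF assms]
 by (subst prod.If_cases) (auto simp: Int_def)

lemma mfun_exp:
 assumes "finite A"
 shows "mfun (\<lambda>x. of_real (exp (- f x))) A = of_real (exp (- (\<Sum>I\<in>triples_of A. f (deficit I))))"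
 unfolding mfun_def using finite_triples_of[OF assms] by (simp add: exp_sum sum_negf[symmetric])

lemma tendsto_mfun:
 assumes "\<And>x. (\<lambda>k. g k x) \<longlonglongrightarrow> g' x"
 shows "(\<lambda>k. mfun (g k) A) \<longlonglongrightarrow> mfun g' A"
 unfolding mfun_def using assms by (intro tendsto_prod)

text \<open>Triples with repeated points are a discontinuity, so injectivity is needed along the sequence.\<close>

lemma tendsto_deficit_image:
 fixes r :: "nat => 'a::real_inner => 'a"
 assumes I: "card I = 3" and r: "\<And>x. (\<lambda>m. r m x) \<longlonglongrightarrow> x"
  and inj: "eventually (\<lambda>m. inj_on (r m) I) sequentially"
 shows "(\<lambda>m. deficit (r m ` I)) \<longlonglongrightarrow> deficit I"
proof -
 have "I \<in> triples_of I" using I by (simp add: triples_of_def)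
 then obtain x y z where I': "I = {x, y, z}" "x ~= y" "x ~= z" "y ~= z" by (rule triples_ofE)
 have "(\<lambda>m. pi - largest_angle (r m x) (r m y) (r m z)) \<longlonglongrightarrow> pi - largest_angle x y z"
  using I' by (intro tendsto_diff tendsto_const tendsto_largest_angle r)
 then have "(\<lambda>m. pi - largest_angle (r m x) (r m y) (r m z)) \<longlonglongrightarrow> deficit I"
  unfolding I'(1) deficit_eq_largest_angle[OF I'(2-4)] .
 moreover have "eventually (\<lambda>m. pi - largest_angle (r m x) (r m y) (r m z) = deficit (r m ` I)) sequentially"
  using inj
 proof eventually_elim
  case (elim m)
  then have "r m x ~= r m y" "r m x ~= r m z" "r m y ~= r m z" using I' by (auto simp: inj_on_def)
  then show ?case unfolding I'(1) by (simp add: deficit_eq_largest_angle)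
 qed
 ultimately show ?thesis by (rule Lim_transform_eventually)
qed

lemma eventually_inj_on:
 fixes r :: "nat => 'a::t2_space => 'a"
 assumes "finite A" and r: "\<And>x. (\<lambda>m. r m x) \<longlonglongrightarrow> x"
 shows "eventually (\<lambda>m. inj_on (r m) A) sequentially"
proof -
 have "eventually (\<lambda>m. \<forall>p\<in>{p \<in> A \<times> A. fst p ~= snd p}. r m (fst p) ~= r m (snd p)) sequentially"
 proof (rule eventually_ball_finite)
  show "finite {p \<in> A \<times> A. fst p ~= snd p}" using assms by simp
  show "\<forall>p\<in>{p \<in> A \<times> A. fst p ~= snd p}. eventually (\<lambda>m. r m (fst p) ~= r m (snd p)) sequentially"
  proof
   fix p assume p: "p \<in> {p \<in> A \<times> A. fst p ~= snd p}"
   then obtain U V where UV: "open U" "open V" "fst p \<in> U" "snd p \<in> V" "U \<inter> V = {}"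
    using hausdorff[of "fst p" "snd p"] by auto
   have "eventually (\<lambda>m. r m (fst p) \<in> U) sequentially" "eventually (\<lambda>m. r m (snd p) \<in> V) sequentially"
    using topological_tendstoD[OF r] UV by auto
   then show "eventually (\<lambda>m. r m (fst p) ~= r m (snd p)) sequentially" by eventually_elim (use UV in auto)
  qed
 qed
 then show ?thesis by eventually_elim (auto simp: inj_on_def)
qed

lemma mfun_image:
 assumes "inj_on r A"
 shows "mfun g (r ` A) = (\<Prod>I\<in>triples_of A. g (deficit (r ` I)))"
proof -
 have "triples_of (r ` A) = (`) r ` triples_of A"
 proof (intro set_eqI iffI)
  fix J assume "J \<in> triples_of (r ` A)"
  then have J: "J \<subseteq> r ` A" "card J = 3" by (auto simp: triples_of_def)
  then obtain I where I: "I \<subseteq> A" "J = r ` I" by (meson subset_imageE)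
  then have "card I = 3" using J card_image[OF inj_on_subset[OF assms I(1)]] by simp
  then show "J \<in> (`) r ` triples_of A" using I by (auto simp: triples_of_def)
 next
  fix J assume "J \<in> (`) r ` triples_of A"
  then obtain I where "I \<subseteq> A" "card I = 3" "J = r ` I" by (auto simp: triples_of_def)
  then show "J \<in> triples_of (r ` A)"
   using card_image[OF inj_on_subset[OF assms]] by (auto simp: triples_of_def)
 qed
 moreover have "inj_on ((`) r) (triples_of A)"
  using inj_on_image_eq_iff[OF assms] by (intro inj_onI) (auto simp: triples_of_def)
 ultimately show ?thesis unfolding mfun_def by (simp add: prod.reindex)
qed

lemma tendsto_mfun_image:
 fixes r :: "nat => 'a::real_inner => 'a"
 assumes A: "finite A" and r: "\<And>x. (\<lambda>m. r m x) \<longlonglongrightarrow> x" and g: "continuous_on UNIV g"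
 shows "(\<lambda>m. mfun g (r m ` A)) \<longlonglongrightarrow> mfun g A"
proof -
 have inj: "eventually (\<lambda>m. inj_on (r m) A) sequentially" by (rule eventually_inj_on[OF A r])
 have "(\<lambda>m. \<Prod>I\<in>triples_of A. g (deficit (r m ` I))) \<longlonglongrightarrow> mfun g A" unfolding mfun_def
 proof (intro tendsto_prod continuous_on_tendsto_compose[OF g] tendsto_deficit_image r)
  fix I assume I: "I \<in> triples_of A"
  then show "card I = 3" by (simp add: triples_of_def)
  show "eventually (\<lambda>m. inj_on (r m) I) sequentially"
   using inj by eventually_elim (use I in \<open>auto simp: triples_of_def intro: inj_on_subset\<close>)
 qed auto
 moreover have "eventually (\<lambda>m. (\<Prod>I\<in>triples_of A. g (deficit (r m ` I))) = mfun g (r m ` A)) sequentially"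
  using inj by eventually_elim (simp add: mfun_image)
 ultimately show ?thesis by (rule Lim_transform_eventually)
qed

text \<open>Rounding to a dyadic grid. A rounded subset of a bounded set takes finitely many values only, which
 reduces questions of measurability and the analysis of Poisson processes to finite combinatorics.\<close>

definition rnd :: "nat => real^2 => real^2" where
 "rnd m x = (\<chi> i. of_int \<lfloor>2 ^ m * x $ i\<rfloor> / 2 ^ m)"

lemma rnd_close: "norm (rnd m x - x) <= 2 / 2 ^ m"
proof -
 have "\<bar>(rnd m x - x) $ i\<bar> <= 1 / 2 ^ m" for i
 proof -
  have "\<bar>of_int \<lfloor>2 ^ m * x $ i\<rfloor> - 2 ^ m * x $ i\<bar> <= 1" by linarith
  then have "\<bar>(of_int \<lfloor>2 ^ m * x $ i\<rfloor> - 2 ^ m * x $ i) / 2 ^ m\<bar> <= 1 / 2 ^ m"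
   by (simp add: abs_divide divide_right_mono)
  then show ?thesis by (simp add: rnd_def diff_divide_distrib)
 qed
 then have "(\<Sum>i\<in>UNIV. \<bar>(rnd m x - x) $ i\<bar>) <= (\<Sum>i\<in>(UNIV::2 set). 1 / 2 ^ m)" by (intro sum_mono)
 then show ?thesis using norm_le_l1_cart[of "rnd m x - x"] by (simp add: UNIV_2)
qed

lemma tendsto_rnd: "(\<lambda>m. rnd m x) \<longlonglongrightarrow> x"
proof (rule Lim_null_comparison[where g="\<lambda>m. 2 * (1 / 2) ^ m", THEN Lim_null[THEN iffD2]])
 show "eventually (\<lambda>m. norm (rnd m x - x) <= 2 * (1 / 2) ^ m) sequentially"
 proof (intro always_eventually allI)
  fix m
  have "2 / 2 ^ m = 2 * (1 / 2 :: real) ^ m" by (simp add: power_one_over)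
  then show "norm (rnd m x - x) <= 2 * (1 / 2) ^ m" using rnd_close[of m x] by simp
 qed
 show "(\<lambda>m. 2 * (1 / 2 :: real) ^ m) \<longlonglongrightarrow> 0" by (intro tendsto_mult_right_zero LIMSEQ_power_zero) simp
qed

lemma rnd_measurable [measurable]: "rnd m \<in> borel_measurable borel"
proof -
 have eq: "rnd m = (\<lambda>x. (of_int \<lfloor>2 ^ m * x $ 1\<rfloor> / 2 ^ m) *\<^sub>R axis 1 1 + (of_int \<lfloor>2 ^ m * x $ 2\<rfloor> / 2 ^ m) *\<^sub>R axis 2 1)"
  by (auto simp: rnd_def fun_eq_iff vec_eq_iff forall_2 axis_def)
 show ?thesis unfolding eq by measurable
qed

lemma finite_rnd_image:
 assumes "bounded K"
 shows "finite (rnd m ` K)"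
proof -
 obtain b where b: "\<And>x. x \<in> K ==> norm x <= b" using assms by (auto simp: bounded_iff)
 define S where "S = (\<lambda>k. of_int k / 2 ^ m :: real) ` {\<lfloor>- (2 ^ m * b)\<rfloor>..\<lfloor>2 ^ m * b\<rfloor>}"
 have "rnd m ` K \<subseteq> {x. \<forall>i. x $ i \<in> S}"
 proof (clarsimp)
  fix x i assume "x \<in> K"
  then have "\<bar>x $ i\<bar> <= b" using b[of x] component_le_norm_cart[of x i] by linarith
  then have "2 ^ m * \<bar>x $ i\<bar> <= 2 ^ m * b" by (intro mult_left_mono) auto
  then have "\<bar>2 ^ m * x $ i\<bar> <= 2 ^ m * b" by (simp only: abs_mult) simp
  then have "- (2 ^ m * b) <= 2 ^ m * x $ i" "2 ^ m * x $ i <= 2 ^ m * b" by linarith+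
  then show "rnd m x $ i \<in> S" unfolding S_def rnd_def by (auto intro!: imageI floor_mono)
 qed
 moreover have "finite {x :: real^2. \<forall>i. x $ i \<in> S}"
 proof (rule finite_subset)
  show "{x :: real^2. \<forall>i. x $ i \<in> S} \<subseteq> (\<lambda>(a, b). vector [a, b]) ` (S \<times> S)"
  proof
   fix x :: "real^2" assume "x \<in> {x. \<forall>i. x $ i \<in> S}"
   then show "x \<in> (\<lambda>(a, b). vector [a, b]) ` (S \<times> S)"
    by (intro image_eqI[of _ _ "(x $ 1, x $ 2)"]) (auto simp: vec_eq_iff forall_2)
  qed
 qed (simp add: S_def)
 ultimately show ?thesis by (rule finite_subset)
qed

text \<open>Hitting events generate the usual \<open>\<sigma>\<close>-algebra on the space of closed sets.\<close>

definition random_finite_set :: "'w measure => (real^2) set => ('w => (real^2) set) => bool" where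
 "random_finite_set P K A \<longleftrightarrow> (\<forall>w\<in>space P. finite (A w) \<and> A w \<subseteq> K) \<and>
   (\<forall>B\<in>sets borel. {w \<in> space P. A w \<inter> B ~= {}} \<in> sets P)"

lemma mfun_rounded:
 assumes C: "finite C" "A \<subseteq> C"
 shows "mfun g A = (\<Prod>I\<in>triples_of C. 1 - (if I \<subseteq> A then 1 - g (deficit I) else 0))"
proof -
 have "(\<Prod>I\<in>triples_of C. 1 - (if I \<subseteq> A then 1 - g (deficit I) else 0)) =
   (\<Prod>I\<in>triples_of A. 1 - (if I \<subseteq> A then 1 - g (deficit I) else 0))" using finite_triples_of[OF C(1)] C(2)
  by (intro prod.mono_neutral_right) (auto simp: triples_of_def)
 also have "... = mfun g A" unfolding mfun_def by (intro prod.cong) (auto simp: triples_of_def)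
 finally show ?thesis by simp
qed

text \<open>An intersection of finitely many hitting events.\<close>

lemma occupied_measurable:
 fixes I :: "(real^2) set"
 assumes A: "random_finite_set P K A" and q: "q \<in> borel_measurable borel" and I: "finite I"
 shows "{w \<in> space P. I \<subseteq> q ` A w} \<in> sets P"
proof -
 have "{w \<in> space P. c \<in> q ` A w} \<in> sets P" for c
 proof -
  have "q -` {c} \<in> sets borel" using measurable_sets[OF q, of "{c}"] by simp
  then have "{w \<in> space P. A w \<inter> q -` {c} ~= {}} \<in> sets P" using A by (auto simp: random_finite_set_def)
  moreover have "{w \<in> space P. A w \<inter> q -` {c} ~= {}} = {w \<in> space P. c \<in> q ` A w}" by auto
  ultimately show ?thesis by simp
 qed
 then have "{w \<in> space P. \<forall>c\<in>I. c \<in> q ` A w} \<in> sets P" using I by (intro sets.sets_Collect_finite_All) auto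
 then show ?thesis by (simp add: subset_iff Ball_def)
qed

lemma mfun_rnd_measurable:
 assumes A: "random_finite_set P K A" and K: "bounded K"
 shows "(\<lambda>w. mfun g (rnd m ` A w)) \<in> borel_measurable P"
proof -
 have fin: "finite (rnd m ` K)" using K by (rule finite_rnd_image)
 have "(\<lambda>w. \<Prod>I\<in>triples_of (rnd m ` K). 1 - (if I \<subseteq> rnd m ` A w then 1 - g (deficit I) else 0)) \<in> borel_measurable P"
 proof (intro borel_measurable_prod borel_measurable_diff borel_measurable_const measurable_If)
  fix I assume "I \<in> triples_of (rnd m ` K)"
  then have "finite I" using fin by (auto simp: triples_of_def intro: finite_subset)
  then show "{w \<in> space P. I \<subseteq> rnd m ` A w} \<in> sets P" by (intro occupied_measurable[OF A rnd_measurable])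
 qed
 moreover have "mfun g (rnd m ` A w) = (\<Prod>I\<in>triples_of (rnd m ` K). 1 - (if I \<subseteq> rnd m ` A w then 1 - g (deficit I) else 0))"
  if "w \<in> space P" for w
  using that A by (intro mfun_rounded fin image_mono) (auto simp: random_finite_set_def)
 ultimately show ?thesis by (simp cong: measurable_cong)
qed

text \<open>The limit of functionals of the rounded sets, because finitely many distinct points eventually stay distinct under rounding.\<close>

lemma mfun_measurable:
 assumes A: "random_finite_set P K A" and K: "bounded K" and g: "continuous_on UNIV g"
 shows "(\<lambda>w. mfun g (A w)) \<in> borel_measurable P"
proof (rule borel_measurable_LIMSEQ_metric)
 show "(\<lambda>w. mfun g (rnd m ` A w)) \<in> borel_measurable P" for m by (rule mfun_rnd_measurable[OF A K])
 show "(\<lambda>m. mfun g (rnd m ` A w)) \<longlonglongrightarrow> mfun g (A w)" if "w \<in> space P" for w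
  using that A by (intro tendsto_mfun_image tendsto_rnd g) (auto simp: random_finite_set_def)
qed

text \<open>A continuous approximation of the indicator of \<open>(0, a]\<close>: rising on \<open>[0, 1 / k]\<close> and falling
 on \<open>[a, a + 1 / k]\<close>, so that the limit excludes \<open>0\<close> and includes \<open>a\<close>.\<close>

definition bump :: "real => nat => real => real" where
 "bump a k x = max 0 (min 1 (real k * x)) * max 0 (min 1 (1 - real k * (x - a)))"

lemma bump_cont: "continuous_on UNIV (bump a k)" unfolding bump_def by (intro continuous_intros)

lemma bump_bounds: "0 <= bump a k x" "bump a k x <= 1" unfolding bump_def by (auto intro!: mult_le_one)

lemma bump_zero: "0 < k ==> a + 1 / real k < x ==> bump a k x = 0"
 unfolding bump_def by (auto simp: field_simps max_def)

lemma tendsto_bump: "(\<lambda>k. bump a k x) \<longlonglongrightarrow> (if 0 < x \<and> x <= a then 1 else 0)"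
proof -
 have big: "eventually (\<lambda>k. 1 <= real k * c) sequentially" if "0 < c" for c
 proof -
  obtain N where N: "1 / c < real N" using reals_Archimedean2 by blast
  have "1 <= real k * c" if "N <= k" for k
  proof -
   have "1 / c <= real k" using N that by linarith
   then show ?thesis using \<open>0 < c\<close> by (simp add: field_simps)
  qed
  then show ?thesis by (auto simp: eventually_sequentially)
 qed
 consider "x <= 0" | "0 < x" "x <= a" | "0 < x" "a < x" by linarith
 then show ?thesis
 proof cases
  case 1
  have m0: "max 0 (min 1 t) = 0" if "t <= 0" for t :: real using that by auto
  have "real k * x <= 0" for k using 1 by (simp add: mult_nonneg_nonpos)
  from m0[OF this] have "bump a k x = 0" for k by (simp add: bump_def)
  then show ?thesis using 1 by simp
 next
  case 2
  have "eventually (\<lambda>k. 1 = bump a k x) sequentially" using big[OF 2(1)]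
  proof eventually_elim
   case (elim k)
   have "0 <= real k * (a - x)" using 2 by simp
   then have "1 <= 1 - real k * (x - a)" by (simp add: algebra_simps)
   then show ?case using elim by (simp add: bump_def)
  qed
  then show ?thesis using 2 by (auto intro: Lim_transform_eventually)
 next
  case 3
  have "eventually (\<lambda>k. 0 = bump a k x) sequentially"
   using big[of "x - a"] 3 by (auto simp: bump_def elim: eventually_mono)
  then show ?thesis using 3 by (auto intro: Lim_transform_eventually)
 qed
qed

lemma angle_count_measurable:
 assumes A: "random_finite_set P K A" and K: "bounded K"
 shows "(\<lambda>w. angle_count a (A w)) \<in> P \<rightarrow>\<^sub>M count_space UNIV"
proof -
 define g where "g k x = complex_of_real (1 - bump a k x / 2)" for k x
 let ?g = "\<lambda>x. if 0 < x \<and> x <= a then 1 / 2 else 1 :: complex"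
 have lim: "(\<lambda>k. g k x) \<longlonglongrightarrow> ?g x" for x
 proof -
  have "(\<lambda>k. g k x) \<longlonglongrightarrow> of_real (1 - (if 0 < x \<and> x <= a then 1 else 0) / 2)"
   unfolding g_def by (intro tendsto_intros tendsto_bump) simp
  then show ?thesis by (auto split: if_splits)
 qed
 have "(\<lambda>w. mfun ?g (A w)) \<in> borel_measurable P"
 proof (rule borel_measurable_LIMSEQ_metric)
  show "(\<lambda>w. mfun (g k) (A w)) \<in> borel_measurable P" for k
   unfolding g_def by (intro mfun_measurable[OF A K] continuous_intros continuous_on_of_real bump_cont) simp
  show "(\<lambda>k. mfun (g k) (A w)) \<longlonglongrightarrow> mfun ?g (A w)" for w by (intro tendsto_mfun lim)
 qed
 then have m: "(\<lambda>w. (1 / 2 :: complex) ^ angle_count a (A w)) \<in> borel_measurable P"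
  using A by (subst (asm) measurable_cong[where g="\<lambda>w. (1 / 2) ^ angle_count a (A w)"])
   (auto simp: mfun_power random_finite_set_def)
 have pow: "(1 / 2 :: complex) ^ i = (1 / 2) ^ j \<longleftrightarrow> i = j" for i j
 proof -
  have "(1 / 2 :: complex) ^ i = (1 / 2) ^ j \<longleftrightarrow> complex_of_real ((1 / 2) ^ i) = complex_of_real ((1 / 2) ^ j)"
   by simp
  also have "... \<longleftrightarrow> (1 / 2 :: real) ^ i = (1 / 2) ^ j" by (rule of_real_eq_iff)
  also have "... \<longleftrightarrow> i = j" by (simp add: power_one_over)
  finally show ?thesis .
 qed
 show ?thesis
 proof (rule measurable_count_space_eq2_countable[THEN iffD2])
  show "(\<lambda>w. angle_count a (A w)) \<in> space P \<rightarrow> UNIV \<and> (\<forall>n\<in>UNIV. (\<lambda>w. angle_count a (A w)) -` {n} \<inter> space P \<in> sets P)"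
  proof (intro conjI ballI)
   fix n
   have "(\<lambda>w. (1 / 2 :: complex) ^ angle_count a (A w)) -` {(1 / 2) ^ n} \<inter> space P \<in> sets P"
    using m by (rule measurable_sets) simp
   also have "(\<lambda>w. (1 / 2 :: complex) ^ angle_count a (A w)) -` {(1 / 2) ^ n} \<inter> space P =
     (\<lambda>w. angle_count a (A w)) -` {n} \<inter> space P" by (auto simp: pow)
   finally show "(\<lambda>w. angle_count a (A w)) -` {n} \<inter> space P \<in> sets P" .
  qed auto
 qed (auto?)
qed

section \<open>Triples of independent points\<close>

lemma card_triples_of: "finite A ==> card (triples_of A) = card A choose 3"
 unfolding triples_of_def by (rule n_subsets)

lemma card_triples_of_le: "finite A ==> card (triples_of A) <= card A ^ 3"
 using binomial_fact_pow[of "card A" 3] le_trans[of "card A choose 3" "(card A choose 3) * fact 3"]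
 by (simp add: card_triples_of)

lemma triples_containing:
 assumes "v \<in> J" "J \<in> triples_of A"
 obtains j k where "J = {v, j, k}" "v ~= j" "v ~= k" "j ~= k" "v \<in> A" "j \<in> A" "k \<in> A"
proof -
 obtain x y z where J: "J = {x, y, z}" "x ~= y" "x ~= z" "y ~= z" "x \<in> A" "y \<in> A" "z \<in> A"
  using assms(2) by (rule triples_ofE)
 consider "v = x" | "v = y" | "v = z" using assms(1) J(1) by auto
 then show ?thesis
 proof cases
  case 1 then show ?thesis using J that[of y z] by auto
 next
  case 2 then show ?thesis using J that[of x z] by (auto simp: insert_commute)
 next
  case 3 then show ?thesis using J that[of x y] by (auto simp: insert_commute)
 qed
qed

lemma card_overlapping_triples:
 assumes "finite V" "I \<in> triples_of V"
 shows "card {J \<in> triples_of V. J \<inter> I ~= {}} <= 3 * card V ^ 2"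
proof -
 have fI: "finite I" "card I = 3" using assms by (auto simp: triples_of_def intro: finite_subset)
 have "{J \<in> triples_of V. J \<inter> I ~= {}} \<subseteq> (\<Union>v\<in>I. (\<lambda>(j, k). {v, j, k}) ` (V \<times> V))"
 proof
  fix J assume "J \<in> {J \<in> triples_of V. J \<inter> I ~= {}}"
  then obtain v where v: "v \<in> J" "v \<in> I" "J \<in> triples_of V" by auto
  from v(1,3) obtain j k where "J = {v, j, k}" "j \<in> V" "k \<in> V" by (rule triples_containing)
  then show "J \<in> (\<Union>v\<in>I. (\<lambda>(j, k). {v, j, k}) ` (V \<times> V))" using v(2) by auto
 qed
 then have "card {J \<in> triples_of V. J \<inter> I ~= {}} <= card (\<Union>v\<in>I. (\<lambda>(j, k). {v, j, k}) ` (V \<times> V))"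
  using assms(1) fI by (intro card_mono) auto
 also have "... <= (\<Sum>v\<in>I. card ((\<lambda>(j, k). {v, j, k}) ` (V \<times> V)))" by (rule card_UN_le[OF fI(1)])
 also have "... <= (\<Sum>v\<in>I. card (V \<times> V))" using assms(1) by (intro sum_mono card_image_le) auto
 also have "... = 3 * card V ^ 2" using fI by (simp add: card_cartesian_product power2_eq_square)
 finally show ?thesis .
qed

text \<open>Triples of indices are used in place of triples of points. Coinciding points, an event of probability \<open>0\<close>,
 receive the neutral value.\<close>

definition kernel :: "(real => complex) => 'i set => ('i => real^2) => complex" where
 "kernel g I x = (if inj_on x I then 1 - g (deficit (x ` I)) else 0)"

lemma kernel_cong: "(\<And>i. i \<in> I ==> x i = y i) ==> kernel g I x = kernel g I y"
 unfolding kernel_def by (metis image_cong inj_on_cong)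

lemma kernel_triple:
 assumes "i ~= j" "i ~= k" "j ~= k"
 shows "kernel g {i, j, k} x = (if x i ~= x j \<and> x i ~= x k \<and> x j ~= x k then 1 - g (pi - largest_angle (x i) (x j) (x k)) else 0)"
 using assms by (auto simp: kernel_def deficit_eq_largest_angle)

lemma mfun_eq_kernel:
 assumes "inj_on x V"
 shows "mfun g (x ` V) = (\<Prod>I\<in>triples_of V. 1 - kernel g I x)"
 unfolding mfun_image[OF assms] kernel_def
 by (intro prod.cong) (auto simp: triples_of_def intro: inj_on_subset[OF assms])

text \<open>Joint laws of functions of independent variables whose values lie in
 different spaces.\<close>

lemma (in prob_space) distr_pair_of_indep_var:
 assumes ind: "indep_var M1 X M2 Y" and f [measurable]: "f \<in> M1 \<rightarrow>\<^sub>M N1" and h [measurable]: "h \<in> M2 \<rightarrow>\<^sub>M N2"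
 shows "distr M (N1 \<Otimes>\<^sub>M N2) (\<lambda>w. (f (X w), h (Y w))) = distr M N1 (\<lambda>w. f (X w)) \<Otimes>\<^sub>M distr M N2 (\<lambda>w. h (Y w))"
proof -
 have X [measurable]: "X \<in> M \<rightarrow>\<^sub>M M1" and Y [measurable]: "Y \<in> M \<rightarrow>\<^sub>M M2"
  using ind by (auto dest: indep_var_rv1 indep_var_rv2)
 have D: "distr M M1 X \<Otimes>\<^sub>M distr M M2 Y = distr M (M1 \<Otimes>\<^sub>M M2) (\<lambda>x. (X x, Y x))"
  using ind by (simp add: indep_var_distribution_eq)
 interpret D2: prob_space "distr M M2 Y" by (rule prob_space_distr) fact
 interpret D3: prob_space "distr (distr M M2 Y) N2 h" by (rule D2.prob_space_distr) simp
 have "distr (distr M M1 X) N1 f \<Otimes>\<^sub>M distr (distr M M2 Y) N2 h =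
  distr (distr M M1 X \<Otimes>\<^sub>M distr M M2 Y) (N1 \<Otimes>\<^sub>M N2) (\<lambda>(x, y). (f x, h y))"
  by (rule pair_measure_distr) (simp_all add: D3.sigma_finite_measure_axioms)
 then show ?thesis unfolding D by (simp add: distr_distr comp_def)
qed

context lipschitz_density
begin

lemma component_measurable_\<mu>:
 assumes "i \<in> S" shows "(\<lambda>x. x i) \<in> borel_measurable (PiM S (\<lambda>_. \<mu>))"
proof -
 have "(\<lambda>x. x i) \<in> PiM S (\<lambda>_. \<mu>) \<rightarrow>\<^sub>M \<mu>" using assms by (rule measurable_component_singleton)
 from measurable_compose[OF this id_measurable_\<mu>] show ?thesis .
qed

text \<open>The kernel as a function of a point of the product space \<open>mu3\<close>.\<close>

definition defect :: "(real => complex) => (real^2) \<times> (real^2) \<times> (real^2) => complex" where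
 "defect g t = (if fst t ~= fst (snd t) \<and> fst t ~= snd (snd t) \<and> fst (snd t) ~= snd (snd t)
  then 1 - g (pi - largest_angle (fst t) (fst (snd t)) (snd (snd t))) else 0)"

lemma defect_triple:
 "defect g (x, y, z) = (if x ~= y \<and> x ~= z \<and> y ~= z then 1 - g (pi - largest_angle x y z) else 0)"
 by (auto simp: defect_def)

lemma defect_measurable:
 assumes [measurable]: "g \<in> borel_measurable borel"
 shows "defect g \<in> borel_measurable mu3"
 unfolding defect_def[abs_def] by measurable

lemma kernel_measurable:
 assumes g: "g \<in> borel_measurable borel" and I: "card I = 3" "I \<subseteq> S"
 shows "kernel g I \<in> borel_measurable (PiM S (\<lambda>_. \<mu>))"
proof -
 have "I \<in> triples_of S" using I by (simp add: triples_of_def)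
 then obtain i j k where I': "I = {i, j, k}" "i ~= j" "i ~= k" "j ~= k" "i \<in> S" "j \<in> S" "k \<in> S"
  by (rule triples_ofE)
 have T: "(\<lambda>x. (x i, x j, x k)) \<in> PiM S (\<lambda>_. \<mu>) \<rightarrow>\<^sub>M mu3"
  using I'(5-7) by (intro measurable_Pair measurable_component_singleton)
 have "kernel g I = (\<lambda>x. defect g (x i, x j, x k))"
  unfolding I'(1) kernel_triple[OF I'(2-4), abs_def] defect_triple by simp
 then show ?thesis using measurable_compose[OF T defect_measurable[OF g]] by simp
qed

definition expected_defect :: "(real => complex) => complex" where
 "expected_defect g = (\<integral>t. defect g t \<partial>mu3)"

lemma distr_triple:
 assumes P: "prob_space P" and ind: "prob_space.indep_vars P (\<lambda>_. \<mu>) X V"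
  and law: "\<And>i. i \<in> V ==> distr P \<mu> (X i) = \<mu>" and V: "i \<in> V" "j \<in> V" "k \<in> V" "i ~= j" "i ~= k" "j ~= k"
 shows "(\<lambda>w. (X i w, X j w, X k w)) \<in> P \<rightarrow>\<^sub>M mu3" "distr P mu3 (\<lambda>w. (X i w, X j w, X k w)) = mu3"
  "distr P mu2 (\<lambda>w. (X j w, X k w)) = mu2"
proof -
 interpret P: prob_space P by (rule P)
 have X: "X i \<in> P \<rightarrow>\<^sub>M \<mu>" if "i \<in> V" for i using ind that by (auto simp: P.indep_vars_def)
 have "distr P mu2 (\<lambda>w. (X j w, X k w)) = distr P \<mu> (X j) \<Otimes>\<^sub>M distr P \<mu> (X k)"
  using P.distr_pair_of_indep_var[OF P.indep_var_restrict[OF ind, of "{j}" "{k}"], of "\<lambda>f. f j" \<mu> "\<lambda>f. f k" \<mu>] V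
  by (simp add: measurable_component_singleton)
 then show jk': "distr P mu2 (\<lambda>w. (X j w, X k w)) = mu2" using V law by simp
 have pair_meas: "(\<lambda>f. (f j, f k)) \<in> PiM {j, k} (\<lambda>_. \<mu>) \<rightarrow>\<^sub>M mu2"
  by (intro measurable_Pair measurable_component_singleton) auto
 have "distr P mu3 (\<lambda>w. (X i w, X j w, X k w)) = distr P \<mu> (X i) \<Otimes>\<^sub>M distr P mu2 (\<lambda>w. (X j w, X k w))"
  using P.distr_pair_of_indep_var[OF P.indep_var_restrict[OF ind, of "{i}" "{j, k}"], of "\<lambda>f. f i" \<mu> "\<lambda>f. (f j, f k)" mu2] V
  by (simp add: measurable_component_singleton pair_meas)
 then show "distr P mu3 (\<lambda>w. (X i w, X j w, X k w)) = mu3" using V law jk' by simp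
 show "(\<lambda>w. (X i w, X j w, X k w)) \<in> P \<rightarrow>\<^sub>M mu3" using X V by (intro measurable_Pair) auto
qed

lemma AE_mu2_neq: "AE p in mu2. fst p ~= snd p"
proof -
 have [measurable]: "fst \<in> borel_measurable mu2" "snd \<in> borel_measurable mu2"
  by (auto intro: measurable_compose[OF measurable_fst id_measurable_\<mu>] measurable_compose[OF measurable_snd id_measurable_\<mu>])
 define N where "N = {p \<in> space mu2. fst p = snd p}"
 have N: "N \<in> sets mu2" unfolding N_def by measurable
 have "emeasure mu2 N = (\<integral>\<^sup>+x. emeasure \<mu> (Pair x -` N) \<partial>\<mu>)" using N by (rule mu.emeasure_pair_measure_alt)
 also have "... = (\<integral>\<^sup>+x. 0 \<partial>\<mu>)"
 proof (intro nn_integral_cong)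
  fix x assume "x \<in> space \<mu>"
  then have "Pair x -` N = {x}" by (auto simp: N_def space_pair_measure)
  then show "emeasure \<mu> (Pair x -` N) = 0" using measure_\<mu>_singleton[of x] by (simp add: mu.emeasure_eq_measure)
 qed
 finally have "N \<in> null_sets mu2" using N by auto
 then show ?thesis by (rule AE_I') (auto simp: N_def)
qed

lemma AE_inj_on:
 assumes P: "prob_space P" and ind: "prob_space.indep_vars P (\<lambda>_. \<mu>) X {..<n}"
  and law: "\<And>i. i < n ==> distr P \<mu> (X i) = \<mu>"
 shows "AE w in P. inj_on (\<lambda>i. X i w) {..<n :: nat}"
proof -
 interpret P: prob_space P by (rule P)
 have X: "X i \<in> P \<rightarrow>\<^sub>M \<mu>" if "i < n" for i using ind that by (auto simp: P.indep_vars_def)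
 have "AE w in P. \<forall>p\<in>{p \<in> {..<n} \<times> {..<n}. fst p ~= snd p}. X (fst p) w ~= X (snd p) w"
 proof (rule AE_finite_allI)
  fix p assume p: "p \<in> {p \<in> {..<n} \<times> {..<n}. fst p ~= snd p}"
  define j k where "j = fst p" and "k = snd p"
  have jk: "j < n" "k < n" "j ~= k" using p by (auto simp: j_def k_def)
  have "distr P mu2 (\<lambda>w. (X j w, X k w)) = distr P \<mu> (X j) \<Otimes>\<^sub>M distr P \<mu> (X k)"
   using P.distr_pair_of_indep_var[OF P.indep_var_restrict[OF ind, of "{j}" "{k}"], of "\<lambda>f. f j" \<mu> "\<lambda>f. f k" \<mu>] jk
   by (simp add: measurable_component_singleton)
  then have "distr P mu2 (\<lambda>w. (X j w, X k w)) = mu2" using jk law by simp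
  then have "AE p in distr P mu2 (\<lambda>w. (X j w, X k w)). fst p ~= snd p" using AE_mu2_neq by (simp only:)
  then have "AE w in P. fst (X j w, X k w) ~= snd (X j w, X k w)"
   using X jk by (intro AE_distrD[of "\<lambda>w. (X j w, X k w)" P mu2]) auto
  then show "AE w in P. X (fst p) w ~= X (snd p) w" by (simp add: j_def k_def)
 qed simp
 then show ?thesis by eventually_elim (auto simp: inj_on_def)
qed

text \<open>The indicator of a flat triangle; it dominates the kernels, which have no sign.\<close>

definition near :: "real => 'i set => ('i => real^2) => real" where
 "near e I x = (if inj_on x I \<and> deficit (x ` I) <= e then 1 else 0)"

lemma near_eq_kernel: "near e I x = Re (kernel (\<lambda>d. if d <= e then 0 else 1) I x)"
 by (simp add: near_def kernel_def)

lemma near_measurable: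
 assumes "card I = 3" "I \<subseteq> S"
 shows "near e I \<in> borel_measurable (PiM S (\<lambda>_. \<mu>))"
 unfolding near_eq_kernel[abs_def]
 by (intro measurable_compose[OF kernel_measurable borel_measurable_Re] assms) measurable

text \<open>Given all other points, the vertex \<open>k\<close> of \<open>J\<close> has to fall into the set of \<open>measure_deficit_le\<close>.
 The factor \<open>F\<close> stands for an event that does not involve \<open>k\<close>, for instance that another triangle is
 flat: conditioning allows to multiply the two bounds.\<close>

lemma expectation_near_le:
 assumes P: "prob_space P" and ind: "prob_space.indep_vars P (\<lambda>_. \<mu>) X V"
  and law: "\<And>i. i \<in> V ==> distr P \<mu> (X i) = \<mu>"
  and J: "J \<in> triples_of V" "k \<in> J" and e: "0 <= e"
  and F: "F \<in> borel_measurable (PiM (V - {k}) (\<lambda>_. \<mu>))" "\<And>x. 0 <= F x" "\<And>x. F x <= 1"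
 shows "(\<integral>w. F (restrict (\<lambda>i. X i w) (V - {k})) * near e J (\<lambda>i. X i w) \<partial>P) <=
   C_line * e * (\<integral>w. F (restrict (\<lambda>i. X i w) (V - {k})) \<partial>P)"
proof -
 interpret P: prob_space P by (rule P)
 from J(2,1) obtain i j where ij: "J = {k, i, j}" "k ~= i" "k ~= j" "i ~= j" "k \<in> V" "i \<in> V" "j \<in> V"
  by (rule triples_containing)
 let ?W = "V - {k}"
 let ?PW = "PiM ?W (\<lambda>_. \<mu>)"
 let ?U = "\<lambda>w. restrict (\<lambda>i. X i w) ?W"
 have X: "X i \<in> P \<rightarrow>\<^sub>M \<mu>" if "i \<in> V" for i using ind that by (auto simp: P.indep_vars_def)
 have U: "?U \<in> P \<rightarrow>\<^sub>M ?PW" using X by (intro measurable_restrict) auto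
 have D: "distr P ?PW ?U \<Otimes>\<^sub>M \<mu> = distr P (?PW \<Otimes>\<^sub>M \<mu>) (\<lambda>w. (?U w, X k w))"
  using P.distr_pair_of_indep_var[OF P.indep_var_restrict[OF ind, of ?W "{k}"], of "\<lambda>f. f" ?PW "\<lambda>f. f k" \<mu>] ij law
  by (simp add: measurable_component_singleton)
 define b where "b = (\<lambda>(u :: 'b => real^2, z). if u i ~= u j \<and> z ~= u i \<and> z ~= u j \<and> pi - largest_angle z (u i) (u j) <= e then 1 else 0 :: real)"
 have near: "near e J (\<lambda>i. X i w) = b (?U w, X k w)" for w
  unfolding ij(1) near_eq_kernel kernel_triple[OF ij(2-4)] b_def using ij by (auto split: if_splits)
 have iW: "i \<in> ?W" "j \<in> ?W" using ij by auto
 note [measurable] =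
  measurable_compose[where f=fst and g="\<lambda>x. x i", OF measurable_fst[of ?PW \<mu>] component_measurable_\<mu>[OF iW(1)]]
  measurable_compose[where f=fst and g="\<lambda>x. x j", OF measurable_fst[of ?PW \<mu>] component_measurable_\<mu>[OF iW(2)]]
  measurable_compose[where f=snd and g="\<lambda>x. x", OF measurable_snd[of ?PW \<mu>] id_measurable_\<mu>] F(1)
 have bm [measurable]: "b \<in> borel_measurable (?PW \<Otimes>\<^sub>M \<mu>)" unfolding b_def case_prod_beta' by measurable
 interpret D: prob_space "distr P ?PW ?U" using U by (rule P.prob_space_distr)
 have inner: "(\<integral>\<^sup>+z. ennreal (b (u, z)) \<partial>\<mu>) <= ennreal (C_line * e)" if u: "u \<in> space ?PW" for u
 proof -
  have uK: "u i \<in> K" "u j \<in> K" using u iW by (auto simp: space_PiM)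
  let ?S = "{z \<in> space \<mu>. b (u, z) = 1}"
  have "(\<lambda>z. b (u, z)) \<in> borel_measurable \<mu>" using u by (intro measurable_Pair2[OF bm])
  then have S: "?S \<in> sets \<mu>" by measurable
  have "measure \<mu> ?S <= C_line * (e + 0)"
  proof (cases "u i = u j")
   case True
   then have "?S = {}" by (auto simp: b_def)
   then show ?thesis using e C_line_ge_1 by (simp only: measure_empty) simp
  next
   case False
   show ?thesis
   proof (rule measure_deficit_le[where q="\<lambda>z. z", OF S])
    show "u i ~= u j" by fact
    show "norm (u i) <= rad" "norm (u j) <= rad" using rad(2)[OF uK(1)] rad(2)[OF uK(2)] by auto
    fix z assume "z \<in> ?S"
    then have z: "z ~= u i" "z ~= u j" "pi - largest_angle z (u i) (u j) <= e"
     by (auto simp: b_def split: if_splits)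
    have "deficit {u i, u j, z} = deficit {z, u i, u j}" by (rule arg_cong[where f=deficit]) auto
    then show "z ~= u i \<and> z ~= u j \<and> deficit {u i, u j, z} <= e"
     using z False deficit_eq_largest_angle[of z "u i" "u j"] by auto
   qed (use e in auto)
  qed
  moreover have "(\<integral>\<^sup>+z. ennreal (b (u, z)) \<partial>\<mu>) = (\<integral>\<^sup>+z. indicator ?S z \<partial>\<mu>)"
   by (intro nn_integral_cong) (auto simp: b_def indicator_def)
  moreover have "(\<integral>\<^sup>+z. indicator ?S z \<partial>\<mu>) = ennreal (measure \<mu> ?S)"
   using S by (simp add: mu.emeasure_eq_measure)
  ultimately show ?thesis by (simp add: ennreal_leI)
 qed
 have b01: "0 <= b p" "b p <= 1" for p by (auto simp: b_def split: prod.splits)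
 have FU: "integrable P (\<lambda>w. F (?U w))" using F U by (intro P.integrable_const_bound[where B=1]) auto
 have Fb: "integrable P (\<lambda>w. F (?U w) * b (?U w, X k w))"
 proof (rule P.integrable_const_bound[where B="1 * 1"])
  show "AE w in P. norm (F (?U w) * b (?U w, X k w)) <= 1 * 1"
   using F(2,3) b01 by (intro AE_I2) (auto simp: abs_mult intro!: mult_le_one)
  show "(\<lambda>w. F (?U w) * b (?U w, X k w)) \<in> borel_measurable P"
   using U X[OF ij(5)] F(1) bm by (intro borel_measurable_times measurable_compose[OF U]
     measurable_compose[OF measurable_Pair[OF U X[OF ij(5)]] bm])
 qed
 have "ennreal (\<integral>w. F (?U w) * b (?U w, X k w) \<partial>P) = (\<integral>\<^sup>+w. ennreal (F (?U w) * b (?U w, X k w)) \<partial>P)"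
  using Fb F(2) b01 by (intro nn_integral_eq_integral[symmetric]) auto
 also have "... = (\<integral>\<^sup>+p. ennreal (F (fst p) * b p) \<partial>distr P (?PW \<Otimes>\<^sub>M \<mu>) (\<lambda>w. (?U w, X k w)))"
  using U X[OF ij(5)] by (subst nn_integral_distr) auto
 also have "... = (\<integral>\<^sup>+p. ennreal (F (fst p) * b p) \<partial>(distr P ?PW ?U \<Otimes>\<^sub>M \<mu>))" unfolding D ..
 also have "... = (\<integral>\<^sup>+u. \<integral>\<^sup>+z. ennreal (F u * b (u, z)) \<partial>\<mu> \<partial>distr P ?PW ?U)"
  by (subst mu.nn_integral_fst[symmetric]) (auto cong: measurable_cong_sets)
 also have "... = (\<integral>\<^sup>+u. ennreal (F u) * (\<integral>\<^sup>+z. ennreal (b (u, z)) \<partial>\<mu>) \<partial>distr P ?PW ?U)"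
 proof (intro nn_integral_cong)
  fix u assume "u \<in> space (distr P ?PW ?U)"
  then have "(\<lambda>z. b (u, z)) \<in> borel_measurable \<mu>" by (intro measurable_Pair2[OF bm]) simp
  then show "(\<integral>\<^sup>+z. ennreal (F u * b (u, z)) \<partial>\<mu>) = ennreal (F u) * (\<integral>\<^sup>+z. ennreal (b (u, z)) \<partial>\<mu>)"
   using F(2) b01 by (subst nn_integral_cmult[symmetric]) (auto simp: ennreal_mult)
 qed
 also have "... <= (\<integral>\<^sup>+u. ennreal (F u) * ennreal (C_line * e) \<partial>distr P ?PW ?U)"
  using inner by (intro nn_integral_mono mult_left_mono) auto
 also have "... = (\<integral>\<^sup>+w. ennreal (F (?U w)) \<partial>P) * ennreal (C_line * e)"
  using U by (simp add: nn_integral_multc nn_integral_distr)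
 also have "(\<integral>\<^sup>+w. ennreal (F (?U w)) \<partial>P) = ennreal (\<integral>w. F (?U w) \<partial>P)"
  using FU F(2) by (intro nn_integral_eq_integral) auto
 also have "ennreal (\<integral>w. F (?U w) \<partial>P) * ennreal (C_line * e) = ennreal (C_line * e * (\<integral>w. F (?U w) \<partial>P))"
  using F(2) C_line_ge_1 e by (simp add: ennreal_mult[symmetric] lint_nonneg mult.commute)
 finally have "(\<integral>w. F (?U w) * b (?U w, X k w) \<partial>P) <= C_line * e * (\<integral>w. F (?U w) \<partial>P)"
  using F(2) C_line_ge_1 e by (subst (asm) ennreal_le_iff) (auto intro!: mult_nonneg_nonneg lint_nonneg)
 then show ?thesis by (simp add: near)
qed

end

section \<open>Independent points: product formula\<close>

context lipschitz_density
begin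

lemma norm_kernel_le:
 assumes "\<And>x. e < x ==> g x = 1" "\<And>x. norm (1 - g x) <= c"
 shows "norm (kernel g I x) <= c * near e I x"
proof (cases "inj_on x I \<and> deficit (x ` I) <= e")
 case True
 then show ?thesis using assms(2) by (simp add: kernel_def near_def)
next
 case False
 then have "kernel g I x = 0" using assms(1) by (auto simp: kernel_def not_le)
 moreover have "near e I x = 0" unfolding near_def using False by (rule if_not_P)
 ultimately show ?thesis by simp
qed

lemma expected_defect_eq:
 assumes P: "prob_space P" and ind: "prob_space.indep_vars P (\<lambda>_. \<mu>) X V"
  and law: "\<And>i. i \<in> V ==> distr P \<mu> (X i) = \<mu>" and I: "I \<in> triples_of V"
  and g: "g \<in> borel_measurable borel"
 shows "(\<integral>w. kernel g I (\<lambda>i. X i w) \<partial>P) = expected_defect g"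
proof -
 obtain i j k where ijk: "I = {i, j, k}" "i ~= j" "i ~= k" "j ~= k" "i \<in> V" "j \<in> V" "k \<in> V"
  using I by (rule triples_ofE)
 have D: "(\<lambda>w. (X i w, X j w, X k w)) \<in> P \<rightarrow>\<^sub>M mu3" "distr P mu3 (\<lambda>w. (X i w, X j w, X k w)) = mu3"
  by (rule distr_triple[OF P ind law]; use ijk in simp)+
 have "(\<integral>w. kernel g I (\<lambda>i. X i w) \<partial>P) = (\<integral>w. defect g (X i w, X j w, X k w) \<partial>P)"
  unfolding ijk(1) kernel_triple[OF ijk(2-4)] defect_triple by simp
 also have "... = (\<integral>t. defect g t \<partial>mu3)"
  using defect_measurable[OF g] D(1) by (subst D(2)[symmetric], subst integral_distr) auto
 finally show ?thesis by (simp add: expected_defect_def)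
qed

text \<open>Apply \<open>dissociated_prod_approx\<close> with \<open>D I\<close> the triples that meet \<open>I\<close>. There are at most
 \<open>n^3\<close> triples and \<open>3 n^2\<close> triples that meet a given one. Any \<open>J \<noteq> I\<close> has a vertex outside \<open>I\<close>,
 so each product of expectations and each expectation of a product is at most the square of
 \<open>c * (C_line * e)\<close>, even if \<open>J\<close> shares two vertices with \<open>I\<close>.\<close>

theorem binomial_mfun_bound:
 fixes g :: "real => complex"
 assumes P: "prob_space P" and ind: "prob_space.indep_vars P (\<lambda>_. \<mu>) X {..<n}"
  and law: "\<And>i. i < n ==> distr P \<mu> (X i) = \<mu>"
  and g [measurable]: "g \<in> borel_measurable borel" and g1: "\<And>x. norm (g x) <= 1"
  and ge: "\<And>x. e < x ==> g x = 1" and gc: "\<And>x. norm (1 - g x) <= c" and e: "0 <= e"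
  and meas: "(\<lambda>w. mfun g ((\<lambda>i. X i w) ` {..<n})) \<in> borel_measurable P"
 shows "norm ((\<integral>w. mfun g ((\<lambda>i. X i w) ` {..<n}) \<partial>P) - exp (- (of_nat (n choose 3) * expected_defect g)))
   <= 6 * real n ^ 5 * (c * (C_line * e))\<^sup>2"
proof -
 interpret P: prob_space P by (rule P)
 let ?V = "{..<n}"
 let ?\<I> = "triples_of ?V"
 define h where "h = C_line * e"
 have h: "0 <= h" using C_line_ge_1 e by (simp add: h_def)
 have c: "0 <= c" using gc[of 0] norm_ge_zero order_trans by blast
 define G where "G I w = kernel g I (\<lambda>i. X i w)" for I w
 define D where "D I = {J \<in> ?\<I>. J \<inter> I ~= {}}" for I
 have X: "X i \<in> P \<rightarrow>\<^sub>M \<mu>" if "i < n" for i using ind that by (auto simp: P.indep_vars_def)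
 have fin: "finite ?\<I>" by (rule finite_triples_of) simp
 have card3: "card I = 3" "I \<subseteq> ?V" if "I \<in> ?\<I>" for I using that by (auto simp: triples_of_def)
 have G_restrict: "G I w = kernel g I (restrict (\<lambda>i. X i w) S)" if "I \<subseteq> S" for I S w
  unfolding G_def using that by (intro kernel_cong) auto
 have near_restrict: "near e I (\<lambda>i. X i w) = near e I (restrict (\<lambda>i. X i w) S)" if "I \<subseteq> S" for I S w
  unfolding near_eq_kernel using that by (intro arg_cong[where f=Re] kernel_cong) auto
 have restr: "(\<lambda>w. restrict (\<lambda>i. X i w) S) \<in> P \<rightarrow>\<^sub>M PiM S (\<lambda>_. \<mu>)" if "S \<subseteq> ?V" for S
  using X that by (intro measurable_restrict) auto
 have Gm [measurable]: "G I \<in> borel_measurable P" if "I \<in> ?\<I>" for I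
 proof -
  have "(\<lambda>w. kernel g I (restrict (\<lambda>i. X i w) ?V)) \<in> borel_measurable P"
   using that by (intro measurable_compose[OF restr kernel_measurable] g) (auto simp: card3)
  then show ?thesis using G_restrict[of I ?V] card3[OF that] by (simp add: fun_eq_iff cong: measurable_cong)
 qed
 have nm: "(\<lambda>w. near e I (\<lambda>i. X i w)) \<in> borel_measurable P" if "I \<in> ?\<I>" for I
 proof -
  have "(\<lambda>w. near e I (restrict (\<lambda>i. X i w) ?V)) \<in> borel_measurable P"
   using that by (intro measurable_compose[OF restr near_measurable]) (auto simp: card3)
  then show ?thesis using near_restrict[of I ?V] card3[OF that] by simp
 qed
 have near01: "0 <= near e I x" "near e I x <= 1" for I :: "nat set" and x by (auto simp: near_def)
 have ni: "integrable P (\<lambda>w. near e I (\<lambda>i. X i w))" if "I \<in> ?\<I>" for I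
  using nm[OF that] near01 by (intro P.integrable_const_bound[where B=1]) auto
 have Gle: "norm (G I w) <= c * near e I (\<lambda>i. X i w)" for I w
  unfolding G_def by (rule norm_kernel_le[OF ge gc])
 have le1: "norm (1 - G I w) <= 1" for I w using g1 by (simp add: G_def kernel_def)
 have En: "P.expectation (\<lambda>w. near e I (\<lambda>i. X i w)) <= h" if I: "I \<in> ?\<I>" for I
 proof -
  obtain k where "k \<in> I" using card3[OF I] by fastforce
  then show ?thesis
   using expectation_near_le[OF P ind law I, of k e "\<lambda>_. 1"] e by (simp add: h_def P.prob_space)
 qed
 have Enn: "P.expectation (\<lambda>w. near e I (\<lambda>i. X i w) * near e J (\<lambda>i. X i w)) <= h * h"
  if I: "I \<in> ?\<I>" and J: "J \<in> ?\<I>" and "J ~= I" for I J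
 proof -
  \<comment> \<open>Condition on all points but a vertex of \<open>J\<close> that is not in \<open>I\<close>.\<close>
  have "\<not> J \<subseteq> I" using card3[OF I] card3[OF J] \<open>J ~= I\<close> by (metis card_subset_eq finite_lessThan finite_subset)
  then obtain k where k: "k \<in> J" "k \<notin> I" by blast
  let ?W = "?V - {k}"
  have IW: "I \<subseteq> ?W" using card3[OF I] k by auto
  have "P.expectation (\<lambda>w. near e I (\<lambda>i. X i w) * near e J (\<lambda>i. X i w)) <=
    C_line * e * P.expectation (\<lambda>w. near e I (\<lambda>i. X i w))" unfolding near_restrict[OF IW]
   using near01 card3[OF I] IW near_restrict[OF IW]
   by (intro order_trans[OF _ expectation_near_le[OF P ind law J k(1) e, of "near e I"]] near_measurable)
     (auto simp: near_restrict[OF IW, symmetric])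
  also have "... <= h * h" unfolding h_def[symmetric] using En[OF I] h by (intro mult_left_mono) auto
  finally show ?thesis .
 qed
 have EG: "P.expectation (\<lambda>w. norm (G I w)) <= c * h" if I: "I \<in> ?\<I>" for I
 proof -
  have "P.expectation (\<lambda>w. norm (G I w)) <= P.expectation (\<lambda>w. c * near e I (\<lambda>i. X i w))"
   using ni[OF I] Gle c near01 by (intro integral_mono') auto
  also have "... <= c * h" using En[OF I] c by (simp add: mult_left_mono)
  finally show ?thesis .
 qed
 have EGG: "P.expectation (\<lambda>w. norm (G I w) * norm (G J w)) <= (c * h)\<^sup>2"
  if I: "I \<in> ?\<I>" and J: "J \<in> ?\<I>" and "J ~= I" for I J
 proof -
  have int: "integrable P (\<lambda>w. c\<^sup>2 * (near e I (\<lambda>i. X i w) * near e J (\<lambda>i. X i w)))"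
   using nm[OF I] nm[OF J] near01
   by (intro integrable_mult_right P.integrable_const_bound[where B=1]) (auto intro!: mult_le_one simp: abs_mult)
  have "P.expectation (\<lambda>w. norm (G I w) * norm (G J w)) <=
    P.expectation (\<lambda>w. c\<^sup>2 * (near e I (\<lambda>i. X i w) * near e J (\<lambda>i. X i w)))"
  proof (rule integral_mono'[OF int])
   fix w assume "w \<in> space P"
   have "norm (G I w) * norm (G J w) <= (c * near e I (\<lambda>i. X i w)) * (c * near e J (\<lambda>i. X i w))"
    using Gle c near01 by (intro mult_mono) auto
   then show "norm (G I w) * norm (G J w) <= c\<^sup>2 * (near e I (\<lambda>i. X i w) * near e J (\<lambda>i. X i w))"
    by (simp add: power2_eq_square algebra_simps)
  qed (use c near01 in auto)
  also have "... <= c\<^sup>2 * (h * h)" using Enn[OF I J \<open>J ~= I\<close>] by (simp add: mult_left_mono)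
  finally show ?thesis by (simp add: power2_eq_square algebra_simps)
 qed
 have main: "norm (P.expectation (\<lambda>w. \<Prod>I\<in>?\<I>. 1 - G I w) - exp (- (\<Sum>I\<in>?\<I>. P.expectation (G I)))) <=
  (\<Sum>I\<in>?\<I>. (\<Sum>J\<in>D I. P.expectation (\<lambda>w. norm (G I w)) * P.expectation (\<lambda>w. norm (G J w))) +
    (\<Sum>J\<in>D I - {I}. P.expectation (\<lambda>w. norm (G I w) * norm (G J w))))"
 proof (rule P.dissociated_prod_approx[OF fin Gm le1])
  show "I \<in> D I" if "I \<in> ?\<I>" for I using that card3[OF that] by (auto simp: D_def)
  show "D I \<subseteq> ?\<I>" for I by (auto simp: D_def)
  fix I s assume I: "I \<in> ?\<I>" and s: "0 <= s" "s <= (1::real)"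
  let ?Q = "?\<I> - D I"
  have Q: "J \<subseteq> ?V - I" "card J = 3" "J \<in> ?\<I>" if "J \<in> ?Q" for J using that by (auto simp: D_def triples_of_def)
  define H where "H x = (\<Prod>J\<in>?Q. 1 - of_real s * kernel g J x)" for x
  have Hm: "H \<in> borel_measurable (PiM (?V - I) (\<lambda>_. \<mu>))" unfolding H_def using Q
   by (intro borel_measurable_prod borel_measurable_diff borel_measurable_times borel_measurable_const kernel_measurable g) auto
  have "P.indep_var borel (kernel g I \<circ> (\<lambda>w. restrict (\<lambda>i. X i w) I)) borel (H \<circ> (\<lambda>w. restrict (\<lambda>i. X i w) (?V - I)))"
   using card3[OF I] by (intro P.indep_var_compose[OF P.indep_var_restrict[OF ind]] kernel_measurable g Hm) auto
  moreover have "kernel g I \<circ> (\<lambda>w. restrict (\<lambda>i. X i w) I) = G I"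
   by (simp add: fun_eq_iff G_restrict[OF order_refl])
  moreover have "H \<circ> (\<lambda>w. restrict (\<lambda>i. X i w) (?V - I)) = (\<lambda>w. \<Prod>J\<in>?Q. 1 - of_real s * G J w)"
  proof (rule ext)
   fix w
   have "kernel g J (restrict (\<lambda>i. X i w) (?V - I)) = G J w" if "J \<in> ?Q" for J
    using G_restrict[OF Q(1)[OF that], of w] by simp
   then show "(H \<circ> (\<lambda>w. restrict (\<lambda>i. X i w) (?V - I))) w = (\<Prod>J\<in>?Q. 1 - of_real s * G J w)"
    unfolding H_def comp_def by (intro prod.cong refl) simp
  qed
  ultimately have iv: "P.indep_var borel (G I) borel (\<lambda>w. \<Prod>J\<in>?Q. 1 - of_real s * G J w)" by simp
  show "P.expectation (\<lambda>w. G I w * (\<Prod>J\<in>?Q. 1 - of_real s * G J w)) =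
   P.expectation (G I) * P.expectation (\<lambda>w. \<Prod>J\<in>?Q. 1 - of_real s * G J w)"
  proof (rule P.indep_var_lebesgue_integral[OF iv])
   have "norm (G I w) <= 2" for w using le1[of I w] norm_triangle_ineq4[of 1 "1 - G I w"] by simp
   then show "integrable P (G I)" using I by (intro P.integrable_const_bound[where B=2]) auto
   have "norm (\<Prod>J\<in>?Q. 1 - of_real s * G J w) <= 1" for w
    unfolding prod_norm[symmetric] by (intro prod_le_1) (auto intro!: norm_one_minus_scaleR_le_1 le1 s)
   then show "integrable P (\<lambda>w. \<Prod>J\<in>?Q. 1 - of_real s * G J w)"
    using Q(3) by (intro P.integrable_const_bound[where B=1]) auto
  qed
 qed
 have cD: "real (card (D I)) <= 3 * real n ^ 2" if "I \<in> ?\<I>" for I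
 proof -
  have "card (D I) <= 3 * n ^ 2" using card_overlapping_triples[OF _ that] by (simp add: D_def)
  then have "real (card (D I)) <= real (3 * n ^ 2)" by (simp only: of_nat_le_iff)
  then show ?thesis by simp
 qed
 have fD: "finite (D I)" for I using fin by (auto simp: D_def)
 have cI: "real (card ?\<I>) <= real n ^ 3"
 proof -
  have "real (card ?\<I>) <= real (n ^ 3)" using card_triples_of_le[of ?V] by (simp only: of_nat_le_iff) simp
  then show ?thesis by simp
 qed
 have "(\<Sum>I\<in>?\<I>. (\<Sum>J\<in>D I. P.expectation (\<lambda>w. norm (G I w)) * P.expectation (\<lambda>w. norm (G J w))) +
    (\<Sum>J\<in>D I - {I}. P.expectation (\<lambda>w. norm (G I w) * norm (G J w)))) <=
  (\<Sum>I\<in>?\<I>. (\<Sum>J\<in>D I. (c * h)\<^sup>2) + (\<Sum>J\<in>D I. (c * h)\<^sup>2))"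
 proof (intro sum_mono add_mono)
  fix I J assume I: "I \<in> ?\<I>" and J: "J \<in> D I"
  then have "J \<in> ?\<I>" by (simp add: D_def)
  then show "P.expectation (\<lambda>w. norm (G I w)) * P.expectation (\<lambda>w. norm (G J w)) <= (c * h)\<^sup>2"
   unfolding power2_eq_square using EG[OF I] EG c h by (intro mult_mono) auto
 next
  fix I assume I: "I \<in> ?\<I>"
  have "(\<Sum>J\<in>D I - {I}. P.expectation (\<lambda>w. norm (G I w) * norm (G J w))) <= (\<Sum>J\<in>D I - {I}. (c * h)\<^sup>2)"
   using I by (intro sum_mono EGG) (auto simp: D_def)
  also have "... <= (\<Sum>J\<in>D I. (c * h)\<^sup>2)" using fD by (intro sum_mono2) auto
  finally show "(\<Sum>J\<in>D I - {I}. P.expectation (\<lambda>w. norm (G I w) * norm (G J w))) <= (\<Sum>J\<in>D I. (c * h)\<^sup>2)" .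
 qed
 also have "... <= (\<Sum>I\<in>?\<I>. 6 * real n ^ 2 * (c * h)\<^sup>2)"
 proof (rule sum_mono)
  fix I assume "I \<in> ?\<I>"
  then have "real (card (D I)) * (c * h)\<^sup>2 <= 3 * real n ^ 2 * (c * h)\<^sup>2" by (intro mult_right_mono cD) auto
  then show "(\<Sum>J\<in>D I. (c * h)\<^sup>2) + (\<Sum>J\<in>D I. (c * h)\<^sup>2) <= 6 * real n ^ 2 * (c * h)\<^sup>2" by simp
 qed
 also have "... = real (card ?\<I>) * (6 * real n ^ 2 * (c * h)\<^sup>2)" by simp
 also have "... <= real n ^ 3 * (6 * real n ^ 2 * (c * h)\<^sup>2)" using cI by (intro mult_right_mono) auto
 also have "... = 6 * real n ^ 5 * (c * h)\<^sup>2" by (simp add: power_add[symmetric] algebra_simps flip: power_add)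
 finally have bound: "norm (P.expectation (\<lambda>w. \<Prod>I\<in>?\<I>. 1 - G I w) - exp (- (\<Sum>I\<in>?\<I>. P.expectation (G I)))) <=
   6 * real n ^ 5 * (c * h)\<^sup>2" using main by simp
 have "(\<Sum>I\<in>?\<I>. P.expectation (G I)) = (\<Sum>I\<in>?\<I>. expected_defect g)"
  unfolding G_def by (intro sum.cong refl expected_defect_eq[OF P ind law _ g]) auto
 also have "... = of_nat (n choose 3) * expected_defect g" by (simp add: card_triples_of)
 finally have lam: "(\<Sum>I\<in>?\<I>. P.expectation (G I)) = of_nat (n choose 3) * expected_defect g" .
 have "P.expectation (\<lambda>w. mfun g ((\<lambda>i. X i w) ` ?V)) = P.expectation (\<lambda>w. \<Prod>I\<in>?\<I>. 1 - G I w)"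
 proof (rule integral_cong_AE)
  show "(\<lambda>w. \<Prod>I\<in>?\<I>. 1 - G I w) \<in> borel_measurable P" by (intro borel_measurable_prod) auto
  show "AE w in P. mfun g ((\<lambda>i. X i w) ` ?V) = (\<Prod>I\<in>?\<I>. 1 - G I w)"
  proof -
   have "AE w in P. inj_on (\<lambda>i. X i w) ?V" by (rule AE_inj_on[OF P ind law])
   then show ?thesis by eventually_elim (simp add: mfun_eq_kernel G_def)
  qed
 qed fact
 then show ?thesis using bound by (simp add: lam h_def)
qed

end

section \<open>Weighted sums over overlapping triples\<close>

lemma sum_le_sum_image:
 fixes f :: "'a => real"
 assumes "finite S" "A \<subseteq> h ` S" "\<And>x. x \<in> h ` S ==> 0 <= f x"
 shows "(\<Sum>x\<in>A. f x) <= (\<Sum>s\<in>S. f (h s))"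
proof -
 have "(\<Sum>x\<in>A. f x) <= (\<Sum>x\<in>h ` S. f x)" using assms by (intro sum_mono2) auto
 also have "... <= (\<Sum>s\<in>S. f (h s))" using sum_image_le[OF assms(1), of f h] assms(3) by simp
 finally show ?thesis .
qed

text \<open>Elements \<open>c\<close> are cells, \<open>p c\<close> is the probability that the cell is occupied, and \<open>b I\<close>
 marks flat triples. The constant \<open>H\<close> bounds the mean number of occupied cells that complete a given
 pair to a flat triple.\<close>

locale weighted_triples =
 fixes C :: "'v set" and p :: "'v => real" and b :: "'v set => real" and H t :: real
 assumes fin: "finite C" and p: "\<And>c. c \<in> C ==> 0 <= p c" "\<And>c. c \<in> C ==> p c <= 1"
  and b: "\<And>I. 0 <= b I" and total: "(\<Sum>c\<in>C. p c) <= t" and t: "1 <= t"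
  and H: "\<And>u v. u \<in> C ==> v \<in> C ==> u ~= v ==> (\<Sum>k\<in>C - {u, v}. p k * b {u, v, k}) <= H" "0 <= H"
begin

definition q :: "'v set => real" where "q S = (\<Prod>c\<in>S. p c)"

lemma q_nonneg: "S \<subseteq> C ==> 0 <= q S" unfolding q_def using p by (intro prod_nonneg) auto

text \<open>Choose the second element freely, with total weight \<open>t\<close>, and the third one to complete the pair, with weight \<open>H\<close>.\<close>

lemma sum_at_vertex:
 assumes v: "v \<in> C"
 shows "(\<Sum>J\<in>{J \<in> triples_of C. v \<in> J}. q (J - {v}) * b J) <= t * H"
proof -
 let ?S = "Sigma (C - {v}) (\<lambda>j. C - {v, j})"
 have sub: "{J \<in> triples_of C. v \<in> J} \<subseteq> (\<lambda>(j, k). {v, j, k}) ` ?S"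
 proof
  fix J assume "J \<in> {J \<in> triples_of C. v \<in> J}"
  then have "v \<in> J" "J \<in> triples_of C" by auto
  then obtain j k where "J = {v, j, k}" "v ~= j" "v ~= k" "j ~= k" "j \<in> C" "k \<in> C" by (rule triples_containing)
  then show "J \<in> (\<lambda>(j, k). {v, j, k}) ` ?S" by (intro image_eqI[of _ _ "(j, k)"]) auto
 qed
 have "(\<Sum>J\<in>{J \<in> triples_of C. v \<in> J}. q (J - {v}) * b J) <=
   (\<Sum>s\<in>?S. q ((case s of (j, k) => {v, j, k}) - {v}) * b (case s of (j, k) => {v, j, k}))"
  using fin v by (intro sum_le_sum_image[OF _ sub]) (auto intro!: mult_nonneg_nonneg q_nonneg b)
 also have "... = (\<Sum>(j, k)\<in>?S. p j * (p k * b {v, j, k}))"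
 proof (rule sum.cong[OF refl])
  fix s assume "s \<in> ?S"
  then obtain j k where s: "s = (j, k)" "j ~= v" "k ~= v" "k ~= j" by auto
  then have "{v, j, k} - {v} = {j, k}" "j ~= k" by auto
  then show "q ((case s of (j, k) => {v, j, k}) - {v}) * b (case s of (j, k) => {v, j, k}) = (case s of (j, k) => p j * (p k * b {v, j, k}))"
   by (simp add: q_def s(1))
 qed
 also have "... = (\<Sum>j\<in>C - {v}. \<Sum>k\<in>C - {v, j}. p j * (p k * b {v, j, k}))" using fin by (subst sum.Sigma) auto
 also have "... = (\<Sum>j\<in>C - {v}. p j * (\<Sum>k\<in>C - {v, j}. p k * b {v, j, k}))" by (simp add: sum_distrib_left)
 also have "... <= (\<Sum>j\<in>C - {v}. p j * H)" using p v H by (intro sum_mono mult_left_mono) auto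
 also have "... = (\<Sum>j\<in>C - {v}. p j) * H" by (simp add: sum_distrib_right)
 also have "... <= t * H"
 proof (rule mult_right_mono[OF _ H(2)])
  have "(\<Sum>j\<in>C - {v}. p j) <= (\<Sum>j\<in>C. p j)" using fin p by (intro sum_mono2) auto
  then show "(\<Sum>j\<in>C - {v}. p j) <= t" using total by simp
 qed
 finally show ?thesis .
qed

lemma sum_vertex_weight:
 assumes v: "v \<in> C"
 shows "(\<Sum>J\<in>{J \<in> triples_of C. v \<in> J}. q J * b J) <= p v * (t * H)"
proof -
 have "q J = p v * q (J - {v})" if "J \<in> triples_of C" "v \<in> J" for J
  unfolding q_def using that fin by (subst prod.remove[of J v]) (auto simp: triples_of_def intro: finite_subset)
 then have "(\<Sum>J\<in>{J \<in> triples_of C. v \<in> J}. q J * b J) = p v * (\<Sum>J\<in>{J \<in> triples_of C. v \<in> J}. q (J - {v}) * b J)"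
  by (simp add: sum_distrib_left mult.assoc)
 also have "... <= p v * (t * H)" using p v sum_at_vertex by (intro mult_left_mono) auto
 finally show ?thesis .
qed

lemma sum_meeting_weight:
 assumes S: "S \<subseteq> C"
 shows "(\<Sum>J\<in>{J \<in> triples_of C. J \<inter> S ~= {}}. q J * b J) <= (\<Sum>v\<in>S. p v) * (t * H)"
proof -
 have fS: "finite S" using S fin finite_subset by blast
 have fT: "finite (triples_of C)" using fin by (rule finite_triples_of)
 have "(\<Sum>J\<in>{J \<in> triples_of C. J \<inter> S ~= {}}. q J * b J) <= (\<Sum>s\<in>Sigma S (\<lambda>v. {J \<in> triples_of C. v \<in> J}). q (snd s) * b (snd s))"
 proof (rule sum_le_sum_image)
  show "finite (Sigma S (\<lambda>v. {J \<in> triples_of C. v \<in> J}))" using fS fT by auto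
  show "{J \<in> triples_of C. J \<inter> S ~= {}} \<subseteq> snd ` Sigma S (\<lambda>v. {J \<in> triples_of C. v \<in> J})"
   by (force simp: image_iff)
  fix J assume "J \<in> snd ` Sigma S (\<lambda>v. {J \<in> triples_of C. v \<in> J})"
  then have "J \<subseteq> C" by (auto simp: triples_of_def)
  then show "0 <= q J * b J" by (intro mult_nonneg_nonneg q_nonneg b)
 qed
 also have "... = (\<Sum>v\<in>S. \<Sum>J\<in>{J \<in> triples_of C. v \<in> J}. q J * b J)"
  using fS fT by (subst sum.Sigma) (auto simp: case_prod_beta')
 also have "... <= (\<Sum>v\<in>S. p v * (t * H))" using S by (intro sum_mono sum_vertex_weight) auto
 finally show ?thesis by (simp add: sum_distrib_right)
qed

lemma sum_all_weight: "(\<Sum>J\<in>triples_of C. q J * b J) <= t * (t * H)"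
proof -
 have "J \<inter> C ~= {}" if "J \<in> triples_of C" for J using that by (elim triples_ofE) auto
 then have "{J \<in> triples_of C. J \<inter> C ~= {}} = triples_of C" by auto
 then have "(\<Sum>J\<in>triples_of C. q J * b J) <= (\<Sum>v\<in>C. p v) * (t * H)" using sum_meeting_weight[of C] by simp
 also have "... <= t * (t * H)" using total t H by (intro mult_right_mono) auto
 finally show ?thesis .
qed

text \<open>Given that the cells of \<open>I\<close> are occupied, a triple \<open>J\<close> that meets \<open>I\<close> only pays for its remaining
 cells. One common element leaves \<open>3\<close> choices and weight \<open>t * H\<close>, two common elements leave \<open>6\<close> ordered
 choices and weight \<open>H \<le> t * H\<close>.\<close>

lemma sum_overlap_excess:
 assumes I: "I \<in> triples_of C"
 shows "(\<Sum>J\<in>{J \<in> triples_of C. J \<inter> I ~= {}} - {I}. q (J - I) * b J) <= 9 * (t * H)"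
proof -
 have I3: "card I = 3" "I \<subseteq> C" using I by (auto simp: triples_of_def)
 have fI: "finite I" using I3(2) fin finite_subset by blast
 have fT: "finite (triples_of C)" using fin by (rule finite_triples_of)
 let ?A = "{J \<in> triples_of C. J \<inter> I ~= {}} - {I}"
 let ?A1 = "{J \<in> ?A. card (J \<inter> I) = 1}" and ?A2 = "{J \<in> ?A. card (J \<inter> I) ~= 1}"
 let ?T1 = "Sigma I (\<lambda>v. {J \<in> triples_of C. v \<in> J})"
 let ?T2 = "Sigma {w \<in> I \<times> I. fst w ~= snd w} (\<lambda>w. C - {fst w, snd w})"
 have 1: "(\<Sum>J\<in>?A1. q (J - I) * b J) <= 3 * (t * H)"
 proof -
  have eq: "q (J - I) * b J <= (\<Sum>v\<in>I. if v \<in> J then q (J - {v}) * b J else 0)" if J: "J \<in> ?A1" for J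
  proof -
   obtain v where v: "J \<inter> I = {v}" using J by (auto simp: card_1_singleton_iff)
   then have "J - I = J - {v}" "v \<in> I" "v \<in> J" by auto
   have "0 <= (if w \<in> J then q (J - {w}) * b J else 0)" for w
    using J by (auto simp: triples_of_def intro!: mult_nonneg_nonneg q_nonneg b)
   then have "(if v \<in> J then q (J - {v}) * b J else 0) <= (\<Sum>v\<in>I. if v \<in> J then q (J - {v}) * b J else 0)"
    using fI \<open>v \<in> I\<close> by (intro member_le_sum) auto
   then show ?thesis using \<open>J - I = J - {v}\<close> \<open>v \<in> J\<close> by simp
  qed
  have "(\<Sum>J\<in>?A1. q (J - I) * b J) <= (\<Sum>J\<in>?A1. \<Sum>v\<in>I. if v \<in> J then q (J - {v}) * b J else 0)"
   by (intro sum_mono eq)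
  also have "... <= (\<Sum>J\<in>triples_of C. \<Sum>v\<in>I. if v \<in> J then q (J - {v}) * b J else 0)"
   using fT by (intro sum_mono2 sum_nonneg) (auto simp: triples_of_def intro!: mult_nonneg_nonneg q_nonneg b)
  also have "... = (\<Sum>v\<in>I. \<Sum>J\<in>triples_of C. if v \<in> J then q (J - {v}) * b J else 0)" by (rule sum.swap)
  also have "... = (\<Sum>v\<in>I. \<Sum>J\<in>{J \<in> triples_of C. v \<in> J}. q (J - {v}) * b J)"
   using fT by (intro sum.cong refl sum.inter_filter[symmetric])
  also have "... <= (\<Sum>v\<in>I. t * H)" using I3(2) by (intro sum_mono sum_at_vertex) auto
  finally show ?thesis using I3(1) by simp
 qed
 have 2: "(\<Sum>J\<in>?A2. q (J - I) * b J) <= 6 * (t * H)"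
 proof -
  have sub: "?A2 \<subseteq> (\<lambda>(w, k). {fst w, snd w, k}) ` (Sigma {w \<in> I \<times> I. fst w ~= snd w} (\<lambda>w. C - I))"
  proof
   fix J assume J: "J \<in> ?A2"
   have J3: "card J = 3" "J \<subseteq> C" "J ~= I" using J by (auto simp: triples_of_def)
   have fJ: "finite J" using J3(2) fin finite_subset by blast
   have "\<not> J \<subseteq> I" using J3 I3 fI card_subset_eq by metis
   then obtain k where k: "k \<in> J" "k \<notin> I" by auto
   from J3(1) k(1) have "J \<in> triples_of J" by (simp add: triples_of_def)
   then obtain u v where uv: "J = {k, u, v}" "k ~= u" "k ~= v" "u ~= v" "u \<in> J" "v \<in> J"
    using k(1) triples_containing[of k J J] by metis
   have "u \<in> I \<and> v \<in> I"
   proof (rule ccontr)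
    assume "\<not> (u \<in> I \<and> v \<in> I)"
    then have "J \<inter> I \<subseteq> {u} \<or> J \<inter> I \<subseteq> {v}" using uv(1) k by auto
    then have "card (J \<inter> I) <= 1" using card_mono[of "{u}" "J \<inter> I"] card_mono[of "{v}" "J \<inter> I"] by auto
    moreover have "card (J \<inter> I) ~= 0" using J fI by auto
    ultimately show False using J by auto
   qed
   then show "J \<in> (\<lambda>(w, k). {fst w, snd w, k}) ` (Sigma {w \<in> I \<times> I. fst w ~= snd w} (\<lambda>w. C - I))"
    using uv k J3(2) by (intro image_eqI[of _ _ "((u, v), k)"]) auto
  qed
  have fin2: "finite {w \<in> I \<times> I. fst w ~= snd w}" using fI by simp
  have "(\<Sum>J\<in>?A2. q (J - I) * b J) <= (\<Sum>s\<in>Sigma {w \<in> I \<times> I. fst w ~= snd w} (\<lambda>w. C - I).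
    q ((case s of (w, k) => {fst w, snd w, k}) - I) * b (case s of (w, k) => {fst w, snd w, k}))"
  proof (rule sum_le_sum_image[OF _ sub])
   show "finite (Sigma {w \<in> I \<times> I. fst w ~= snd w} (\<lambda>w. C - I))" using fin2 fin by auto
   fix J assume "J \<in> (\<lambda>(w, k). {fst w, snd w, k}) ` (Sigma {w \<in> I \<times> I. fst w ~= snd w} (\<lambda>w. C - I))"
   then have "J \<subseteq> C" using I3 by auto
   then show "0 <= q (J - I) * b J" by (intro mult_nonneg_nonneg q_nonneg b) auto
  qed
  also have "... = (\<Sum>(w, k)\<in>Sigma {w \<in> I \<times> I. fst w ~= snd w} (\<lambda>w. C - I). p k * b {fst w, snd w, k})"
  proof (rule sum.cong[OF refl])
   fix s assume "s \<in> Sigma {w \<in> I \<times> I. fst w ~= snd w} (\<lambda>w. C - I)"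
   then obtain u v k where s: "s = ((u, v), k)" "u \<in> I" "v \<in> I" "k \<notin> I" by auto
   then have "{u, v, k} - I = {k}" by auto
   then show "q ((case s of (w, k) => {fst w, snd w, k}) - I) * b (case s of (w, k) => {fst w, snd w, k}) =
     (case s of (w, k) => p k * b {fst w, snd w, k})" by (simp add: q_def s(1))
  qed
  also have "... = (\<Sum>w\<in>{w \<in> I \<times> I. fst w ~= snd w}. \<Sum>k\<in>C - I. p k * b {fst w, snd w, k})"
   using fin2 fin by (subst sum.Sigma) auto
  also have "... <= (\<Sum>w\<in>{w \<in> I \<times> I. fst w ~= snd w}. H)"
  proof (rule sum_mono)
   fix w assume w: "w \<in> {w \<in> I \<times> I. fst w ~= snd w}"
   have "(\<Sum>k\<in>C - I. p k * b {fst w, snd w, k}) <= (\<Sum>k\<in>C - {fst w, snd w}. p k * b {fst w, snd w, k})"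
    using w fin p b by (intro sum_mono2) auto
   also have "... <= H" using w I3 by (intro H) auto
   finally show "(\<Sum>k\<in>C - I. p k * b {fst w, snd w, k}) <= H" .
  qed
  also have "... = real (card {w \<in> I \<times> I. fst w ~= snd w}) * H" by simp
  also have "card {w \<in> I \<times> I. fst w ~= snd w} = 6"
  proof -
   have "{w \<in> I \<times> I. fst w ~= snd w} = I \<times> I - (\<lambda>x. (x, x)) ` I" by auto
   moreover have "card (I \<times> I - (\<lambda>x. (x, x)) ` I) = card (I \<times> I) - card ((\<lambda>x. (x, x)) ` I)"
    using fI by (intro card_Diff_subset) auto
   moreover have "card ((\<lambda>x. (x, x)) ` I) = 3" using I3 by (subst card_image) (auto simp: inj_on_def)
   ultimately show ?thesis using I3 by (simp add: card_cartesian_product)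
  qed
  also have "real 6 * H <= 6 * (t * H)" using t H mult_right_mono[of 1 t H] by simp
  finally show ?thesis .
 qed
 have "(\<Sum>J\<in>?A. q (J - I) * b J) = (\<Sum>J\<in>?A1. q (J - I) * b J) + (\<Sum>J\<in>?A2. q (J - I) * b J)"
  using fT by (subst sum.union_disjoint[symmetric]) (auto intro!: sum.cong)
 then show ?thesis using 1 2 by simp
qed

lemma overlap_total:
 "(\<Sum>I\<in>triples_of C. (\<Sum>J\<in>{J \<in> triples_of C. J \<inter> I ~= {}}. (q I * b I) * (q J * b J)) +
   (\<Sum>J\<in>{J \<in> triples_of C. J \<inter> I ~= {}} - {I}. q (I \<union> J) * (b I * b J))) <= 12 * t ^ 3 * H\<^sup>2"
proof -
 have fT: "finite (triples_of C)" using fin by (rule finite_triples_of)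
 have tH: "0 <= t * H" using t H by simp
 have "(\<Sum>I\<in>triples_of C. (\<Sum>J\<in>{J \<in> triples_of C. J \<inter> I ~= {}}. (q I * b I) * (q J * b J)) +
   (\<Sum>J\<in>{J \<in> triples_of C. J \<inter> I ~= {}} - {I}. q (I \<union> J) * (b I * b J))) <=
  (\<Sum>I\<in>triples_of C. (q I * b I) * (12 * (t * H)))"
 proof (rule sum_mono)
  fix I assume I: "I \<in> triples_of C"
  have I3: "card I = 3" "I \<subseteq> C" using I by (auto simp: triples_of_def)
  have fI: "finite I" using I3(2) fin finite_subset by blast
  have qb: "0 <= q I * b I" using I3 by (intro mult_nonneg_nonneg q_nonneg b)
  have "(\<Sum>J\<in>{J \<in> triples_of C. J \<inter> I ~= {}}. q J * b J) <= (\<Sum>v\<in>I. p v) * (t * H)"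
   using I3(2) by (rule sum_meeting_weight)
  also have "... <= (\<Sum>v\<in>I. 1) * (t * H)" using I3 p tH by (intro mult_right_mono sum_mono) auto
  finally have A: "(\<Sum>J\<in>{J \<in> triples_of C. J \<inter> I ~= {}}. q J * b J) <= 3 * (t * H)" using I3 by simp
  have un: "q (I \<union> J) = q I * q (J - I)" if "J \<in> triples_of C" for J
  proof -
   have "finite J" using that fin by (auto simp: triples_of_def intro: finite_subset)
   then have "q (I \<union> (J - I)) = q I * q (J - I)" unfolding q_def using fI by (intro prod.union_disjoint) auto
   then show ?thesis by simp
  qed
  have "(\<Sum>J\<in>{J \<in> triples_of C. J \<inter> I ~= {}}. (q I * b I) * (q J * b J)) +
   (\<Sum>J\<in>{J \<in> triples_of C. J \<inter> I ~= {}} - {I}. q (I \<union> J) * (b I * b J)) =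
   (q I * b I) * ((\<Sum>J\<in>{J \<in> triples_of C. J \<inter> I ~= {}}. q J * b J) + (\<Sum>J\<in>{J \<in> triples_of C. J \<inter> I ~= {}} - {I}. q (J - I) * b J))"
   by (simp add: distrib_left sum_distrib_left un mult.assoc mult.left_commute)
  also have "... <= (q I * b I) * (3 * (t * H) + 9 * (t * H))"
   using A sum_overlap_excess[OF I] qb by (intro mult_left_mono add_mono)
  also have "... = (q I * b I) * (12 * (t * H))" by simp
  finally show "(\<Sum>J\<in>{J \<in> triples_of C. J \<inter> I ~= {}}. (q I * b I) * (q J * b J)) +
   (\<Sum>J\<in>{J \<in> triples_of C. J \<inter> I ~= {}} - {I}. q (I \<union> J) * (b I * b J)) <= (q I * b I) * (12 * (t * H))" .
 qed
 also have "... = (\<Sum>I\<in>triples_of C. q I * b I) * (12 * (t * H))" by (simp add: sum_distrib_right)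
 also have "... <= (t * (t * H)) * (12 * (t * H))" using sum_all_weight tH by (intro mult_right_mono) auto
 also have "... = 12 * t ^ 3 * H\<^sup>2" by (simp add: power2_eq_square power3_eq_cube algebra_simps)
 finally show ?thesis .
qed

end

context lipschitz_density
begin

lemma rnd_cell_sets: "rnd m -` {c} \<inter> K \<in> sets \<mu>"
 using measurable_sets[OF rnd_measurable, of "{c}" m] by (simp add: sets_\<mu>_iff)

text \<open>Choose a subset \<open>S\<close> of \<open>B\<close> of least positive measure. Each measurable set contains either almost
 all or almost nothing of \<open>S\<close>, since measures are integers. Hence for every mesh size exactly one
 dyadic cell carries \<open>S\<close>, and these cells shrink to a single point, which is an atom.\<close>

lemma integer_measure_atoms:
 assumes sN: "sets N = sets \<mu>" and nat: "\<And>B. B \<in> sets N ==> emeasure N B \<in> \<nat>"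
 shows "finite (points N)" "points N \<subseteq> K"
  "\<And>B. B \<in> sets borel ==> emeasure N (B \<inter> K) ~= 0 \<longleftrightarrow> points N \<inter> B ~= {}"
proof -
 have spN: "space N = K" using sets_eq_imp_space_eq[OF sN] by simp
 then show sub: "points N \<subseteq> K" by (auto simp: points_def)
 have sing: "{x} \<in> sets N" if "x \<in> K" for x using that unfolding sN by (simp add: sets_\<mu>_iff)
 have fin: "emeasure N B < \<infinity>" if B: "B \<in> sets N" for B
 proof -
  obtain n where "emeasure N B = of_nat n" using nat[OF B] by (auto elim: Nats_cases)
  then show ?thesis by (simp add: of_nat_less_top)
 qed
 have ge1: "1 <= emeasure N {x}" if x: "x \<in> points N" for x
 proof -
  have "x \<in> K" using x sub by auto
  obtain n where n: "emeasure N {x} = of_nat n" using nat[OF sing[OF \<open>x \<in> K\<close>]] by (auto elim: Nats_cases)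
  then have "n ~= 0" using x by (auto simp: points_def)
  then show ?thesis unfolding n by (metis One_nat_def Suc_leI neq0_conv of_nat_1 of_nat_le_iff)
 qed
 show finite_points: "finite (points N)"
 proof (rule ccontr)
  assume inf: "infinite (points N)"
  have "K \<in> sets N" using spN by (metis sets.top)
  then obtain n where n: "emeasure N K = of_nat n" using nat by (auto elim: Nats_cases)
  obtain F where F: "F \<subseteq> points N" "finite F" "card F = Suc n" using inf infinite_arbitrarily_large by metis
  have "of_nat (card F) = (\<Sum>x\<in>F. (1 :: ennreal))" by simp
  also have "... <= (\<Sum>x\<in>F. emeasure N {x})" using F ge1 by (intro sum_mono) auto
  also have "... = emeasure N F" using F sub sing by (intro emeasure_eq_sum_singleton[symmetric]) auto
  also have "... <= emeasure N K" using F sub \<open>K \<in> sets N\<close> by (intro emeasure_mono) auto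
  finally have "(of_nat (Suc n) :: ennreal) <= of_nat n" unfolding F(3) n .
  then show False by (simp only: of_nat_le_iff)
 qed
 fix B :: "(real^2) set" assume B: "B \<in> sets borel"
 then have BK: "B \<inter> K \<in> sets N" unfolding sN by (simp add: sets_\<mu>_iff)
 show "emeasure N (B \<inter> K) ~= 0 \<longleftrightarrow> points N \<inter> B ~= {}"
 proof
  assume "points N \<inter> B ~= {}"
  then obtain x where x: "x \<in> points N" "x \<in> B" by auto
  then have "emeasure N {x} <= emeasure N (B \<inter> K)" using BK sub by (intro emeasure_mono) auto
  then show "emeasure N (B \<inter> K) ~= 0" using x by (auto simp: points_def)
 next
  assume pos: "emeasure N (B \<inter> K) ~= 0"
  \<comment> \<open>\<open>Pr k\<close>: some subset of \<open>B\<close> has positive measure \<open>k\<close>.\<close>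
  define Pr where "Pr k \<longleftrightarrow> k ~= 0 \<and> (\<exists>S\<in>sets N. S \<subseteq> B \<inter> K \<and> emeasure N S = of_nat k)" for k :: nat
  obtain n where n: "emeasure N (B \<inter> K) = of_nat n" using nat[OF BK] by (auto elim: Nats_cases)
  then have "n ~= 0" using pos by auto
  then have "Pr n" unfolding Pr_def using BK n by (intro conjI bexI[of _ "B \<inter> K"]) simp_all
  then have Pk: "Pr (LEAST k. Pr k)" by (rule LeastI)
  define k where "k = (LEAST k. Pr k)"
  obtain S where S: "S \<in> sets N" "S \<subseteq> B \<inter> K" "emeasure N S = of_nat k" and k0: "k ~= 0"
  proof -
   have "Pr k" using Pk by (simp only: k_def)
   then show ?thesis using that unfolding Pr_def by blast
  qed
  have dich: "emeasure N (S - T) = 0" if T: "T \<in> sets N" and nz: "emeasure N (S \<inter> T) ~= 0" for T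
  proof -
   obtain a where a: "emeasure N (S \<inter> T) = of_nat a" using nat[of "S \<inter> T"] S T by (auto elim: Nats_cases)
   obtain c where c: "emeasure N (S - T) = of_nat c" using nat[of "S - T"] S T by (auto elim: Nats_cases)
   have "emeasure N S = emeasure N (S \<inter> T) + emeasure N (S - T)"
   proof -
    have "emeasure N (S \<inter> T) + emeasure N (S - T) = emeasure N ((S \<inter> T) \<union> (S - T))"
     by (rule plus_emeasure) (use S T in auto)
    also have "(S \<inter> T) \<union> (S - T) = S" by auto
    finally show ?thesis by simp
   qed
   then have "(of_nat k :: ennreal) = of_nat (a + c)" by (simp add: S a c)
   then have "k = a + c" by (simp only: of_nat_eq_iff)
   moreover have "a ~= 0" using a nz by auto
   then have "Pr a" unfolding Pr_def using a S(1,2) T by (intro conjI bexI[of _ "S \<inter> T"]) auto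
   then have "k <= a" unfolding k_def by (rule Least_le)
   ultimately show ?thesis by (simp add: c)
  qed
  have "\<exists>c. emeasure N (S - rnd m -` {c}) = 0" for m
  proof -
   let ?C = "rnd m ` K"
   have fC: "finite ?C" using compact_imp_bounded[OF compact_K] by (rule finite_rnd_image)
   have cells: "rnd m -` {c} \<inter> K \<in> sets N" for c unfolding sN by (rule rnd_cell_sets)
   have "\<exists>c\<in>?C. emeasure N (S \<inter> (rnd m -` {c} \<inter> K)) ~= 0"
   proof (rule ccontr)
    assume "\<not> ?thesis"
    then have z: "\<And>c. c \<in> ?C ==> emeasure N (S \<inter> (rnd m -` {c} \<inter> K)) = 0" by auto
    have cov: "S \<subseteq> (\<Union>c\<in>?C. S \<inter> (rnd m -` {c} \<inter> K))" using S(2) by auto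
    have "emeasure N S <= emeasure N (\<Union>c\<in>?C. S \<inter> (rnd m -` {c} \<inter> K))"
     by (rule emeasure_mono[OF cov], rule sets.finite_UN[OF fC], rule sets.Int[OF S(1) cells])
    also have "... <= (\<Sum>c\<in>?C. emeasure N (S \<inter> (rnd m -` {c} \<inter> K)))"
     using S cells fC by (intro emeasure_subadditive_finite) auto
    also have "... = 0" using z by simp
    finally show False using S(3) k0 by simp
   qed
   then obtain c where "emeasure N (S \<inter> (rnd m -` {c} \<inter> K)) ~= 0" by auto
   from dich[OF cells this] have "emeasure N (S - (rnd m -` {c} \<inter> K)) = 0" .
   moreover have "S - (rnd m -` {c} \<inter> K) = S - rnd m -` {c}" using S(2) by auto
   ultimately show ?thesis by auto
  qed
  then obtain c where c: "\<And>m. emeasure N (S - rnd m -` {c m}) = 0" by metis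
  define R where "R = (\<Union>m. S - rnd m -` {c m})"
  have cm: "S - rnd m -` {c m} \<in> sets N" for m
  proof -
   have "S - rnd m -` {c m} = S - (rnd m -` {c m} \<inter> K)" using S(2) by auto
   then show ?thesis using S rnd_cell_sets[of m "c m"] unfolding sN[symmetric] by auto
  qed
  have "R \<in> null_sets N" unfolding R_def using c cm by (intro null_sets_UN) auto
  then have "emeasure N (S - R) = of_nat k" using S by (simp add: emeasure_Diff_null_set)
  then have nz: "emeasure N (S - R) ~= 0" using k0 by simp
  then have "S - R ~= {}" by (metis emeasure_empty)
  then obtain x where x: "x \<in> S - R" by auto
  have "y = x" if "y \<in> S - R" for y
  proof -
   have "rnd m y = rnd m x" for m using that x by (auto simp: R_def)
   then have "(\<lambda>m. rnd m x) \<longlonglongrightarrow> y" using tendsto_rnd[of y] by simp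
   then show "y = x" using tendsto_rnd[of x] LIMSEQ_unique by blast
  qed
  then have "S - R = {x}" using x by blast
  then have "emeasure N {x} ~= 0" using nz by simp
  moreover have "x \<in> K" "x \<in> B" using x S(2) by auto
  ultimately have "x \<in> points N \<inter> B" by (simp add: points_def spN)
  then show "points N \<inter> B ~= {}" by auto
 qed
qed

end

section \<open>Poisson processes on a grid of cells\<close>

context lipschitz_density
begin

text \<open>The definition, with the intensity of the scaled measure evaluated.\<close>

lemma poisson_process_facts:
 fixes F :: "nat => (real^2) set"
 assumes pp: "poisson_process P (scale_measure (ennreal t) \<mu>) \<eta>" and t: "0 < t"
 shows "prob_space P"
  and "w \<in> space P ==> sets (\<eta> w) = sets \<mu>"
  and "w \<in> space P ==> B \<in> sets \<mu> ==> emeasure (\<eta> w) B \<in> \<nat>"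
  and "B \<in> sets \<mu> ==> (\<lambda>w. emeasure (\<eta> w) B) \<in> borel_measurable P"
  and "B \<in> sets \<mu> ==> measure P {w \<in> space P. emeasure (\<eta> w) B = of_nat k} =
    exp (- (t * measure \<mu> B)) * (t * measure \<mu> B) ^ k / fact k"
  and "range F \<subseteq> sets \<mu> ==> disjoint_family F ==>
    prob_space.indep_vars P (\<lambda>_. borel) (\<lambda>i w. emeasure (\<eta> w) (F i)) UNIV"
proof -
 have pt: "point_process P (scale_measure (ennreal t) \<mu>) \<eta>" using pp by (simp add: poisson_process_def)
 then show "prob_space P" by (simp add: point_process_def)
 show "sets (\<eta> w) = sets \<mu>" if "w \<in> space P" using pt that by (auto simp: point_process_def)
 have bd: "bounded B" if "B \<in> sets \<mu>" for B
  using that compact_imp_bounded[OF compact_K] bounded_subset by (auto simp: sets_\<mu>_iff)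
 show "emeasure (\<eta> w) B \<in> \<nat>" if "w \<in> space P" "B \<in> sets \<mu>"
  using pt that bd[OF that(2)] by (auto simp: point_process_def)
 show "(\<lambda>w. emeasure (\<eta> w) B) \<in> borel_measurable P" if "B \<in> sets \<mu>"
  using pt that by (auto simp: point_process_def)
 have m: "measure (scale_measure (ennreal t) \<mu>) B = t * measure \<mu> B" for B
  using t by (simp add: measure_def enn2real_mult)
 have "emeasure (scale_measure (ennreal t) \<mu>) B < \<infinity>" for B
  by (simp add: mu.emeasure_eq_measure ennreal_mult_less_top)
 then show "measure P {w \<in> space P. emeasure (\<eta> w) B = of_nat k} =
    exp (- (t * measure \<mu> B)) * (t * measure \<mu> B) ^ k / fact k" if "B \<in> sets \<mu>"
  using pp that by (simp add: poisson_process_def m)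
 show "prob_space.indep_vars P (\<lambda>_. borel) (\<lambda>i w. emeasure (\<eta> w) (F i)) UNIV"
  if F: "range F \<subseteq> sets \<mu>" "disjoint_family F"
 proof -
  have "\<forall>B::nat => (real^2) set. range B \<subseteq> sets (scale_measure (ennreal t) \<mu>) \<and> disjoint_family B -->
    prob_space.indep_vars P (\<lambda>_. borel) (\<lambda>i w. emeasure (\<eta> w) (B i)) UNIV"
   using pp unfolding poisson_process_def by blast
  from this[rule_format, of F] F show ?thesis by simp
 qed
qed

lemma poisson_atoms:
 assumes pp: "poisson_process P (scale_measure (ennreal t) \<mu>) \<eta>" and t: "0 < t" and w: "w \<in> space P"
 shows "finite (points (\<eta> w))" "points (\<eta> w) \<subseteq> K"
  "B \<in> sets borel ==> emeasure (\<eta> w) (B \<inter> K) ~= 0 \<longleftrightarrow> points (\<eta> w) \<inter> B ~= {}"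
proof -
 note pf = poisson_process_facts[OF pp t]
 have nat: "emeasure (\<eta> w) B \<in> \<nat>" if "B \<in> sets (\<eta> w)" for B using pf(2)[OF w] pf(3)[OF w] that by simp
 note at = integer_measure_atoms[OF pf(2)[OF w] nat]
 show "finite (points (\<eta> w))" "points (\<eta> w) \<subseteq> K" using at(1,2) by auto
 show "B \<in> sets borel ==> emeasure (\<eta> w) (B \<inter> K) ~= 0 \<longleftrightarrow> points (\<eta> w) \<inter> B ~= {}" using at(3)[of B] by auto
qed

lemma poisson_points_random_finite_set:
 assumes pp: "poisson_process P (scale_measure (ennreal t) \<mu>) \<eta>" and t: "0 < t"
 shows "random_finite_set P K (\<lambda>w. points (\<eta> w))"
proof -
 note pf = poisson_process_facts[OF pp t]
 note at = poisson_atoms[OF pp t]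
 show ?thesis unfolding random_finite_set_def
 proof (intro conjI ballI)
  fix w assume w: "w \<in> space P"
  show "finite (points (\<eta> w))" by (rule at(1)[OF w])
  show "points (\<eta> w) \<subseteq> K" by (rule at(2)[OF w])
 next
  fix B :: "(real^2) set" assume B: "B \<in> sets borel"
  then have [measurable]: "(\<lambda>w. emeasure (\<eta> w) (B \<inter> K)) \<in> borel_measurable P"
   by (intro pf(4)) (simp add: sets_\<mu>_iff)
  have "{w \<in> space P. points (\<eta> w) \<inter> B ~= {}} = {w \<in> space P. emeasure (\<eta> w) (B \<inter> K) ~= 0}"
   using at(3)[OF _ B] by auto
  also have "... \<in> sets P" by measurable
  finally show "{w \<in> space P. points (\<eta> w) \<inter> B ~= {}} \<in> sets P" .
 qed
qed

definition cell :: "nat => real^2 => (real^2) set" where "cell m c = rnd m -` {c} \<inter> K"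

lemma cell_sets [measurable]: "cell m c \<in> sets \<mu>" unfolding cell_def by (rule rnd_cell_sets)

text \<open>A cell is contained in a strip.\<close>

lemma measure_cell_le: "measure \<mu> (cell m c) <= 8 * sup_dens * rad / 2 ^ m"
proof -
 let ?e = "axis 1 1 :: real^2"
 have "measure \<mu> (rnd m -` {c} \<inter> K) <= 4 * sup_dens * rad * (2 / 2 ^ m)"
 proof (rule measure_strip[of ?e _ _ c])
  show "norm ?e = 1" by (simp add: norm_axis_1)
  show "rnd m -` {c} \<in> sets borel" using measurable_sets[OF rnd_measurable, of "{c}" m] by simp
  show "rnd m -` {c} \<subseteq> {z. \<bar>cross2 ?e (z - c)\<bar> <= 2 / 2 ^ m}"
  proof clarsimp
   fix z
   have "\<bar>(z - rnd m z) $ 2\<bar> <= norm (z - rnd m z)" by (rule component_le_norm_cart)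
   also have "... <= 2 / 2 ^ m" using rnd_close[of m z] by (simp add: norm_minus_commute)
   finally show "\<bar>cross2 ?e (z - rnd m z)\<bar> <= 2 / 2 ^ m" by (simp add: cross2_def axis_def)
  qed
 qed simp
 then show ?thesis by (simp add: cell_def)
qed

lemma sum_measure_cells:
 assumes "finite C" "inj_on c C"
 shows "(\<Sum>i\<in>C. measure \<mu> (cell m (c i))) = measure \<mu> (\<Union>i\<in>C. cell m (c i))"
 using assms by (intro mu.finite_measure_finite_Union[symmetric]) (auto simp: disjoint_family_on_def cell_def inj_on_def)

lemma exp_defect_bounds:
 fixes w :: real assumes "0 <= w"
 shows "1 - exp (- w) <= w" "w * (1 - w) <= 1 - exp (- w)"
proof -
 show "1 - exp (- w) <= w" using exp_ge_add_one_self[of "- w"] by simp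
 have "exp (- w) * (1 + w) <= exp (- w) * exp w" using exp_ge_add_one_self[of w] by (intro mult_left_mono) auto
 then have "exp (- w) * (1 + w) <= 1" by (simp add: exp_minus)
 then have e: "exp (- w) <= 1 / (1 + w)" using assms by (simp add: field_simps)
 have "(1 - w + w\<^sup>2) * (1 + w) = 1 + w ^ 3" by (simp add: power2_eq_square power3_eq_cube algebra_simps)
 then have "1 <= (1 - w + w\<^sup>2) * (1 + w)" using assms by simp
 then have "1 / (1 + w) <= 1 - w + w\<^sup>2" using assms by (simp add: field_simps)
 then show "w * (1 - w) <= 1 - exp (- w)" using e by (simp add: power2_eq_square algebra_simps)
qed

text \<open>The probability \<open>1 - exp (- w)\<close> that a cell of mean \<open>w\<close> is occupied
 agrees with \<open>w\<close> up to a relative error \<open>w\<close>.\<close>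

lemma prod_weights_close:
 fixes w p :: "'i => real"
 assumes "finite I" and w: "\<And>i. i \<in> I ==> 0 <= w i" "\<And>i. i \<in> I ==> w i <= k" and k: "0 <= k" "k <= 1"
  and p: "\<And>i. i \<in> I ==> w i * (1 - w i) <= p i" "\<And>i. i \<in> I ==> p i <= w i"
 shows "(\<Prod>i\<in>I. w i) - (\<Prod>i\<in>I. p i) <= real (card I) * k * (\<Prod>i\<in>I. w i)" "(\<Prod>i\<in>I. p i) <= (\<Prod>i\<in>I. w i)"
proof -
 have p0: "0 <= p i" if "i \<in> I" for i
 proof -
  have "0 <= w i * (1 - w i)" using w[OF that] k by (intro mult_nonneg_nonneg) auto
  then show ?thesis using p(1)[OF that] by linarith
 qed
 then show "(\<Prod>i\<in>I. p i) <= (\<Prod>i\<in>I. w i)" using p(2) by (intro prod_mono) auto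
 define r where "r i = (if w i = 0 then 1 else p i / w i)" for i
 have r: "p i = w i * r i" "1 - k <= r i" "r i <= 1" "0 <= r i" if "i \<in> I" for i
 proof -
  show "p i = w i * r i" using p0[OF that] p(2)[OF that] by (auto simp: r_def)
  show "r i <= 1" "0 <= r i" using p0[OF that] p(2)[OF that] w(1)[OF that] by (auto simp: r_def divide_le_eq_1)
  show "1 - k <= r i"
  proof (cases "w i = 0")
   case False
   then have "0 < w i" using w(1)[OF that] by simp
   then have "1 - w i <= p i / w i" using p(1)[OF that] by (simp add: field_simps)
   then show ?thesis using False w(2)[OF that] by (simp add: r_def)
  qed (use k in \<open>simp add: r_def\<close>)
 qed
 have "norm ((\<Prod>i\<in>I. 1) - (\<Prod>i\<in>I. r i)) <= (\<Sum>i\<in>I. norm (1 - r i))" using r by (intro norm_prod_diff) auto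
 also have "... <= (\<Sum>i\<in>I. k)"
 proof (rule sum_mono)
  fix i assume "i \<in> I"
  then show "norm (1 - r i) <= k" unfolding real_norm_def using r(2,3)[of i] by linarith
 qed
 finally have "1 - (\<Prod>i\<in>I. r i) <= real (card I) * k" by simp
 moreover have "(\<Prod>i\<in>I. p i) = (\<Prod>i\<in>I. w i) * (\<Prod>i\<in>I. r i)" using r(1) by (simp add: prod.distrib)
 moreover have "0 <= (\<Prod>i\<in>I. w i)" using w by (intro prod_nonneg) auto
 ultimately show "(\<Prod>i\<in>I. w i) - (\<Prod>i\<in>I. p i) <= real (card I) * k * (\<Prod>i\<in>I. w i)"
  using mult_right_mono[of "1 - (\<Prod>i\<in>I. r i)" "real (card I) * k" "\<Prod>i\<in>I. w i"] by (simp add: algebra_simps)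
qed

text \<open>The rounded process is the set of occupied cells, and disjoint cells are occupied independently.
 Hence a triple of cells depends only on the triples that meet it, and \<open>dissociated_prod_approx\<close>
 applies with the weights of \<open>overlap_total\<close>. Rounding displaces points by at most \<open>2 / 2 ^ m\<close>, which
 enters \<open>measure_deficit_le\<close>.\<close>

lemma poisson_mfun_rnd_bound:
 fixes g :: "real => complex" and N :: nat
 assumes pp: "poisson_process P (scale_measure (ennreal t) \<mu>) \<eta>" and t: "1 <= t"
  and g1: "\<And>x. norm (g x) <= 1"
  and ge: "\<And>x. e < x ==> g x = 1" and gc: "\<And>x. norm (1 - g x) <= c" and e: "0 <= e" and m: "1 <= m"
  and cc: "bij_betw cc {..<N} (rnd m ` K)"
 defines "p \<equiv> \<lambda>i. 1 - exp (- (t * measure \<mu> (cell m (cc i))))"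
 shows "norm ((\<integral>w. mfun g (rnd m ` points (\<eta> w)) \<partial>P) -
   exp (- (\<Sum>I\<in>triples_of {..<N}. (1 - g (deficit (cc ` I))) * of_real (\<Prod>i\<in>I. p i))))
   <= 12 * t ^ 3 * (t * (C_line * (e + 2 / 2 ^ m)))\<^sup>2 * c\<^sup>2"
proof -
 have t0: "0 < t" using t by simp
 note pf = poisson_process_facts[OF pp t0]
 interpret P: prob_space P by (rule pf(1))
 have rfs: "random_finite_set P K (\<lambda>w. points (\<eta> w))" by (rule poisson_points_random_finite_set[OF pp t0])
 note at = poisson_atoms[OF pp t0]
 let ?V = "{..<N}"
 let ?\<I> = "triples_of ?V"
 have inj: "inj_on cc ?V" and im: "cc ` ?V = rnd m ` K" using cc by (auto simp: bij_betw_def)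
 have fin: "finite ?\<I>" by (rule finite_triples_of) simp
 have c: "0 <= c" using gc[of 0] norm_ge_zero order_trans by blast
 \<comment> \<open>Cells beyond \<open>N\<close> are empty, so that \<open>F\<close> is a sequence of disjoint sets.\<close>
 define F where "F i = (if i < N then cell m (cc i) else {})" for i
 have F: "range F \<subseteq> sets \<mu>" by (auto simp: F_def)
 have "disjoint_family F" using inj by (auto simp: disjoint_family_on_def F_def cell_def inj_on_def)
 then have iv: "P.indep_vars (\<lambda>_. borel) (\<lambda>i w. emeasure (\<eta> w) (F i)) UNIV" by (rule pf(6)[OF F])
 define Y where "Y i w = emeasure (\<eta> w) (F i)" for i w
 have iv: "P.indep_vars (\<lambda>_. borel) Y UNIV" using iv by (simp add: Y_def[abs_def])
 have Ym [measurable]: "Y i \<in> borel_measurable P" for i unfolding Y_def[abs_def] using F by (intro pf(4)) auto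
 have occ: "Y i w ~= 0 \<longleftrightarrow> cc i \<in> rnd m ` points (\<eta> w)" if "i < N" "w \<in> space P" for i w
 proof -
  have "rnd m -` {cc i} \<in> sets borel" using measurable_sets[OF rnd_measurable, of "{cc i}" m] by simp
  then have "Y i w ~= 0 \<longleftrightarrow> points (\<eta> w) \<inter> rnd m -` {cc i} ~= {}"
   using at(3)[OF that(2)] that by (simp add: Y_def F_def cell_def)
  also have "... \<longleftrightarrow> cc i \<in> rnd m ` points (\<eta> w)"
  proof
   assume "points (\<eta> w) \<inter> rnd m -` {cc i} ~= {}"
   then obtain x where x: "x \<in> points (\<eta> w)" "rnd m x = cc i" by auto
   then show "cc i \<in> rnd m ` points (\<eta> w)" using imageI[OF x(1), of "rnd m"] by simp
  next
   assume "cc i \<in> rnd m ` points (\<eta> w)"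
   then obtain x where "x \<in> points (\<eta> w)" "cc i = rnd m x" by (rule imageE)
   then show "points (\<eta> w) \<inter> rnd m -` {cc i} ~= {}" by auto
  qed
  finally show ?thesis .
 qed
 have p_eq: "P.prob (Y i -` (- {0}) \<inter> space P) = p i" if "i < N" for i
 proof -
  have "P.prob {w \<in> space P. Y i w = 0} = exp (- (t * measure \<mu> (cell m (cc i))))"
   using pf(5)[of "F i" 0] F that by (simp add: Y_def F_def)
  moreover have "Y i -` (- {0}) \<inter> space P = space P - {w \<in> space P. Y i w = 0}" by auto
  moreover have "{w \<in> space P. Y i w = 0} \<in> sets P" by measurable
  ultimately show ?thesis by (simp add: P.prob_compl p_def)
 qed
 have p01: "0 <= p i" "p i <= 1" "p i <= t * measure \<mu> (cell m (cc i))" for i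
  using t0 exp_defect_bounds(1)[of "t * measure \<mu> (cell m (cc i))"] by (auto simp: p_def)
 have card3: "card I = 3" "I \<subseteq> ?V" "finite I" if "I \<in> ?\<I>" for I
  using that by (auto simp: triples_of_def intro: finite_subset)
 define a where "a I = 1 - g (deficit (cc ` I))" for I
 \<comment> \<open>The indicator that all cells of \<open>S\<close> are occupied.\<close>
 define occu where "occu S x = (if \<forall>i\<in>S. x i ~= (0::ennreal) then 1 else 0 :: complex)" for S :: "nat set" and x
 define G where "G I w = a I * occu I (\<lambda>i. Y i w)" for I w
 have occu_meas: "occu S \<in> borel_measurable (PiM S' (\<lambda>_. borel))" if "finite S" "S \<subseteq> S'" for S S'
 proof -
  have "occu S = (\<lambda>x. \<Prod>i\<in>S. if x i ~= 0 then 1 else 0)" using that(1) by (auto simp: occu_def fun_eq_iff)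
  moreover have "(\<lambda>x. \<Prod>i\<in>S. if x i ~= (0::ennreal) then 1 else 0 :: complex) \<in> borel_measurable (PiM S' (\<lambda>_. borel))"
  proof (intro borel_measurable_prod)
   fix i assume "i \<in> S"
   then have [measurable]: "(\<lambda>x. x i) \<in> borel_measurable (PiM S' (\<lambda>_. borel :: ennreal measure))"
    using that(2) by (intro measurable_component_singleton) auto
   have "(\<lambda>y. if y ~= (0::ennreal) then 1 else 0 :: complex) \<in> borel_measurable borel" by measurable
   from measurable_compose[OF \<open>(\<lambda>x. x i) \<in> _\<close> this]
   show "(\<lambda>x. if x i ~= (0::ennreal) then 1 else 0 :: complex) \<in> borel_measurable (PiM S' (\<lambda>_. borel))" .
  qed
  ultimately show ?thesis by simp
 qed
 have occu_cong: "occu S x = occu S y" if "\<And>i. i \<in> S ==> x i = y i" for S x y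
  using that by (auto simp: occu_def)
 have occu_Ym: "(\<lambda>w. occu S (\<lambda>i. Y i w)) \<in> borel_measurable P" if "finite S" for S
 proof -
  have "(\<lambda>w. restrict (\<lambda>i. Y i w) S) \<in> P \<rightarrow>\<^sub>M PiM S (\<lambda>_. borel)" by (intro measurable_restrict) simp
  from measurable_compose[OF this occu_meas[OF that order_refl]]
  have "(\<lambda>w. occu S (restrict (\<lambda>i. Y i w) S)) \<in> borel_measurable P" .
  moreover have "occu S (restrict (\<lambda>i. Y i w) S) = occu S (\<lambda>i. Y i w)" for w by (rule occu_cong) simp
  ultimately show ?thesis by simp
 qed
 have norm_occu: "norm (occu S x) <= 1" for S x by (simp add: occu_def)
 have E_occu: "P.expectation (\<lambda>w. occu S (\<lambda>i. Y i w)) = of_real (\<Prod>i\<in>S. p i)"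
  if "finite S" "S \<subseteq> ?V" for S
 proof (cases "S = {}")
  case True
  then show ?thesis by (simp add: occu_def P.prob_space)
 next
  case False
  have "P.prob (\<Inter>i\<in>S. Y i -` (- {0}) \<inter> space P) = (\<Prod>i\<in>S. P.prob (Y i -` (- {0}) \<inter> space P))"
   using that False by (intro P.indep_varsD[OF iv]) auto
  also have "... = (\<Prod>i\<in>S. p i)" using that by (intro prod.cong p_eq) auto
  finally have pr: "P.prob (\<Inter>i\<in>S. Y i -` (- {0}) \<inter> space P) = (\<Prod>i\<in>S. p i)" .
  have set: "(\<Inter>i\<in>S. Y i -` (- {0}) \<inter> space P) \<in> sets P"
   using that False by (intro sets.finite_INT) (auto intro: measurable_sets)
  have "P.expectation (\<lambda>w. occu S (\<lambda>i. Y i w)) = P.expectation (\<lambda>w. of_real (indicat_real (\<Inter>i\<in>S. Y i -` (- {0}) \<inter> space P) w))"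
   using False by (intro lint_cong) (auto simp: occu_def indicator_def)
  also have "... = of_real (P.prob Q)" if "Q = (\<Inter>i\<in>S. Y i -` (- {0}) \<inter> space P)" for Q
   unfolding that[symmetric] using set[folded that] sets.sets_into_space[OF set[folded that]]
   by (subst integral_complex_of_real) (simp add: Int_absorb2)
  finally show ?thesis using pr by simp
 qed
 have occu_mult: "occu S x * occu T x = occu (S \<union> T) x" for S T x by (auto simp: occu_def)
 have le1: "norm (1 - G I w) <= 1" for I w using g1 by (auto simp: G_def occu_def a_def)
 have Gm [measurable]: "G I \<in> borel_measurable P" if "I \<in> ?\<I>" for I
  unfolding G_def[abs_def] using occu_Ym[OF card3(3)[OF that]] by simp
 have EG: "P.expectation (G I) = a I * of_real (\<Prod>i\<in>I. p i)" if "I \<in> ?\<I>" for I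
  unfolding G_def[abs_def] using E_occu[OF card3(3)[OF that] card3(2)[OF that]] by simp
 define b where "b I = (if deficit (cc ` I) <= e then 1 else 0 :: real)" for I
 have ab: "norm (a I) <= c * b I" for I using gc ge[of "deficit (cc ` I)"] by (auto simp: a_def b_def not_le)
 define D where "D I = {J \<in> ?\<I>. J \<inter> I ~= {}}" for I
 have norm_occu_real: "norm (occu S x) = Re (occu S x)" for S x by (simp add: occu_def)
 have E_Re: "P.expectation (\<lambda>w. Re (occu S (\<lambda>i. Y i w))) = (\<Prod>i\<in>S. p i)" if "finite S" "S \<subseteq> ?V" for S
 proof -
  have "integrable P (\<lambda>w. occu S (\<lambda>i. Y i w))"
   using norm_occu occu_Ym[OF that(1)] by (intro P.integrable_const_bound[where B=1]) auto
  then have "P.expectation (\<lambda>w. Re (occu S (\<lambda>i. Y i w))) = Re (P.expectation (\<lambda>w. occu S (\<lambda>i. Y i w)))"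
   by (rule integral_Re)
  then show ?thesis by (simp only: E_occu[OF that] Re_complex_of_real)
 qed
 have ENG: "P.expectation (\<lambda>w. norm (G I w)) = norm (a I) * (\<Prod>i\<in>I. p i)" if "I \<in> ?\<I>" for I
  unfolding G_def norm_mult norm_occu_real using E_Re[OF card3(3)[OF that] card3(2)[OF that]] by simp
 have ENGG: "P.expectation (\<lambda>w. norm (G I w) * norm (G J w)) = norm (a I) * norm (a J) * (\<Prod>i\<in>I \<union> J. p i)"
  if "I \<in> ?\<I>" "J \<in> ?\<I>" for I J
 proof -
  have "norm (G I w) * norm (G J w) = norm (a I) * norm (a J) * Re (occu (I \<union> J) (\<lambda>i. Y i w))" for w
   unfolding G_def norm_mult occu_mult[symmetric] using norm_occu_real[of "I \<union> J" "\<lambda>i. Y i w"]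
   by (simp add: occu_def)
  then show ?thesis using E_Re[of "I \<union> J"] card3[OF that(1)] card3[OF that(2)] by simp
 qed
 have main: "norm (P.expectation (\<lambda>w. \<Prod>I\<in>?\<I>. 1 - G I w) - exp (- (\<Sum>I\<in>?\<I>. P.expectation (G I)))) <=
  (\<Sum>I\<in>?\<I>. (\<Sum>J\<in>D I. P.expectation (\<lambda>w. norm (G I w)) * P.expectation (\<lambda>w. norm (G J w))) +
    (\<Sum>J\<in>D I - {I}. P.expectation (\<lambda>w. norm (G I w) * norm (G J w))))"
 proof (rule P.dissociated_prod_approx[OF fin Gm le1])
  show "I \<in> D I" if "I \<in> ?\<I>" for I using that card3[OF that] by (auto simp: D_def)
  show "D I \<subseteq> ?\<I>" for I by (auto simp: D_def)
  fix I s assume I: "I \<in> ?\<I>" and s: "0 <= s" "s <= (1::real)"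
  let ?Q = "?\<I> - D I"
  have Q: "J \<subseteq> ?V - I" "finite J" "J \<in> ?\<I>" if "J \<in> ?Q" for J
  proof -
   show J: "J \<in> ?\<I>" using that by simp
   show "finite J" by (rule card3(3)[OF J])
   have "J \<inter> I = {}" using that by (simp add: D_def)
   then show "J \<subseteq> ?V - I" using card3(2)[OF J] by blast
  qed
  define HH where "HH x = (\<Prod>J\<in>?Q. 1 - of_real s * (a J * occu J x))" for x
  have Hm: "HH \<in> borel_measurable (PiM (?V - I) (\<lambda>_. borel))" unfolding HH_def using Q
   by (intro borel_measurable_prod borel_measurable_diff borel_measurable_times borel_measurable_const occu_meas) auto
  have Im: "(\<lambda>x. a I * occu I x) \<in> borel_measurable (PiM I (\<lambda>_. borel))"
   using card3[OF I] by (intro borel_measurable_times borel_measurable_const occu_meas) auto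
  have "P.indep_var borel ((\<lambda>x. a I * occu I x) \<circ> (\<lambda>w. restrict (\<lambda>i. Y i w) I)) borel (HH \<circ> (\<lambda>w. restrict (\<lambda>i. Y i w) (?V - I)))"
   by (intro P.indep_var_compose[OF P.indep_var_restrict[OF iv]] Hm Im) auto
  moreover have "(\<lambda>x. a I * occu I x) \<circ> (\<lambda>w. restrict (\<lambda>i. Y i w) I) = G I"
  proof (rule ext)
   fix w
   have "occu I (restrict (\<lambda>i. Y i w) I) = occu I (\<lambda>i. Y i w)" by (rule occu_cong) simp
   then show "((\<lambda>x. a I * occu I x) \<circ> (\<lambda>w. restrict (\<lambda>i. Y i w) I)) w = G I w" by (simp add: G_def)
  qed
  moreover have "HH \<circ> (\<lambda>w. restrict (\<lambda>i. Y i w) (?V - I)) = (\<lambda>w. \<Prod>J\<in>?Q. 1 - of_real s * G J w)"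
  proof (rule ext)
   fix w
   have "occu J (restrict (\<lambda>i. Y i w) (?V - I)) = occu J (\<lambda>i. Y i w)" if "J \<in> ?Q" for J
    using Q(1)[OF that] by (intro occu_cong) auto
   then show "(HH \<circ> (\<lambda>w. restrict (\<lambda>i. Y i w) (?V - I))) w = (\<Prod>J\<in>?Q. 1 - of_real s * G J w)"
    unfolding HH_def comp_def G_def by (intro prod.cong refl) simp
  qed
  ultimately have ivv: "P.indep_var borel (G I) borel (\<lambda>w. \<Prod>J\<in>?Q. 1 - of_real s * G J w)" by simp
  show "P.expectation (\<lambda>w. G I w * (\<Prod>J\<in>?Q. 1 - of_real s * G J w)) =
   P.expectation (G I) * P.expectation (\<lambda>w. \<Prod>J\<in>?Q. 1 - of_real s * G J w)"
  proof (rule P.indep_var_lebesgue_integral[OF ivv])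
   have "norm (G I w) <= 2" for w using le1[of I w] norm_triangle_ineq4[of 1 "1 - G I w"] by simp
   then show "integrable P (G I)" using I by (intro P.integrable_const_bound[where B=2]) auto
   have "norm (\<Prod>J\<in>?Q. 1 - of_real s * G J w) <= 1" for w
    unfolding prod_norm[symmetric] by (intro prod_le_1) (auto intro!: norm_one_minus_scaleR_le_1 le1 s)
   then show "integrable P (\<lambda>w. \<Prod>J\<in>?Q. 1 - of_real s * G J w)"
    using Q(3) by (intro P.integrable_const_bound[where B=1]) auto
  qed
 qed
 let ?H = "t * (C_line * (e + 2 / 2 ^ m))"
 have H0: "0 <= ?H" using t0 C_line_ge_1 e by (intro mult_nonneg_nonneg) auto
 have two: "2 / 2 ^ m <= (2::real)" by (simp add: field_simps)
 interpret W: weighted_triples ?V p b ?H t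
 proof
  show "(\<Sum>c\<in>?V. p c) <= t"
  proof -
   have "(\<Sum>c\<in>?V. p c) <= (\<Sum>c\<in>?V. t * measure \<mu> (cell m (cc c)))" by (intro sum_mono p01)
   also have "... = t * measure \<mu> (\<Union>i\<in>?V. cell m (cc i))"
    using sum_measure_cells[OF _ inj, of m] by (simp add: sum_distrib_left[symmetric])
   also have "... <= t * 1" using t0 by (intro mult_left_mono) auto
   finally show ?thesis by simp
  qed
  fix u v assume uv: "u \<in> ?V" "v \<in> ?V" "u ~= v"
  let ?B = "{k \<in> ?V - {u, v}. deficit (cc ` {u, v, k}) <= e}"
  have uK: "\<exists>x\<in>K. cc u = rnd m x" "\<exists>x\<in>K. cc v = rnd m x" using im uv by auto
  have rn: "norm (rnd m x) <= rad" if "x \<in> K" for x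
  proof -
   have "norm (rnd m x) <= norm (rnd m x - x) + norm x" using norm_triangle_ineq[of "rnd m x - x" x] by simp
   then show ?thesis using rnd_close[of m x] two rad(2)[OF that] by linarith
  qed
  have "(\<Sum>k\<in>?V - {u, v}. p k * b {u, v, k}) = (\<Sum>k\<in>?V - {u, v}. if deficit (cc ` {u, v, k}) <= e then p k else 0)"
   unfolding b_def by (rule sum.cong[OF refl]) simp
  also have "... = (\<Sum>k\<in>?B. p k)" by (rule sum.inter_filter[symmetric]) simp
  also have "... <= (\<Sum>k\<in>?B. t * measure \<mu> (cell m (cc k)))" by (intro sum_mono p01)
  also have "... = t * measure \<mu> (\<Union>k\<in>?B. cell m (cc k))"
   using sum_measure_cells[of ?B cc m] inj_on_subset[OF inj, of ?B] by (simp add: sum_distrib_left[symmetric] subset_iff)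
  also have "measure \<mu> (\<Union>k\<in>?B. cell m (cc k)) <= C_line * (e + 2 / 2 ^ m)"
  proof (rule measure_deficit_le[where q="rnd m" and x="cc u" and y="cc v"])
   show "(\<Union>k\<in>?B. cell m (cc k)) \<in> sets \<mu>" by (intro sets.finite_UN) auto
   show "cc u ~= cc v" using inj uv by (auto simp: inj_on_def)
   show "norm (cc u) <= rad" "norm (cc v) <= rad" using uK rn by auto
   fix z assume "z \<in> (\<Union>k\<in>?B. cell m (cc k))"
   then obtain k where k: "k \<in> ?B" "rnd m z = cc k" by (auto simp: cell_def)
   then show "rnd m z ~= cc u \<and> rnd m z ~= cc v \<and> deficit {cc u, cc v, rnd m z} <= e"
    using inj uv by (auto simp: inj_on_def)
  qed (use rnd_close two e in auto)
  finally show "(\<Sum>k\<in>?V - {u, v}. p k * b {u, v, k}) <= ?H" using t0 by (simp add: mult_left_mono)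
 qed (use p01 t H0 in \<open>auto simp: b_def\<close>)
 have "(\<Sum>I\<in>?\<I>. (\<Sum>J\<in>D I. P.expectation (\<lambda>w. norm (G I w)) * P.expectation (\<lambda>w. norm (G J w))) +
    (\<Sum>J\<in>D I - {I}. P.expectation (\<lambda>w. norm (G I w) * norm (G J w)))) <=
  (\<Sum>I\<in>?\<I>. (\<Sum>J\<in>D I. c\<^sup>2 * ((W.q I * b I) * (W.q J * b J))) +
   (\<Sum>J\<in>D I - {I}. c\<^sup>2 * (W.q (I \<union> J) * (b I * b J))))"
 proof (intro sum_mono add_mono)
  fix I J assume I: "I \<in> ?\<I>" and J: "J \<in> D I"
  then have J': "J \<in> ?\<I>" by (simp add: D_def)
  have q: "0 <= W.q I" "0 <= W.q J" using W.q_nonneg card3[OF I] card3[OF J'] by auto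
  have "(norm (a I) * W.q I) * (norm (a J) * W.q J) <= (c * b I * W.q I) * (c * b J * W.q J)"
   using ab q c by (intro mult_mono mult_right_mono mult_nonneg_nonneg) (auto simp: b_def)
  then show "P.expectation (\<lambda>w. norm (G I w)) * P.expectation (\<lambda>w. norm (G J w)) <= c\<^sup>2 * ((W.q I * b I) * (W.q J * b J))"
   unfolding ENG[OF I] ENG[OF J'] by (simp add: W.q_def power2_eq_square algebra_simps)
 next
  fix I J assume I: "I \<in> ?\<I>" and J: "J \<in> D I - {I}"
  then have J': "J \<in> ?\<I>" by (simp add: D_def)
  have q: "0 <= W.q (I \<union> J)" using W.q_nonneg card3[OF I] card3[OF J'] by auto
  have "norm (a I) * norm (a J) * W.q (I \<union> J) <= (c * b I) * (c * b J) * W.q (I \<union> J)"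
   using ab q c by (intro mult_right_mono mult_mono mult_nonneg_nonneg) (auto simp: b_def)
  then show "P.expectation (\<lambda>w. norm (G I w) * norm (G J w)) <= c\<^sup>2 * (W.q (I \<union> J) * (b I * b J))"
   unfolding ENGG[OF I J'] by (simp add: W.q_def power2_eq_square algebra_simps)
 qed
 also have "... = c\<^sup>2 * (\<Sum>I\<in>?\<I>. (\<Sum>J\<in>D I. (W.q I * b I) * (W.q J * b J)) + (\<Sum>J\<in>D I - {I}. W.q (I \<union> J) * (b I * b J)))"
  by (simp add: sum_distrib_left distrib_left)
 also have "... <= c\<^sup>2 * (12 * t ^ 3 * ?H\<^sup>2)"
  using W.overlap_total unfolding D_def by (intro mult_left_mono) auto
 finally have bound: "norm (P.expectation (\<lambda>w. \<Prod>I\<in>?\<I>. 1 - G I w) - exp (- (\<Sum>I\<in>?\<I>. P.expectation (G I)))) <=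
  c\<^sup>2 * (12 * t ^ 3 * ?H\<^sup>2)" using main by simp
 have mf: "mfun g (rnd m ` points (\<eta> w)) = (\<Prod>I\<in>?\<I>. 1 - G I w)" if w: "w \<in> space P" for w
 proof -
  define Oc where "Oc = {i \<in> ?V. Y i w ~= 0}"
  have "points (\<eta> w) \<subseteq> K" using rfs w by (simp add: random_finite_set_def)
  then have "rnd m ` points (\<eta> w) \<subseteq> cc ` ?V" unfolding im by (rule image_mono)
  then have eq: "rnd m ` points (\<eta> w) = cc ` Oc"
  proof (intro equalityI subsetI)
   fix z assume z: "z \<in> rnd m ` points (\<eta> w)"
   then obtain i where i: "i < N" "z = cc i" using \<open>rnd m ` points (\<eta> w) \<subseteq> cc ` ?V\<close> by auto
   with z occ[OF _ w, of i] show "z \<in> cc ` Oc" by (simp add: Oc_def)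
  next
   fix z assume "z \<in> cc ` Oc"
   then obtain i where "i < N" "Y i w ~= 0" "z = cc i" by (auto simp: Oc_def)
   with occ[OF _ w, of i] show "z \<in> rnd m ` points (\<eta> w)" by simp
  qed
  have OV: "Oc \<subseteq> ?V" by (auto simp: Oc_def)
  have "mfun g (rnd m ` points (\<eta> w)) = (\<Prod>I\<in>triples_of Oc. g (deficit (cc ` I)))"
   unfolding eq by (rule mfun_image[OF inj_on_subset[OF inj OV]])
  also have "... = (\<Prod>I\<in>triples_of Oc. 1 - G I w)"
   by (intro prod.cong refl) (auto simp: G_def a_def occu_def triples_of_def Oc_def)
  also have "... = (\<Prod>I\<in>?\<I>. 1 - G I w)"
   using fin OV by (intro prod.mono_neutral_left) (auto simp: triples_of_def G_def occu_def Oc_def)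
  finally show ?thesis .
 qed
 have "P.expectation (\<lambda>w. mfun g (rnd m ` points (\<eta> w))) = P.expectation (\<lambda>w. \<Prod>I\<in>?\<I>. 1 - G I w)"
  by (intro lint_cong mf refl)
 moreover have "(\<Sum>I\<in>?\<I>. P.expectation (G I)) = (\<Sum>I\<in>?\<I>. (1 - g (deficit (cc ` I))) * of_real (\<Prod>i\<in>I. p i))"
  by (intro sum.cong refl) (simp add: EG a_def)
 ultimately show ?thesis using bound by (simp add: mult.commute)
qed

end

section \<open>Poisson processes: product formula\<close>

context lipschitz_density
begin

lemma norm_defect_le: "(\<And>x. norm (g x) <= 1) ==> norm (defect g t) <= 2"
proof -
 assume g: "\<And>x. norm (g x) <= 1"
 have "norm (1 - g x) <= 2" for x using norm_triangle_ineq4[of 1 "g x"] g[of x] by simp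
 then show ?thesis by (simp add: defect_def)
qed

lemma measure_mu3_box:
 assumes "A \<in> sets \<mu>" "B \<in> sets \<mu>" "D \<in> sets \<mu>"
 shows "measure mu3 (A \<times> B \<times> D) = measure \<mu> A * measure \<mu> B * measure \<mu> D" "A \<times> B \<times> D \<in> sets mu3"
proof -
 show "A \<times> B \<times> D \<in> sets mu3" using assms by auto
 have "emeasure mu3 (A \<times> B \<times> D) = emeasure \<mu> A * (emeasure \<mu> B * emeasure \<mu> D)"
  using assms by (simp add: mu2.P.emeasure_pair_measure_Times mu.emeasure_pair_measure_Times)
 then show "measure mu3 (A \<times> B \<times> D) = measure \<mu> A * measure \<mu> B * measure \<mu> D"
  by (simp add: measure_def enn2real_mult mult.assoc)
qed

text \<open>The integrand is constant on products of three cells.\<close>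

lemma rounded_mean:
 assumes g: "\<And>x. norm (g x) <= 1" and cc: "bij_betw cc {..<N :: nat} (rnd m ` K)"
 shows "(\<integral>(x, y, z). defect g (rnd m x, rnd m y, rnd m z) \<partial>mu3) =
   6 * (\<Sum>I\<in>triples_of {..<N}. (1 - g (deficit (cc ` I))) * of_real (\<Prod>i\<in>I. measure \<mu> (cell m (cc i))))"
proof -
 let ?V = "{..<N}"
 have inj: "inj_on cc ?V" and im: "cc ` ?V = rnd m ` K" using cc by (auto simp: bij_betw_def)
 let ?d = "\<lambda>s. defect g (cc (fst s), cc (fst (snd s)), cc (snd (snd s)))"
 let ?B = "\<lambda>s. cell m (cc (fst s)) \<times> cell m (cc (fst (snd s))) \<times> cell m (cc (snd (snd s)))"
 have pt: "(case t of (x, y, z) => defect g (rnd m x, rnd m y, rnd m z)) = (\<Sum>s\<in>?V \<times> ?V \<times> ?V. indicat_real (?B s) t *\<^sub>R ?d s)"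
  if t: "t \<in> space mu3" for t
 proof -
  obtain x y z where [simp]: "t = (x, y, z)" by (cases t) auto
  have xyz: "x \<in> K" "y \<in> K" "z \<in> K" using t by (auto simp: space_mu3)
  have ex: "\<exists>i\<in>?V. rnd m u = cc i" if "u \<in> K" for u
   using imageI[OF that, of "rnd m"] unfolding im[symmetric] by auto
  obtain i j k where ijk: "i \<in> ?V" "j \<in> ?V" "k \<in> ?V" "rnd m x = cc i" "rnd m y = cc j" "rnd m z = cc k"
   using ex[OF xyz(1)] ex[OF xyz(2)] ex[OF xyz(3)] by blast
  have only: "t \<in> ?B s \<longleftrightarrow> s = (i, j, k)" if s: "s \<in> ?V \<times> ?V \<times> ?V" for s
   using s ijk xyz inj by (cases s) (auto simp: cell_def inj_on_def)
  have "(\<Sum>s\<in>?V \<times> ?V \<times> ?V. indicat_real (?B s) t *\<^sub>R ?d s) = (\<Sum>s\<in>?V \<times> ?V \<times> ?V. if s = (i, j, k) then ?d s else 0)"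
   using only by (intro sum.cong refl) (simp add: indicator_def)
  also have "... = ?d (i, j, k)" using ijk by (subst sum.delta) auto
  finally show ?thesis using ijk by simp
 qed
 have B: "?B s \<in> sets mu3" for s by (intro measure_mu3_box cell_sets)
 have "(\<integral>(x, y, z). defect g (rnd m x, rnd m y, rnd m z) \<partial>mu3) =
   (\<integral>t. (\<Sum>s\<in>?V \<times> ?V \<times> ?V. indicat_real (?B s) t *\<^sub>R ?d s) \<partial>mu3)"
  by (intro lint_cong refl pt)
 also have "... = (\<Sum>s\<in>?V \<times> ?V \<times> ?V. (\<integral>t. indicat_real (?B s) t *\<^sub>R ?d s \<partial>mu3))"
  using B by (intro Bochner_Integration.integral_sum integrable_scaleR_left integrable_real_indicator)
    (simp_all add: mu3.P.emeasure_eq_measure)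
 also have "... = (\<Sum>s\<in>?V \<times> ?V \<times> ?V. measure mu3 (?B s) *\<^sub>R ?d s)"
  using B by (intro sum.cong refl) (simp add: mu3.P.emeasure_eq_measure)
 also have "... = (\<Sum>s\<in>distinct_triples ?V. measure mu3 (?B s) *\<^sub>R ?d s)"
 proof (rule sum.mono_neutral_right)
  show "\<forall>s\<in>?V \<times> ?V \<times> ?V - distinct_triples ?V. measure mu3 (?B s) *\<^sub>R ?d s = 0"
   by (auto simp: distinct_triples_def defect_triple)
 qed (auto simp: distinct_triples_def)
 also have "... = (\<Sum>(i, j, k)\<in>distinct_triples ?V. (1 - g (deficit (cc ` {i, j, k}))) * of_real (\<Prod>i\<in>{i, j, k}. measure \<mu> (cell m (cc i))))"
 proof (rule sum.cong[OF refl])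
  fix s assume s: "s \<in> distinct_triples ?V"
  then obtain i j k where s': "s = (i, j, k)" "i ~= j" "i ~= k" "j ~= k" "i \<in> ?V" "j \<in> ?V" "k \<in> ?V"
   by (auto simp: distinct_triples_def)
  have "cc i ~= cc j" "cc i ~= cc k" "cc j ~= cc k" using s' inj by (auto simp: inj_on_def)
  then show "measure mu3 (?B s) *\<^sub>R ?d s =
    (case s of (i, j, k) => (1 - g (deficit (cc ` {i, j, k}))) * of_real (\<Prod>i\<in>{i, j, k}. measure \<mu> (cell m (cc i))))"
   using s' by (simp add: s'(1) measure_mu3_box defect_triple deficit_eq_largest_angle scaleR_conv_of_real algebra_simps)
 qed
 also have "... = 6 *\<^sub>R (\<Sum>I\<in>triples_of ?V. (1 - g (deficit (cc ` I))) * of_real (\<Prod>i\<in>I. measure \<mu> (cell m (cc i))))"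
  by (rule sum_distinct_triples) simp
 finally show ?thesis by (simp add: scaleR_conv_of_real)
qed

lemma rounded_mean_tendsto:
 assumes g1: "\<And>x. norm (g x) <= 1" and g: "continuous_on UNIV g"
 shows "(\<lambda>m. \<integral>(x, y, z). defect g (rnd m x, rnd m y, rnd m z) \<partial>mu3) \<longlonglongrightarrow> expected_defect g"
 unfolding expected_defect_def
proof (rule integral_dominated_convergence[where w="\<lambda>_. 2"])
 have [measurable]: "g \<in> borel_measurable borel" using g by (rule borel_measurable_continuous_onI)
 show "defect g \<in> borel_measurable mu3" by (rule defect_measurable) simp
 show "(\<lambda>(x, y, z). defect g (rnd m x, rnd m y, rnd m z)) \<in> borel_measurable mu3" for m
  unfolding defect_triple case_prod_beta' by measurable
 show "AE t in mu3. norm (case t of (x, y, z) => defect g (rnd m x, rnd m y, rnd m z)) <= 2" for m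
  using norm_defect_le[OF g1] by (intro AE_I2) (auto split: prod.splits)
 show "AE t in mu3. (\<lambda>m. case t of (x, y, z) => defect g (rnd m x, rnd m y, rnd m z)) \<longlonglongrightarrow> defect g t"
  using AE_mu3_generic
 proof eventually_elim
  case (elim t)
  obtain x y z where t: "t = (x, y, z)" by (cases t) auto
  have d: "x ~= y" "x ~= z" "y ~= z" using elim by (auto simp: t)
  have "(\<lambda>m. 1 - g (pi - largest_angle (rnd m x) (rnd m y) (rnd m z))) \<longlonglongrightarrow> 1 - g (pi - largest_angle x y z)"
   by (intro tendsto_diff tendsto_const continuous_on_tendsto_compose[OF g] tendsto_largest_angle tendsto_rnd d) auto
  moreover have "eventually (\<lambda>m. inj_on (rnd m) {x, y, z}) sequentially"
   by (rule eventually_inj_on) (auto intro: tendsto_rnd)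
  then have "eventually (\<lambda>m. 1 - g (pi - largest_angle (rnd m x) (rnd m y) (rnd m z)) = defect g (rnd m x, rnd m y, rnd m z)) sequentially"
   by eventually_elim (use d in \<open>auto simp: defect_triple inj_on_def\<close>)
  ultimately show ?case using d by (auto simp: t defect_triple intro: Lim_transform_eventually)
 qed
qed simp

text \<open>Occupation probabilities may be replaced by the means of the cells, which are uniformly small;
 with the means in their place the sum is an integral over rounded points.\<close>

lemma poisson_mean_tendsto:
 fixes cc :: "nat => nat => real^2" and N :: "nat => nat"
 assumes g1: "\<And>x. norm (g x) <= 1" and g: "continuous_on UNIV g" and t: "0 < t"
  and cc: "\<And>m. bij_betw (cc m) {..<N m} (rnd m ` K)"
 shows "(\<lambda>m. \<Sum>I\<in>triples_of {..<N m}. (1 - g (deficit (cc m ` I))) * of_real (\<Prod>i\<in>I. 1 - exp (- (t * measure \<mu> (cell m (cc m i))))))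
   \<longlonglongrightarrow> of_real (t ^ 3 / 6) * expected_defect g"
proof -
 define w where "w m i = t * measure \<mu> (cell m (cc m i))" for m i
 define p where "p m i = 1 - exp (- w m i)" for m i
 define k where "k m = t * (8 * sup_dens * rad / 2 ^ m)" for m :: nat
 let ?S = "\<lambda>m. \<Sum>I\<in>triples_of {..<N m}. (1 - g (deficit (cc m ` I))) * of_real (\<Prod>i\<in>I. p m i)"
 let ?W = "\<lambda>m. \<Sum>I\<in>triples_of {..<N m}. (1 - g (deficit (cc m ` I))) * of_real (\<Prod>i\<in>I. w m i)"
 have w: "0 <= w m i" "w m i <= k m" for m i
 proof -
  show "0 <= w m i" using t by (simp add: w_def)
  show "w m i <= k m" unfolding w_def k_def using t by (intro mult_left_mono measure_cell_le) simp
 qed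
 have k0: "k \<longlonglongrightarrow> 0"
 proof -
  have "k = (\<lambda>m. (t * (8 * sup_dens * rad)) * (1 / 2) ^ m)" by (simp add: k_def fun_eq_iff power_one_over)
  then show ?thesis by (simp add: LIMSEQ_power_zero tendsto_mult_right_zero)
 qed
 have "?W m = of_real (t ^ 3 / 6) * (\<integral>(x, y, z). defect g (rnd m x, rnd m y, rnd m z) \<partial>mu3)" for m
 proof -
  have "(\<Prod>i\<in>I. w m i) = t ^ 3 * (\<Prod>i\<in>I. measure \<mu> (cell m (cc m i)))" if "I \<in> triples_of {..<N m}" for I
   using that by (simp add: w_def prod.distrib triples_of_def)
  then have "?W m = of_real (t ^ 3) * (\<Sum>I\<in>triples_of {..<N m}. (1 - g (deficit (cc m ` I))) * of_real (\<Prod>i\<in>I. measure \<mu> (cell m (cc m i))))"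
   by (simp add: sum_distrib_left algebra_simps)
  then show ?thesis unfolding rounded_mean[OF g1 cc] by simp
 qed
 then have W_eq: "?W = (\<lambda>m. of_real (t ^ 3 / 6) * (\<integral>(x, y, z). defect g (rnd m x, rnd m y, rnd m z) \<partial>mu3))"
  by (rule ext)
 have Wlim: "?W \<longlonglongrightarrow> of_real (t ^ 3 / 6) * expected_defect g"
  unfolding W_eq by (intro tendsto_mult_left rounded_mean_tendsto g1 g)
 \<comment> \<open>The cells are disjoint, so their means sum to at most \<open>t\<close>.\<close>
 have total: "(\<Sum>I\<in>triples_of {..<N m}. \<Prod>i\<in>I. w m i) <= t ^ 3" for m
 proof -
  let ?V = "{..<N m}"
  have "(\<Sum>I\<in>triples_of ?V. \<Prod>i\<in>I. w m i) <= 6 *\<^sub>R (\<Sum>I\<in>triples_of ?V. \<Prod>i\<in>I. w m i)"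
   using w sum_nonneg[of "triples_of ?V" "\<lambda>I. \<Prod>i\<in>I. w m i"] by (simp add: prod_nonneg)
  also have "... = (\<Sum>(i, j, l)\<in>distinct_triples ?V. \<Prod>i\<in>{i, j, l}. w m i)"
   by (rule sum_distinct_triples[symmetric]) simp
  also have "... = (\<Sum>(i, j, l)\<in>distinct_triples ?V. w m i * (w m j * w m l))"
   by (intro sum.cong) (auto simp: distinct_triples_def)
  also have "... <= (\<Sum>(i, j, l)\<in>?V \<times> ?V \<times> ?V. w m i * (w m j * w m l))"
   using w by (intro sum_mono2) (auto simp: distinct_triples_def)
  also have "... = (\<Sum>i\<in>?V. w m i) * ((\<Sum>j\<in>?V. w m j) * (\<Sum>l\<in>?V. w m l))"
   by (simp add: sum_product sum.cartesian_product case_prod_beta')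
  also have "... <= t * (t * t)"
  proof -
   have "(\<Sum>i\<in>?V. w m i) = t * measure \<mu> (\<Union>i\<in>?V. cell m (cc m i))"
    using sum_measure_cells[of ?V "cc m" m] cc[of m] by (simp add: w_def sum_distrib_left[symmetric] bij_betw_def)
   also have "... <= t * 1" using t by (intro mult_left_mono) auto
   finally have "(\<Sum>i\<in>?V. w m i) <= t" by simp
   moreover have "0 <= (\<Sum>i\<in>?V. w m i)" using w by (intro sum_nonneg)
   ultimately show ?thesis using t by (intro mult_mono) auto
  qed
  finally show ?thesis by (simp add: power3_eq_cube)
 qed
 have "(\<lambda>m. ?S m - ?W m) \<longlonglongrightarrow> 0"
 proof (rule Lim_null_comparison[where g="\<lambda>m. 2 * (3 * k m * t ^ 3)"])
  show "(\<lambda>m. 2 * (3 * k m * t ^ 3)) \<longlonglongrightarrow> 0" by (intro tendsto_mult_right_zero tendsto_mult_left_zero k0)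
  have "eventually (\<lambda>m. k m < 1) sequentially" using k0 by (rule order_tendstoD) simp
  then show "eventually (\<lambda>m. norm (?S m - ?W m) <= 2 * (3 * k m * t ^ 3)) sequentially"
  proof eventually_elim
   case (elim m)
   have km: "0 <= k m" "k m <= 1" using w[of m 0] elim by auto
   have "norm (?S m - ?W m) = norm (\<Sum>I\<in>triples_of {..<N m}. (1 - g (deficit (cc m ` I))) * of_real ((\<Prod>i\<in>I. p m i) - (\<Prod>i\<in>I. w m i)))"
    by (simp add: sum_subtractf[symmetric] right_diff_distrib)
   also have "... <= (\<Sum>I\<in>triples_of {..<N m}. 2 * (3 * k m * (\<Prod>i\<in>I. w m i)))"
   proof (rule order_trans[OF norm_sum sum_mono])
    fix I assume "I \<in> triples_of {..<N m}"
    then have I: "card I = 3" "finite I" by (auto simp: triples_of_def intro: finite_subset)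
    have "(\<Prod>i\<in>I. w m i) - (\<Prod>i\<in>I. p m i) <= real (card I) * k m * (\<Prod>i\<in>I. w m i)"
     "(\<Prod>i\<in>I. p m i) <= (\<Prod>i\<in>I. w m i)" using w km exp_defect_bounds[OF w(1)[of m]]
     by (auto intro!: prod_weights_close I simp: p_def)
    then have "\<bar>(\<Prod>i\<in>I. p m i) - (\<Prod>i\<in>I. w m i)\<bar> <= 3 * k m * (\<Prod>i\<in>I. w m i)" by (simp add: I abs_le_iff)
    moreover have "norm (1 - g (deficit (cc m ` I))) <= 2"
     using norm_triangle_ineq4[of 1 "g (deficit (cc m ` I))"] g1[of "deficit (cc m ` I)"] by simp
    ultimately show "norm ((1 - g (deficit (cc m ` I))) * of_real ((\<Prod>i\<in>I. p m i) - (\<Prod>i\<in>I. w m i))) <= 2 * (3 * k m * (\<Prod>i\<in>I. w m i))"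
     unfolding norm_mult norm_of_real by (intro mult_mono) auto
   qed
   also have "... = 2 * (3 * k m * (\<Sum>I\<in>triples_of {..<N m}. \<Prod>i\<in>I. w m i))" by (simp add: sum_distrib_left)
   also have "... <= 2 * (3 * k m * t ^ 3)" using km total by (intro mult_left_mono) auto
   finally show ?case .
  qed
 qed
 from tendsto_add[OF this Wlim] show ?thesis by (simp add: p_def w_def)
qed

text \<open>Let the mesh tend to \<open>0\<close>. Continuity of \<open>g\<close> makes both sides converge.\<close>

theorem poisson_mfun_bound:
 fixes g :: "real => complex"
 assumes pp: "poisson_process P (scale_measure (ennreal t) \<mu>) \<eta>" and t: "1 <= t"
  and g: "continuous_on UNIV g" and g1: "\<And>x. norm (g x) <= 1"
  and ge: "\<And>x. e < x ==> g x = 1" and gc: "\<And>x. norm (1 - g x) <= c" and e: "0 <= e"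
 shows "norm ((\<integral>w. mfun g (points (\<eta> w)) \<partial>P) - exp (- (of_real (t ^ 3 / 6) * expected_defect g)))
   <= 12 * t ^ 5 * (c * (C_line * e))\<^sup>2"
proof -
 have t0: "0 < t" using t by simp
 interpret P: prob_space P by (rule poisson_process_facts(1)[OF pp t0])
 have rfs: "random_finite_set P K (\<lambda>w. points (\<eta> w))" by (rule poisson_points_random_finite_set[OF pp t0])
 have bK: "bounded K" using compact_K by (rule compact_imp_bounded)
 have "\<exists>h. bij_betw h {..<card (rnd m ` K)} (rnd m ` K)" for m
  using ex_bij_betw_nat_finite[OF finite_rnd_image[OF bK], of m] by (simp add: atLeast0LessThan)
 then obtain cc where cc: "\<And>m. bij_betw (cc m) {..<card (rnd m ` K)} (rnd m ` K)" by metis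
 define S where "S m = (\<Sum>I\<in>triples_of {..<card (rnd m ` K)}. (1 - g (deficit (cc m ` I))) *
   of_real (\<Prod>i\<in>I. 1 - exp (- (t * measure \<mu> (cell m (cc m i))))))" for m
 have Slim: "S \<longlonglongrightarrow> of_real (t ^ 3 / 6) * expected_defect g"
  unfolding S_def by (rule poisson_mean_tendsto[OF g1 g t0 cc])
 have Elim: "(\<lambda>m. P.expectation (\<lambda>w. mfun g (rnd m ` points (\<eta> w)))) \<longlonglongrightarrow> P.expectation (\<lambda>w. mfun g (points (\<eta> w)))"
 proof (rule integral_dominated_convergence[where w="\<lambda>_. 1"])
  show "(\<lambda>w. mfun g (points (\<eta> w))) \<in> borel_measurable P" by (rule mfun_measurable[OF rfs bK g])
  show "(\<lambda>w. mfun g (rnd m ` points (\<eta> w))) \<in> borel_measurable P" for m by (rule mfun_rnd_measurable[OF rfs bK])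
  show "AE w in P. (\<lambda>m. mfun g (rnd m ` points (\<eta> w))) \<longlonglongrightarrow> mfun g (points (\<eta> w))"
   using rfs by (intro AE_I2 tendsto_mfun_image tendsto_rnd g) (auto simp: random_finite_set_def)
  show "AE w in P. norm (mfun g (rnd m ` points (\<eta> w))) <= 1" for m by (intro AE_I2 norm_mfun_le g1)
 qed simp
 have h: "(\<lambda>m. 2 / 2 ^ m :: real) \<longlonglongrightarrow> 0"
 proof -
  have "(\<lambda>m. 2 * (1 / 2) ^ m :: real) \<longlonglongrightarrow> 0" by (intro tendsto_mult_right_zero LIMSEQ_power_zero) simp
  then show ?thesis by (simp add: power_one_over)
 qed
 have "norm (P.expectation (\<lambda>w. mfun g (points (\<eta> w))) - exp (- (of_real (t ^ 3 / 6) * expected_defect g))) <=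
   12 * t ^ 3 * (t * (C_line * (e + 0)))\<^sup>2 * c\<^sup>2"
 proof (rule LIMSEQ_le)
  show "(\<lambda>m. norm (P.expectation (\<lambda>w. mfun g (rnd m ` points (\<eta> w))) - exp (- S m))) \<longlonglongrightarrow>
   norm (P.expectation (\<lambda>w. mfun g (points (\<eta> w))) - exp (- (of_real (t ^ 3 / 6) * expected_defect g)))"
   by (intro tendsto_intros Elim Slim)
  show "(\<lambda>m. 12 * t ^ 3 * (t * (C_line * (e + 2 / 2 ^ m)))\<^sup>2 * c\<^sup>2) \<longlonglongrightarrow> 12 * t ^ 3 * (t * (C_line * (e + 0)))\<^sup>2 * c\<^sup>2"
   by (intro tendsto_intros h)
  show "\<exists>M. \<forall>m\<ge>M. norm (P.expectation (\<lambda>w. mfun g (rnd m ` points (\<eta> w))) - exp (- S m)) <=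
    12 * t ^ 3 * (t * (C_line * (e + 2 / 2 ^ m)))\<^sup>2 * c\<^sup>2"
   unfolding S_def by (intro exI[of _ 1] allI impI poisson_mfun_rnd_bound[OF pp t g1 ge gc e _ cc])
 qed
 also have "... = 12 * t ^ 5 * (c * (C_line * e))\<^sup>2" by (simp add: power_mult_distrib flip: power_add)
 finally show ?thesis .
qed

end

section \<open>Counts of large angles\<close>

lemma norm_exp_minus_diff_le:
 fixes u v :: complex
 assumes "0 <= Re u" "0 <= Re v"
 shows "norm (exp (- u) - exp (- v)) <= norm (u - v)"
proof -
 have "norm (exp (- u) - exp (- v)) <= 1 * norm (u - v)"
 proof (rule field_differentiable_bound[where S="{z. 0 <= Re z}" and f'="\<lambda>z. - exp (- z)"])
  show "convex {z. 0 <= Re z}" by (rule convex_halfspace_Re_ge)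
  fix z :: complex assume z: "z \<in> {z. 0 <= Re z}"
  show "((\<lambda>z. exp (- z)) has_field_derivative - exp (- z)) (at z within {z. 0 <= Re z})"
   by (auto intro!: derivative_eq_intros)
  show "norm (- exp (- z)) <= 1" using z by (simp add: norm_exp_eq_Re)
 qed (use assms in auto)
 then show ?thesis by simp
qed

context lipschitz_density
begin

definition F_angle :: "real => real" where "F_angle a = measure mu3 (angle_event a)"

lemma F_angle_nonneg: "0 <= F_angle a" by (simp add: F_angle_def)

lemma expected_defect_step:
 "expected_defect (\<lambda>x. if 0 < x \<and> x <= a then z else 1) = (1 - z) * of_real (F_angle a)"
proof -
 have "expected_defect (\<lambda>x. if 0 < x \<and> x <= a then z else 1) = (\<integral>t. (1 - z) * of_real (indicat_real (angle_event a) t) \<partial>mu3)"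
  unfolding expected_defect_def
  by (intro lint_cong refl) (auto simp: defect_def angle_event_def indicator_def split: prod.splits)
 also have "... = (1 - z) * of_real (F_angle a)"
  unfolding F_angle_def using sets.sets_into_space[OF angle_event_sets, of a]
  by (simp add: Int_absorb2 del: of_real_indicator)
 finally show ?thesis .
qed

definition C_angle :: real where
 "C_angle = (SOME C. 0 < C \<and> (\<forall>e>0. \<bar>F_angle e - 6 * e * beta\<bar> <= C * e\<^sup>2))"

lemma C_angle: "0 < C_angle" "0 < e ==> \<bar>F_angle e - 6 * e * beta\<bar> <= C_angle * e\<^sup>2"
proof -
 have "\<exists>C. 0 < C \<and> (\<forall>e>0. \<bar>F_angle e - 6 * e * beta\<bar> <= C * e\<^sup>2)"
  using angle_event_asymptotics by (simp add: F_angle_def)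
 then have "0 < C_angle \<and> (\<forall>e>0. \<bar>F_angle e - 6 * e * beta\<bar> <= C_angle * e\<^sup>2)"
  unfolding C_angle_def by (rule someI_ex)
 then show "0 < C_angle" "0 < e ==> \<bar>F_angle e - 6 * e * beta\<bar> <= C_angle * e\<^sup>2" by auto
qed

text \<open>Since \<open>norm (1 - z) \<le> 2\<close> on the unit circle, one of the two factors can be given away. The
 generating functions of the Poisson laws with parameters \<open>l\<close> and \<open>l'\<close> differ by at most
 \<open>abs (l - l') * norm (1 - z)\<close>.\<close>

lemma count_kolmogorov:
 assumes P: "prob_space P" and W: "W \<in> P \<rightarrow>\<^sub>M count_space (UNIV :: nat set)"
  and B: "0 <= B" "0 <= l" "0 <= l'"
  and bound: "\<And>z :: complex. norm z = 1 ==> norm ((\<integral>w. z ^ W w \<partial>P) - exp (- (of_real l * (1 - z)))) <= B * (norm (1 - z))\<^sup>2"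
 shows "\<bar>measure P {w \<in> space P. W w < m} - exp (- l') * (\<Sum>i<m. l' ^ i / fact i)\<bar> <= 2 * (2 * B + \<bar>l - l'\<bar>)"
proof -
 interpret P: prob_space P by (rule P)
 show ?thesis
 proof (rule P.poisson_kolmogorov_bound[OF W B(3)])
  fix x :: real
  let ?z = "cis x"
  have le2: "norm (1 - ?z) <= 2" using norm_triangle_ineq4[of 1 ?z] by simp
  have Re: "0 <= Re (1 - ?z)" by simp
  have "norm (P.expectation (\<lambda>w. ?z ^ W w) - exp (- (of_real l * (1 - ?z)))) <= B * (norm (1 - ?z))\<^sup>2"
   by (rule bound) simp
  also have "... <= B * (2 * norm (1 - ?z))"
   using B le2 unfolding power2_eq_square by (intro mult_left_mono mult_right_mono) auto
  finally have 1: "norm (P.expectation (\<lambda>w. ?z ^ W w) - exp (- (of_real l * (1 - ?z)))) <= B * (2 * norm (1 - ?z))" .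
  have "norm (exp (- (of_real l * (1 - ?z))) - exp (- (of_real l' * (1 - ?z)))) <= norm (of_real l * (1 - ?z) - of_real l' * (1 - ?z))"
   using B Re by (intro norm_exp_minus_diff_le) auto
  also have "... = norm (of_real (l - l') * (1 - ?z))" by (simp add: left_diff_distrib)
  also have "... = \<bar>l - l'\<bar> * norm (1 - ?z)" by (simp only: norm_mult norm_of_real)
  finally have 2: "norm (exp (- (of_real l * (1 - ?z))) - exp (- (of_real l' * (1 - ?z)))) <= \<bar>l - l'\<bar> * norm (1 - ?z)" .
  have "P.expectation (\<lambda>w. ?z ^ W w) - exp (of_real l' * (?z - 1)) =
   (P.expectation (\<lambda>w. ?z ^ W w) - exp (- (of_real l * (1 - ?z)))) + (exp (- (of_real l * (1 - ?z))) - exp (- (of_real l' * (1 - ?z))))"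
   by (simp add: algebra_simps)
  then have "norm (P.expectation (\<lambda>w. ?z ^ W w) - exp (of_real l' * (?z - 1))) <= B * (2 * norm (1 - ?z)) + \<bar>l - l'\<bar> * norm (1 - ?z)"
   using 1 2 norm_triangle_mono by metis
  then show "norm (P.expectation (\<lambda>w. ?z ^ W w) - exp (of_real l' * (?z - 1))) <= (2 * B + \<bar>l - l'\<bar>) * norm (1 - ?z)"
   by (simp add: algebra_simps)
 qed
qed

lemma binomial_random_finite_set:
 assumes X: "\<And>i. i < n ==> X i \<in> P \<rightarrow>\<^sub>M \<mu>"
 shows "random_finite_set P K (\<lambda>w. (\<lambda>i. X i w) ` {..<n :: nat})"
 unfolding random_finite_set_def
proof (intro conjI ballI)
 fix w assume "w \<in> space P"
 then show "(\<lambda>i. X i w) ` {..<n} \<subseteq> K" using measurable_space[OF X] by auto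
next
 fix B :: "(real^2) set" assume B: "B \<in> sets borel"
 have eq: "{w \<in> space P. (\<lambda>i. X i w) ` {..<n} \<inter> B ~= {}} = (\<Union>i\<in>{..<n}. X i -` (B \<inter> K) \<inter> space P)"
  using measurable_space[OF X] by auto
 have "X i -` (B \<inter> K) \<inter> space P \<in> sets P" if "i \<in> {..<n}" for i
  using X that B by (intro measurable_sets[of "X i" P \<mu>]) (auto simp: sets_\<mu>_iff)
 then show "{w \<in> space P. (\<lambda>i. X i w) ` {..<n} \<inter> B ~= {}} \<in> sets P" unfolding eq by (intro sets.finite_UN) auto
qed auto

lemma binomial_process_points:
 assumes "\<And>i. i < n ==> x i \<in> K"
 shows "points (distr (count_space {..<n :: nat}) \<mu> x) = x ` {..<n}"
proof -
 have x: "x \<in> count_space {..<n} \<rightarrow>\<^sub>M \<mu>" using assms by auto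
 have em: "emeasure (distr (count_space {..<n}) \<mu> x) {y} = of_nat (card (x -` {y} \<inter> {..<n}))" if "y \<in> K" for y
 proof -
  have "{y} \<in> sets \<mu>" using that by (simp add: sets_\<mu>_iff)
  then show ?thesis using x by (simp add: emeasure_distr)
 qed
 have "y \<in> points (distr (count_space {..<n}) \<mu> x) \<longleftrightarrow> y \<in> x ` {..<n}" for y
 proof (cases "y \<in> K")
  case True
  then have "y \<in> points (distr (count_space {..<n}) \<mu> x) \<longleftrightarrow> card (x -` {y} \<inter> {..<n}) ~= 0"
   by (simp add: points_def em)
  also have "... \<longleftrightarrow> y \<in> x ` {..<n}" by auto
  finally show ?thesis .
 next
  case False
  then show ?thesis using assms by (auto simp: points_def)
 qed
 then show ?thesis by blast
qed

lemma binomial_process_rep: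
 assumes "binomial_process P \<mu> n \<zeta>"
 obtains X where "prob_space P" "prob_space.indep_vars P (\<lambda>_. \<mu>) X {..<n}" "\<And>i. i < n ==> distr P \<mu> (X i) = \<mu>"
  "\<And>i. i < n ==> X i \<in> P \<rightarrow>\<^sub>M \<mu>" "\<And>w. w \<in> space P ==> points (\<zeta> w) = (\<lambda>i. X i w) ` {..<n}"
proof -
 obtain X where P: "prob_space P" and X: "prob_space.indep_vars P (\<lambda>_. \<mu>) X {..<n}" "\<forall>i<n. distr P \<mu> (X i) = \<mu>"
   "\<forall>w\<in>space P. \<zeta> w = distr (count_space {..<n}) \<mu> (\<lambda>i. X i w)"
  using assms by (auto simp: binomial_process_def)
 interpret P: prob_space P by (rule P)
 have Xm: "X i \<in> P \<rightarrow>\<^sub>M \<mu>" if "i < n" for i using X(1) that by (auto simp: P.indep_vars_def)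
 have "points (\<zeta> w) = (\<lambda>i. X i w) ` {..<n}" if "w \<in> space P" for w
  using X(3) that measurable_space[OF Xm that] by (simp add: binomial_process_points)
 then show ?thesis using that P X Xm by blast
qed

lemma choose3_real: "real (n choose 3) = real n * (real n - 1) * (real n - 2) / 6"
proof -
 consider "n = 0" | "n = 1" | "n = 2" | "3 <= n" by linarith
 then show ?thesis
 proof cases
  case 4
  have "real (n choose 3) = real n gchoose 3" by (simp add: binomial_gbinomial)
  also have "... = real n * (real n - 1) * (real n - 2) / 6"
   by (simp add: gbinomial_prod_rev numeral_3_eq_3 atLeast0_lessThan_Suc algebra_simps)
  finally show ?thesis .
 qed (simp_all add: binomial_eq_0)
qed

lemma choose3_bounds:
 assumes "1 <= n"
 shows "real (n choose 3) <= real n ^ 3 / 6" "real n ^ 3 / 6 - real n ^ 2 / 2 <= real (n choose 3)"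
proof -
 have n: "1 <= real n" using assms by simp
 have "real n * (real n - 1) * (real n - 2) = real n ^ 3 - 3 * real n ^ 2 + 2 * real n"
  by (simp add: power2_eq_square power3_eq_cube algebra_simps)
 then have eq: "real (n choose 3) = (real n ^ 3 - 3 * real n ^ 2 + 2 * real n) / 6" by (simp only: choose3_real)
 have "real n * 1 <= real n * real n" using n by (intro mult_left_mono) auto
 then have "real n <= real n ^ 2" by (simp add: power2_eq_square)
 moreover have "0 <= real n" by simp
 ultimately show "real (n choose 3) <= real n ^ 3 / 6" "real n ^ 3 / 6 - real n ^ 2 / 2 <= real (n choose 3)"
  unfolding eq atomize_conj by argo
qed

text \<open>With \<open>a = y / n ^ 3\<close> the mean number of flat triangles is
 \<open>(n choose 3) * (6 * a * beta + O (a\<^sup>2)) = beta * y + O (1 / n)\<close>; replacing \<open>n choose 3\<close> by \<open>n ^ 3 / 6\<close>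
 costs the term with \<open>6 * beta * y\<close>.\<close>

theorem binomial_count_bound:
 assumes bp: "binomial_process P \<mu> n \<zeta>" and n: "1 <= n" and y: "0 < y"
 shows "\<bar>measure P {w \<in> space P. angle_count (y / real n ^ 3) (points (\<zeta> w)) < m} - exp (- (beta * y)) * (\<Sum>i<m. (beta * y) ^ i / fact i)\<bar>
  <= (24 * (C_line * y)\<^sup>2 + 6 * beta * y + C_angle * y\<^sup>2) / real n"
proof -
 obtain X where X: "prob_space P" "prob_space.indep_vars P (\<lambda>_. \<mu>) X {..<n}" "\<And>i. i < n ==> distr P \<mu> (X i) = \<mu>"
  "\<And>i. i < n ==> X i \<in> P \<rightarrow>\<^sub>M \<mu>" "\<And>w. w \<in> space P ==> points (\<zeta> w) = (\<lambda>i. X i w) ` {..<n}"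
  using bp by (rule binomial_process_rep) blast
 have n0: "0 < real n" "1 <= real n" using n by auto
 define a where "a = y / real n ^ 3"
 have a: "0 < a" using y n0 by (simp add: a_def)
 define W where "W w = angle_count a ((\<lambda>i. X i w) ` {..<n})" for w
 define l where "l = real (n choose 3) * F_angle a"
 have bK: "bounded K" using compact_K by (rule compact_imp_bounded)
 have rfs: "random_finite_set P K (\<lambda>w. (\<lambda>i. X i w) ` {..<n})" by (rule binomial_random_finite_set[OF X(4)])
 have W: "W \<in> P \<rightarrow>\<^sub>M count_space UNIV" unfolding W_def by (rule angle_count_measurable[OF rfs bK])
 have bnd: "norm ((\<integral>w. z ^ W w \<partial>P) - exp (- (of_real l * (1 - z)))) <= (6 * real n ^ 5 * (C_line * a)\<^sup>2) * (norm (1 - z))\<^sup>2"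
  if z: "norm z = 1" for z :: complex
 proof -
  let ?g = "\<lambda>x. if 0 < x \<and> x <= a then z else 1"
  have mf: "mfun ?g ((\<lambda>i. X i w) ` {..<n}) = z ^ W w" for w unfolding W_def by (rule mfun_power) simp
  have meas: "(\<lambda>w. z ^ W w) \<in> borel_measurable P" by (rule measurable_compose[OF W]) simp
  have "norm ((\<integral>w. mfun ?g ((\<lambda>i. X i w) ` {..<n}) \<partial>P) - exp (- (of_nat (n choose 3) * expected_defect ?g)))
   <= 6 * real n ^ 5 * (norm (1 - z) * (C_line * a))\<^sup>2"
  proof (rule binomial_mfun_bound[OF X(1-3), where e=a])
   show "(\<lambda>w. mfun ?g ((\<lambda>i. X i w) ` {..<n})) \<in> borel_measurable P" unfolding mf by (rule meas)
  qed (use z a in auto)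
  then show ?thesis unfolding mf expected_defect_step by (simp add: l_def power_mult_distrib algebra_simps)
 qed
 have l0: "0 <= l" by (simp add: l_def F_angle_nonneg)
 have by0: "0 <= beta * y" using beta_nonneg y by simp
 have B0: "0 <= 6 * real n ^ 5 * (C_line * a)\<^sup>2" by simp
 have "\<bar>measure P {w \<in> space P. W w < m} - exp (- (beta * y)) * (\<Sum>i<m. (beta * y) ^ i / fact i)\<bar> <=
   2 * (2 * (6 * real n ^ 5 * (C_line * a)\<^sup>2) + \<bar>l - beta * y\<bar>)"
  by (rule count_kolmogorov[OF X(1) W B0 l0 by0 bnd])
 also have "6 * real n ^ 5 * (C_line * a)\<^sup>2 = 6 * (C_line * y)\<^sup>2 / real n"
  using n0 by (simp add: a_def power_mult_distrib power_divide field_simps flip: power_mult power_add power_Suc2, (simp add: eval_nat_numeral)?)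
 also have "\<bar>l - beta * y\<bar> <= (3 * beta * y + C_angle * y\<^sup>2 / 2) / real n"
 proof -
  let ?c = "real (n choose 3)"
  have c: "0 <= ?c" by simp
  have "\<bar>l - ?c * (6 * a * beta)\<bar> = ?c * \<bar>F_angle a - 6 * a * beta\<bar>"
   by (simp add: l_def right_diff_distrib[symmetric] abs_mult)
  also have "... <= (real n ^ 3 / 6) * (C_angle * a\<^sup>2)"
   using choose3_bounds(1)[OF n] C_angle(2)[OF a] by (intro mult_mono) auto
  also have "... = C_angle * y\<^sup>2 / (6 * real n ^ 3)"
   using n0 by (simp add: a_def power_divide field_simps flip: power_mult power_add power_Suc2, (simp add: eval_nat_numeral)?)
  also have "... <= C_angle * y\<^sup>2 / (2 * real n)"
  proof (rule divide_left_mono)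
   have "real n * 1 <= real n * (real n * real n)"
    using n0 mult_mono[of 1 "real n" 1 "real n"] by (intro mult_left_mono) auto
   then show "2 * real n <= 6 * real n ^ 3" using n0 by (simp add: power3_eq_cube)
  qed (use C_angle(1) n0 in auto)
  finally have 1: "\<bar>l - ?c * (6 * a * beta)\<bar> <= C_angle * y\<^sup>2 / (2 * real n)" .
  have ba: "0 <= 6 * a * beta" using a beta_nonneg by simp
  have e1: "(real n ^ 3 / 6) * (6 * a * beta) = beta * y" using n0 by (simp add: a_def)
  have e2: "(real n ^ 2 / 2) * (6 * a * beta) = 3 * beta * y / real n"
   using n0 by (simp add: a_def field_simps power2_eq_square power3_eq_cube)
  have "?c * (6 * a * beta) <= (real n ^ 3 / 6) * (6 * a * beta)"
   using choose3_bounds(1)[OF n] ba by (rule mult_right_mono)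
  moreover have "(real n ^ 3 / 6 - real n ^ 2 / 2) * (6 * a * beta) <= ?c * (6 * a * beta)"
   using choose3_bounds(2)[OF n] ba by (rule mult_right_mono)
  ultimately have "\<bar>?c * (6 * a * beta) - beta * y\<bar> <= 3 * beta * y / real n"
   unfolding left_diff_distrib e1 e2 by linarith
  then have "\<bar>l - beta * y\<bar> <= 3 * beta * y / real n + C_angle * y\<^sup>2 / (2 * real n)" using 1 by linarith
  then show ?thesis by (simp add: add_divide_distrib)
 qed
 finally have "\<bar>measure P {w \<in> space P. W w < m} - exp (- (beta * y)) * (\<Sum>i<m. (beta * y) ^ i / fact i)\<bar> <=
   2 * (2 * (6 * (C_line * y)\<^sup>2 / real n) + (3 * beta * y + C_angle * y\<^sup>2 / 2) / real n)" by simp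
 also have "... = (24 * (C_line * y)\<^sup>2 + 6 * beta * y + C_angle * y\<^sup>2) / real n"
  using n0 by (simp add: field_simps)
 finally have "\<bar>measure P {w \<in> space P. W w < m} - exp (- (beta * y)) * (\<Sum>i<m. (beta * y) ^ i / fact i)\<bar> <= (24 * (C_line * y)\<^sup>2 + 6 * beta * y + C_angle * y\<^sup>2) / real n" .
 moreover have "{w \<in> space P. W w < m} = {w \<in> space P. angle_count (y / real n ^ 3) (points (\<zeta> w)) < m}"
  using X(5) by (auto simp: W_def a_def)
 ultimately show ?thesis by simp
qed

text \<open>The product formula for Poisson processes needs a continuous \<open>g\<close>, so the step function is
 approximated by bumps first.\<close>

theorem poisson_count_bound:
 assumes pp: "poisson_process P (scale_measure (ennreal t) \<mu>) \<eta>" and t: "1 <= t" and y: "0 < y"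
 shows "\<bar>measure P {w \<in> space P. angle_count (y / t ^ 3) (points (\<eta> w)) < m} - exp (- (beta * y)) * (\<Sum>i<m. (beta * y) ^ i / fact i)\<bar>
  <= (48 * (C_line * y)\<^sup>2 + C_angle * y\<^sup>2) / t"
proof -
 have t0: "0 < t" using t by simp
 have P: "prob_space P" by (rule poisson_process_facts(1)[OF pp t0])
 interpret P: prob_space P by (rule P)
 define a where "a = y / t ^ 3"
 have a: "0 < a" using y t0 by (simp add: a_def)
 have bK: "bounded K" using compact_K by (rule compact_imp_bounded)
 have rfs: "random_finite_set P K (\<lambda>w. points (\<eta> w))" by (rule poisson_points_random_finite_set[OF pp t0])
 define W where "W w = angle_count a (points (\<eta> w))" for w
 have W: "W \<in> P \<rightarrow>\<^sub>M count_space UNIV" unfolding W_def by (rule angle_count_measurable[OF rfs bK])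
 define l where "l = t ^ 3 / 6 * F_angle a"
 have bnd: "norm ((\<integral>w. z ^ W w \<partial>P) - exp (- (of_real l * (1 - z)))) <= (12 * t ^ 5 * (C_line * a)\<^sup>2) * (norm (1 - z))\<^sup>2"
  if z: "norm z = 1" for z :: complex
 proof -
  define g where "g k x = 1 - of_real (bump a (Suc k) x) * (1 - z)" for k x
  let ?g = "\<lambda>x. if 0 < x \<and> x <= a then z else 1"
  have glim: "(\<lambda>k. g k x) \<longlonglongrightarrow> ?g x" for x
  proof -
   have "(\<lambda>k. g k x) \<longlonglongrightarrow> 1 - of_real (if 0 < x \<and> x <= a then 1 else 0) * (1 - z)"
    unfolding g_def by (intro tendsto_intros LIMSEQ_Suc[OF tendsto_bump])
   then show ?thesis by (auto split: if_splits)
  qed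
  have g1: "norm (g k x) <= 1" for k x
   unfolding g_def using z bump_bounds by (intro norm_one_minus_scaleR_le_1) auto
  have gcont: "continuous_on UNIV (g k)" for k
   unfolding g_def by (intro continuous_intros continuous_on_of_real bump_cont)
  have gc: "norm (1 - g k x) <= norm (1 - z)" for k x
   using bump_bounds[of a "Suc k" x] by (simp add: g_def norm_mult mult_left_le_one_le)
  have ge: "g k x = 1" if "a + 1 / real (Suc k) < x" for k x
   using bump_zero[of "Suc k" a x] that by (simp add: g_def)
  have mf: "mfun ?g (points (\<eta> w)) = z ^ W w" if "w \<in> space P" for w
   unfolding W_def using rfs that by (intro mfun_power) (simp add: random_finite_set_def)
  have Elim: "(\<lambda>k. P.expectation (\<lambda>w. mfun (g k) (points (\<eta> w)))) \<longlonglongrightarrow> P.expectation (\<lambda>w. z ^ W w)"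
  proof (rule integral_dominated_convergence[where w="\<lambda>_. 1"])
   show "(\<lambda>w. z ^ W w) \<in> borel_measurable P" by (rule measurable_compose[OF W]) simp
   show "(\<lambda>w. mfun (g k) (points (\<eta> w))) \<in> borel_measurable P" for k by (rule mfun_measurable[OF rfs bK gcont])
   show "AE w in P. (\<lambda>k. mfun (g k) (points (\<eta> w))) \<longlonglongrightarrow> z ^ W w"
   proof (intro AE_I2)
    fix w assume "w \<in> space P"
    have "(\<lambda>k. mfun (g k) (points (\<eta> w))) \<longlonglongrightarrow> mfun ?g (points (\<eta> w))" by (rule tendsto_mfun) (rule glim)
    with mf[OF \<open>w \<in> space P\<close>] show "(\<lambda>k. mfun (g k) (points (\<eta> w))) \<longlonglongrightarrow> z ^ W w" by simp
   qed
   show "AE w in P. norm (mfun (g k) (points (\<eta> w))) <= 1" for k by (intro AE_I2 norm_mfun_le g1)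
  qed simp
  have Dlim: "(\<lambda>k. expected_defect (g k)) \<longlonglongrightarrow> expected_defect ?g" unfolding expected_defect_def
  proof (rule integral_dominated_convergence[where w="\<lambda>_. 2"])
   show "defect (g k) \<in> borel_measurable mu3" for k
    by (intro defect_measurable borel_measurable_continuous_onI gcont)
   show "defect ?g \<in> borel_measurable mu3" by (intro defect_measurable) measurable
   show "AE t in mu3. (\<lambda>k. defect (g k) t) \<longlonglongrightarrow> defect ?g t"
   proof (intro AE_I2)
    fix t
    show "(\<lambda>k. defect (g k) t) \<longlonglongrightarrow> defect ?g t"
    proof (cases "fst t ~= fst (snd t) \<and> fst t ~= snd (snd t) \<and> fst (snd t) ~= snd (snd t)")
     case True
     have "(\<lambda>k. 1 - g k x) \<longlonglongrightarrow> 1 - ?g x" for x by (intro tendsto_diff tendsto_const glim)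
     then show ?thesis unfolding defect_def by (simp only: True if_True simp_thms)
    qed (simp only: defect_def if_False tendsto_const)
   qed
   show "AE t in mu3. norm (defect (g k) t) <= 2" for k by (intro AE_I2 norm_defect_le g1)
  qed simp
  have "norm (P.expectation (\<lambda>w. z ^ W w) - exp (- (of_real (t ^ 3 / 6) * expected_defect ?g))) <=
    12 * t ^ 5 * (norm (1 - z) * (C_line * (a + 0)))\<^sup>2"
  proof (rule LIMSEQ_le)
   show "(\<lambda>k. norm (P.expectation (\<lambda>w. mfun (g k) (points (\<eta> w))) - exp (- (of_real (t ^ 3 / 6) * expected_defect (g k))))) \<longlonglongrightarrow>
    norm (P.expectation (\<lambda>w. z ^ W w) - exp (- (of_real (t ^ 3 / 6) * expected_defect ?g)))"
    by (intro tendsto_intros Elim Dlim)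
   show "(\<lambda>k. 12 * t ^ 5 * (norm (1 - z) * (C_line * (a + 1 / real (Suc k))))\<^sup>2) \<longlonglongrightarrow> 12 * t ^ 5 * (norm (1 - z) * (C_line * (a + 0)))\<^sup>2"
    by (intro tendsto_intros LIMSEQ_Suc[OF lim_1_over_n])
   show "\<exists>N. \<forall>k\<ge>N. norm (P.expectation (\<lambda>w. mfun (g k) (points (\<eta> w))) - exp (- (of_real (t ^ 3 / 6) * expected_defect (g k)))) <=
     12 * t ^ 5 * (norm (1 - z) * (C_line * (a + 1 / real (Suc k))))\<^sup>2"
    using a by (intro exI[of _ 0] allI impI poisson_mfun_bound[OF pp t gcont g1 ge gc]) auto
  qed
  then show ?thesis unfolding expected_defect_step by (simp add: l_def power_mult_distrib algebra_simps)
 qed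
 have l0: "0 <= l" using t0 by (simp add: l_def F_angle_nonneg)
 have by0: "0 <= beta * y" using beta_nonneg y by simp
 have B0: "0 <= 12 * t ^ 5 * (C_line * a)\<^sup>2" using t0 by simp
 have "\<bar>measure P {w \<in> space P. W w < m} - exp (- (beta * y)) * (\<Sum>i<m. (beta * y) ^ i / fact i)\<bar> <=
   2 * (2 * (12 * t ^ 5 * (C_line * a)\<^sup>2) + \<bar>l - beta * y\<bar>)" by (rule count_kolmogorov[OF P W B0 l0 by0 bnd])
 also have "12 * t ^ 5 * (C_line * a)\<^sup>2 = 12 * (C_line * y)\<^sup>2 / t"
  using t0 by (simp add: a_def power_mult_distrib power_divide field_simps flip: power_mult power_add power_Suc2, (simp add: eval_nat_numeral)?)
 also have "\<bar>l - beta * y\<bar> <= C_angle * y\<^sup>2 / 2 / t"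
 proof -
  have "beta * y = t ^ 3 / 6 * (6 * a * beta)" using t0 by (simp add: a_def)
  then have "\<bar>l - beta * y\<bar> = t ^ 3 / 6 * \<bar>F_angle a - 6 * a * beta\<bar>"
   using t0 by (simp only: l_def right_diff_distrib[symmetric] abs_mult) simp
  also have "... <= t ^ 3 / 6 * (C_angle * a\<^sup>2)" using C_angle(2)[OF a] t0 by (intro mult_left_mono) auto
  also have "... = C_angle * y\<^sup>2 / (6 * t ^ 3)"
   using t0 by (simp add: a_def power_divide field_simps flip: power_mult power_add power_Suc2, (simp add: eval_nat_numeral)?)
  also have "... <= C_angle * y\<^sup>2 / (2 * t)"
  proof (rule divide_left_mono)
   have "t * 1 <= t * (t * t)" using t mult_mono[of 1 t 1 t] by (intro mult_left_mono) auto
   then show "2 * t <= 6 * t ^ 3" using t0 by (simp add: power3_eq_cube)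
  qed (use C_angle(1) t0 in auto)
  finally show ?thesis by simp
 qed
 finally have "\<bar>measure P {w \<in> space P. W w < m} - exp (- (beta * y)) * (\<Sum>i<m. (beta * y) ^ i / fact i)\<bar> <=
   2 * (2 * (12 * (C_line * y)\<^sup>2 / t) + C_angle * y\<^sup>2 / 2 / t)" by simp
 also have "... = (48 * (C_line * y)\<^sup>2 + C_angle * y\<^sup>2) / t" using t0 by (simp add: field_simps)
 finally show ?thesis by (simp add: W_def a_def)
qed

end

section \<open>Laplace functionals of the rescaled angle processes\<close>

text \<open>Only the masses of the intervals \<open>(0, x]\<close> enter, because these are what the asymptotics of large
 angles provides.\<close>

lemma riemann_stieltjes_error:
 fixes G :: "real => real"
 assumes s: "sets \<nu> = sets borel" and fin: "emeasure \<nu> {0<..R} < \<infinity>" and k: "0 < (k :: nat)" and R: "0 < R"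
  and G: "continuous_on UNIV G"
  and osc: "\<And>x y. 0 <= x ==> x <= R ==> 0 <= y ==> y <= R ==> \<bar>x - y\<bar> <= R / k ==> \<bar>G x - G y\<bar> <= e"
 shows "\<bar>(\<integral>x. indicator {0<..R} x * G x \<partial>\<nu>) -
   (\<Sum>i<k. G (real (Suc i) * R / k) * (measure \<nu> {0<..real (Suc i) * R / k} - measure \<nu> {0<..real i * R / k}))\<bar> <= e * measure \<nu> {0<..R}"
proof -
 define x where "x i = real i * R / k" for i :: nat
 have xm: "x i <= x (Suc i)" for i using R k by (simp add: x_def divide_right_mono)
 have x0: "x 0 = 0" and xk: "x k = R" using k by (auto simp: x_def)
 have xR: "0 <= x i" "x i <= R" if "i <= k" for i using that R k by (auto simp: x_def field_simps)
 define I where "I i = (\<lambda>y. indicat_real {0<..x (Suc i)} y - indicat_real {0<..x i} y)" for i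
 have I: "I i y = indicat_real {x i<..x (Suc i)} y" if "i < k" for i y
  using xm[of i] xR(1)[of i] that by (auto simp: I_def indicator_def)
 have tele: "(\<Sum>i<k. I i y) = indicat_real {0<..R} y" for y
  unfolding I_def by (subst sum_lessThan_telescope) (simp add: x0 xk)
 have [measurable]: "G \<in> borel_measurable \<nu>"
  using borel_measurable_continuous_onI[OF G] s by (simp cong: measurable_cong_sets)
 have sets [measurable]: "{0<..a} \<in> sets \<nu>" for a using s by simp
 have fin': "emeasure \<nu> {0<..x i} < \<infinity>" if "i <= k" for i
 proof -
  have "emeasure \<nu> {0<..x i} <= emeasure \<nu> {0<..R}" using xR(2)[OF that] by (intro emeasure_mono) auto
  then show ?thesis using fin by (rule le_less_trans)
 qed
 have int_ind: "integrable \<nu> (indicat_real {0<..x i})" if "i <= k" for i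
  using fin'[OF that] by (intro integrable_real_indicator) auto
 have int_ind_R: "integrable \<nu> (indicat_real {0<..R})" using fin by (intro integrable_real_indicator) auto
 have int_I: "integrable \<nu> (I i)" if "i < k" for i
  unfolding I_def using that by (intro Bochner_Integration.integrable_diff int_ind) auto
 have EI: "(\<integral>y. I i y \<partial>\<nu>) = measure \<nu> {0<..x (Suc i)} - measure \<nu> {0<..x i}" if "i < k" for i
  unfolding I_def using that int_ind[of i] int_ind[of "Suc i"] s by (subst Bochner_Integration.integral_diff) auto
 obtain B where B: "\<And>y. 0 <= y ==> y <= R ==> \<bar>G y\<bar> <= B"
 proof -
  have "compact (G ` {0..R})" by (intro compact_continuous_image continuous_on_subset[OF G]) auto
  then have "bounded (G ` {0..R})" by (rule compact_imp_bounded)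
  then obtain B where "\<forall>x\<in>{0..R}. \<bar>G x\<bar> <= B" by (auto simp: bounded_iff)
  then show ?thesis by (intro that[of B]) auto
 qed
 have intG: "integrable \<nu> (\<lambda>y. indicator {0<..R} y * G y)"
 proof (rule integrableI_bounded_set[where A="{0<..R}" and B=B])
  show "AE y in \<nu>. y \<in> {0<..R} --> norm (indicator {0<..R} y * G y) <= B"
   using B by (intro AE_I2) (auto simp: abs_mult)
 qed (use fin in auto)
 have intS: "integrable \<nu> (\<lambda>y. \<Sum>i<k. G (x (Suc i)) * I i y)"
  using int_I by (intro Bochner_Integration.integrable_sum integrable_mult_right) auto
 have "(\<Sum>i<k. G (x (Suc i)) * (measure \<nu> {0<..x (Suc i)} - measure \<nu> {0<..x i})) = (\<Sum>i<k. \<integral>y. G (x (Suc i)) * I i y \<partial>\<nu>)"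
  by (intro sum.cong refl) (simp add: EI)
 also have "... = (\<integral>y. (\<Sum>i<k. G (x (Suc i)) * I i y) \<partial>\<nu>)"
  using int_I by (intro Bochner_Integration.integral_sum[symmetric] integrable_mult_right) auto
 finally have "(\<integral>y. indicator {0<..R} y * G y \<partial>\<nu>) - (\<Sum>i<k. G (x (Suc i)) * (measure \<nu> {0<..x (Suc i)} - measure \<nu> {0<..x i})) =
   (\<integral>y. indicator {0<..R} y * G y - (\<Sum>i<k. G (x (Suc i)) * I i y) \<partial>\<nu>)" using intG intS by simp
 also have "\<bar>...\<bar> <= (\<integral>y. e * indicator {0<..R} y \<partial>\<nu>)" unfolding real_norm_def[symmetric]
 proof (rule norm_integral_le_integral)
  show "integrable \<nu> (\<lambda>y. e * indicator {0<..R} y)" using int_ind_R by simp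
  fix y
  have "indicator {0<..R} y * G y - (\<Sum>i<k. G (x (Suc i)) * I i y) = (\<Sum>i<k. (G y - G (x (Suc i))) * I i y)"
   by (simp add: tele[symmetric] sum_distrib_right sum_distrib_left left_diff_distrib right_diff_distrib sum_subtractf mult.commute)
  also have "norm ... <= (\<Sum>i<k. e * I i y)"
  proof (rule order_trans[OF norm_sum sum_mono])
   fix i assume "i \<in> {..<k}"
   then have i: "i < k" by simp
   show "norm ((G y - G (x (Suc i))) * I i y) <= e * I i y"
   proof (cases "y \<in> {x i<..x (Suc i)}")
    case True
    have "\<bar>y - x (Suc i)\<bar> <= x (Suc i) - x i" using True by auto
    also have "... = R / k" by (simp add: x_def diff_divide_distrib[symmetric] algebra_simps)
    finally have "\<bar>G y - G (x (Suc i))\<bar> <= e" using True xR[of i] xR[of "Suc i"] i by (intro osc) auto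
    then show ?thesis using True by (simp add: I[OF i])
   qed (simp add: I[OF i])
  qed
  also have "... = e * indicator {0<..R} y" by (simp add: sum_distrib_left[symmetric] tele)
  finally show "norm (indicator {0<..R} y * G y - (\<Sum>i<k. G (x (Suc i)) * I i y)) <= e * indicator {0<..R} y" .
 qed
 also have "... = e * measure \<nu> {0<..R}" using s by simp
 finally show ?thesis by (simp add: x_def)
qed

lemma integral_tendsto_of_cdf:
 fixes G :: "real => real" and \<nu> :: "'i => real measure"
 assumes s: "\<And>i. sets (\<nu> i) = sets borel" and fin: "\<And>i. emeasure (\<nu> i) {0<..R} < \<infinity>" and R: "0 < R"
  and G: "continuous_on UNIV G" and c: "\<And>i. 0 <= c i" and b: "0 <= b"
  and lim: "\<And>x. 0 <= x ==> ((\<lambda>i. c i * measure (\<nu> i) {0<..x}) \<longlongrightarrow> b * x) F"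
 shows "((\<lambda>i. c i * (\<integral>x. indicator {0<..R} x * G x \<partial>\<nu> i)) \<longlongrightarrow> b * (\<integral>x. indicator {0<..R} x * G x \<partial>lborel)) F"
proof (rule tendstoI)
 fix e0 :: real assume e0: "0 < e0"
 \<comment> \<open>The masses of \<open>(0, R]\<close> stay below \<open>b * R + 1\<close> eventually.\<close>
 define e where "e = e0 / (4 * (b * R + 1))"
 have bR: "0 <= b * R" using b R by simp
 have e: "0 < e" using e0 bR by (simp add: e_def)
 have "e0 / (4 * u) * u = e0 / 4" if "u ~= 0" for u using that by simp
 from this[of "b * R + 1"] bR have eb: "e * (b * R + 1) = e0 / 4" unfolding e_def by linarith
 have "uniformly_continuous_on {0..R} G"
  by (intro compact_uniformly_continuous continuous_on_subset[OF G]) auto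
 then obtain d where d: "0 < d" "\<And>x y. x \<in> {0..R} ==> y \<in> {0..R} ==> dist y x < d ==> dist (G y) (G x) < e"
  using e unfolding uniformly_continuous_on_def by metis
 obtain k :: nat where k: "R / d < real k" using reals_Archimedean2 by blast
 have "0 < R / d" using R d by simp
 then have "0 < real k" using k by linarith
 then have k0: "0 < k" by simp
 have "R / k < d" using k k0 d(1) by (simp add: field_simps)
 then have osc: "\<bar>G x - G y\<bar> <= e" if "0 <= x" "x <= R" "0 <= y" "y <= R" "\<bar>x - y\<bar> <= R / k" for x y
  using d(2)[of y x] that by (auto simp: dist_real_def)
 define S where "S m = (\<Sum>i<k. G (real (Suc i) * R / k) * (m (real (Suc i) * R / k) - m (real i * R / k)))" for m
 have S: "((\<lambda>i. S (\<lambda>x. c i * measure (\<nu> i) {0<..x})) \<longlongrightarrow> S (\<lambda>x. b * x)) F"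
  unfolding S_def using R by (intro tendsto_intros lim) auto
 have ev1: "eventually (\<lambda>i. dist (S (\<lambda>x. c i * measure (\<nu> i) {0<..x})) (S (\<lambda>x. b * x)) < e0 / 4) F"
  using e0 by (intro tendstoD[OF S]) auto
 have ev2: "eventually (\<lambda>i. c i * measure (\<nu> i) {0<..R} < b * R + 1) F"
  using R by (intro order_tendstoD(2)[OF lim]) auto
 have lb: "\<bar>b * (\<integral>x. indicator {0<..R} x * G x \<partial>lborel) - S (\<lambda>x. b * x)\<bar> <= e0 / 4"
 proof -
  have "\<bar>(\<integral>x. indicator {0<..R} x * G x \<partial>lborel) - (\<Sum>i<k. G (real (Suc i) * R / k) * (measure lborel {0<..real (Suc i) * R / k} - measure lborel {0<..real i * R / k}))\<bar> <= e * measure lborel {0<..R}"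
   using R by (intro riemann_stieltjes_error[OF _ _ k0 R G osc]) auto
  also have "(\<Sum>i<k. G (real (Suc i) * R / k) * (measure lborel {0<..real (Suc i) * R / k} - measure lborel {0<..real i * R / k})) = S (\<lambda>x. x)"
   unfolding S_def using R by (intro sum.cong refl) simp
  finally have "\<bar>(\<integral>x. indicator {0<..R} x * G x \<partial>lborel) - S (\<lambda>x. x)\<bar> <= e * R" using R by simp
  then have "b * \<bar>(\<integral>x. indicator {0<..R} x * G x \<partial>lborel) - S (\<lambda>x. x)\<bar> <= b * (e * R)" using b by (rule mult_left_mono)
  moreover have "b * (e * R) <= e0 / 4" using eb e by (simp add: algebra_simps)
  moreover have "S (\<lambda>x. b * x) = b * S (\<lambda>x. x)" unfolding S_def by (simp add: sum_distrib_left algebra_simps)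
  ultimately show ?thesis using b by (simp add: abs_mult right_diff_distrib[symmetric])
 qed
 from ev1 ev2
 show "eventually (\<lambda>i. dist (c i * (\<integral>x. indicator {0<..R} x * G x \<partial>\<nu> i)) (b * (\<integral>x. indicator {0<..R} x * G x \<partial>lborel)) < e0) F"
 proof eventually_elim
  case (elim i)
  have "\<bar>(\<integral>x. indicator {0<..R} x * G x \<partial>\<nu> i) - S (\<lambda>x. measure (\<nu> i) {0<..x})\<bar> <= e * measure (\<nu> i) {0<..R}"
   unfolding S_def by (rule riemann_stieltjes_error[OF s fin k0 R G osc])
  then have "c i * \<bar>(\<integral>x. indicator {0<..R} x * G x \<partial>\<nu> i) - S (\<lambda>x. measure (\<nu> i) {0<..x})\<bar> <= c i * (e * measure (\<nu> i) {0<..R})"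
   using c by (rule mult_left_mono)
  also have "... = e * (c i * measure (\<nu> i) {0<..R})" by simp
  also have "... <= e * (b * R + 1)" using elim(2) e by (intro mult_left_mono) auto
  finally have "c i * \<bar>(\<integral>x. indicator {0<..R} x * G x \<partial>\<nu> i) - S (\<lambda>x. measure (\<nu> i) {0<..x})\<bar> <= e0 / 4" by (simp only: eb)
  moreover have "S (\<lambda>x. c i * measure (\<nu> i) {0<..x}) = c i * S (\<lambda>x. measure (\<nu> i) {0<..x})"
   unfolding S_def by (simp add: sum_distrib_left algebra_simps)
  ultimately have "\<bar>c i * (\<integral>x. indicator {0<..R} x * G x \<partial>\<nu> i) - S (\<lambda>x. c i * measure (\<nu> i) {0<..x})\<bar> <= e0 / 4"
   using c[of i] by (simp add: abs_mult right_diff_distrib[symmetric])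
  then show ?case using elim(1) lb e0 unfolding dist_real_def by linarith
 qed
qed

context lipschitz_density
begin

definition angle_law :: "real => real measure" where
 "angle_law s = distr mu3 borel (\<lambda>t. s * (pi - largest_angle (fst t) (fst (snd t)) (snd (snd t))))"

lemma angle_law_facts:
 assumes s: "0 < s"
 shows "sets (angle_law s) = sets borel" "emeasure (angle_law s) A < \<infinity>"
  "measure (angle_law s) {0<..x} = F_angle (x / s)"
proof -
 show "sets (angle_law s) = sets borel" by (simp add: angle_law_def)
 have m: "(\<lambda>t. s * (pi - largest_angle (fst t) (fst (snd t)) (snd (snd t)))) \<in> borel_measurable mu3" by measurable
 interpret A: prob_space "angle_law s" unfolding angle_law_def by (rule mu3.P.prob_space_distr[OF m])
 show "emeasure (angle_law s) A < \<infinity>" by (simp add: A.emeasure_eq_measure)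
 have "measure (angle_law s) {0<..x} = measure mu3 ((\<lambda>t. s * (pi - largest_angle (fst t) (fst (snd t)) (snd (snd t)))) -` {0<..x} \<inter> space mu3)"
  unfolding angle_law_def using m by (subst measure_distr) auto
 also have "... = F_angle (x / s)" unfolding F_angle_def
 proof (rule mu3.P.finite_measure_eq_AE)
  show "AE t in mu3. (t \<in> (\<lambda>t. s * (pi - largest_angle (fst t) (fst (snd t)) (snd (snd t)))) -` {0<..x} \<inter> space mu3) = (t \<in> angle_event (x / s))"
   using AE_mu3_generic AE_space
  proof eventually_elim
   case (elim t)
   then show ?case using s by (auto simp: angle_event_def field_simps split: prod.splits)
  qed
  show "(\<lambda>t. s * (pi - largest_angle (fst t) (fst (snd t)) (snd (snd t)))) -` {0<..x} \<inter> space mu3 \<in> sets mu3"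
   by (rule measurable_sets[OF m]) simp
 qed simp
 finally show "measure (angle_law s) {0<..x} = F_angle (x / s)" .
qed

text \<open>Almost all triangles are nondegenerate, so their deficits are positive, and \<open>f\<close> vanishes beyond \<open>R\<close>.\<close>

lemma expected_defect_exp:
 fixes f :: "real => real"
 assumes f: "continuous_on UNIV f" and fR: "\<And>x. R < x ==> f x = 0" and s: "0 < s" and R: "0 < R"
 shows "expected_defect (\<lambda>x. of_real (exp (- f (s * x)))) =
  of_real (\<integral>x. indicator {0<..R} x * (1 - exp (- f x)) \<partial>angle_law s)"
proof -
 let ?a = "\<lambda>t. s * (pi - largest_angle (fst t) (fst (snd t)) (snd (snd t)))"
 have m [measurable]: "?a \<in> borel_measurable mu3" by measurable
 have [measurable]: "f \<in> borel_measurable borel" using f by (rule borel_measurable_continuous_onI)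
 have "expected_defect (\<lambda>x. of_real (exp (- f (s * x)))) = (\<integral>t. of_real (indicator {0<..R} (?a t) * (1 - exp (- f (?a t)))) \<partial>mu3)"
  unfolding expected_defect_def
 proof (rule integral_cong_AE)
  show "defect (\<lambda>x. of_real (exp (- f (s * x)))) \<in> borel_measurable mu3"
   by (rule defect_measurable) measurable
  show "AE t in mu3. defect (\<lambda>x. of_real (exp (- f (s * x)))) t = of_real (indicator {0<..R} (?a t) * (1 - exp (- f (?a t))))"
   using AE_mu3_generic
  proof eventually_elim
   case (elim t)
   then have "0 < ?a t" using s by (auto split: prod.splits)
   then have "indicator {0<..R} (?a t) * (1 - exp (- f (?a t))) = 1 - exp (- f (?a t))"
    using fR[of "?a t"] by (cases "?a t <= R") auto
   then show ?case using elim by (auto simp: defect_def split: prod.splits)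
  qed
 qed simp
 also have "... = of_real (\<integral>t. indicator {0<..R} (?a t) * (1 - exp (- f (?a t))) \<partial>mu3)"
  by (rule integral_complex_of_real)
 also have "(\<integral>t. indicator {0<..R} (?a t) * (1 - exp (- f (?a t))) \<partial>mu3) = (\<integral>x. indicator {0<..R} x * (1 - exp (- f x)) \<partial>angle_law s)"
  unfolding angle_law_def by (subst integral_distr) auto
 finally show ?thesis .
qed

lemma F_angle_scaled_bound:
 assumes s: "0 < s" and x: "0 <= x"
 shows "\<bar>s / 6 * F_angle (x / s) - beta * x\<bar> <= C_angle * x\<^sup>2 / (6 * s)"
proof (cases "x = 0")
 case True
 have "angle_event 0 = {}" by (auto simp: angle_event_def)
 then show ?thesis using True by (simp add: F_angle_def)
next
 case False
 then have xs: "0 < x / s" using x s by simp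
 have "s / 6 * F_angle (x / s) - beta * x = s / 6 * (F_angle (x / s) - 6 * (x / s) * beta)"
  using s by (simp add: field_simps)
 then have "\<bar>s / 6 * F_angle (x / s) - beta * x\<bar> = s / 6 * \<bar>F_angle (x / s) - 6 * (x / s) * beta\<bar>"
  using s by (simp only: abs_mult)
 also have "... <= s / 6 * (C_angle * (x / s)\<^sup>2)" using C_angle(2)[OF xs] s by (intro mult_left_mono) auto
 also have "... = C_angle * x\<^sup>2 / (6 * s)" using s by (simp add: power_divide power2_eq_square)
 finally show ?thesis .
qed

lemma F_angle_tendsto:
 fixes s :: "'i => real"
 assumes s: "filterlim s at_top F" and x: "0 <= x"
 shows "((\<lambda>i. s i / 6 * F_angle (x / s i)) \<longlongrightarrow> beta * x) F"
proof (rule Lim_null[THEN iffD2], rule Lim_null_comparison)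
 show "eventually (\<lambda>i. norm (s i / 6 * F_angle (x / s i) - beta * x) <= C_angle * x\<^sup>2 / (6 * s i)) F"
  using filterlim_at_top_dense[THEN iffD1, OF s, rule_format, of 0]
  by eventually_elim (use F_angle_scaled_bound[OF _ x] in simp)
 show "((\<lambda>i. C_angle * x\<^sup>2 / (6 * s i)) \<longlongrightarrow> 0) F"
  by (intro tendsto_divide_0[OF tendsto_const] filterlim_at_top_imp_at_infinity
    filterlim_tendsto_pos_mult_at_top[OF tendsto_const _ s]) simp
qed

text \<open>The Laplace functional of a Poisson process with intensity \<open>beta\<close> on \<open>(0, \<infinity>)\<close>, see \<open>poisson_line_laplace\<close>.\<close>

definition limit_laplace :: "(real => real) => real => real" where
 "limit_laplace f R = exp (- (beta * (\<integral>x. indicator {0<..R} x * (1 - exp (- f x)) \<partial>lborel)))"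

lemma complex_exp_tendsto_real:
 fixes E :: "'i => real" and l :: "'i => real"
 assumes b: "eventually (\<lambda>i. norm (complex_of_real (E i) - exp (- of_real (l i))) <= d i) F"
  and d: "(d \<longlongrightarrow> 0) F" and l: "(l \<longlongrightarrow> c) F"
 shows "(E \<longlongrightarrow> exp (- c)) F"
proof -
 have "((\<lambda>i. E i - exp (- l i)) \<longlongrightarrow> 0) F"
 proof (rule Lim_null_comparison[OF _ d])
  show "eventually (\<lambda>i. norm (E i - exp (- l i)) <= d i) F" using b
  proof eventually_elim
   case (elim i)
   have "complex_of_real (E i) - exp (- of_real (l i)) = of_real (E i - exp (- l i))"
    by (simp add: exp_of_real[symmetric])
   then show ?case using elim by (simp only: norm_of_real real_norm_def)
  qed
 qed
 moreover have "((\<lambda>i. exp (- l i)) \<longlongrightarrow> exp (- c)) F" using l by (intro tendsto_intros)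
 ultimately show ?thesis using tendsto_add by fastforce
qed

lemma binomial_laplace_tendsto:
 fixes f :: "real => real"
 assumes bp: "\<And>n. binomial_process (P n) \<mu> n (\<zeta> n)"
  and f: "continuous_on UNIV f" "\<And>x. 0 <= f x" "\<And>x. R < x ==> f x = 0" and R: "0 < R"
 shows "(\<lambda>n. \<integral>w. exp (- (\<integral>x. f x \<partial>rescale (real n ^ 3) (angle_process (\<zeta> n w)))) \<partial>P n) \<longlonglongrightarrow> limit_laplace f R"
 unfolding limit_laplace_def
proof (rule complex_exp_tendsto_real)
 define g where "g n x = complex_of_real (exp (- f (real n ^ 3 * x)))" for n :: nat and x
 define l where "l n = real (n choose 3) * (\<integral>x. indicator {0<..R} x * (1 - exp (- f x)) \<partial>angle_law (real n ^ 3))" for n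
 have bK: "bounded K" using compact_K by (rule compact_imp_bounded)
 have fm: "f \<in> borel_measurable borel" using f(1) by (rule borel_measurable_continuous_onI)
 have gcont: "continuous_on UNIV (g n)" for n
  unfolding g_def by (intro continuous_on_of_real continuous_intros continuous_on_compose2[OF f(1)]) auto
 show "eventually (\<lambda>n. norm (complex_of_real (\<integral>w. exp (- (\<integral>x. f x \<partial>rescale (real n ^ 3) (angle_process (\<zeta> n w)))) \<partial>P n) - exp (- of_real (l n)))
   <= 6 * (C_line * R)\<^sup>2 * (1 / real n)) sequentially" using eventually_gt_at_top[of 0]
 proof eventually_elim
  case (elim n)
  then have n0: "0 < real n" "0 < real n ^ 3" by auto
  obtain X where X: "prob_space (P n)" "prob_space.indep_vars (P n) (\<lambda>_. \<mu>) X {..<n}" "\<And>i. i < n ==> distr (P n) \<mu> (X i) = \<mu>"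
   "\<And>i. i < n ==> X i \<in> P n \<rightarrow>\<^sub>M \<mu>" "\<And>w. w \<in> space (P n) ==> points (\<zeta> n w) = (\<lambda>i. X i w) ` {..<n}"
   using bp[of n] by (rule binomial_process_rep) blast
  have rfs: "random_finite_set (P n) K (\<lambda>w. (\<lambda>i. X i w) ` {..<n})" by (rule binomial_random_finite_set[OF X(4)])
  have "norm ((\<integral>w. mfun (g n) ((\<lambda>i. X i w) ` {..<n}) \<partial>P n) - exp (- (of_nat (n choose 3) * expected_defect (g n))))
   <= 6 * real n ^ 5 * (1 * (C_line * (R / real n ^ 3)))\<^sup>2"
  proof (rule binomial_mfun_bound[OF X(1-3)])
   show "g n \<in> borel_measurable borel" by (rule borel_measurable_continuous_onI[OF gcont])
   show "norm (g n x) <= 1" for x using f(2) by (simp add: g_def)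
   show "g n x = 1" if "R / real n ^ 3 < x" for x
    using that n0 f(3)[of "real n ^ 3 * x"] by (simp add: g_def field_simps)
   show "norm (1 - g n x) <= 1" for x
   proof -
    have "1 - g n x = complex_of_real (1 - exp (- f (real n ^ 3 * x)))" by (simp add: g_def)
    then show ?thesis using f(2) by (simp only: norm_of_real) simp
   qed
   show "0 <= R / real n ^ 3" using R by simp
   show "(\<lambda>w. mfun (g n) ((\<lambda>i. X i w) ` {..<n})) \<in> borel_measurable (P n)" by (rule mfun_measurable[OF rfs bK gcont])
  qed
  also have "... = 6 * (C_line * R)\<^sup>2 * (1 / real n)"
   using n0 by (simp add: power_mult_distrib power_divide field_simps flip: power_mult power_add power_Suc2, (simp add: eval_nat_numeral)?)
  also have "of_nat (n choose 3) * expected_defect (g n) = of_real (l n)"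
   unfolding g_def using expected_defect_exp[OF f(1,3) n0(2) R] by (simp add: l_def)
  also have "(\<integral>w. mfun (g n) ((\<lambda>i. X i w) ` {..<n}) \<partial>P n) =
   (\<integral>w. complex_of_real (exp (- (\<integral>x. f x \<partial>rescale (real n ^ 3) (angle_process (\<zeta> n w))))) \<partial>P n)"
  proof (intro lint_cong refl)
   fix w assume w: "w \<in> space (P n)"
   show "mfun (g n) ((\<lambda>i. X i w) ` {..<n}) = complex_of_real (exp (- (\<integral>x. f x \<partial>rescale (real n ^ 3) (angle_process (\<zeta> n w)))))"
    unfolding g_def using X(5)[OF w] by (subst mfun_exp) (simp_all add: integral_rescale_angle_process[OF _ fm])
  qed
  finally show ?case by (simp only: integral_complex_of_real)
 qed
 show "(\<lambda>n. 6 * (C_line * R)\<^sup>2 * (1 / real n)) \<longlonglongrightarrow> 0" by (intro tendsto_mult_right_zero lim_1_over_n)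
 have ch: "(\<lambda>n. real (n choose 3) / (real n ^ 3 / 6)) \<longlonglongrightarrow> 1"
 proof (rule tendsto_sandwich[where f="\<lambda>n. 1 - 3 * (1 / real n)" and h="\<lambda>_. 1"])
  show "eventually (\<lambda>n. 1 - 3 * (1 / real n) <= real (n choose 3) / (real n ^ 3 / 6)) sequentially"
   using eventually_gt_at_top[of 0]
  proof eventually_elim
   case (elim n)
   then have "(1 - 3 * (1 / real n)) * (real n ^ 3 / 6) = real n ^ 3 / 6 - real n ^ 2 / 2"
    by (simp add: field_simps power2_eq_square power3_eq_cube)
   then show ?case using choose3_bounds(2)[of n] elim by (simp add: le_divide_eq)
  qed
  show "eventually (\<lambda>n. real (n choose 3) / (real n ^ 3 / 6) <= 1) sequentially"
   using eventually_gt_at_top[of 0] by eventually_elim (use choose3_bounds(1) in \<open>simp add: divide_le_eq\<close>)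
  have "(\<lambda>n. 1 - 3 * (1 / real n)) \<longlonglongrightarrow> 1 - 3 * 0" by (intro tendsto_intros lim_1_over_n)
  then show "(\<lambda>n. 1 - 3 * (1 / real n)) \<longlonglongrightarrow> 1" by simp
 qed simp
 have lim3: "filterlim (\<lambda>n. real n ^ 3) at_top sequentially"
  by (intro filterlim_pow_at_top filterlim_real_sequentially) simp
 have "(\<lambda>n. real (Suc n choose 3) * (\<integral>x. indicator {0<..R} x * (1 - exp (- f x)) \<partial>angle_law (real (Suc n) ^ 3))) \<longlonglongrightarrow>
  beta * (\<integral>x. indicator {0<..R} x * (1 - exp (- f x)) \<partial>lborel)"
 proof (rule integral_tendsto_of_cdf[OF _ _ R])
  have pos: "0 < real (Suc n) ^ 3" for n by simp
  show "sets (angle_law (real (Suc n) ^ 3)) = sets borel" for n by (rule angle_law_facts(1)[OF pos])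
  show "emeasure (angle_law (real (Suc n) ^ 3)) {0<..R} < \<infinity>" for n by (rule angle_law_facts(2)[OF pos])
  show "continuous_on UNIV (\<lambda>x. 1 - exp (- f x))" by (intro continuous_intros f)
  fix x :: real assume x: "0 <= x"
  have "(\<lambda>n. (real (n choose 3) / (real n ^ 3 / 6)) * (real n ^ 3 / 6 * F_angle (x / real n ^ 3))) \<longlonglongrightarrow> 1 * (beta * x)"
   by (intro tendsto_mult ch F_angle_tendsto lim3 x)
  then have "(\<lambda>n. (real (Suc n choose 3) / (real (Suc n) ^ 3 / 6)) * (real (Suc n) ^ 3 / 6 * F_angle (x / real (Suc n) ^ 3))) \<longlonglongrightarrow> 1 * (beta * x)"
   by (rule LIMSEQ_Suc)
  moreover have "(real (Suc n choose 3) / (real (Suc n) ^ 3 / 6)) * (real (Suc n) ^ 3 / 6 * F_angle (x / real (Suc n) ^ 3)) =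
    real (Suc n choose 3) * measure (angle_law (real (Suc n) ^ 3)) {0<..x}" for n
  proof -
   have "0 < real (Suc n) ^ 3" by simp
   then show ?thesis unfolding angle_law_facts(3)[OF \<open>0 < real (Suc n) ^ 3\<close>] by (simp del: of_nat_Suc)
  qed
  ultimately show "(\<lambda>n. real (Suc n choose 3) * measure (angle_law (real (Suc n) ^ 3)) {0<..x}) \<longlonglongrightarrow> beta * x"
   by (simp only: mult_1)
 qed (auto simp: beta_nonneg)
 then have "(\<lambda>n. l (Suc n)) \<longlonglongrightarrow> beta * (\<integral>x. indicator {0<..R} x * (1 - exp (- f x)) \<partial>lborel)"
  by (simp only: l_def)
 then show "l \<longlonglongrightarrow> beta * (\<integral>x. indicator {0<..R} x * (1 - exp (- f x)) \<partial>lborel)" by (rule LIMSEQ_imp_Suc)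
qed

text \<open>The auxiliary \<open>s t = max 1 t\<close> keeps the laws below well-defined for all \<open>t\<close>; only large \<open>t\<close>
 matter.\<close>

lemma poisson_laplace_tendsto:
 fixes f :: "real => real"
 assumes pp: "\<And>t. 0 < t ==> poisson_process (P t) (scale_measure (ennreal t) \<mu>) (\<eta> t)"
  and f: "continuous_on UNIV f" "\<And>x. 0 <= f x" "\<And>x. R < x ==> f x = 0" and R: "0 < R"
 shows "((\<lambda>t. \<integral>w. exp (- (\<integral>x. f x \<partial>rescale (t ^ 3) (angle_process (\<eta> t w)))) \<partial>P t) \<longlongrightarrow> limit_laplace f R) at_top"
 unfolding limit_laplace_def
proof (rule complex_exp_tendsto_real)
 define g where "g t x = complex_of_real (exp (- f (t ^ 3 * x)))" for t x
 define s where "s t = max 1 t" for t :: real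
 define l where "l t = s t ^ 3 / 6 * (\<integral>x. indicator {0<..R} x * (1 - exp (- f x)) \<partial>angle_law (s t ^ 3))" for t
 have fm: "f \<in> borel_measurable borel" using f(1) by (rule borel_measurable_continuous_onI)
 have gcont: "continuous_on UNIV (g t)" for t
  unfolding g_def by (intro continuous_on_of_real continuous_intros continuous_on_compose2[OF f(1)]) auto
 show "eventually (\<lambda>t. norm (complex_of_real (\<integral>w. exp (- (\<integral>x. f x \<partial>rescale (t ^ 3) (angle_process (\<eta> t w)))) \<partial>P t) - exp (- of_real (l t)))
   <= 12 * (C_line * R)\<^sup>2 * (1 / t)) at_top" using eventually_ge_at_top[of 1]
 proof eventually_elim
  case (elim t)
  then have t0: "0 < t" "0 < t ^ 3" by auto
  have st: "s t = t" using elim by (simp add: s_def)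
  have "norm ((\<integral>w. mfun (g t) (points (\<eta> t w)) \<partial>P t) - exp (- (of_real (t ^ 3 / 6) * expected_defect (g t))))
   <= 12 * t ^ 5 * (1 * (C_line * (R / t ^ 3)))\<^sup>2"
  proof (rule poisson_mfun_bound[OF pp[OF t0(1)] elim gcont])
   show "norm (g t x) <= 1" for x using f(2) by (simp add: g_def)
   show "g t x = 1" if "R / t ^ 3 < x" for x
    using that t0 f(3)[of "t ^ 3 * x"] by (simp add: g_def field_simps)
   show "norm (1 - g t x) <= 1" for x
   proof -
    have "1 - g t x = complex_of_real (1 - exp (- f (t ^ 3 * x)))" by (simp add: g_def)
    then show ?thesis using f(2) by (simp only: norm_of_real) simp
   qed
   show "0 <= R / t ^ 3" using R t0 by simp
  qed
  also have "... = 12 * (C_line * R)\<^sup>2 * (1 / t)"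
   using t0 by (simp add: power_mult_distrib power_divide field_simps flip: power_mult power_add power_Suc2, (simp add: eval_nat_numeral)?)
  also have "of_real (t ^ 3 / 6) * expected_defect (g t) = of_real (l t)"
   unfolding g_def using expected_defect_exp[OF f(1,3) t0(2) R] by (simp add: l_def st)
  also have "(\<integral>w. mfun (g t) (points (\<eta> t w)) \<partial>P t) =
   (\<integral>w. complex_of_real (exp (- (\<integral>x. f x \<partial>rescale (t ^ 3) (angle_process (\<eta> t w))))) \<partial>P t)"
  proof (intro lint_cong refl)
   fix w assume w: "w \<in> space (P t)"
   have fin: "finite (points (\<eta> t w))" by (rule poisson_atoms(1)[OF pp[OF t0(1)] t0(1) w])
   show "mfun (g t) (points (\<eta> t w)) = complex_of_real (exp (- (\<integral>x. f x \<partial>rescale (t ^ 3) (angle_process (\<eta> t w)))))"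
    unfolding g_def by (simp add: mfun_exp[OF fin] integral_rescale_angle_process[OF fin fm])
  qed
  finally show ?case by (simp only: integral_complex_of_real)
 qed
 have inv: "((\<lambda>t::real. 1 / t) \<longlongrightarrow> 0) at_top"
  by (intro tendsto_divide_0[OF tendsto_const] filterlim_at_top_imp_at_infinity filterlim_ident)
 show "((\<lambda>t. 12 * (C_line * R)\<^sup>2 * (1 / t)) \<longlongrightarrow> 0) at_top" by (intro tendsto_mult_right_zero inv)
 have s_lim: "filterlim s at_top at_top" by (rule filterlim_at_top_mono[OF filterlim_ident]) (simp add: s_def)
 have lim3: "filterlim (\<lambda>t. s t ^ 3) at_top at_top" by (intro filterlim_pow_at_top s_lim) simp
 have s0: "0 < s t ^ 3" for t by (simp add: s_def)
 show "(l \<longlongrightarrow> beta * (\<integral>x. indicator {0<..R} x * (1 - exp (- f x)) \<partial>lborel)) at_top" unfolding l_def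
 proof (rule integral_tendsto_of_cdf[OF _ _ R])
  show "sets (angle_law (s t ^ 3)) = sets borel" for t by (rule angle_law_facts(1)[OF s0])
  show "emeasure (angle_law (s t ^ 3)) {0<..R} < \<infinity>" for t by (rule angle_law_facts(2)[OF s0])
  show "continuous_on UNIV (\<lambda>x. 1 - exp (- f x))" by (intro continuous_intros f)
  show "0 <= s t ^ 3 / 6" for t using s0[of t] by simp
  fix x :: real assume x: "0 <= x"
  show "((\<lambda>t. s t ^ 3 / 6 * measure (angle_law (s t ^ 3)) {0<..x}) \<longlongrightarrow> beta * x) at_top"
   unfolding angle_law_facts(3)[OF s0] by (rule F_angle_tendsto[OF lim3 x])
 qed (rule beta_nonneg)
qed

end

section \<open>Convergence in distribution from convergence of Laplace functionals\<close>

definition monomial_at :: "'j list => ('j => real) => real" where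
 "monomial_at m x = (\<Prod>j\<leftarrow>m. x j)"

text \<open>Polynomials in the coordinates, as sums of monomials: this form makes convergence of expectations
 an induction, while the closure under products is proved separately.\<close>

inductive poly_fun :: "(('j => real) => real) => bool" where
 zero: "poly_fun (\<lambda>_. 0)"
| step: "poly_fun f ==> poly_fun (\<lambda>x. c * monomial_at m x + f x)"

lemma poly_fun_add: "poly_fun f ==> poly_fun g ==> poly_fun (\<lambda>x. f x + g x)"
 by (induction rule: poly_fun.induct) (auto simp: add.assoc intro: poly_fun.step)

lemma poly_fun_monomial_mult: "poly_fun f ==> poly_fun (\<lambda>x. (c * monomial_at m x) * f x)"
proof (induction rule: poly_fun.induct)
 case (step f d n)
 have "poly_fun (\<lambda>x. (c * d) * monomial_at (m @ n) x + (c * monomial_at m x) * f x)"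
  by (intro poly_fun.step step)
 then show ?case by (simp add: monomial_at_def algebra_simps)
qed (simp add: poly_fun.zero)

lemma poly_fun_mult: "poly_fun f ==> poly_fun g ==> poly_fun (\<lambda>x. f x * g x)"
proof (induction rule: poly_fun.induct)
 case (step f c m)
 have "poly_fun (\<lambda>x. (c * monomial_at m x) * g x + f x * g x)"
  by (intro poly_fun_add poly_fun_monomial_mult step)
 then show ?case by (simp add: algebra_simps)
qed (simp add: poly_fun.zero)

lemma poly_fun_const: "poly_fun (\<lambda>_. c)"
 using poly_fun.step[OF poly_fun.zero, of c "[]"] by (simp add: monomial_at_def)

lemma poly_fun_coordinate: "poly_fun (\<lambda>x. x j)"
 using poly_fun.step[OF poly_fun.zero, of 1 "[j]"] by (simp add: monomial_at_def)

lemma continuous_monomial_at: "continuous_on UNIV (monomial_at m :: ('j :: countable => real) => real)"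
 unfolding monomial_at_def by (induction m) (auto intro!: continuous_intros)

lemma continuous_poly_fun: "poly_fun f ==> continuous_on UNIV (f :: ('j :: countable => real) => real)"
 by (induction rule: poly_fun.induct) (auto intro!: continuous_intros continuous_monomial_at)

lemma compact_cube: "compact {x :: 'j::countable => real. \<forall>j. x j \<in> {0..1}}"
proof -
 have "compactin (product_topology (\<lambda>_::'j. euclideanreal) UNIV) (PiE UNIV (\<lambda>_. {0..1}))"
  by (subst compactin_PiE) auto
 moreover have "PiE UNIV (\<lambda>_::'j. {0..1::real}) = {x. \<forall>j. x j \<in> {0..1}}" by (auto simp: PiE_def Pi_def)
 ultimately show ?thesis unfolding euclidean_product_topology compactin_euclidean_iff by auto
qed

lemma poly_fun_approx:
 fixes f :: "('j::countable => real) => real"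
 assumes f: "continuous_on UNIV f" and e: "0 < e"
 obtains g where "poly_fun g" "\<And>x. (\<And>j. 0 <= x j \<and> x j <= 1) ==> \<bar>f x - g x\<bar> < e"
proof -
 have "\<exists>g. poly_fun g \<and> (\<forall>x\<in>{x. \<forall>j. x j \<in> {0..1}}. \<bar>f x - g x\<bar> < e)"
 proof (rule Stone_Weierstrass_HOL[where P=poly_fun and f=f])
  show "poly_fun g ==> continuous_on {x. \<forall>j. x j \<in> {0..1}} g" for g :: "('j => real) => real"
   using continuous_poly_fun continuous_on_subset by blast
  show "continuous_on {x. \<forall>j. x j \<in> {0..1}} f" using f by (rule continuous_on_subset) simp
  fix x y :: "'j => real"
  assume "x \<in> {x. \<forall>j. x j \<in> {0..1}} \<and> y \<in> {x. \<forall>j. x j \<in> {0..1}} \<and> x ~= y"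
  then obtain j where "x j ~= y j" by (auto simp: fun_eq_iff)
  then show "\<exists>g. poly_fun g \<and> g x ~= g y" by (intro exI[of _ "\<lambda>x. x j"]) (simp add: poly_fun_coordinate)
 qed (use compact_cube in \<open>auto simp: poly_fun_const poly_fun_add poly_fun_mult e\<close>)
 then show ?thesis using that by auto
qed

text \<open>A topology that is at most as fine as the one induced by countably many bounded coordinates. For
 such a topology, convergence in distribution reduces to functions on a compact cube.\<close>

locale coordinate_topology =
 fixes T :: "'s topology" and crd :: "'s => ('j::countable => real)"
 assumes coord: "\<nu> \<in> topspace T ==> 0 <= crd \<nu> j \<and> crd \<nu> j <= 1"
  and nbhd: "openin T U ==> \<nu> \<in> U ==> \<exists>r>0. \<forall>\<nu>'\<in>topspace T. dist (crd \<nu>) (crd \<nu>') < r --> \<nu>' \<in> U"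
begin

definition random_element :: "'a measure => ('a => 's) => bool" where
 "random_element M \<xi> \<longleftrightarrow> prob_space M \<and> (\<forall>w\<in>space M. \<xi> w \<in> topspace T) \<and>
   (\<forall>j. (\<lambda>w. crd (\<xi> w) j) \<in> borel_measurable M)"

lemma random_element_crd: "random_element M \<xi> ==> (\<lambda>w. crd (\<xi> w)) \<in> borel_measurable M"
 unfolding random_element_def by (intro measurable_coordinatewise_then_product) auto

text \<open>An open set \<open>U\<close> is the preimage of the union \<open>V\<close> of the balls around the coordinates of its
 points that \<open>nbhd\<close> provides, and \<open>V\<close> is open in a space where measurability can be checked coordinatewise.\<close>

lemma random_element_measurable:
 assumes "random_element M \<xi>"
 shows "\<xi> \<in> measurable M (sigma (topspace T) {U. openin T U})"
proof (rule measurable_measure_of)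
 show "{U. openin T U} \<subseteq> Pow (topspace T)" using openin_subset by auto
 show "\<xi> \<in> space M \<rightarrow> topspace T" using assms by (auto simp: random_element_def)
 fix U assume "U \<in> {U. openin T U}"
 then have U: "openin T U" by simp
 obtain r where r: "\<And>\<nu>. \<nu> \<in> U ==> 0 < r \<nu>"
   "\<And>\<nu> \<nu>'. \<nu> \<in> U ==> \<nu>' \<in> topspace T ==> dist (crd \<nu>) (crd \<nu>') < r \<nu> ==> \<nu>' \<in> U" using nbhd[OF U] by metis
 define V where "V = (\<Union>\<nu>\<in>U. ball (crd \<nu>) (r \<nu>))"
 have "open V" unfolding V_def by auto
 have "\<xi> -` U \<inter> space M = (\<lambda>w. crd (\<xi> w)) -` V \<inter> space M"
 proof (intro set_eqI iffI)
  fix w assume "w \<in> \<xi> -` U \<inter> space M"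
  then show "w \<in> (\<lambda>w. crd (\<xi> w)) -` V \<inter> space M"
   using r(1)[of "\<xi> w"] by (auto simp: V_def intro!: bexI[of _ "\<xi> w"])
 next
  fix w assume crd: "w \<in> (\<lambda>w. crd (\<xi> w)) -` V \<inter> space M"
  then obtain \<nu> where "\<nu> \<in> U" "dist (crd \<nu>) (crd (\<xi> w)) < r \<nu>" by (auto simp: V_def)
  moreover have "\<xi> w \<in> topspace T" using assms crd by (auto simp: random_element_def)
  ultimately show "w \<in> \<xi> -` U \<inter> space M" using r(2) crd by blast
 qed
 then show "\<xi> -` U \<inter> space M \<in> sets M"
  using random_element_crd[OF assms] \<open>open V\<close> by (simp add: measurable_sets_borel[where A=V] borel_open)
qed

lemma integrable_of_coordinates:
 fixes f :: "('j => real) => real"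
 assumes M: "random_element M \<xi>" and f: "continuous_on UNIV f"
 shows "integrable M (\<lambda>w. f (crd (\<xi> w)) :: real)"
proof -
 interpret prob_space M using M by (simp add: random_element_def)
 have "compact (f ` {x. \<forall>j. x j \<in> {0..1}})"
  by (intro compact_continuous_image continuous_on_subset[OF f] compact_cube) simp
 then have "bounded (f ` {x. \<forall>j. x j \<in> {0..1}})" by (rule compact_imp_bounded)
 then obtain B where B: "\<And>x. (\<forall>j. x j \<in> {0..1}) ==> norm (f x) <= B" by (auto simp: bounded_iff)
 show ?thesis
 proof (rule integrable_const_bound[where B=B])
  show "AE w in M. norm (f (crd (\<xi> w))) <= B" using M coord by (intro AE_I2 B) (auto simp: random_element_def)
  show "(\<lambda>w. f (crd (\<xi> w))) \<in> borel_measurable M"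
   by (rule measurable_compose[OF random_element_crd[OF M] borel_measurable_continuous_onI[OF f]])
 qed
qed

lemma integral_coordinates_close:
 fixes f g :: "('j => real) => real"
 assumes M: "random_element M \<zeta>" and f: "continuous_on UNIV f" and g: "continuous_on UNIV g"
  and close: "\<And>x. (\<And>j. 0 <= x j \<and> x j <= 1) ==> \<bar>f x - g x\<bar> < e"
 shows "\<bar>(\<integral>w. f (crd (\<zeta> w)) \<partial>M) - (\<integral>w. g (crd (\<zeta> w)) \<partial>M)\<bar> <= e"
proof -
 interpret prob_space M using M by (simp add: random_element_def)
 have i: "integrable M (\<lambda>w. f (crd (\<zeta> w)))" "integrable M (\<lambda>w. g (crd (\<zeta> w)))"
  by (rule integrable_of_coordinates[OF M f], rule integrable_of_coordinates[OF M g])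
 have "norm (\<integral>w. f (crd (\<zeta> w)) - g (crd (\<zeta> w)) \<partial>M) <= (\<integral>w. e \<partial>M)"
 proof (rule norm_integral_le_integral)
  fix w assume "w \<in> space M"
  then have "\<zeta> w \<in> topspace T" using M by (simp add: random_element_def)
  then show "norm (f (crd (\<zeta> w)) - g (crd (\<zeta> w))) <= e"
   using close[of "crd (\<zeta> w)"] coord by (simp add: less_imp_le)
 qed (use i in auto)
 then show ?thesis using i by (simp add: prob_space)
qed

text \<open>The Lipschitz regularizations \<open>x \<mapsto> INF \<nu>. g \<nu> + n * dist x (crd \<nu>)\<close> increase to \<open>g\<close>.
 They are defined on the whole cube, although the coordinates of measures need not form a closed set.\<close>

lemma lower_envelope:
 assumes g: "continuous_map T euclideanreal g" and Bo: "\<forall>\<nu>\<in>topspace T. \<bar>g \<nu>\<bar> <= B" and ne: "topspace T ~= {}"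
 obtains \<Psi> where "\<And>n :: nat. continuous_on UNIV (\<Psi> n)"
  "\<And>n \<nu>. \<nu> \<in> topspace T ==> \<Psi> n (crd \<nu>) <= g \<nu>" "\<And>n \<nu>. \<nu> \<in> topspace T ==> \<bar>\<Psi> n (crd \<nu>)\<bar> <= B"
  "\<And>\<nu>. \<nu> \<in> topspace T ==> (\<lambda>n. \<Psi> n (crd \<nu>)) \<longlonglongrightarrow> g \<nu>"
proof -
 note B = Bo[rule_format]
 let ?N = "topspace T"
 define \<Psi> where "\<Psi> n x = (INF \<nu>\<in>?N. g \<nu> + real n * dist x (crd \<nu>))" for n :: nat and x
 have bb: "bdd_below ((\<lambda>\<nu>. g \<nu> + real n * dist x (crd \<nu>)) ` ?N)" for n x
 proof (rule bdd_belowI2)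
  fix \<nu> assume "\<nu> \<in> ?N"
  then have "- B <= g \<nu>" using B[of \<nu>] by linarith
  moreover have "0 <= real n * dist x (crd \<nu>)" by simp
  ultimately show "- B <= g \<nu> + real n * dist x (crd \<nu>)" by linarith
 qed
 have le: "\<Psi> n x <= g \<nu> + real n * dist x (crd \<nu>)" if "\<nu> \<in> ?N" for n x \<nu>
  unfolding \<Psi>_def using bb that by (rule cINF_lower)
 have ge: "c <= \<Psi> n x" if "\<And>\<nu>. \<nu> \<in> ?N ==> c <= g \<nu> + real n * dist x (crd \<nu>)" for c n x
  unfolding \<Psi>_def using ne that by (rule cINF_greatest)
 have ub: "\<Psi> n (crd \<nu>) <= g \<nu>" if "\<nu> \<in> ?N" for n \<nu> using le[OF that, of n "crd \<nu>"] by simp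
 have lb: "- B <= \<Psi> n x" for n x
 proof (rule ge)
  fix \<nu> assume "\<nu> \<in> ?N"
  then have "- B <= g \<nu>" using B[of \<nu>] by linarith
  moreover have "0 <= real n * dist x (crd \<nu>)" by simp
  ultimately show "- B <= g \<nu> + real n * dist x (crd \<nu>)" by linarith
 qed
 have lip: "\<Psi> n x - real n * dist x y <= \<Psi> n y" for n x y
 proof (rule ge)
  fix \<nu> assume \<nu>: "\<nu> \<in> ?N"
  have "real n * dist x (crd \<nu>) <= real n * (dist x y + dist y (crd \<nu>))"
   by (intro mult_left_mono dist_triangle) simp
  then show "\<Psi> n x - real n * dist x y <= g \<nu> + real n * dist y (crd \<nu>)"
   using le[OF \<nu>, of n x] by (simp add: distrib_left)
 qed
 have "continuous_on UNIV (\<Psi> n)" for n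
 proof (rule lipschitz_on_continuous_on, rule lipschitz_onI)
  fix x y
  show "dist (\<Psi> n x) (\<Psi> n y) <= real n * dist x y"
   using lip[of n x y] lip[of n y x] unfolding dist_real_def by (simp add: dist_commute)
 qed simp
 moreover have "(\<lambda>n. \<Psi> n (crd \<nu>)) \<longlonglongrightarrow> g \<nu>" if \<nu>: "\<nu> \<in> ?N" for \<nu>
 proof (rule LIMSEQ_I)
  fix e :: real assume e: "0 < e"
  have "openin T {\<nu>' \<in> ?N. g \<nu>' \<in> {g \<nu> - e / 2<..}}" by (rule openin_continuous_map_preimage[OF g]) auto
  from nbhd[OF this, of \<nu>] \<nu> e obtain r where r: "0 < r"
    "\<And>\<nu>'. \<nu>' \<in> ?N ==> dist (crd \<nu>) (crd \<nu>') < r ==> g \<nu> - e / 2 < g \<nu>'" by auto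
  \<comment> \<open>Beyond distance \<open>r\<close> the penalty \<open>n * r\<close> exceeds the oscillation \<open>2 * B\<close> of \<open>g\<close>.\<close>
  obtain n0 :: nat where n0: "2 * B / r < n0" using reals_Archimedean2 by blast
  show "\<exists>n0. \<forall>n\<ge>n0. norm (\<Psi> n (crd \<nu>) - g \<nu>) < e"
  proof (intro exI allI impI)
   fix n assume "n0 <= n"
   then have "2 * B / r < real n" using n0 by linarith
   then have nr: "2 * B <= real n * r" using r(1) by (simp add: field_simps)
   have "g \<nu> - e / 2 <= \<Psi> n (crd \<nu>)"
   proof (rule ge)
    fix \<nu>' assume \<nu>': "\<nu>' \<in> ?N"
    show "g \<nu> - e / 2 <= g \<nu>' + real n * dist (crd \<nu>) (crd \<nu>')"
    proof (cases "dist (crd \<nu>) (crd \<nu>') < r")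
     case True
     moreover have "0 <= real n * dist (crd \<nu>) (crd \<nu>')" by simp
     ultimately show ?thesis using r(2)[OF \<nu>'] by linarith
    next
     case False
     then have "real n * r <= real n * dist (crd \<nu>) (crd \<nu>')" by (intro mult_left_mono) auto
     then show ?thesis using nr B[OF \<nu>] B[OF \<nu>'] e by linarith
    qed
   qed
   then show "norm (\<Psi> n (crd \<nu>) - g \<nu>) < e" using ub[OF \<nu>, of n] e unfolding real_norm_def by linarith
  qed
 qed
 moreover have "\<bar>\<Psi> n (crd \<nu>)\<bar> <= B" if "\<nu> \<in> ?N" for n \<nu>
  using ub[OF that, of n] lb[of n "crd \<nu>"] B[OF that] by linarith
 ultimately show ?thesis using ub by (intro that[of \<Psi>]) auto
qed

lemma integrable_bounded_map:
 assumes M: "random_element M \<zeta>" and g: "continuous_map T euclideanreal g" and B: "\<forall>\<nu>\<in>topspace T. \<bar>g \<nu>\<bar> <= B"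
 shows "integrable M (\<lambda>w. g (\<zeta> w))"
proof -
 interpret prob_space M using M by (simp add: random_element_def)
 have "g \<in> borel_measurable (sigma (topspace T) {U. openin T U})"
 proof (rule borel_measurableI)
  have sub: "{U. openin T U} \<subseteq> Pow (topspace T)" by (auto dest: openin_subset)
  fix S :: "real set" assume "open S"
  then have "openin T {\<nu> \<in> topspace T. g \<nu> \<in> S}" by (intro openin_continuous_map_preimage[OF g]) simp
  moreover have "g -` S \<inter> space (sigma (topspace T) {U. openin T U}) = {\<nu> \<in> topspace T. g \<nu> \<in> S}"
   using sub by (subst space_measure_of) auto
  ultimately show "g -` S \<inter> space (sigma (topspace T) {U. openin T U}) \<in> sets (sigma (topspace T) {U. openin T U})"
   using sub by (subst sets_measure_of) (auto intro: sigma_sets.Basic)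
 qed
 from measurable_compose[OF random_element_measurable[OF M] this] show ?thesis
  using M B by (intro integrable_const_bound[where B=B] AE_I2) (auto simp: random_element_def)
qed

context
 fixes P :: "'i => 'a measure" and \<xi> :: "'i => 'a => 's" and Q :: "'b measure" and Z :: "'b => 's" and F :: "'i filter"
 assumes P: "eventually (\<lambda>i. random_element (P i) (\<xi> i)) F" and Q: "random_element Q Z"
  and conv: "\<And>m. ((\<lambda>i. \<integral>w. monomial_at m (crd (\<xi> i w)) \<partial>P i) \<longlongrightarrow> (\<integral>w. monomial_at m (crd (Z w)) \<partial>Q)) F"
begin

lemma poly_fun_tendsto:
 "poly_fun f ==> ((\<lambda>i. \<integral>w. f (crd (\<xi> i w)) \<partial>P i) \<longlongrightarrow> (\<integral>w. f (crd (Z w)) \<partial>Q)) F"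
proof (induction rule: poly_fun.induct)
 case (step f c m)
 have split: "(\<integral>w. c * monomial_at m (crd (Z w)) + f (crd (Z w)) \<partial>Q) =
   c * (\<integral>w. monomial_at m (crd (Z w)) \<partial>Q) + (\<integral>w. f (crd (Z w)) \<partial>Q)"
  using integrable_of_coordinates[OF Q continuous_monomial_at, of m]
   integrable_of_coordinates[OF Q continuous_poly_fun[OF step(1)]] by simp
 have "((\<lambda>i. c * (\<integral>w. monomial_at m (crd (\<xi> i w)) \<partial>P i) + (\<integral>w. f (crd (\<xi> i w)) \<partial>P i)) \<longlongrightarrow>
   c * (\<integral>w. monomial_at m (crd (Z w)) \<partial>Q) + (\<integral>w. f (crd (Z w)) \<partial>Q)) F" by (intro tendsto_intros conv step)
 then show ?case unfolding split
 proof (rule Lim_transform_eventually)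
  show "eventually (\<lambda>i. c * (\<integral>w. monomial_at m (crd (\<xi> i w)) \<partial>P i) + (\<integral>w. f (crd (\<xi> i w)) \<partial>P i) =
   (\<integral>w. c * monomial_at m (crd (\<xi> i w)) + f (crd (\<xi> i w)) \<partial>P i)) F" using P
  proof eventually_elim
   case (elim i)
   then show ?case using integrable_of_coordinates[OF elim continuous_monomial_at, of m]
    integrable_of_coordinates[OF elim continuous_poly_fun[OF step(1)]] by simp
  qed
 qed
qed simp

lemma continuous_tendsto:
 fixes f :: "('j => real) => real"
 assumes f: "continuous_on UNIV f"
 shows "((\<lambda>i. \<integral>w. f (crd (\<xi> i w)) \<partial>P i) \<longlongrightarrow> (\<integral>w. f (crd (Z w)) \<partial>Q)) F"
proof (rule tendstoI)
 fix e :: real assume e: "0 < e"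
 obtain g where g: "poly_fun g" "\<And>x. (\<And>j. 0 <= x j \<and> x j <= 1) ==> \<bar>f x - g x\<bar> < e / 4"
  using e by (auto intro: poly_fun_approx[OF f, of "e / 4"])
 have gc: "continuous_on UNIV g" by (rule continuous_poly_fun[OF g(1)])
 have "eventually (\<lambda>i. dist (\<integral>w. g (crd (\<xi> i w)) \<partial>P i) (\<integral>w. g (crd (Z w)) \<partial>Q) < e / 4) F"
  using e by (intro tendstoD[OF poly_fun_tendsto[OF g(1)]]) auto
 with P show "eventually (\<lambda>i. dist (\<integral>w. f (crd (\<xi> i w)) \<partial>P i) (\<integral>w. f (crd (Z w)) \<partial>Q) < e) F"
 proof eventually_elim
  case (elim i)
  have "\<bar>(\<integral>w. f (crd (\<xi> i w)) \<partial>P i) - (\<integral>w. g (crd (\<xi> i w)) \<partial>P i)\<bar> <= e / 4"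
   by (rule integral_coordinates_close[OF elim(1) f gc g(2)])
  moreover have "\<bar>(\<integral>w. f (crd (Z w)) \<partial>Q) - (\<integral>w. g (crd (Z w)) \<partial>Q)\<bar> <= e / 4"
   by (rule integral_coordinates_close[OF Q f gc g(2)])
  ultimately show ?case using elim(2) e unfolding dist_real_def by linarith
 qed
qed

text \<open>Half of the portmanteau theorem: \<open>g\<close> is approximated from below by functions of the coordinates.
 The other half follows with \<open>- g\<close>.\<close>

lemma eventually_integral_ge:
 assumes g: "continuous_map T euclideanreal g" and B: "\<forall>\<nu>\<in>topspace T. \<bar>g \<nu>\<bar> <= B" and e: "0 < e"
 shows "eventually (\<lambda>i. (\<integral>w. g (Z w) \<partial>Q) - e < (\<integral>w. g (\<xi> i w) \<partial>P i)) F"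
proof -
 interpret Q: prob_space Q using Q by (simp add: random_element_def)
 have ZT: "Z w \<in> topspace T" if "w \<in> space Q" for w using Q that by (simp add: random_element_def)
 then have ne: "topspace T ~= {}" using Q.not_empty by auto
 obtain \<Psi> where \<Psi>: "\<And>n :: nat. continuous_on UNIV (\<Psi> n)"
  "\<And>n \<nu>. \<nu> \<in> topspace T ==> \<Psi> n (crd \<nu>) <= g \<nu>" "\<And>n \<nu>. \<nu> \<in> topspace T ==> \<bar>\<Psi> n (crd \<nu>)\<bar> <= B"
  "\<And>\<nu>. \<nu> \<in> topspace T ==> (\<lambda>n. \<Psi> n (crd \<nu>)) \<longlonglongrightarrow> g \<nu>" using lower_envelope[OF g B ne] by metis
 have "(\<lambda>n. \<integral>w. \<Psi> n (crd (Z w)) \<partial>Q) \<longlonglongrightarrow> (\<integral>w. g (Z w) \<partial>Q)"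
 proof (rule integral_dominated_convergence[where w="\<lambda>_. B"])
  show "(\<lambda>w. g (Z w)) \<in> borel_measurable Q"
   using integrable_bounded_map[OF Q g B] by (rule borel_measurable_integrable)
  show "(\<lambda>w. \<Psi> n (crd (Z w))) \<in> borel_measurable Q" for n
   using integrable_of_coordinates[OF Q \<Psi>(1)] by (rule borel_measurable_integrable)
  show "AE w in Q. (\<lambda>n. \<Psi> n (crd (Z w))) \<longlonglongrightarrow> g (Z w)" using \<Psi>(4) ZT by (intro AE_I2) auto
  show "AE w in Q. norm (\<Psi> n (crd (Z w))) <= B" for n using \<Psi>(3) ZT by (intro AE_I2) auto
 qed simp
 then have "eventually (\<lambda>n. (\<integral>w. g (Z w) \<partial>Q) - e < (\<integral>w. \<Psi> n (crd (Z w)) \<partial>Q)) sequentially"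
  using e by (intro order_tendstoD) auto
 then obtain n where n: "(\<integral>w. g (Z w) \<partial>Q) - e < (\<integral>w. \<Psi> n (crd (Z w)) \<partial>Q)"
  by (auto simp: eventually_sequentially)
 have "eventually (\<lambda>i. (\<integral>w. g (Z w) \<partial>Q) - e < (\<integral>w. \<Psi> n (crd (\<xi> i w)) \<partial>P i)) F"
  using continuous_tendsto[OF \<Psi>(1)] n by (rule order_tendstoD)
 with P show ?thesis
 proof eventually_elim
  case (elim i)
  have "(\<integral>w. \<Psi> n (crd (\<xi> i w)) \<partial>P i) <= (\<integral>w. g (\<xi> i w) \<partial>P i)"
   using elim(1) by (intro integral_mono integrable_of_coordinates[OF _ \<Psi>(1)] integrable_bounded_map[OF _ g B] \<Psi>(2))
    (auto simp: random_element_def)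
  then show ?case using elim(2) by linarith
 qed
qed

theorem converges_in_distribution_of_monomials: "converges_in_distribution T P \<xi> Q Z F"
 unfolding converges_in_distribution_def
proof (intro conjI allI impI)
 show "eventually (\<lambda>i. \<xi> i \<in> measurable (P i) (sigma (topspace T) {U. openin T U})) F"
  using P by eventually_elim (rule random_element_measurable)
 show "Z \<in> measurable Q (sigma (topspace T) {U. openin T U})" using Q by (rule random_element_measurable)
 fix g :: "'s => real" assume "continuous_map T euclideanreal g \<and> bounded (g ` topspace T)"
 then have g: "continuous_map T euclideanreal g" and "bounded (g ` topspace T)" by auto
 then obtain B where B: "\<forall>\<nu>\<in>topspace T. \<bar>g \<nu>\<bar> <= B" by (auto simp: bounded_iff)
 show "((\<lambda>i. \<integral>w. g (\<xi> i w) \<partial>P i) \<longlongrightarrow> (\<integral>w. g (Z w) \<partial>Q)) F"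
 proof (rule tendstoI)
  fix e :: real assume e: "0 < e"
  have g': "continuous_map T euclideanreal (\<lambda>\<nu>. - g \<nu>)" using g by (rule continuous_map_minus)
  have B': "\<forall>\<nu>\<in>topspace T. \<bar>- g \<nu>\<bar> <= B" using B by simp
  from eventually_integral_ge[OF g B e] eventually_integral_ge[OF g' B' e]
  show "eventually (\<lambda>i. dist (\<integral>w. g (\<xi> i w) \<partial>P i) (\<integral>w. g (Z w) \<partial>Q) < e) F"
  proof eventually_elim
   case (elim i)
   then show ?case by (simp add: dist_real_def abs_less_iff)
  qed
 qed
qed

end

end

section \<open>The vague topology\<close>

abbreviation LF :: "real measure set" where "LF \<equiv> locally_finite_measures"

lemma integrable_locally_finite:
 fixes f :: "real => real"
 assumes \<nu>: "\<nu> \<in> LF" and f: "continuous_on UNIV f" and R: "\<And>x. R < \<bar>x\<bar> ==> f x = 0"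
 shows "integrable \<nu> f"
proof -
 have "bounded (f ` {-R..R})"
  by (intro compact_imp_bounded compact_continuous_image continuous_on_subset[OF f]) auto
 then obtain B where B: "\<forall>x\<in>{-R..R}. \<bar>f x\<bar> <= B" by (auto simp: bounded_iff)
 show ?thesis
 proof (rule integrableI_bounded_set[where A="{-R..R}" and B=B])
  show "f \<in> borel_measurable \<nu>"
   using borel_measurable_continuous_onI[OF f] \<nu> by (simp add: locally_finite_measures_def cong: measurable_cong_sets)
  show "AE x in \<nu>. x \<in> {-R..R} --> norm (f x) <= B" using B by (intro AE_I2) auto
  have "f x = 0" if "x \<notin> {-R..R}" for x using R[of x] that by (cases "R < \<bar>x\<bar>") auto
  then show "AE x in \<nu>. x \<notin> {-R..R} --> f x = 0" by simp
 qed (use \<nu> in \<open>auto simp: locally_finite_measures_def\<close>)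
qed

text \<open>Hat functions of width \<open>2 / 2 ^ k\<close> at the dyadic points \<open>i / 2 ^ k\<close>. Those of one level form a
 partition of unity and interpolate linearly between the dyadic points.\<close>

definition tent :: "nat \<times> int => real => real" where
 "tent = (\<lambda>(k, i) x. max 0 (1 - \<bar>2 ^ k * x - of_int i\<bar>))"

lemma tent_nonneg: "0 <= tent j x" by (auto simp: tent_def split: prod.splits)

lemma tent_continuous: "continuous_on UNIV (tent j)"
 unfolding tent_def by (cases j) (auto intro!: continuous_intros)

lemma tent_support: "\<bar>real_of_int (snd j)\<bar> + 1 < \<bar>x\<bar> ==> tent j x = 0"
proof -
 assume a: "\<bar>real_of_int (snd j)\<bar> + 1 < \<bar>x\<bar>"
 have "1 * \<bar>x\<bar> <= 2 ^ fst j * \<bar>x\<bar>" by (intro mult_right_mono) auto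
 also have "... = \<bar>2 ^ fst j * x\<bar>" by (simp add: abs_mult)
 finally show ?thesis using a by (auto simp: tent_def split: prod.splits)
qed

lemma integrable_tent: "\<nu> \<in> LF ==> integrable \<nu> (tent j)"
 by (rule integrable_locally_finite[OF _ tent_continuous tent_support])

lemma sum_tent_interpolates:
 assumes I: "finite I" and cover: "\<And>i. i \<notin> I ==> a i = 0"
 shows "(\<Sum>i\<in>I. a i * tent (k, i) x) =
  (1 - frac (2 ^ k * x)) * a \<lfloor>2 ^ k * x\<rfloor> + frac (2 ^ k * x) * a (\<lfloor>2 ^ k * x\<rfloor> + 1)"
proof -
 let ?j = "\<lfloor>2 ^ k * x\<rfloor>"
 have far: "tent (k, i) x = 0" if "i ~= ?j" "i ~= ?j + 1" for i
 proof -
  have "real_of_int i <= of_int (?j - 1) \<or> real_of_int (?j + 2) <= of_int i"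
   using that unfolding of_int_le_iff by linarith
  then have "1 <= \<bar>2 ^ k * x - of_int i\<bar>" by linarith
  then show ?thesis by (simp add: tent_def)
 qed
 have "(\<Sum>i\<in>I. a i * tent (k, i) x) = (\<Sum>i\<in>I \<union> {?j, ?j + 1}. a i * tent (k, i) x)"
  using I cover by (intro sum.mono_neutral_left) auto
 also have "... = (\<Sum>i\<in>{?j, ?j + 1}. a i * tent (k, i) x)" using I far by (intro sum.mono_neutral_right) auto
 also have "... = a ?j * tent (k, ?j) x + a (?j + 1) * tent (k, ?j + 1) x" by simp
 also have "tent (k, ?j) x = 1 - frac (2 ^ k * x)"
  using frac_ge_0[of "2 ^ k * x"] frac_lt_1[of "2 ^ k * x"] by (simp add: tent_def frac_def)
 also have "tent (k, ?j + 1) x = frac (2 ^ k * x)"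
  using frac_ge_0[of "2 ^ k * x"] frac_lt_1[of "2 ^ k * x"] by (simp add: tent_def frac_def)
 finally show ?thesis by (simp add: mult.commute)
qed

text \<open>Interpolate \<open>f\<close> linearly at a fine level. The error is dominated by a fixed combination of
 tents of level \<open>0\<close>, so its integral is controlled for all measures close to a given one.\<close>

lemma tent_approximation:
 fixes f :: "real => real"
 assumes f: "continuous_on UNIV f" and fM: "\<And>x. real M <= \<bar>x\<bar> ==> f x = 0" and e: "0 < e"
 shows "\<exists>k I b. finite I \<and>
  (\<forall>x. \<bar>f x - (\<Sum>i\<in>I. b i * tent (k, i) x)\<bar> <= e * (\<Sum>i\<in>{- (int M + 1)..int M + 1}. tent (0, i) x))"
proof -
 have "uniformly_continuous_on {-(real M + 1)..real M + 1} f"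
  by (intro compact_uniformly_continuous continuous_on_subset[OF f]) auto
 then obtain d where d: "0 < d" "\<And>x y. x \<in> {-(real M + 1)..real M + 1} ==> y \<in> {-(real M + 1)..real M + 1} ==> dist y x < d ==> dist (f y) (f x) < e"
  using e unfolding uniformly_continuous_on_def by metis
 obtain k where k: "(1 / 2) ^ k < min d (1 / 2 :: real)"
  using real_arch_pow_inv[of "min d (1 / 2)" "1 / 2"] d(1) by auto
 have osc: "\<bar>f x - f y\<bar> <= e" if xy: "\<bar>x - y\<bar> <= (1 / 2) ^ k" for x y
 proof (cases "real M <= \<bar>x\<bar> \<and> real M <= \<bar>y\<bar>")
  case True
  then show ?thesis using fM e by simp
 next
  case False
  then have "x \<in> {-(real M + 1)..real M + 1} \<and> y \<in> {-(real M + 1)..real M + 1}" using xy k by auto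
  moreover have "dist y x < d" using xy k by (simp add: dist_real_def abs_minus_commute)
  ultimately show ?thesis using d(2)[of x y] by (simp add: dist_real_def abs_minus_commute)
 qed
 define I where "I = {- (2 ^ k * int M)..2 ^ k * int M}"
 define b where "b i = f (of_int i / 2 ^ k)" for i :: int
 define I0 where "I0 = {- (int M + 1)..int M + 1}"
 have bI: "b i = 0" if "i \<notin> I" for i
 proof -
  have "2 ^ k * int M <= \<bar>i\<bar>" using that by (auto simp: I_def)
  then have "real_of_int (2 ^ k * int M) <= real_of_int \<bar>i\<bar>" by (simp only: of_int_le_iff)
  then have "real M <= \<bar>of_int i / 2 ^ k\<bar>" by (simp add: abs_divide field_simps)
  then show ?thesis unfolding b_def by (rule fM)
 qed
 have err: "\<bar>f x - (\<Sum>i\<in>I. b i * tent (k, i) x)\<bar> <= e * (\<Sum>i\<in>I0. tent (0, i) x)" for x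
 proof -
  let ?u = "frac (2 ^ k * x)" and ?j = "\<lfloor>2 ^ k * x\<rfloor>"
  have u: "0 <= ?u" "?u <= 1" using frac_ge_0[of "2 ^ k * x"] frac_lt_1[of "2 ^ k * x"] by auto
  have S: "(\<Sum>i\<in>I. b i * tent (k, i) x) = (1 - ?u) * b ?j + ?u * b (?j + 1)"
   by (rule sum_tent_interpolates) (auto simp: I_def[symmetric] bI, simp add: I_def)
  have x: "x = (of_int ?j + ?u) / 2 ^ k" by (simp add: frac_def)
  have "x - of_int ?j / 2 ^ k = ?u * (1 / 2) ^ k" "of_int (?j + 1) / 2 ^ k - x = (1 - ?u) * (1 / 2) ^ k"
   by (simp_all add: frac_def field_simps power_one_over)
  then have near: "\<bar>x - of_int ?j / 2 ^ k\<bar> <= (1 / 2) ^ k" "\<bar>x - of_int (?j + 1) / 2 ^ k\<bar> <= (1 / 2) ^ k"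
   using u by (simp_all add: abs_minus_commute[of x] abs_mult mult_left_le_one_le del: of_int_add)
  show ?thesis
  proof (cases "\<bar>x\<bar> < real M + 1")
   case True
   have "(\<Sum>i\<in>I0. tent (0, i) x) = (\<Sum>i\<in>I0. (if i \<in> I0 then 1 else 0) * tent (0, i) x)" by simp
   also have "... = (1 - frac x) * (if \<lfloor>x\<rfloor> \<in> I0 then 1 else 0) + frac x * (if \<lfloor>x\<rfloor> + 1 \<in> I0 then 1 else 0)"
    by (subst sum_tent_interpolates) (auto simp: I0_def)
   finally have h: "(\<Sum>i\<in>I0. tent (0, i) x) = (1 - frac x) * (if \<lfloor>x\<rfloor> \<in> I0 then 1 else 0) + frac x * (if \<lfloor>x\<rfloor> + 1 \<in> I0 then 1 else 0)" .
   have "- (int M + 1) <= \<lfloor>x\<rfloor>" using True by (simp add: le_floor_iff)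
   moreover have "\<lfloor>x\<rfloor> <= int M" using True by (simp add: floor_le_iff)
   ultimately have "\<lfloor>x\<rfloor> \<in> I0" "\<lfloor>x\<rfloor> + 1 \<in> I0" by (auto simp: I0_def)
   then have h: "(\<Sum>i\<in>I0. tent (0, i) x) = 1" unfolding h by simp
   have "f x - ((1 - ?u) * b ?j + ?u * b (?j + 1)) = (1 - ?u) * (f x - b ?j) + ?u * (f x - b (?j + 1))"
    by (simp add: algebra_simps)
   also have "\<bar>...\<bar> <= (1 - ?u) * \<bar>f x - b ?j\<bar> + ?u * \<bar>f x - b (?j + 1)\<bar>"
    using u by (intro order_trans[OF abs_triangle_ineq]) (simp add: abs_mult)
   also have "... <= (1 - ?u) * e + ?u * e"
    using u osc[OF near(1)] osc[OF near(2)] unfolding b_def by (intro add_mono mult_left_mono) auto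
   also have "... = e * 1" by (simp add: algebra_simps)
   finally show ?thesis unfolding S h .
  next
   case False
   have "(1 / 2) ^ k <= (1 :: real)" by (simp add: power_le_one)
   then have "real M <= \<bar>x\<bar>" "real M <= \<bar>of_int ?j / 2 ^ k\<bar>" "real M <= \<bar>of_int (?j + 1) / 2 ^ k\<bar>"
    using near False by linarith+
   then have "f x = 0" "b ?j = 0" "b (?j + 1) = 0" unfolding b_def by (auto intro: fM simp del: of_int_add)
   then show ?thesis unfolding S using e by (simp add: sum_nonneg tent_nonneg)
  qed
 qed
 show ?thesis
 proof (intro exI conjI allI)
  show "finite I" by (simp add: I_def)
  show "\<bar>f x - (\<Sum>i\<in>I. b i * tent (k, i) x)\<bar> <= e * (\<Sum>i\<in>{- (int M + 1)..int M + 1}. tent (0, i) x)" for x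
   using err[of x] by (simp only: I0_def)
 qed
qed

text \<open>The exponential makes the coordinates bounded and monomials in them Laplace functionals.\<close>

definition tent_coordinates :: "real measure => nat \<times> int => real" where
 "tent_coordinates \<nu> j = exp (- (\<integral>x. tent j x \<partial>\<nu>))"

lemma tent_integrals_close:
 assumes J: "finite J" and e: "0 < e"
 shows "\<exists>r>0. \<forall>\<nu>'. dist (tent_coordinates \<nu>) (tent_coordinates \<nu>') < r -->
  (\<forall>j\<in>J. \<bar>(\<integral>x. tent j x \<partial>\<nu>') - (\<integral>x. tent j x \<partial>\<nu>)\<bar> < e)"
proof -
 define c where "c j = (\<integral>x. tent j x \<partial>\<nu>)" for j
 define V where "V = {y :: nat \<times> int => real. \<forall>j\<in>J. exp (- (c j + e)) < y j \<and> y j < exp (- (c j - e))}"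
 have V: "V = (\<Inter>j\<in>J. {y. exp (- (c j + e)) < y j} \<inter> {y. y j < exp (- (c j - e))})" by (auto simp: V_def)
 have "open V" unfolding V using J by (intro open_INT open_Int open_Collect_less continuous_intros ballI) auto
 moreover have "tent_coordinates \<nu> \<in> V" using e by (auto simp: V_def tent_coordinates_def c_def)
 ultimately obtain r where r: "0 < r" "ball (tent_coordinates \<nu>) r \<subseteq> V" using open_contains_ball by blast
 show ?thesis
 proof (intro exI[of _ r] conjI allI impI r(1) ballI)
  fix \<nu>' j assume "dist (tent_coordinates \<nu>) (tent_coordinates \<nu>') < r" "j \<in> J"
  then have "tent_coordinates \<nu>' \<in> V" using r(2) by auto
  with \<open>j \<in> J\<close> have "exp (- (c j + e)) < tent_coordinates \<nu>' j" "tent_coordinates \<nu>' j < exp (- (c j - e))"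
   by (auto simp: V_def)
  then show "\<bar>(\<integral>x. tent j x \<partial>\<nu>') - (\<integral>x. tent j x \<partial>\<nu>)\<bar> < e"
   unfolding tent_coordinates_def by (simp add: c_def abs_less_iff)
 qed
qed

text \<open>Tents near the support control the mass there, whence the interpolation error is uniformly
 small for all measures whose coordinates are close to those of \<open>\<nu>\<close>.\<close>

lemma integral_close:
 fixes f :: "real => real"
 assumes \<nu>: "\<nu> \<in> LF" and f: "continuous_on UNIV f" and R: "\<And>x. R < \<bar>x\<bar> ==> f x = 0" and e0: "0 < e0"
 shows "\<exists>r>0. \<forall>\<nu>'\<in>LF. dist (tent_coordinates \<nu>) (tent_coordinates \<nu>') < r --> \<bar>(\<integral>x. f x \<partial>\<nu>') - (\<integral>x. f x \<partial>\<nu>)\<bar> < e0"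
proof -
 obtain M :: nat where M: "R < real M" using reals_Archimedean2 by blast
 have fM: "f x = 0" if "real M <= \<bar>x\<bar>" for x using R M that by simp
 let ?I0 = "{- (int M + 1)..int M + 1}"
 define H where "H \<kappa> = (\<Sum>i\<in>?I0. \<integral>x. tent (0, i) x \<partial>\<kappa>)" for \<kappa>
 have H0: "0 <= H \<kappa>" for \<kappa>
  unfolding H_def by (intro sum_nonneg lint_nonneg tent_nonneg)
 define e where "e = e0 / (4 * (H \<nu> + 1))"
 have e: "0 < e" using e0 H0[of \<nu>] by (simp add: e_def)
 have "e0 / (4 * u) * u = e0 / 4" if "u ~= 0" for u using that by simp
 from this[of "H \<nu> + 1"] H0[of \<nu>] have eH: "e * (H \<nu> + 1) = e0 / 4" unfolding e_def by linarith
 obtain k I b where I: "finite I" and app: "\<And>x. \<bar>f x - (\<Sum>i\<in>I. b i * tent (k, i) x)\<bar> <= e * (\<Sum>i\<in>?I0. tent (0, i) x)"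
  using tent_approximation[OF f fM e] by blast
 define S where "S \<kappa> = (\<Sum>i\<in>I. b i * (\<integral>x. tent (k, i) x \<partial>\<kappa>))" for \<kappa>
 have app_int: "\<bar>(\<integral>x. f x \<partial>\<kappa>) - S \<kappa>\<bar> <= e * H \<kappa>" if \<kappa>: "\<kappa> \<in> LF" for \<kappa>
 proof -
  note [simp] = integrable_tent[OF \<kappa>] integrable_locally_finite[OF \<kappa> f R]
  have "(\<integral>x. f x \<partial>\<kappa>) - S \<kappa> = (\<integral>x. f x - (\<Sum>i\<in>I. b i * tent (k, i) x) \<partial>\<kappa>)" by (simp add: S_def)
  also have "\<bar>...\<bar> <= (\<integral>x. e * (\<Sum>i\<in>?I0. tent (0, i) x) \<partial>\<kappa>)" unfolding real_norm_def[symmetric]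
   by (rule norm_integral_le_integral) (use app in auto)
  also have "... = e * H \<kappa>" by (simp add: H_def)
  finally show ?thesis .
 qed
 \<comment> \<open>The first bound controls the mass, the second one the interpolated integral.\<close>
 define d where "d = min (1 / (real (card ?I0) + 1)) (e0 / (4 * ((\<Sum>i\<in>I. \<bar>b i\<bar>) + 1)))"
 have B0: "0 <= (\<Sum>i\<in>I. \<bar>b i\<bar>)" by (simp add: sum_nonneg)
 have "0 < 4 * ((\<Sum>i\<in>I. \<bar>b i\<bar>) + 1)" using B0 by (intro mult_pos_pos add_nonneg_pos) auto
 then have d: "0 < d" unfolding d_def min_less_iff_conj using e0 by (intro conjI divide_pos_pos) auto
 have d1: "real (card ?I0) * d <= 1"
 proof -
  have "real (card ?I0) * d <= real (card ?I0) * (1 / (real (card ?I0) + 1))"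
   unfolding d_def by (intro mult_left_mono) auto
  also have "... <= 1" by simp
  finally show ?thesis .
 qed
 have d2: "(\<Sum>i\<in>I. \<bar>b i\<bar>) * d <= e0 / 4"
 proof -
  have "(\<Sum>i\<in>I. \<bar>b i\<bar>) * d <= ((\<Sum>i\<in>I. \<bar>b i\<bar>) + 1) * (e0 / (4 * ((\<Sum>i\<in>I. \<bar>b i\<bar>) + 1)))"
   using B0 d unfolding d_def by (intro mult_mono) auto
  also have "... = e0 / 4"
  proof -
   have "u * (e0 / (4 * u)) = e0 / 4" if "u ~= 0" for u using that by simp
   moreover have "(\<Sum>i\<in>I. \<bar>b i\<bar>) + 1 ~= 0" using B0 add_nonneg_pos[of "\<Sum>i\<in>I. \<bar>b i\<bar>" 1] by simp
   ultimately show ?thesis by blast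
  qed
  finally show ?thesis .
 qed
 have fin: "finite (Pair (0 :: nat) ` ?I0 \<union> Pair k ` I)" using I by simp
 obtain r where r: "0 < r" "\<And>\<nu>'. dist (tent_coordinates \<nu>) (tent_coordinates \<nu>') < r ==>
   \<forall>j\<in>Pair 0 ` ?I0 \<union> Pair k ` I. \<bar>(\<integral>x. tent j x \<partial>\<nu>') - (\<integral>x. tent j x \<partial>\<nu>)\<bar> < d"
  using tent_integrals_close[OF fin d, of \<nu>] by auto
 show ?thesis
 proof (intro exI[of _ r] conjI r(1) ballI impI)
  fix \<nu>' assume \<nu>': "\<nu>' \<in> LF" and near: "dist (tent_coordinates \<nu>) (tent_coordinates \<nu>') < r"
  have close: "\<bar>(\<integral>x. tent j x \<partial>\<nu>') - (\<integral>x. tent j x \<partial>\<nu>)\<bar> <= d" if "j \<in> Pair 0 ` ?I0 \<union> Pair k ` I" for j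
   using bspec[OF r(2)[OF near] that] by simp
  have "\<bar>H \<nu>' - H \<nu>\<bar> <= (\<Sum>i\<in>?I0. d)"
   unfolding H_def sum_subtractf[symmetric] by (intro order_trans[OF sum_abs sum_mono] close) auto
  then have "H \<nu>' <= H \<nu> + 1" using d1 by simp
  then have "e * H \<nu>' <= e * (H \<nu> + 1)" using e by (intro mult_left_mono) auto
  then have 1: "\<bar>(\<integral>x. f x \<partial>\<nu>') - S \<nu>'\<bar> <= e0 / 4" using app_int[OF \<nu>'] eH by linarith
  have "e * H \<nu> <= e * (H \<nu> + 1)" using e by (intro mult_left_mono) auto
  then have 2: "\<bar>(\<integral>x. f x \<partial>\<nu>) - S \<nu>\<bar> <= e0 / 4" using app_int[OF \<nu>] eH by linarith
  have "\<bar>S \<nu>' - S \<nu>\<bar> <= (\<Sum>i\<in>I. \<bar>b i\<bar> * d)"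
   unfolding S_def sum_subtractf[symmetric] right_diff_distrib[symmetric]
   by (intro order_trans[OF sum_abs sum_mono]) (auto simp: abs_mult intro!: mult_left_mono close)
  then have "\<bar>S \<nu>' - S \<nu>\<bar> <= e0 / 4" using d2 unfolding sum_distrib_right by linarith
  then show "\<bar>(\<integral>x. f x \<partial>\<nu>') - (\<integral>x. f x \<partial>\<nu>)\<bar> < e0" using 1 2 e0 by linarith
 qed
qed

lemma topspace_vague: "topspace vague_topology = LF"
proof -
 have "{\<nu> \<in> LF. (\<integral>x. 0 \<partial>\<nu>) \<in> (UNIV :: real set)} \<in> {{\<nu> \<in> LF. (\<integral>x. f x \<partial>\<nu>) \<in> U} | (f :: real => real) (U :: real set).
    continuous_on UNIV f \<and> compact (closure {x. f x ~= 0}) \<and> open U}"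
  by (intro CollectI exI[of _ "\<lambda>_. 0"] exI[of _ UNIV]) auto
 then show ?thesis unfolding vague_topology_def topology_generated_by_topspace by auto
qed

lemma compact_support_bound:
 fixes f :: "real => real"
 assumes "compact (closure {x. f x ~= 0})"
 shows "\<exists>R>0. \<forall>x. R < \<bar>x\<bar> --> f x = 0"
proof -
 have "bounded {x. f x ~= 0}" by (rule bounded_subset[OF compact_imp_bounded[OF assms] closure_subset])
 then obtain B where B: "\<forall>x. f x ~= 0 --> \<bar>x\<bar> <= B" by (auto simp: bounded_iff)
 show ?thesis
 proof (intro exI[of _ "\<bar>B\<bar> + 1"] conjI allI impI)
  show "f x = 0" if "\<bar>B\<bar> + 1 < \<bar>x\<bar>" for x using B that by force
 qed simp
qed

interpretation vague: coordinate_topology vague_topology tent_coordinates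
proof
 fix \<nu> j
 have "0 <= (\<integral>x. tent j x \<partial>\<nu>)" by (intro lint_nonneg tent_nonneg)
 then show "0 <= tent_coordinates \<nu> j \<and> tent_coordinates \<nu> j <= 1" by (simp add: tent_coordinates_def)
next
 fix U \<nu> assume "openin vague_topology U" "\<nu> \<in> U"
 then have "generate_topology_on {{\<nu> \<in> LF. (\<integral>x. f x \<partial>\<nu>) \<in> U} | (f :: real => real) (U :: real set).
    continuous_on UNIV f \<and> compact (closure {x. f x ~= 0}) \<and> open U} U"
  by (simp add: vague_topology_def openin_topology_generated_by_iff)
 then show "\<exists>r>0. \<forall>\<nu>'\<in>topspace vague_topology. dist (tent_coordinates \<nu>) (tent_coordinates \<nu>') < r --> \<nu>' \<in> U"
  using \<open>\<nu> \<in> U\<close> unfolding topspace_vague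
 proof (induction rule: generate_topology_on.induct)
  case (Int a b)
  then obtain r s where "0 < r" "\<forall>\<nu>'\<in>LF. dist (tent_coordinates \<nu>) (tent_coordinates \<nu>') < r --> \<nu>' \<in> a"
   "0 < s" "\<forall>\<nu>'\<in>LF. dist (tent_coordinates \<nu>) (tent_coordinates \<nu>') < s --> \<nu>' \<in> b" by auto
  then show ?case by (intro exI[of _ "min r s"]) auto
 next
  case (UN K)
  then obtain k where k: "k \<in> K" "\<nu> \<in> k" by auto
  from UN.IH[OF this] obtain r where "0 < r" "\<forall>\<nu>'\<in>LF. dist (tent_coordinates \<nu>) (tent_coordinates \<nu>') < r --> \<nu>' \<in> k" by auto
  then show ?case using k(1) by (intro exI[of _ r]) auto
 next
  case (Basis s)
  then obtain f :: "real => real" and V where s: "s = {\<nu> \<in> LF. (\<integral>x. f x \<partial>\<nu>) \<in> V}"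
   and f: "continuous_on UNIV f" "compact (closure {x. f x ~= 0})" "open V" by auto
  obtain R where R: "0 < R" "\<And>x. R < \<bar>x\<bar> ==> f x = 0" using compact_support_bound[OF f(2)] by blast
  have \<nu>: "\<nu> \<in> LF" "(\<integral>x. f x \<partial>\<nu>) \<in> V" using Basis s by auto
  then obtain e where e: "0 < e" "\<And>y. \<bar>y - (\<integral>x. f x \<partial>\<nu>)\<bar> < e ==> y \<in> V"
   using f(3) unfolding open_dist dist_real_def by metis
  from integral_close[OF \<nu>(1) f(1) R(2) e(1)] show ?case using e(2) unfolding s by blast
 qed auto
qed

text \<open>A monomial in the coordinates is \<open>exp\<close> of minus the integral of a sum of
 tents.\<close>

theorem vague_convergence_of_laplace:
 fixes P :: "'i => 'a measure" and Q :: "'b measure"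
 assumes P: "eventually (\<lambda>i. prob_space (P i) \<and> (\<forall>w\<in>space (P i). \<xi> i w \<in> LF) \<and>
   (\<forall>f :: real => real. continuous_on UNIV f --> (\<forall>x. 0 <= f x) --> (\<lambda>w. exp (- (\<integral>x. f x \<partial>\<xi> i w))) \<in> borel_measurable (P i))) F"
  and Q: "prob_space Q" "\<And>w. w \<in> space Q ==> Z w \<in> LF"
   "\<And>f :: real => real. continuous_on UNIV f ==> (\<And>x. 0 <= f x) ==> (\<lambda>w. exp (- (\<integral>x. f x \<partial>Z w))) \<in> borel_measurable Q"
  and conv: "\<And>(f :: real => real) R. continuous_on UNIV f ==> (\<And>x. 0 <= f x) ==> 0 < R ==> (\<And>x. R < \<bar>x\<bar> ==> f x = 0) ==>
   ((\<lambda>i. \<integral>w. exp (- (\<integral>x. f x \<partial>\<xi> i w)) \<partial>P i) \<longlongrightarrow> (\<integral>w. exp (- (\<integral>x. f x \<partial>Z w)) \<partial>Q)) F"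
 shows "converges_in_distribution vague_topology P \<xi> Q Z F"
proof (rule vague.converges_in_distribution_of_monomials)
 show P': "eventually (\<lambda>i. vague.random_element (P i) (\<xi> i)) F"
  using P by eventually_elim (simp add: vague.random_element_def topspace_vague tent_coordinates_def tent_continuous tent_nonneg)
 show Q': "vague.random_element Q Z"
  using Q by (simp add: vague.random_element_def topspace_vague tent_coordinates_def tent_continuous tent_nonneg)
 fix m :: "(nat \<times> int) list"
 define f where "f x = (\<Sum>j\<leftarrow>m. tent j x)" for x
 have f: "continuous_on UNIV f" unfolding f_def by (induction m) (auto intro!: continuous_intros tent_continuous)
 have f0: "0 <= f x" for x unfolding f_def by (induction m) (auto intro: add_nonneg_nonneg tent_nonneg)
 define R where "R = (\<Sum>j\<leftarrow>m. \<bar>real_of_int (snd j)\<bar>) + 1"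
 have R: "0 < R \<and> (\<forall>x. R < \<bar>x\<bar> --> f x = 0)" unfolding R_def f_def
 proof (induction m)
  case (Cons j m)
  have "0 <= (\<Sum>j\<leftarrow>m. \<bar>real_of_int (snd j)\<bar>)" by (induction m) auto
  then show ?case using Cons tent_support[of j] by (auto simp: add_nonneg_pos)
 qed simp
 have mon: "monomial_at m (tent_coordinates \<nu>) = exp (- (\<integral>x. f x \<partial>\<nu>))" if \<nu>: "\<nu> \<in> LF" for \<nu>
 proof -
  note [simp] = integrable_tent[OF \<nu>]
  have "integrable \<nu> (\<lambda>x. \<Sum>j\<leftarrow>m. tent j x) \<and> monomial_at m (tent_coordinates \<nu>) = exp (- (\<integral>x. (\<Sum>j\<leftarrow>m. tent j x) \<partial>\<nu>))"
   by (induction m) (auto simp: monomial_at_def tent_coordinates_def exp_add[symmetric])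
  then show ?thesis by (simp add: f_def)
 qed
 have "((\<lambda>i. \<integral>w. exp (- (\<integral>x. f x \<partial>\<xi> i w)) \<partial>P i) \<longlongrightarrow> (\<integral>w. exp (- (\<integral>x. f x \<partial>Z w)) \<partial>Q)) F"
  using R by (intro conv[OF f f0, of R]) auto
 moreover have "(\<integral>w. exp (- (\<integral>x. f x \<partial>Z w)) \<partial>Q) = (\<integral>w. monomial_at m (tent_coordinates (Z w)) \<partial>Q)"
  by (intro lint_cong refl) (simp add: mon Q(2))
 moreover have "eventually (\<lambda>i. (\<integral>w. exp (- (\<integral>x. f x \<partial>\<xi> i w)) \<partial>P i) = (\<integral>w. monomial_at m (tent_coordinates (\<xi> i w)) \<partial>P i)) F"
  using P
 proof eventually_elim
  case (elim i)
  then show ?case by (intro lint_cong refl) (simp add: mon)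
 qed
 ultimately show "((\<lambda>i. \<integral>w. monomial_at m (tent_coordinates (\<xi> i w)) \<partial>P i) \<longlongrightarrow> (\<integral>w. monomial_at m (tent_coordinates (Z w)) \<partial>Q)) F"
  using Lim_transform_eventually by fastforce
qed

section \<open>The Laplace functional of the Poisson process\<close>

lemma riemann_stieltjes_tendsto:
 fixes G :: "real => real"
 assumes s: "sets \<nu> = sets borel" and fin: "emeasure \<nu> {0<..R} < \<infinity>" and R: "0 < R" and G: "continuous_on UNIV G"
 shows "(\<lambda>k. \<Sum>i<Suc k. G (real (Suc i) * R / real (Suc k)) *
   (measure \<nu> {0<..real (Suc i) * R / real (Suc k)} - measure \<nu> {0<..real i * R / real (Suc k)}))
  \<longlonglongrightarrow> (\<integral>x. indicator {0<..R} x * G x \<partial>\<nu>)"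
proof (rule LIMSEQ_I)
 fix e0 :: real assume e0: "0 < e0"
 let ?m = "measure \<nu> {0<..R}"
 define e where "e = e0 / (2 * (?m + 1))"
 have m0: "0 <= ?m" by simp
 have e: "0 < e" using e0 m0 by (simp add: e_def add_nonneg_pos)
 have "e0 / (2 * u) * u = e0 / 2" if "u ~= 0" for u using that by simp
 from this[of "?m + 1"] m0 have em: "e * (?m + 1) = e0 / 2" unfolding e_def by linarith
 have "uniformly_continuous_on {0..R} G"
  by (intro compact_uniformly_continuous continuous_on_subset[OF G]) auto
 then obtain d where d: "0 < d" "\<And>x y. x \<in> {0..R} ==> y \<in> {0..R} ==> dist y x < d ==> dist (G y) (G x) < e"
  using e unfolding uniformly_continuous_on_def by metis
 obtain k0 :: nat where k0: "R / d < real k0" using reals_Archimedean2 by blast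
 show "\<exists>k0. \<forall>k\<ge>k0. norm ((\<Sum>i<Suc k. G (real (Suc i) * R / real (Suc k)) *
   (measure \<nu> {0<..real (Suc i) * R / real (Suc k)} - measure \<nu> {0<..real i * R / real (Suc k)})) -
   (\<integral>x. indicator {0<..R} x * G x \<partial>\<nu>)) < e0"
 proof (intro exI allI impI)
  fix k assume "k0 <= k"
  then have "R / d < real (Suc k)" using k0 by linarith
  then have "R / real (Suc k) < d" using d(1) by (simp add: field_simps)
  then have osc: "\<bar>G x - G y\<bar> <= e" if "0 <= x" "x <= R" "0 <= y" "y <= R" "\<bar>x - y\<bar> <= R / real (Suc k)" for x y
   using d(2)[of y x] that by (auto simp: dist_real_def)
  have "\<bar>(\<integral>x. indicator {0<..R} x * G x \<partial>\<nu>) - (\<Sum>i<Suc k. G (real (Suc i) * R / real (Suc k)) *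
   (measure \<nu> {0<..real (Suc i) * R / real (Suc k)} - measure \<nu> {0<..real i * R / real (Suc k)}))\<bar> <= e * ?m"
   by (rule riemann_stieltjes_error[OF s fin _ R G osc]) auto
  moreover have "e * ?m <= e * (?m + 1)" using e by (intro mult_left_mono) auto
  ultimately show "norm ((\<Sum>i<Suc k. G (real (Suc i) * R / real (Suc k)) *
   (measure \<nu> {0<..real (Suc i) * R / real (Suc k)} - measure \<nu> {0<..real i * R / real (Suc k)})) -
   (\<integral>x. indicator {0<..R} x * G x \<partial>\<nu>)) < e0" using em e0 unfolding real_norm_def by linarith
 qed
qed

lemma measurable_nn_integral_random_measure:
 assumes s: "\<And>w. w \<in> space Q ==> sets (Z w) = sets borel"
  and m: "\<And>B. B \<in> sets borel ==> (\<lambda>w. emeasure (Z w) B) \<in> borel_measurable Q"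
  and f: "f \<in> borel_measurable borel"
 shows "(\<lambda>w. \<integral>\<^sup>+x. f x \<partial>Z w) \<in> borel_measurable Q"
 using f
proof (induct f)
 case (cong f g)
 have "(\<lambda>w. \<integral>\<^sup>+x. f x \<partial>Z w) \<in> borel_measurable Q \<longleftrightarrow> (\<lambda>w. \<integral>\<^sup>+x. g x \<partial>Z w) \<in> borel_measurable Q"
  by (intro measurable_cong nn_integral_cong cong) (auto dest!: s sets_eq_imp_space_eq)
 with cong show ?case by simp
next
 case (set B)
 then have "(\<lambda>w. \<integral>\<^sup>+x. indicator B x \<partial>Z w) \<in> borel_measurable Q \<longleftrightarrow> (\<lambda>w. emeasure (Z w) B) \<in> borel_measurable Q"
  by (intro measurable_cong nn_integral_indicator) (simp add: s)
 with set show ?case by (simp add: m)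
next
 case (mult f c)
 then have "(\<lambda>w. \<integral>\<^sup>+x. c * f x \<partial>Z w) \<in> borel_measurable Q \<longleftrightarrow> (\<lambda>w. c * (\<integral>\<^sup>+x. f x \<partial>Z w)) \<in> borel_measurable Q"
  by (intro measurable_cong nn_integral_cmult) (simp add: s cong: measurable_cong_sets)
 with mult show ?case by simp
next
 case (add f g)
 then have "(\<lambda>w. \<integral>\<^sup>+x. f x + g x \<partial>Z w) \<in> borel_measurable Q \<longleftrightarrow> (\<lambda>w. (\<integral>\<^sup>+x. f x \<partial>Z w) + (\<integral>\<^sup>+x. g x \<partial>Z w)) \<in> borel_measurable Q"
  by (intro measurable_cong nn_integral_add) (simp_all add: s cong: measurable_cong_sets)
 with add show ?case by (simp add: ac_simps)
next
 case (seq F)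
 then have "(\<lambda>w. \<integral>\<^sup>+x. (SUP i. F i) x \<partial>Z w) \<in> borel_measurable Q \<longleftrightarrow> (\<lambda>w. SUP i. (\<integral>\<^sup>+x. F i x \<partial>Z w)) \<in> borel_measurable Q"
  unfolding SUP_apply
  by (intro measurable_cong nn_integral_monotone_convergence_SUP) (simp_all add: s cong: measurable_cong_sets)
 with seq show ?case by simp
qed

context
 fixes Q :: "'w measure" and \<beta> :: real and Z :: "'w => real measure"
 assumes hp: "homogeneous_poisson_process Q \<beta> Z" and \<beta>: "0 <= \<beta>"
begin

abbreviation intensity :: "real measure" where
 "intensity \<equiv> density lborel (\<lambda>x. ennreal \<beta> * indicator {0<..} x)"

lemma poisson_line:
 shows "prob_space Q"
  and "w \<in> space Q ==> sets (Z w) = sets borel"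
  and "w \<in> space Q ==> B \<in> sets borel ==> bounded B ==> emeasure (Z w) B \<in> \<nat>"
  and "B \<in> sets borel ==> (\<lambda>w. emeasure (Z w) B) \<in> borel_measurable Q"
  and "B \<in> sets borel ==> emeasure intensity B < \<infinity> ==>
   measure Q {w\<in>space Q. emeasure (Z w) B = of_nat k} = exp (- measure intensity B) * measure intensity B ^ k / fact k"
  and "range F \<subseteq> sets borel ==> disjoint_family F ==> prob_space.indep_vars Q (\<lambda>_. borel) (\<lambda>i w. emeasure (Z w) (F i)) (UNIV :: nat set)"
 using hp unfolding homogeneous_poisson_process_def poisson_process_def point_process_def by auto

lemma poisson_line_LF: "w \<in> space Q ==> Z w \<in> LF"
proof -
 assume w: "w \<in> space Q"
 have "emeasure (Z w) B < \<infinity>" if "B \<in> sets borel" "bounded B" for B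
 proof -
  have "emeasure (Z w) B \<in> \<nat>" using poisson_line(3) w that by blast
  then obtain n where "emeasure (Z w) B = of_nat n" by (auto elim: Nats_cases)
  then show ?thesis by (simp add: of_nat_less_top)
 qed
 then show "Z w \<in> LF" using poisson_line(2)[OF w] by (simp add: locally_finite_measures_def)
qed

lemma poisson_line_laplace_measurable:
 fixes f :: "real => real"
 assumes f: "continuous_on UNIV f" "\<And>x. 0 <= f x"
 shows "(\<lambda>w. exp (- (\<integral>x. f x \<partial>Z w))) \<in> borel_measurable Q"
proof -
 have fm: "f \<in> borel_measurable borel" using f(1) by (rule borel_measurable_continuous_onI)
 have "(\<lambda>w. \<integral>\<^sup>+x. ennreal (f x) \<partial>Z w) \<in> borel_measurable Q"
  by (rule measurable_nn_integral_random_measure) (use fm poisson_line(2,4) in auto)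
 then have "(\<lambda>w. exp (- enn2real (\<integral>\<^sup>+x. ennreal (f x) \<partial>Z w))) \<in> borel_measurable Q" by measurable
 moreover have "(\<integral>x. f x \<partial>Z w) = enn2real (\<integral>\<^sup>+x. ennreal (f x) \<partial>Z w)" if "w \<in> space Q" for w
  using fm f(2) poisson_line(2)[OF that] by (intro integral_eq_nn_integral) (auto cong: measurable_cong_sets)
 ultimately show ?thesis by (simp cong: measurable_cong)
qed

lemma emeasure_intensity: "B \<in> sets borel ==> emeasure intensity B = ennreal \<beta> * emeasure lborel ({0<..} \<inter> B)"
proof -
 assume B: "B \<in> sets borel"
 then have "emeasure intensity B = (\<integral>\<^sup>+x. ennreal \<beta> * indicator {0<..} x * indicator B x \<partial>lborel)"
  by (intro emeasure_density) auto
 also have "... = (\<integral>\<^sup>+x. ennreal \<beta> * indicator ({0<..} \<inter> B) x \<partial>lborel)"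
  by (intro nn_integral_cong) (auto simp: indicator_def)
 also have "... = ennreal \<beta> * emeasure lborel ({0<..} \<inter> B)"
  using B by (intro nn_integral_cmult_indicator) auto
 finally show ?thesis .
qed

lemma emeasure_intensity_Ioc:
 assumes "0 <= a" "a <= b"
 shows "emeasure intensity {a<..b} = ennreal (\<beta> * (b - a))"
proof -
 have "{0<..} \<inter> {a<..b} = {a<..b}" using assms by auto
 then show ?thesis using assms \<beta> by (simp add: emeasure_intensity ennreal_mult)
qed

lemma poisson_line_count_laplace:
 assumes ab: "0 <= a" "a <= b"
 shows "(\<integral>w. exp (- (c * enn2real (emeasure (Z w) {a<..b}))) \<partial>Q) = exp (- (\<beta> * (b - a) * (1 - exp (- c))))"
proof -
 interpret Q: prob_space Q by (rule poisson_line(1))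
 define W where "W w = nat \<lfloor>enn2real (emeasure (Z w) {a<..b})\<rfloor>" for w
 have W: "W \<in> Q \<rightarrow>\<^sub>M count_space UNIV" unfolding W_def using poisson_line(4)[of "{a<..b}"] by measurable
 have ZW: "emeasure (Z w) {a<..b} = of_nat (W w)" if "w \<in> space Q" for w
 proof -
  have "emeasure (Z w) {a<..b} \<in> \<nat>" by (rule poisson_line(3)[OF that]) auto
  then obtain n where n: "emeasure (Z w) {a<..b} = of_nat n" by (auto elim: Nats_cases)
  then show ?thesis by (simp add: W_def ennreal_of_nat_eq_real_of_nat)
 qed
 let ?l = "\<beta> * (b - a)"
 have l0: "0 <= ?l" using \<beta> ab by simp
 have "measure intensity {a<..b} = ?l" using emeasure_intensity_Ioc[OF ab] l0 by (simp add: measure_def)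
 then have prob: "Q.prob {w \<in> space Q. W w = k} = exp (- ?l) * ?l ^ k / fact k" for k
 proof -
  assume m: "measure intensity {a<..b} = ?l"
  have "{w \<in> space Q. W w = k} = {w \<in> space Q. emeasure (Z w) {a<..b} = of_nat k}"
   using ZW by (auto simp: ennreal_of_nat_eq_real_of_nat)
  then show ?thesis using poisson_line(5)[of "{a<..b}" k] emeasure_intensity_Ioc[OF ab] by (simp add: m)
 qed
 have "complex_of_real (\<integral>w. exp (- (c * enn2real (emeasure (Z w) {a<..b}))) \<partial>Q) =
   (\<integral>w. complex_of_real (exp (- (c * enn2real (emeasure (Z w) {a<..b})))) \<partial>Q)"
  by (rule integral_complex_of_real[symmetric])
 also have "... = Q.expectation (\<lambda>w. complex_of_real (exp (- c)) ^ W w)"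
 proof (intro lint_cong refl)
  fix w assume "w \<in> space Q"
  from ZW[OF this] have "exp (- (c * enn2real (emeasure (Z w) {a<..b}))) = exp (- c) ^ W w"
   by (simp add: ennreal_of_nat_eq_real_of_nat exp_of_nat_mult[symmetric] mult.commute)
  then show "complex_of_real (exp (- (c * enn2real (emeasure (Z w) {a<..b})))) = complex_of_real (exp (- c)) ^ W w"
   by (simp only: of_real_power)
 qed
 also have "... = exp (of_real ?l * (complex_of_real (exp (- c)) - 1))"
  by (rule Q.expectation_power_poisson[OF W l0 prob])
 also have "... = complex_of_real (exp (?l * (exp (- c) - 1)))" by (simp add: exp_of_real[symmetric])
 also have "?l * (exp (- c) - 1) = - (?l * (1 - exp (- c)))" by (simp add: algebra_simps)
 finally show ?thesis by (simp only: of_real_eq_iff)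
qed

text \<open>For a step function the integral is a combination of independent Poisson counts, whose Laplace
 transforms multiply. Refining the steps, both sides converge. The negative axis carries no points almost
 surely.\<close>

lemma poisson_line_laplace:
 fixes f :: "real => real"
 assumes f: "continuous_on UNIV f" "\<And>x. 0 <= f x" "\<And>x. R < x ==> f x = 0" and R: "0 < R"
 shows "(\<integral>w. exp (- (\<integral>x. f x \<partial>Z w)) \<partial>Q) = exp (- (\<beta> * (\<integral>x. indicator {0<..R} x * (1 - exp (- f x)) \<partial>lborel)))"
proof -
 interpret Q: prob_space Q by (rule poisson_line(1))
 have fm: "f \<in> borel_measurable borel" using f(1) by (rule borel_measurable_continuous_onI)
 define x where "x k i = real i * R / real (Suc k)" for k i
 have x_mono: "x k i <= x k (Suc i)" and x0: "0 <= x k i" for k i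
  using R by (auto simp: x_def divide_right_mono)
 have x_mono': "x k i <= x k j" if "i <= j" for k i j using R that by (simp add: x_def divide_right_mono)
 define N where "N k i w = enn2real (emeasure (Z w) {x k i<..x k (Suc i)})" for k i w
 define S where "S k w = (\<Sum>i<Suc k. f (x k (Suc i)) * N k i w)" for k w
 have ES: "(\<integral>w. exp (- S k w) \<partial>Q) =
   exp (- (\<beta> * (\<Sum>i<Suc k. (1 - exp (- f (x k (Suc i)))) * (measure lborel {0<..x k (Suc i)} - measure lborel {0<..x k i}))))" for k
 proof -
  have "disjoint_family (\<lambda>i. {x k i<..x k (Suc i)})" unfolding disjoint_family_on_def
  proof (intro ballI impI)
   fix i j :: nat assume "i ~= j"
   then have "x k (Suc i) <= x k j \<or> x k (Suc j) <= x k i"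
    using x_mono'[of "Suc i" j k] x_mono'[of "Suc j" i k] by linarith
   then show "{x k i<..x k (Suc i)} \<inter> {x k j<..x k (Suc j)} = {}" by auto
  qed
  then have "Q.indep_vars (\<lambda>_. borel) (\<lambda>i w. emeasure (Z w) {x k i<..x k (Suc i)}) UNIV"
   by (intro poisson_line(6)) auto
  then have "Q.indep_vars (\<lambda>_. borel) (\<lambda>i w. emeasure (Z w) {x k i<..x k (Suc i)}) {..<Suc k}"
   by (rule Q.indep_vars_subset) simp
  then have ind: "Q.indep_vars (\<lambda>_. borel) (\<lambda>i w. exp (- (f (x k (Suc i)) * N k i w))) {..<Suc k}"
   unfolding N_def by (rule Q.indep_vars_compose2[where Y="\<lambda>i y. exp (- (f (x k (Suc i)) * enn2real y))"]) measurable
  have Nm: "(\<lambda>w. N k i w) \<in> borel_measurable Q" for i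
   unfolding N_def using poisson_line(4)[of "{x k i<..x k (Suc i)}"] by measurable
  have int: "integrable Q (\<lambda>w. exp (- (f (x k (Suc i)) * N k i w)))" for i
  proof (rule Q.integrable_const_bound[where B=1])
   show "AE w in Q. norm (exp (- (f (x k (Suc i)) * N k i w))) <= 1"
    using f(2) by (intro AE_I2) (simp add: N_def)
   show "(\<lambda>w. exp (- (f (x k (Suc i)) * N k i w))) \<in> borel_measurable Q" using Nm[of i] by measurable
  qed
  have "(\<integral>w. exp (- S k w) \<partial>Q) = (\<integral>w. (\<Prod>i<Suc k. exp (- (f (x k (Suc i)) * N k i w))) \<partial>Q)"
   by (simp only: S_def exp_sum[OF finite_lessThan] sum_negf[symmetric])
  also have "... = (\<Prod>i<Suc k. \<integral>w. exp (- (f (x k (Suc i)) * N k i w)) \<partial>Q)"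
   by (rule Q.indep_vars_lebesgue_integral[OF finite_lessThan ind int])
  also have "... = (\<Prod>i<Suc k. exp (- (\<beta> * ((1 - exp (- f (x k (Suc i)))) * (measure lborel {0<..x k (Suc i)} - measure lborel {0<..x k i})))))"
  proof (intro prod.cong refl)
   fix i
   have "(\<integral>w. exp (- (f (x k (Suc i)) * N k i w)) \<partial>Q) = exp (- (\<beta> * (x k (Suc i) - x k i) * (1 - exp (- f (x k (Suc i))))))"
    unfolding N_def by (rule poisson_line_count_laplace[OF x0 x_mono])
   then show "(\<integral>w. exp (- (f (x k (Suc i)) * N k i w)) \<partial>Q) =
     exp (- (\<beta> * ((1 - exp (- f (x k (Suc i)))) * (measure lborel {0<..x k (Suc i)} - measure lborel {0<..x k i}))))"
    using x0 by (simp add: mult.commute mult.left_commute)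
  qed
  also have "... = exp (\<Sum>i<Suc k. - (\<beta> * ((1 - exp (- f (x k (Suc i)))) * (measure lborel {0<..x k (Suc i)} - measure lborel {0<..x k i}))))"
   by (rule exp_sum[OF finite_lessThan, symmetric])
  finally show ?thesis by (simp only: sum_negf sum_distrib_left)
 qed
 have lim1: "(\<lambda>k. \<integral>w. exp (- S k w) \<partial>Q) \<longlonglongrightarrow> exp (- (\<beta> * (\<integral>x. indicator {0<..R} x * (1 - exp (- f x)) \<partial>lborel)))"
 proof -
  have c: "continuous_on UNIV (\<lambda>x. 1 - exp (- f x))" by (intro continuous_intros f)
  show ?thesis unfolding ES x_def using R by (intro tendsto_intros riemann_stieltjes_tendsto[OF _ _ R c]) auto
 qed
 have null: "AE w in Q. emeasure (Z w) {..0} = 0"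
 proof -
  have "{0<..} \<inter> {..0 :: real} = {}" by auto
  then have "emeasure intensity {..0} = 0" by (subst emeasure_intensity) auto
  then have "Q.prob {w \<in> space Q. emeasure (Z w) {..0} = 0} = 1"
   using poisson_line(5)[of "{..0}" 0] by (simp add: measure_def)
  moreover have "{w \<in> space Q. emeasure (Z w) {..0} = 0} \<in> sets Q"
   using poisson_line(4)[of "{..0}"] by measurable
  ultimately show ?thesis by (simp add: Q.prob_Collect_eq_1)
 qed
 have lim2: "(\<lambda>k. \<integral>w. exp (- S k w) \<partial>Q) \<longlonglongrightarrow> (\<integral>w. exp (- (\<integral>x. f x \<partial>Z w)) \<partial>Q)"
 proof (rule integral_dominated_convergence[where w="\<lambda>_. 1"])
  show "(\<lambda>w. exp (- (\<integral>x. f x \<partial>Z w))) \<in> borel_measurable Q" by (rule poisson_line_laplace_measurable[OF f(1,2)])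
  show "(\<lambda>w. exp (- S k w)) \<in> borel_measurable Q" for k
  proof -
   have [measurable]: "(\<lambda>w. N k i w) \<in> borel_measurable Q" for i
    unfolding N_def using poisson_line(4)[of "{x k i<..x k (Suc i)}"] by measurable
   show ?thesis unfolding S_def by measurable
  qed
  show "AE w in Q. norm (exp (- S k w)) <= 1" for k
  proof (intro AE_I2)
   fix w
   have "0 <= S k w" unfolding S_def N_def using f(2) by (intro sum_nonneg mult_nonneg_nonneg) auto
   then show "norm (exp (- S k w)) <= 1" by simp
  qed
  show "AE w in Q. (\<lambda>k. exp (- S k w)) \<longlonglongrightarrow> exp (- (\<integral>x. f x \<partial>Z w))" using null AE_space
  proof eventually_elim
   case (elim w)
   have s: "sets (Z w) = sets borel" by (rule poisson_line(2)[OF elim(2)])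
   have fin: "emeasure (Z w) B < \<infinity>" if "B \<in> sets borel" "bounded B" for B
    using poisson_line_LF[OF elim(2)] that by (simp add: locally_finite_measures_def)
   have SS: "S k w = (\<Sum>i<Suc k. f (x k (Suc i)) * (measure (Z w) {0<..x k (Suc i)} - measure (Z w) {0<..x k i}))" for k
    unfolding S_def
   proof (intro sum.cong refl)
    fix i
    have "{0<..x k (Suc i)} = {0<..x k i} \<union> {x k i<..x k (Suc i)}" using x0[of k i] x_mono[of k i] by auto
    then have "measure (Z w) {0<..x k (Suc i)} = measure (Z w) {0<..x k i} + measure (Z w) {x k i<..x k (Suc i)}"
     using fin[of "{0<..x k i}"] fin[of "{x k i<..x k (Suc i)}"] s by (simp only:) (rule measure_Union, auto)
    then show "f (x k (Suc i)) * N k i w = f (x k (Suc i)) * (measure (Z w) {0<..x k (Suc i)} - measure (Z w) {0<..x k i})"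
     by (simp add: N_def measure_def)
   qed
   have "AE y in Z w. y \<notin> {..0}" using elim(1) s by (intro AE_not_in) (auto simp: null_sets_def)
   then have "(\<integral>y. indicator {0<..R} y * f y \<partial>Z w) = (\<integral>y. f y \<partial>Z w)"
   proof (intro integral_cong_AE)
    assume "AE y in Z w. y \<notin> {..0}"
    then show "AE y in Z w. indicator {0<..R} y * f y = f y"
    proof eventually_elim
     case (elim y)
     then show ?case using f(3)[of y] by (cases "y <= R") auto
    qed
   qed (use fm s in \<open>auto cong: measurable_cong_sets\<close>)
   moreover have "(\<lambda>k. S k w) \<longlonglongrightarrow> (\<integral>y. indicator {0<..R} y * f y \<partial>Z w)"
    unfolding SS x_def by (rule riemann_stieltjes_tendsto[OF s _ R f(1)]) (intro fin, auto)
   ultimately show ?case by (intro tendsto_intros) simp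
  qed
 qed simp
 show ?thesis using lim2 lim1 by (rule LIMSEQ_unique)
qed

end

section \<open>Convergence of the angle processes\<close>

context lipschitz_density
begin

lemma angle_laplace_measurable:
 fixes f :: "real => real"
 assumes A: "random_finite_set P K A" and f: "continuous_on UNIV f"
  and N: "\<And>w. w \<in> space P ==> points (N w) = A w"
 shows "(\<lambda>w. exp (- (\<integral>x. f x \<partial>rescale c (angle_process (N w))))) \<in> borel_measurable P"
proof -
 define g where "g x = complex_of_real (exp (- f (c * x)))" for x
 have fm: "f \<in> borel_measurable borel" using f by (rule borel_measurable_continuous_onI)
 have "continuous_on UNIV g"
  unfolding g_def by (intro continuous_on_of_real continuous_intros continuous_on_compose2[OF f]) auto
 then have "(\<lambda>w. mfun g (A w)) \<in> borel_measurable P"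
  by (rule mfun_measurable[OF A compact_imp_bounded[OF compact_K]])
 then have "(\<lambda>w. Re (mfun g (A w))) \<in> borel_measurable P" by measurable
 moreover have "Re (mfun g (A w)) = exp (- (\<integral>x. f x \<partial>rescale c (angle_process (N w))))" if w: "w \<in> space P" for w
 proof -
  have fin: "finite (A w)" using A w by (simp add: random_finite_set_def)
  then show ?thesis
   unfolding g_def using N[OF w] by (simp add: mfun_exp integral_rescale_angle_process[OF _ fm] del: of_real_exp)
 qed
 ultimately show ?thesis by (simp cong: measurable_cong)
qed

lemma angle_convergence:
 assumes Z: "homogeneous_poisson_process Q beta Z"
  and A: "eventually (\<lambda>i. prob_space (P i) \<and> random_finite_set (P i) K (A i) \<and> (\<forall>w\<in>space (P i). points (N i w) = A i w)) F"
  and lap: "\<And>(f :: real => real) R. continuous_on UNIV f ==> (\<And>x. 0 <= f x) ==> (\<And>x. R < x ==> f x = 0) ==> 0 < R ==>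
   ((\<lambda>i. \<integral>w. exp (- (\<integral>x. f x \<partial>rescale (c i) (angle_process (N i w)))) \<partial>P i) \<longlongrightarrow> limit_laplace f R) F"
 shows "converges_in_distribution vague_topology P (\<lambda>i w. rescale (c i) (angle_process (N i w))) Q Z F"
proof (rule vague_convergence_of_laplace)
 note hp = Z beta_nonneg
 show "eventually (\<lambda>i. prob_space (P i) \<and> (\<forall>w\<in>space (P i). rescale (c i) (angle_process (N i w)) \<in> LF) \<and>
   (\<forall>f :: real => real. continuous_on UNIV f --> (\<forall>x. 0 <= f x) -->
    (\<lambda>w. exp (- (\<integral>x. f x \<partial>rescale (c i) (angle_process (N i w))))) \<in> borel_measurable (P i))) F" using A
 proof eventually_elim
  case (elim i)
  show ?case
  proof (intro conjI allI impI ballI)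
   show "rescale (c i) (angle_process (N i w)) \<in> LF" if "w \<in> space (P i)" for w
    using elim that by (intro rescale_angle_process_locally_finite) (simp add: random_finite_set_def)
  qed (use elim in \<open>auto intro!: angle_laplace_measurable\<close>)
 qed
 show "prob_space Q" by (rule poisson_line(1)[OF hp])
 show "Z w \<in> LF" if "w \<in> space Q" for w by (rule poisson_line_LF[OF hp that])
 show "(\<lambda>w. exp (- (\<integral>x. f x \<partial>Z w))) \<in> borel_measurable Q" if "continuous_on UNIV f" "\<And>x. 0 <= f x" for f :: "real => real"
  by (rule poisson_line_laplace_measurable[OF hp that])
 fix f :: "real => real" and R :: real
 assume f: "continuous_on UNIV f" "\<And>x. 0 <= f x" and R: "0 < R" and f0: "\<And>x. R < \<bar>x\<bar> ==> f x = 0"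
 have fR: "f x = 0" if "R < x" for x using f0[of x] that by simp
 have "(\<integral>w. exp (- (\<integral>x. f x \<partial>Z w)) \<partial>Q) = limit_laplace f R"
  unfolding limit_laplace_def by (rule poisson_line_laplace[OF hp f]) (use fR R in auto)
 then show "((\<lambda>i. \<integral>w. exp (- (\<integral>x. f x \<partial>rescale (c i) (angle_process (N i w)))) \<partial>P i) \<longlongrightarrow> (\<integral>w. exp (- (\<integral>x. f x \<partial>Z w)) \<partial>Q)) F"
  by (simp only:) (rule lap[OF f], use fR R in auto)
qed

theorem poisson_convergence:
 assumes pp: "\<And>t. 0 < t ==> poisson_process (P t) (scale_measure (ennreal t) \<mu>) (\<eta> t)"
  and Z: "homogeneous_poisson_process Q beta Z"
 shows "converges_in_distribution vague_topology P (\<lambda>t w. rescale (t ^ 3) (angle_process (\<eta> t w))) Q Z at_top"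
proof (rule angle_convergence[OF Z])
 show "eventually (\<lambda>t. prob_space (P t) \<and> random_finite_set (P t) K (\<lambda>w. points (\<eta> t w)) \<and>
   (\<forall>w\<in>space (P t). points (\<eta> t w) = points (\<eta> t w))) at_top" using eventually_gt_at_top[of 0]
  by eventually_elim (auto intro: poisson_points_random_finite_set[OF pp] poisson_process_facts(1)[OF pp])
qed (rule poisson_laplace_tendsto[OF pp])

theorem binomial_convergence:
 assumes bp: "\<And>n. binomial_process (P n) \<mu> n (\<zeta> n)"
  and Z: "homogeneous_poisson_process Q beta Z"
 shows "converges_in_distribution vague_topology P (\<lambda>n w. rescale (real n ^ 3) (angle_process (\<zeta> n w))) Q Z sequentially"
proof -
 have "\<exists>A. prob_space (P n) \<and> random_finite_set (P n) K A \<and> (\<forall>w\<in>space (P n). points (\<zeta> n w) = A w)" for n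
  using bp[of n]
 proof (rule binomial_process_rep)
  fix X assume "prob_space (P n)" "\<And>i. i < n ==> X i \<in> P n \<rightarrow>\<^sub>M \<mu>"
   "\<And>w. w \<in> space (P n) ==> points (\<zeta> n w) = (\<lambda>i. X i w) ` {..<n}"
  then show ?thesis by (intro exI[of _ "\<lambda>w. (\<lambda>i. X i w) ` {..<n}"]) (auto intro: binomial_random_finite_set)
 qed
 then obtain A where A: "\<And>n. prob_space (P n) \<and> random_finite_set (P n) K (A n) \<and> (\<forall>w\<in>space (P n). points (\<zeta> n w) = A n w)"
  by metis
 show ?thesis
 proof (rule angle_convergence[OF Z])
  show "eventually (\<lambda>n. prob_space (P n) \<and> random_finite_set (P n) K (A n) \<and>
    (\<forall>w\<in>space (P n). points (\<zeta> n w) = A n w)) sequentially" using A by (intro always_eventually allI)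
 qed (rule binomial_laplace_tendsto[OF bp])
qed

text \<open>Fubini, and convexity of \<open>K\<close>: on a segment between points of \<open>K\<close> the extended
 density agrees with \<open>\<phi>\<close>.\<close>

lemma beta_eq:
 "beta = (\<integral>x1. (\<integral>x2. (LBINT s:{0..1}. s * (1 - s) * \<phi> (s *\<^sub>R x1 + (1 - s) *\<^sub>R x2) * (norm (x1 - x2))\<^sup>2) \<partial>\<mu>) \<partial>\<mu>)"
proof -
 have "beta = (\<integral>x1. (\<integral>x2. kern x1 x2 \<partial>\<mu>) \<partial>\<mu>)"
  unfolding beta_def using mu2.integral_fst'[OF kern_integrable] by simp
 also have "... = (\<integral>x1. (\<integral>x2. (LBINT s:{0..1}. s * (1 - s) * \<phi> (s *\<^sub>R x1 + (1 - s) *\<^sub>R x2) * (norm (x1 - x2))\<^sup>2) \<partial>\<mu>) \<partial>\<mu>)"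
 proof (intro lint_cong refl)
  fix x1 x2 assume x: "x1 \<in> space \<mu>" "x2 \<in> space \<mu>"
  have "kern x1 x2 = (\<integral>s. (norm (x1 - x2))\<^sup>2 * (indicator {0..1} s * (s * (1 - s) * dens (x2 + s *\<^sub>R (x1 - x2)))) \<partial>lborel)"
   by (simp add: kern_def chord_def)
  also have "... = (LBINT s:{0..1}. s * (1 - s) * \<phi> (s *\<^sub>R x1 + (1 - s) *\<^sub>R x2) * (norm (x1 - x2))\<^sup>2)"
   unfolding set_lebesgue_integral_def
  proof (intro lint_cong refl)
   fix s :: real
   have "x2 + s *\<^sub>R (x1 - x2) = s *\<^sub>R x1 + (1 - s) *\<^sub>R x2" by (simp add: algebra_simps)
   moreover have "s *\<^sub>R x1 + (1 - s) *\<^sub>R x2 \<in> K" if "s \<in> {0..1}"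
    using convexD[OF convex_K, of x1 x2 s "1 - s"] x that by simp
   ultimately show "(norm (x1 - x2))\<^sup>2 * (indicator {0..1} s * (s * (1 - s) * dens (x2 + s *\<^sub>R (x1 - x2)))) =
     indicat_real {0..1} s *\<^sub>R (s * (1 - s) * \<phi> (s *\<^sub>R x1 + (1 - s) *\<^sub>R x2) * (norm (x1 - x2))\<^sup>2)"
    by (cases "s \<in> {0..1}") (simp_all add: dens_def)
  qed
  finally show "kern x1 x2 = (LBINT s:{0..1}. s * (1 - s) * \<phi> (s *\<^sub>R x1 + (1 - s) *\<^sub>R x2) * (norm (x1 - x2))\<^sup>2)" .
 qed
 finally show ?thesis .
qed

lemma sum_to_pred: "1 <= m ==> (\<Sum>i=0..m-1. g i :: real) = (\<Sum>i<m. g i)" for m :: nat by (intro sum.cong) auto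

lemma poisson_minimum_bound:
 assumes pp: "poisson_process P (scale_measure (ennreal t) \<mu>) \<eta>" and t: "1 <= t" and m: "1 <= m" and y: "0 < y"
 shows "\<bar>measure P {w \<in> space P. ereal y < ereal (t ^ 3) * mth_point m (angle_process (\<eta> w))}
   - exp (- beta * y) * (\<Sum>i=0..m-1. (beta * y) ^ i / fact i)\<bar> <= (48 * (C_line * y)\<^sup>2 + C_angle * y\<^sup>2) / t"
proof -
 have t0: "0 < t" "0 < t ^ 3" using t by auto
 have "{w \<in> space P. ereal y < ereal (t ^ 3) * mth_point m (angle_process (\<eta> w))} =
   {w \<in> space P. angle_count (y / t ^ 3) (points (\<eta> w)) < m}"
  using less_times_mth_point_iff[OF poisson_atoms(1)[OF pp t0(1)] m y t0(2)] by auto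
 then show ?thesis unfolding sum_to_pred[OF m] using poisson_count_bound[OF pp t y, of m] by simp
qed

lemma binomial_minimum_bound:
 assumes bp: "binomial_process P \<mu> n \<zeta>" and n: "1 <= n" and m: "1 <= m" and y: "0 < y"
 shows "\<bar>measure P {w \<in> space P. ereal y < ereal (real n ^ 3) * mth_point m (angle_process (\<zeta> w))}
   - exp (- beta * y) * (\<Sum>i=0..m-1. (beta * y) ^ i / fact i)\<bar>
  <= (24 * (C_line * y)\<^sup>2 + 6 * beta * y + C_angle * y\<^sup>2) / real n"
proof -
 have n0: "0 < real n ^ 3" using n by auto
 obtain X where X: "\<And>w. w \<in> space P ==> points (\<zeta> w) = (\<lambda>i. X i w) ` {..<n}"
  using bp by (rule binomial_process_rep) blast
 have fin: "finite (points (\<zeta> w))" if "w \<in> space P" for w by (simp add: X[OF that])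
 have "{w \<in> space P. ereal y < ereal (real n ^ 3) * mth_point m (angle_process (\<zeta> w))} =
   {w \<in> space P. angle_count (y / real n ^ 3) (points (\<zeta> w)) < m}"
  using less_times_mth_point_iff[OF fin m y n0] by auto
 then show ?thesis unfolding sum_to_pred[OF m] using binomial_count_bound[OF bp n y, of m] by simp
qed

end

theorem corollary6:
  fixes K :: "(real ^ 2) set" and \<phi> :: "real ^ 2 \<Rightarrow> real"
    and \<mu> :: "(real ^ 2) measure" and \<beta> :: real
  assumes "compact K" and "convex K" and "interior K \<noteq> {}"
    and "\<forall>x\<in>K. 0 \<le> \<phi> x" and "\<exists>L. L-lipschitz_on K \<phi>"
    and "\<mu> = density (restrict_space lborel K) (\<lambda>x. ennreal (\<phi> x))" and "prob_space \<mu>"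
    and "\<beta> = (\<integral>x1. (\<integral>x2. (LBINT s:{0..1}.
                 s * (1 - s) * \<phi> (s *\<^sub>R x1 + (1 - s) *\<^sub>R x2) * (norm (x1 - x2))\<^sup>2) \<partial>\<mu>) \<partial>\<mu>)"
  shows
    "(\<forall>(P :: real \<Rightarrow> 'p measure) \<eta> (Q :: 'q measure) Z.
        (\<forall>t>0. poisson_process (P t) (scale_measure (ennreal t) \<mu>) (\<eta> t)) \<and>
        homogeneous_poisson_process Q \<beta> Z \<longrightarrow>
        converges_in_distribution vague_topology
          P (\<lambda>t \<omega>. rescale (t ^ 3) (angle_process (\<eta> t \<omega>))) Q Z at_top) \<and>
     (\<forall>(P :: nat \<Rightarrow> 'b measure) \<zeta> (Q :: 'q measure) Z.
        (\<forall>n. binomial_process (P n) \<mu> n (\<zeta> n)) \<and>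
        homogeneous_poisson_process Q \<beta> Z \<longrightarrow>
        converges_in_distribution vague_topology
          P (\<lambda>n \<omega>. rescale (real n ^ 3) (angle_process (\<zeta> n \<omega>))) Q Z sequentially) \<and>
     (\<forall>y>0. \<exists>C>0.
        (\<forall>t\<ge>1. \<forall>m\<ge>1. \<forall>(P :: 'p measure) \<eta>.
           poisson_process P (scale_measure (ennreal t) \<mu>) \<eta> \<longrightarrow>
           \<bar>measure P {\<omega> \<in> space P. ereal y < ereal (t ^ 3) * mth_point m (angle_process (\<eta> \<omega>))}
             - exp (- \<beta> * y) * (\<Sum>i=0..m-1. (\<beta> * y) ^ i / fact i)\<bar> \<le> C / t) \<and>
        (\<forall>n\<ge>3. \<forall>m\<ge>1. \<forall>(P :: 'b measure) \<zeta>.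
           binomial_process P \<mu> n \<zeta> \<longrightarrow>
           \<bar>measure P {\<omega> \<in> space P. ereal y < ereal (real n ^ 3) * mth_point m (angle_process (\<zeta> \<omega>))}
             - exp (- \<beta> * y) * (\<Sum>i=0..m-1. (\<beta> * y) ^ i / fact i)\<bar> \<le> C / real n))"
proof -
 obtain L where L: "L-lipschitz_on K \<phi>" using assms(5) by auto
 interpret lipschitz_density K \<phi> \<mu> L unfolding lipschitz_density_def using assms(1-4,6,7) L by blast
 have \<beta>: "\<beta> = beta" unfolding assms(8) beta_eq ..
 show ?thesis unfolding \<beta>
 proof (intro conjI allI impI)
  fix P :: "real => 'p measure" and \<eta> and Q :: "'q measure" and Z
  assume a: "(\<forall>t>0. poisson_process (P t) (scale_measure (ennreal t) \<mu>) (\<eta> t)) \<and> homogeneous_poisson_process Q beta Z"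
  show "converges_in_distribution vague_topology P (\<lambda>t w. rescale (t ^ 3) (angle_process (\<eta> t w))) Q Z at_top"
   by (rule poisson_convergence) (use a in auto)
 next
  fix P :: "nat => 'b measure" and \<zeta> and Q :: "'q measure" and Z
  assume a: "(\<forall>n. binomial_process (P n) \<mu> n (\<zeta> n)) \<and> homogeneous_poisson_process Q beta Z"
  show "converges_in_distribution vague_topology P (\<lambda>n w. rescale (real n ^ 3) (angle_process (\<zeta> n w))) Q Z sequentially"
   by (rule binomial_convergence) (use a in auto)
 next
  fix y :: real assume y: "0 < y"
  define C where "C = 48 * (C_line * y)\<^sup>2 + 6 * beta * y + C_angle * y\<^sup>2"
  have b: "0 <= 6 * beta * y" using beta_nonneg y by simp
  have c: "0 < C_angle * y\<^sup>2" using C_angle(1) y by simp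
  have le: "48 * (C_line * y)\<^sup>2 + C_angle * y\<^sup>2 <= C" "24 * (C_line * y)\<^sup>2 + 6 * beta * y + C_angle * y\<^sup>2 <= C"
   using b unfolding C_def by auto
  have "0 <= 48 * (C_line * y)\<^sup>2" by simp
  then have C: "0 < C" unfolding C_def using b c by linarith
  show "\<exists>C>0.
    (\<forall>t\<ge>1. \<forall>m\<ge>1. \<forall>(P :: 'p measure) \<eta>.
      poisson_process P (scale_measure (ennreal t) \<mu>) \<eta> -->
      \<bar>measure P {w \<in> space P. ereal y < ereal (t ^ 3) * mth_point m (angle_process (\<eta> w))}
       - exp (- beta * y) * (\<Sum>i=0..m-1. (beta * y) ^ i / fact i)\<bar> <= C / t) \<and>
    (\<forall>n\<ge>3. \<forall>m\<ge>1. \<forall>(P :: 'b measure) \<zeta>.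
      binomial_process P \<mu> n \<zeta> -->
      \<bar>measure P {w \<in> space P. ereal y < ereal (real n ^ 3) * mth_point m (angle_process (\<zeta> w))}
       - exp (- beta * y) * (\<Sum>i=0..m-1. (beta * y) ^ i / fact i)\<bar> <= C / real n)"
  proof (intro exI[of _ C] conjI C allI impI)
   fix t :: real and m :: nat and P :: "'p measure" and \<eta>
   assume t: "1 <= t" and m: "1 <= m" and pp: "poisson_process P (scale_measure (ennreal t) \<mu>) \<eta>"
   have "(48 * (C_line * y)\<^sup>2 + C_angle * y\<^sup>2) / t <= C / t" using le(1) t by (intro divide_right_mono) auto
   with poisson_minimum_bound[OF pp t m y]
   show "\<bar>measure P {w \<in> space P. ereal y < ereal (t ^ 3) * mth_point m (angle_process (\<eta> w))}
       - exp (- beta * y) * (\<Sum>i=0..m-1. (beta * y) ^ i / fact i)\<bar> <= C / t" by (rule order_trans)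
  next
   fix n m :: nat and P :: "'b measure" and \<zeta>
   assume n: "3 <= n" and m: "1 <= m" and bp: "binomial_process P \<mu> n \<zeta>"
   have n1: "1 <= n" using n by simp
   have "(24 * (C_line * y)\<^sup>2 + 6 * beta * y + C_angle * y\<^sup>2) / real n <= C / real n" using le(2) by (intro divide_right_mono) auto
   with binomial_minimum_bound[OF bp n1 m y]
   show "\<bar>measure P {w \<in> space P. ereal y < ereal (real n ^ 3) * mth_point m (angle_process (\<zeta> w))}
       - exp (- beta * y) * (\<Sum>i=0..m-1. (beta * y) ^ i / fact i)\<bar> <= C / real n" by (rule order_trans)
  qed
 qed
qed

end
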